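(* The following three kinds of data are equivalent. $(\alpha)$ $(H_{\mathbb R},M,S,m)$: $H_{\mathbb R}$ a finite dimensional real vector space, $M$ an automorphism of it with eigenvalues in $S^1$, $m\in\mathbb{Z}$, and $S$ an $M$-invariant nondegenerate bilinear form on $H_{\mathbb R}$ which is $(-1)^m$-symmetric on $H_{\ne1}$ and $(-1)^{m+1}$-symmetric on $H_1$. $(\beta)$ $(H_{\mathbb R},L,m)$: $(H_{\mathbb R},L)$ a Seifert form pair such that the eigenvalues of its monodromy are in $S^1$, and $m\in\mathbb{Z}$. $(\gamma)$ $(H^{bun}_{\mathbb R}\to\mathbb{C}^*,\nabla,P,m)$: $H^{bun}_{\mathbb R}\to\mathbb{C}^*$ a bundle of real vector spaces on $\mathbb{C}^*$ with flat connection $\nabla$ whose monodromy has eigenvalues in $S^1$, $m\in\mathbb{Z}$, and $P$ a flat, nondegenerate, $(-1)^{m+1}$-symmetric pairing $P:H^{bun}_{\mathbb R,z}\times H^{bun}_{\mathbb R,-z}\to i^{m+1}\cdot\mathbb{R}$ for $z\in\mathbb{C}^*$. The equivalence is given by the following constructions, which can be inverted. From $(\alpha)$ to $(\beta)$: $L(a,b):=L^{nor}(a,b):=-S(a,\nu^{-1}b)$ with $\nu=\frac1{M-\mathrm{id}}$ on $H_{\ne1}$ and $\nu=\frac{-N}{M-\mathrm{id}}$ on $H_1$. From $(\beta)$ to $(\gamma)$: let $M$ be the monodromy of $L$; take the flat bundle $H^{bun}_{\mathbb R}\to\mathbb{C}^*$ with fiber $H_{\mathbb R}$ and monodromy $(-1)^{m+1}M$;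 then $L$ induces a flat pairing on each fiber, and $$P(a,b):=\frac1{(2\pi i)^{m+1}}\cdot L(a,\gamma_{-\pi}b)\qquad\text{for }a\in H^{bun}_{\mathbb R,z},\ b\in H^{bun}_{\mathbb R,-z},$$ where $\gamma_{-\pi}$ is the isomorphism between the fibers over $-z$ and $z$ by flat shift by the angle $\pi$ in the mathematically negative direction.
   Context: $H_{\mathbb C}=H_{\mathbb R}\otimes\mathbb{C}$; for an automorphism $M$: $M=M_sM_u=M_uM_s$ (semisimple, unipotent), $N=\log M_u$, $H_\lambda=\ker(M_s-\lambda\,\mathrm{id})\subset H_{\mathbb C}$, $H_{\ne1}=\bigoplus_{\lambda\ne1}H_\lambda$. On $H_1$, $\frac{N}{M-\mathrm{id}}$ is the inverse of $\frac{M-\mathrm{id}}N:=\sum_{k\ge1}\frac1{k!}N^{k-1}$. A Seifert form pair $(H_{\mathbb R},L)$ is a finite dimensional real vector space with a nondegenerate bilinear form $L$; its monodromy is the unique automorphism $M$ with $L(Ma,b)=L(b,a)$ for all $a,b$. The monodromy of a flat bundle on $\mathbb{C}^*$ is the flat shift once around $0$ in the mathematically positive direction. $P$ being $(-1)^{m+1}$-symmetric means $P(b,a)=(-1)^{m+1}P(a,b)$ for $a\in H^{bun}_{\mathbb R,z}$, $b\in H^{bun}_{\mathbb R,-z}$. "Equivalent" means that the constructions yield one-to-one correspondences of isomorphism classes of data (with fixed $m$). *)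

theory Defs
  imports "HOL-Analysis.Analysis"
begin

section \<open>Finite dimensional real vector spaces, linear and bilinear maps\<close>

text \<open>
  A finite dimensional real vector space is a finite dimensional subspace of an arbitrary type of
  class \<open>real_vector\<close>. Maps are HOL functions of which only the restriction to these subspaces
  matters; isomorphisms below compare them only there.
\<close>

definition fin_dim_space :: "'v::real_vector set \<Rightarrow> bool" where
  "fin_dim_space H \<longleftrightarrow> (\<exists>B. finite B \<and> H = span B)"

definition linear_map_on :: "'v::real_vector set \<Rightarrow> ('v \<Rightarrow> 'w::real_vector) \<Rightarrow> bool" where
  "linear_map_on V f \<longleftrightarrow>
     (\<forall>x\<in>V. \<forall>y\<in>V. f (x + y) = f x + f y) \<and> (\<forall>c. \<forall>x\<in>V. f (c *\<^sub>R x) = c *\<^sub>R f x)"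

definition linear_iso :: "'v::real_vector set \<Rightarrow> 'w::real_vector set \<Rightarrow> ('v \<Rightarrow> 'w) \<Rightarrow> bool" where
  "linear_iso V W f \<longleftrightarrow> linear_map_on V f \<and> bij_betw f V W"

definition bilinear_form_on ::
    "'v::real_vector set \<Rightarrow> 'w::real_vector set \<Rightarrow> ('v \<Rightarrow> 'w \<Rightarrow> 'c::real_vector) \<Rightarrow> bool" where
  "bilinear_form_on V W B \<longleftrightarrow>
     (\<forall>a\<in>V. linear_map_on W (B a)) \<and> (\<forall>b\<in>W. linear_map_on V (\<lambda>a. B a b))"

definition nondegenerate_on ::
    "'v::real_vector set \<Rightarrow> 'w::real_vector set \<Rightarrow> ('v \<Rightarrow> 'w \<Rightarrow> 'c::real_vector) \<Rightarrow> bool" where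
  "nondegenerate_on V W B \<longleftrightarrow>
     (\<forall>a\<in>V. (\<forall>b\<in>W. B a b = 0) \<longrightarrow> a = 0) \<and> (\<forall>b\<in>W. (\<forall>a\<in>V. B a b = 0) \<longrightarrow> b = 0)"


section \<open>Complexification\<close>

text \<open>
  The complexification of \<open>H\<close> is \<open>H \<times> H\<close>, where \<open>(a, b)\<close> stands for \<open>a + i b\<close>; the complex
  scalar multiplication is \<open>cscale\<close>. The complexification of a real endomorphism \<open>f\<close> is
  \<open>map_prod f f\<close>.
\<close>

definition cscale :: "complex \<Rightarrow> 'v::real_vector \<times> 'v \<Rightarrow> 'v \<times> 'v" where
  "cscale c x = (Re c *\<^sub>R fst x - Im c *\<^sub>R snd x, Re c *\<^sub>R snd x + Im c *\<^sub>R fst x)"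

definition cform :: "('v::real_vector \<Rightarrow> 'v \<Rightarrow> real) \<Rightarrow> 'v \<times> 'v \<Rightarrow> 'v \<times> 'v \<Rightarrow> complex" where
  "cform S x y = Complex (S (fst x) (fst y) - S (snd x) (snd y)) (S (fst x) (snd y) + S (snd x) (fst y))"

definition eigenvalue_on :: "'v::real_vector set \<Rightarrow> ('v \<Rightarrow> 'v) \<Rightarrow> complex \<Rightarrow> bool" where
  "eigenvalue_on H f l \<longleftrightarrow> (\<exists>x \<in> H \<times> H. x \<noteq> 0 \<and> map_prod f f x = cscale l x)"

definition eigenvalues_in_circle :: "'v::real_vector set \<Rightarrow> ('v \<Rightarrow> 'v) \<Rightarrow> bool" where
  "eigenvalues_in_circle H f \<longleftrightarrow> (\<forall>l. eigenvalue_on H f l \<longrightarrow> cmod l = 1)"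

definition clinear_endo :: "('v::real_vector \<times> 'v) set \<Rightarrow> ('v \<times> 'v \<Rightarrow> 'v \<times> 'v) \<Rightarrow> bool" where
  "clinear_endo W f \<longleftrightarrow> (\<forall>x\<in>W. f x \<in> W) \<and>
     (\<forall>x\<in>W. \<forall>y\<in>W. f (x + y) = f x + f y) \<and> (\<forall>c. \<forall>x\<in>W. f (cscale c x) = cscale c (f x))"


section \<open>Jordan decomposition, generalized eigenspaces, and the normalized Seifert form\<close>

text \<open>Over the complex numbers, semisimple means diagonalizable.\<close>

definition semisimple_on :: "('v::real_vector \<times> 'v) set \<Rightarrow> ('v \<times> 'v \<Rightarrow> 'v \<times> 'v) \<Rightarrow> bool" where
  "semisimple_on W f \<longleftrightarrow> W \<subseteq> module.span cscale {x \<in> W. \<exists>l. f x = cscale l x}"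

definition unipotent_on :: "('v::real_vector \<times> 'v) set \<Rightarrow> ('v \<times> 'v \<Rightarrow> 'v \<times> 'v) \<Rightarrow> bool" where
  "unipotent_on W f \<longleftrightarrow> (\<exists>n. \<forall>x\<in>W. ((\<lambda>y. f y - y) ^^ n) x = 0)"

definition jordan_decomposition ::
    "'v::real_vector set \<Rightarrow> ('v \<Rightarrow> 'v) \<Rightarrow> ('v \<times> 'v \<Rightarrow> 'v \<times> 'v) \<Rightarrow> ('v \<times> 'v \<Rightarrow> 'v \<times> 'v) \<Rightarrow> bool" where
  "jordan_decomposition H M Ms Mu \<longleftrightarrow>
     clinear_endo (H \<times> H) Ms \<and> clinear_endo (H \<times> H) Mu \<and>
     semisimple_on (H \<times> H) Ms \<and> unipotent_on (H \<times> H) Mu \<and>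
     (\<forall>x \<in> H \<times> H. map_prod M M x = Ms (Mu x) \<and> map_prod M M x = Mu (Ms x))"

text \<open>The Jordan decomposition is unique on \<open>H \<times> H\<close>, so \<open>SOME\<close> involves no choice there.\<close>

definition semisimple_part :: "'v::real_vector set \<Rightarrow> ('v \<Rightarrow> 'v) \<Rightarrow> 'v \<times> 'v \<Rightarrow> 'v \<times> 'v" where
  "semisimple_part H M = (SOME Ms. \<exists>Mu. jordan_decomposition H M Ms Mu)"

definition unipotent_part :: "'v::real_vector set \<Rightarrow> ('v \<Rightarrow> 'v) \<Rightarrow> 'v \<times> 'v \<Rightarrow> 'v \<times> 'v" where
  "unipotent_part H M = (SOME Mu. \<exists>Ms. jordan_decomposition H M Ms Mu)"

text \<open>
  \<open>nilp_log\<close> is \<open>N = log M\<^sub>u\<close> and \<open>exp_quot\<close> is \<open>(M - id) / N\<close>, the sum over \<open>k \<ge> 1\<close> of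
  \<open>N\<^sup>k\<^sup>-\<^sup>1 / k!\<close>. Both series are truncated at \<open>k = dim H\<close>: on the complexification the powers of
  \<open>M\<^sub>u - id\<close> and of \<open>N\<close> with exponent at least \<open>dim H\<close> vanish.
\<close>

definition nilp_log :: "'v::real_vector set \<Rightarrow> ('v \<Rightarrow> 'v) \<Rightarrow> 'v \<times> 'v \<Rightarrow> 'v \<times> 'v" where
  "nilp_log H M x =
     (\<Sum>k = 1..dim H. ((- 1) ^ (k + 1) / real k) *\<^sub>R ((\<lambda>y. unipotent_part H M y - y) ^^ k) x)"

definition exp_quot :: "'v::real_vector set \<Rightarrow> ('v \<Rightarrow> 'v) \<Rightarrow> 'v \<times> 'v \<Rightarrow> 'v \<times> 'v" where
  "exp_quot H M x = (\<Sum>k = 1..dim H. (1 / fact k) *\<^sub>R (nilp_log H M ^^ (k - 1)) x)"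

definition gen_eigenspace :: "'v::real_vector set \<Rightarrow> ('v \<Rightarrow> 'v) \<Rightarrow> complex \<Rightarrow> ('v \<times> 'v) set" where
  "gen_eigenspace H M l = {x \<in> H \<times> H. semisimple_part H M x = cscale l x}"

definition H_one :: "'v::real_vector set \<Rightarrow> ('v \<Rightarrow> 'v) \<Rightarrow> ('v \<times> 'v) set" where
  "H_one H M = gen_eigenspace H M 1"

definition H_ne_one :: "'v::real_vector set \<Rightarrow> ('v \<Rightarrow> 'v) \<Rightarrow> ('v \<times> 'v) set" where
  "H_ne_one H M = module.span cscale (\<Union>l\<in>- {1}. gen_eigenspace H M l)"

definition nu :: "'v::real_vector set \<Rightarrow> ('v \<Rightarrow> 'v) \<Rightarrow> 'v \<times> 'v \<Rightarrow> 'v \<times> 'v" where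
  "nu H M x = (THE y. \<exists>x1 \<in> H_one H M. \<exists>x2 \<in> H_ne_one H M. x = x1 + x2 \<and>
     y = inv_into (H_ne_one H M) (\<lambda>u. map_prod M M u - u) x2
         - inv_into (H_one H M) (exp_quot H M) x1)"

text \<open>
  \<open>nu\<close> commutes with complex conjugation, so for real arguments the value of the complexified
  form is real, and \<open>Re\<close> only changes its type.
\<close>

definition L_nor ::
    "'v::real_vector set \<Rightarrow> ('v \<Rightarrow> 'v) \<Rightarrow> ('v \<Rightarrow> 'v \<Rightarrow> real) \<Rightarrow> 'v \<Rightarrow> 'v \<Rightarrow> real" where
  "L_nor H M S a b = - Re (cform S (a, 0) (inv_into (H \<times> H) (nu H M) (b, 0)))"

definition Seifert_monodromy :: "'v::real_vector set \<Rightarrow> ('v \<Rightarrow> 'v \<Rightarrow> real) \<Rightarrow> 'v \<Rightarrow> 'v" where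
  "Seifert_monodromy H L =
     (THE M. M \<in> extensional H \<and> linear_iso H H M \<and> (\<forall>a\<in>H. \<forall>b\<in>H. L (M a) b = L b a))"


section \<open>Data of types alpha and beta\<close>

text \<open>The integer \<open>m\<close> is a parameter, as isomorphism classes are compared for fixed \<open>m\<close>.\<close>

type_synonym 'v alpha = "'v set \<times> ('v \<Rightarrow> 'v) \<times> ('v \<Rightarrow> 'v \<Rightarrow> real)"
type_synonym 'v beta = "'v set \<times> ('v \<Rightarrow> 'v \<Rightarrow> real)"

definition alpha_data :: "int \<Rightarrow> 'v::real_vector alpha set" where
  "alpha_data m = {(H, M, S). fin_dim_space H \<and> linear_iso H H M \<and> eigenvalues_in_circle H M \<and>
     bilinear_form_on H H S \<and> nondegenerate_on H H S \<and>
     (\<forall>a\<in>H. \<forall>b\<in>H. S (M a) (M b) = S a b) \<and>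
     (\<forall>x \<in> H_ne_one H M. \<forall>y \<in> H_ne_one H M. cform S y x = (- 1) powi m * cform S x y) \<and>
     (\<forall>x \<in> H_one H M. \<forall>y \<in> H_one H M. cform S y x = (- 1) powi (m + 1) * cform S x y)}"

definition alpha_iso :: "int \<Rightarrow> ('v::real_vector alpha \<times> 'v alpha) set" where
  "alpha_iso m = {((H, M, S), (H', M', S')).
     (H, M, S) \<in> alpha_data m \<and> (H', M', S') \<in> alpha_data m \<and>
     (\<exists>f. linear_iso H H' f \<and> (\<forall>a\<in>H. f (M a) = M' (f a)) \<and>
          (\<forall>a\<in>H. \<forall>b\<in>H. S' (f a) (f b) = S a b))}"

definition beta_data :: "'v::real_vector beta set" where
  "beta_data = {(H, L). fin_dim_space H \<and> bilinear_form_on H H L \<and> nondegenerate_on H H L \<and>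
     eigenvalues_in_circle H (Seifert_monodromy H L)}"

definition beta_iso :: "('v::real_vector beta \<times> 'v beta) set" where
  "beta_iso = {((H, L), (H', L')). (H, L) \<in> beta_data \<and> (H', L') \<in> beta_data \<and>
     (\<exists>f. linear_iso H H' f \<and> (\<forall>a\<in>H. \<forall>b\<in>H. L' (f a) (f b) = L a b))}"


section \<open>Smooth real vector bundles on the punctured plane with flat connection\<close>

fun Ck_on :: "nat \<Rightarrow> complex set \<Rightarrow> (complex \<Rightarrow> real) \<Rightarrow> bool" where
  "Ck_on 0 U f = continuous_on U f"
| "Ck_on (Suc k) U f =
     ((\<forall>z\<in>U. f differentiable (at z)) \<and> (\<forall>v. Ck_on k U (\<lambda>z. frechet_derivative f (at z) v)))"

definition smooth_on :: "complex set \<Rightarrow> (complex \<Rightarrow> real) \<Rightarrow> bool" where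
  "smooth_on U f \<longleftrightarrow> (\<forall>k. Ck_on k U f)"

text \<open>
  \<open>frames\<close> is an atlas of smooth local frames \<open>(V, r, e)\<close>: for \<open>z \<in> V\<close> the vectors
  \<open>e 0 z, \<dots>, e (r - 1) z\<close> form a basis of the fibre over \<open>z\<close>. The fibres carry no relation to each
  other besides the one given by the atlas.
  The connection is given by \<open>nabla s z v\<close>, the covariant derivative of the local section \<open>s\<close> at
  \<open>z\<close> in the direction of the (real) tangent vector \<open>v\<close>.
\<close>

record 'v vbundle =
  fibre :: "complex \<Rightarrow> 'v set"
  frames :: "(complex set \<times> nat \<times> (nat \<Rightarrow> complex \<Rightarrow> 'v)) set"
  nabla :: "(complex \<Rightarrow> 'v) \<Rightarrow> complex \<Rightarrow> complex \<Rightarrow> 'v"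

definition open_punctured :: "complex set \<Rightarrow> bool" where
  "open_punctured U \<longleftrightarrow> open U \<and> 0 \<notin> U"

definition smooth_section :: "'v::real_vector vbundle \<Rightarrow> complex set \<Rightarrow> (complex \<Rightarrow> 'v) \<Rightarrow> bool" where
  "smooth_section E U s \<longleftrightarrow> (\<forall>(V, r, e) \<in> frames E. \<exists>f.
     (\<forall>i<r. smooth_on (U \<inter> V) (f i)) \<and> (\<forall>z \<in> U \<inter> V. s z = (\<Sum>i<r. f i z *\<^sub>R e i z)))"

definition vector_bundle :: "'v::real_vector vbundle \<Rightarrow> bool" where
  "vector_bundle E \<longleftrightarrow>
     (\<forall>z. z \<noteq> 0 \<longrightarrow> (\<exists>(V, r, e) \<in> frames E. z \<in> V)) \<and>
     (\<forall>(V, r, e) \<in> frames E. open_punctured V \<and>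
        (\<forall>z\<in>V. inj_on (\<lambda>i. e i z) {..<r} \<and> independent ((\<lambda>i. e i z) ` {..<r}) \<and>
               span ((\<lambda>i. e i z) ` {..<r}) = fibre E z) \<and>
        (\<forall>j<r. smooth_section E V (e j)))"

text \<open>
  The third condition says that \<open>nabla\<close> is compatible with restriction to open subsets.
\<close>

definition connection :: "'v::real_vector vbundle \<Rightarrow> bool" where
  "connection E \<longleftrightarrow> (\<forall>U s. open_punctured U \<and> smooth_section E U s \<longrightarrow>
     (\<forall>v. smooth_section E U (\<lambda>z. nabla E s z v)) \<and>
     (\<forall>z\<in>U. linear (nabla E s z)) \<and>
     (\<forall>t. (\<forall>z\<in>U. t z = s z) \<longrightarrow> (\<forall>z\<in>U. \<forall>v. nabla E t z v = nabla E s z v)) \<and>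
     (\<forall>t. smooth_section E U t \<longrightarrow>
        (\<forall>z\<in>U. \<forall>v. nabla E (\<lambda>w. s w + t w) z v = nabla E s z v + nabla E t z v)) \<and>
     (\<forall>f. smooth_on U f \<longrightarrow>
        (\<forall>z\<in>U. \<forall>v. nabla E (\<lambda>w. f w *\<^sub>R s w) z v =
                     f z *\<^sub>R nabla E s z v + frechet_derivative f (at z) v *\<^sub>R s z)))"

text \<open>
  Vanishing of the curvature is tested on constant vector fields \<open>u, v\<close>, which commute and
  span each tangent space.
\<close>

definition flat_bundle :: "'v::real_vector vbundle \<Rightarrow> bool" where
  "flat_bundle E \<longleftrightarrow> vector_bundle E \<and> connection E \<and>
     (\<forall>U s. open_punctured U \<and> smooth_section E U s \<longrightarrow>
        (\<forall>z\<in>U. \<forall>u v. nabla E (\<lambda>w. nabla E s w v) z u = nabla E (\<lambda>w. nabla E s w u) z v))"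

definition flat_section :: "'v::real_vector vbundle \<Rightarrow> complex set \<Rightarrow> (complex \<Rightarrow> 'v) \<Rightarrow> bool" where
  "flat_section E U s \<longleftrightarrow> smooth_section E U s \<and> (\<forall>z\<in>U. \<forall>v. nabla E s z v = 0)"

text \<open>
  \<open>\<sigma>\<close> is a flat section along the circle \<open>t \<mapsto> z e\<^sup>i\<^sup>t\<close>, possibly multivalued on the circle itself;
  \<open>flat_shift E z \<theta>\<close> is the flat shift from the fibre over \<open>z\<close> to the fibre over \<open>z e\<^sup>i\<^sup>\<theta>\<close> along the
  arc of signed angle \<open>\<theta>\<close>.
\<close>

definition flat_along_circle :: "'v::real_vector vbundle \<Rightarrow> complex \<Rightarrow> (real \<Rightarrow> 'v) \<Rightarrow> bool" where
  "flat_along_circle E z \<sigma> \<longleftrightarrow> (\<forall>t. \<exists>U s. open_punctured U \<and> z * cis t \<in> U \<and> flat_section E U s \<and>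
     (\<forall>\<^sub>F t' in nhds t. \<sigma> t' = s (z * cis t')))"

definition flat_shift :: "'v::real_vector vbundle \<Rightarrow> complex \<Rightarrow> real \<Rightarrow> 'v \<Rightarrow> 'v" where
  "flat_shift E z \<theta> a = (THE b. \<exists>\<sigma>. flat_along_circle E z \<sigma> \<and> \<sigma> 0 = a \<and> \<sigma> \<theta> = b)"

definition bundle_monodromy :: "'v::real_vector vbundle \<Rightarrow> complex \<Rightarrow> 'v \<Rightarrow> 'v" where
  "bundle_monodromy E z = flat_shift E z (2 * pi)"

text \<open>
  For \<open>c = 1\<close> or \<open>c = - 1\<close>, flatness of a family \<open>P z\<close> of bilinear pairings between the fibres over
  \<open>z\<close> and \<open>c z\<close>: the derivative of \<open>P (s, t)\<close> is \<open>P (\<nabla>s, t) + P (s, \<nabla>t)\<close>. The tangent vector \<open>v\<close>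
  at \<open>z\<close> corresponds to \<open>c v\<close> at \<open>c z\<close>.
\<close>

definition flat_pairing ::
    "'v::real_vector vbundle \<Rightarrow> complex \<Rightarrow> (complex \<Rightarrow> 'v \<Rightarrow> 'v \<Rightarrow> 'c::real_normed_vector) \<Rightarrow> bool" where
  "flat_pairing E c P \<longleftrightarrow>
     (\<forall>z. z \<noteq> 0 \<longrightarrow> bilinear_form_on (fibre E z) (fibre E (c * z)) (P z)) \<and>
     (\<forall>U s t. open_punctured U \<and> smooth_section E U s \<and> smooth_section E ((\<lambda>z. c * z) ` U) t \<longrightarrow>
        (\<forall>z\<in>U. ((\<lambda>w. P w (s w) (t (c * w))) has_derivative
           (\<lambda>v. P z (nabla E s z v) (t (c * z)) + P z (s z) (nabla E t (c * z) (c * v)))) (at z)))"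


section \<open>Data of type gamma\<close>

type_synonym 'v gamma = "'v vbundle \<times> (complex \<Rightarrow> 'v \<Rightarrow> 'v \<Rightarrow> complex)"

definition gamma_data :: "int \<Rightarrow> 'v::real_vector gamma set" where
  "gamma_data m = {(E, P). flat_bundle E \<and>
     (\<forall>z. z \<noteq> 0 \<longrightarrow> eigenvalues_in_circle (fibre E z) (bundle_monodromy E z)) \<and>
     flat_pairing E (- 1) P \<and>
     (\<forall>z. z \<noteq> 0 \<longrightarrow> nondegenerate_on (fibre E z) (fibre E (- z)) (P z) \<and>
        (\<forall>a \<in> fibre E z. \<forall>b \<in> fibre E (- z).
           P z a b \<in> range (\<lambda>x::real. \<i> powi (m + 1) * of_real x) \<and>
           P (- z) b a = (- 1) powi (m + 1) * P z a b))}"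

definition gamma_iso :: "int \<Rightarrow> ('v::real_vector gamma \<times> 'v gamma) set" where
  "gamma_iso m = {((E, P), (E', P')). (E, P) \<in> gamma_data m \<and> (E', P') \<in> gamma_data m \<and>
     (\<exists>f. (\<forall>z. z \<noteq> 0 \<longrightarrow> linear_iso (fibre E z) (fibre E' z) (f z)) \<and>
          (\<forall>U s. open_punctured U \<and> (\<forall>z\<in>U. s z \<in> fibre E z) \<longrightarrow>
             (smooth_section E U s \<longleftrightarrow> smooth_section E' U (\<lambda>z. f z (s z)))) \<and>
          (\<forall>U s. open_punctured U \<and> smooth_section E U s \<longrightarrow>
             (\<forall>z\<in>U. \<forall>v. nabla E' (\<lambda>w. f w (s w)) z v = f z (nabla E s z v))) \<and>
          (\<forall>z. z \<noteq> 0 \<longrightarrow> (\<forall>a \<in> fibre E z. \<forall>b \<in> fibre E (- z).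
             P' z (f z a) (f (- z) b) = P z a b)))}"


section \<open>The constructions, and correspondences of isomorphism classes\<close>

definition alpha_to_beta :: "'v::real_vector alpha \<Rightarrow> 'v beta \<Rightarrow> bool" where
  "alpha_to_beta = (\<lambda>(H, M, S) y. y = (H, L_nor H M S))"

text \<open>
  "The" flat bundle with given fibre and monodromy is determined only up to isomorphism, so the
  second construction is a relation: \<open>E\<close> is any such bundle, with an identification \<open>\<iota>\<close> of \<open>H\<close> with
  the fibre over the base point \<open>1\<close>, and \<open>\<Lambda>\<close> is the flat pairing on the fibres of \<open>E\<close> induced by \<open>L\<close>.
\<close>

definition beta_to_gamma :: "int \<Rightarrow> 'v::real_vector beta \<Rightarrow> 'v gamma \<Rightarrow> bool" where
  "beta_to_gamma m = (\<lambda>(H, L) (E, P). flat_bundle E \<and>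
     (\<exists>\<iota> (\<Lambda> :: complex \<Rightarrow> 'v \<Rightarrow> 'v \<Rightarrow> real).
        linear_iso H (fibre E 1) \<iota> \<and>
        (\<forall>a\<in>H. bundle_monodromy E 1 (\<iota> a) = \<iota> ((- 1) powi (m + 1) *\<^sub>R Seifert_monodromy H L a)) \<and>
        flat_pairing E 1 \<Lambda> \<and>
        (\<forall>a\<in>H. \<forall>b\<in>H. \<Lambda> 1 (\<iota> a) (\<iota> b) = L a b) \<and>
        (\<forall>z. z \<noteq> 0 \<longrightarrow> (\<forall>a \<in> fibre E z. \<forall>b \<in> fibre E (- z).
           P z a b = 1 / (2 * of_real pi * \<i>) powi (m + 1)
                     * of_real (\<Lambda> z a (flat_shift E (- z) (- pi) b))))))"

text \<open>
  A construction \<open>K\<close>, defined on the data \<open>A\<close> with isomorphism relation \<open>R\<close>, always yields data in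
  \<open>B\<close>, with isomorphism relation \<open>S\<close>, and induces a bijection from the isomorphism classes of \<open>A\<close>
  to those of \<open>B\<close>.
\<close>

definition class_correspondence ::
    "'a set \<Rightarrow> ('a \<times> 'a) set \<Rightarrow> 'b set \<Rightarrow> ('b \<times> 'b) set \<Rightarrow> ('a \<Rightarrow> 'b \<Rightarrow> bool) \<Rightarrow> bool" where
  "class_correspondence A R B S K \<longleftrightarrow> equiv A R \<and> equiv B S \<and>
     (\<forall>x\<in>A. (\<exists>y. K x y) \<and> (\<forall>y. K x y \<longrightarrow> y \<in> B)) \<and>
     (\<forall>x x' y y'. (x, x') \<in> R \<and> K x y \<and> K x' y' \<longrightarrow> (y, y') \<in> S) \<and>
     bij_betw (\<lambda>X. {y'. \<exists>x\<in>X. \<exists>y. K x y \<and> (y, y') \<in> S}) (A // R) (B // S)"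

end

theory Submission
  imports Defs "HOL-Computational_Algebra.Fundamental_Theorem_Algebra"
begin

text \<open>
  From alpha to beta. Put \<open>X = M - id\<close>. The space \<open>H\<close> is the direct sum of the Fitting null component and
  the Fitting range of \<open>X\<close>, and these complexify to the eigenspace of \<open>M\<^sub>s\<close> for the eigenvalue \<open>1\<close> and to the
  sum of the other eigenspaces (\<open>jordan_decomposition_fitting\<close>). So \<open>\<nu>\<^sup>-\<^sup>1\<close> is the real endomorphism
  \<open>nu_inv\<close>, which is \<open>X\<close> on the range and a power series in \<open>X\<close> on the null component. If \<open>S\<close> is invariant,
  then \<open>X\<close> has the left adjoint \<open>- X / (1 + X)\<close>, and an identity of power series
  (\<open>exp_quot_fps_compose\<close>) gives the adjoint of \<open>nu_inv\<close>. It follows that the symmetry conditions on \<open>S\<close>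
  say exactly that \<open>(-1)\<^sup>m\<^sup>+\<^sup>1 M\<close> is the monodromy of \<open>L a b = - S a (\<nu>\<^sup>-\<^sup>1 b)\<close>. Conversely, \<open>L\<close> determines
  \<open>M\<close>, hence \<open>\<nu>\<close> and \<open>S\<close>.

  From beta to gamma. A flat bundle on the punctured plane is controlled by its parallel transport. Near
  each point there is a frame of flat sections (\<open>flat_frame_exists\<close>): its coordinates solve an integrable linear
  system of differential equations, whose solutions are constructed by iterated integrals and are smooth.
  Flat sections continue along paths, and on the simply connected plane that covers the punctured plane by the
  exponential map they become global. This gives the transport \<open>T w\<close> from the fibre over \<open>1\<close> to the fibre over
  \<open>exp w\<close>, and \<open>T (2 \<pi> i)\<close> is the monodromy. Flat pairings are those that are invariant under simultaneous
  transport (\<open>flat_pairing_T\<close>, \<open>flat_pairingI\<close>). Therefore all of gamma is encoded in the fibre over \<open>1\<close>,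
  the monodromy and the form \<open>P 1 a (T (i \<pi>) b)\<close>, which up to a constant is the Seifert form. The symmetry of \<open>P\<close>
  says that its monodromy is up to sign that of the bundle.
  Isomorphisms of these data extend to bundle isomorphisms by transport (\<open>transported_iso\<close>), and a bundle with
  any given monodromy is glued from two cut planes (\<open>flat_bundle_with_monodromy\<close>).
\<close>

section \<open>Linear maps on finite dimensional subspaces\<close>

lemma linear_map_on_add: "linear_map_on V f ==> x \<in> V ==> y \<in> V ==> f (x + y) = f x + f y"
 by (simp add: linear_map_on_def)

lemma linear_map_on_scale: "linear_map_on V f ==> x \<in> V ==> f (c *\<^sub>R x) = c *\<^sub>R f x"
 by (simp add: linear_map_on_def)

lemma linear_map_on_zero: "linear_map_on V f ==> subspace V ==> f 0 = 0"
 by (metis linear_map_on_scale scaleR_zero_left subspace_0)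

lemma linear_map_on_neg: "linear_map_on V f ==> x \<in> V ==> f (- x) = - f x"
 using linear_map_on_scale[of V f x "-1"] by simp

lemma linear_map_on_diff:
 "linear_map_on V f ==> subspace V ==> x \<in> V ==> y \<in> V ==> f (x - y) = f x - f y"
 using linear_map_on_add[of V f x "- y"] linear_map_on_neg[of V f y] subspace_neg[of V y] by simp

lemma linear_map_on_sum:
 assumes "linear_map_on V f" "subspace V" "\<And>i. i \<in> I ==> g i \<in> V"
 shows "f (\<Sum>i\<in>I. g i) = (\<Sum>i\<in>I. f (g i))"
 using assms(3)
proof (induction I rule: infinite_finite_induct)
 case (insert i I)
 then have "(\<Sum>i\<in>I. g i) \<in> V" using assms(2) by (auto intro: subspace_sum)
 then show ?case using insert assms linear_map_on_add[of V f] by simp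
qed (use assms linear_map_on_zero in auto)

lemma linear_map_on_subset: "linear_map_on V f ==> U \<subseteq> V ==> linear_map_on U f"
 unfolding linear_map_on_def by (meson subsetD)

lemma linear_map_on_comp:
 "linear_map_on V f ==> f ` V \<subseteq> W ==> linear_map_on W g ==> linear_map_on V (\<lambda>x. g (f x))"
 unfolding linear_map_on_def by (simp add: image_subset_iff)

lemma linear_map_on_funpow:
 assumes "linear_map_on V f" "f ` V \<subseteq> V"
 shows "linear_map_on V (f ^^ k)" "(f ^^ k) ` V \<subseteq> V"
proof -
 have "linear_map_on V (f ^^ k) \<and> (f ^^ k) ` V \<subseteq> V"
 proof (induction k)
  case (Suc k)
  then show ?case
   using assms linear_map_on_comp[of V "f ^^ k" V f] by (auto simp: o_def)
 qed (auto simp: linear_map_on_def)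
 then show "linear_map_on V (f ^^ k)" "(f ^^ k) ` V \<subseteq> V" by auto
qed

lemma subspace_image_on:
 assumes "linear_map_on V f" "subspace V" shows "subspace (f ` V)"
proof (rule subspaceI)
 show "0 \<in> f ` V" using assms linear_map_on_zero subspace_0 by (metis image_eqI)
 fix x y assume "x \<in> f ` V" "y \<in> f ` V"
 then show "x + y \<in> f ` V" using assms linear_map_on_add subspace_add by (smt (verit) imageE image_eqI)
next
 fix c x assume "x \<in> f ` V"
 then show "c *\<^sub>R x \<in> f ` V" using assms linear_map_on_scale subspace_scale by (smt (verit) imageE image_eqI)
qed

lemma subspace_kernel_on:
 assumes "linear_map_on V f" "subspace V" shows "subspace {x \<in> V. f x = 0}"
 using assms linear_map_on_zero[OF assms] linear_map_on_add[OF assms(1)] linear_map_on_scale[OF assms(1)]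
 by (auto intro!: subspaceI simp: subspace_0 subspace_add subspace_scale)

lemma inj_on_linear_iff:
 assumes "linear_map_on V f" "subspace V"
 shows "inj_on f V \<longleftrightarrow> (\<forall>x\<in>V. f x = 0 --> x = 0)"
proof
 assume "inj_on f V" then show "\<forall>x\<in>V. f x = 0 --> x = 0"
  using linear_map_on_zero[OF assms] subspace_0[OF assms(2)] by (metis inj_onD)
next
 assume *: "\<forall>x\<in>V. f x = 0 --> x = 0"
 show "inj_on f V"
 proof (rule inj_onI)
  fix x y assume "x \<in> V" "y \<in> V" "f x = f y"
  then show "x = y"
   using * linear_map_on_diff[OF assms] subspace_diff[OF assms(2)] by (metis eq_iff_diff_eq_0)
 qed
qed

lemma linear_map_on_inv_into:
 assumes "linear_map_on V f" "subspace V" "inj_on f V"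
 shows "linear_map_on (f ` V) (inv_into V f)"
 unfolding linear_map_on_def
proof (safe)
 fix x y assume "x \<in> V" "y \<in> V"
 then show "inv_into V f (f x + f y) = inv_into V f (f x) + inv_into V f (f y)"
  using assms by (metis inv_into_f_eq linear_map_on_add subspace_add)
next
 fix c x assume "x \<in> V"
 then show "inv_into V f (c *\<^sub>R f x) = c *\<^sub>R inv_into V f (f x)"
  using assms by (metis inv_into_f_eq linear_map_on_scale subspace_scale)
qed

lemma linear_isoD:
 assumes "linear_iso V W f"
 shows "linear_map_on V f" "inj_on f V" "f ` V = W" "\<And>x. x \<in> V ==> f x \<in> W"
 using assms by (auto simp: linear_iso_def bij_betw_def)

lemma linear_iso_inv:
 assumes "linear_iso V W f" "subspace V" shows "linear_iso W V (inv_into V f)"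
 using linear_map_on_inv_into[of V f] assms bij_betw_inv_into[of f V W]
 by (auto simp: linear_iso_def bij_betw_def)

lemma linear_iso_comp:
 assumes "linear_iso U V f" "linear_iso V W g" shows "linear_iso U W (\<lambda>x. g (f x))"
 using assms linear_map_on_comp[of U f V g] bij_betw_trans[of f U V g W]
 by (auto simp: linear_iso_def bij_betw_def o_def)

lemma linear_iso_id: "linear_iso V V (\<lambda>x. x)"
 by (auto simp: linear_iso_def linear_map_on_def bij_betw_def)

lemma fin_dim_space_subspace: "fin_dim_space H ==> subspace H"
 by (auto simp: fin_dim_space_def)

lemma fin_dim_space_basis:
 assumes "fin_dim_space H"
 shows "\<exists>B. finite B \<and> independent B \<and> span B = H \<and> card B = dim H"
proof -
 obtain C where C: "finite C" "H = span C" using assms by (auto simp: fin_dim_space_def)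
 obtain B where B: "B \<subseteq> H" "independent B" "H \<subseteq> span B" "card B = dim H"
  using basis_exists by blast
 have "finite B" using independent_span_bound[of C B] B C by auto
 moreover have "span B = H" using B C by (simp add: span_minimal subset_antisym)
 ultimately show ?thesis using B by auto
qed

lemma fin_dim_space_mono:
 assumes "fin_dim_space W" "subspace V" "V \<subseteq> W" shows "fin_dim_space V"
proof -
 obtain C where C: "finite C" "W = span C" using assms by (auto simp: fin_dim_space_def)
 obtain B where B: "B \<subseteq> V" "independent B" "V \<subseteq> span B" using basis_exists[of V] by metis
 have "finite B" using independent_span_bound[of C B] B C assms by auto
 moreover have "span B = V" using B assms by (simp add: span_minimal subset_antisym)
 ultimately show ?thesis by (auto simp: fin_dim_space_def)
qed

lemma fin_dim_space_dim_mono: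
 assumes "fin_dim_space W" "V \<subseteq> W" shows "dim V \<le> dim W"
proof -
 obtain B where B: "finite B" "span B = W" "card B = dim W"
  using fin_dim_space_basis[OF assms(1)] by auto
 then show ?thesis using dim_le_card[of V B] assms by auto
qed

lemma fin_dim_space_dim_eq:
 assumes W: "fin_dim_space W" and V: "subspace V" "V \<subseteq> W" and "dim W \<le> dim V" shows "V = W"
proof -
 obtain B where B: "finite B" "independent B" "span B = V" "card B = dim V"
  using fin_dim_space_basis[OF fin_dim_space_mono[OF W V]] by auto
 obtain C where C: "B \<subseteq> C" "C \<subseteq> W" "independent C" "W \<subseteq> span C"
  using maximal_independent_subset_extend[of B W] B V span_superset by blast
 obtain D where D: "finite D" "span D = W" "card D = dim W" using fin_dim_space_basis[OF W] by auto
 have "finite C \<and> card C \<le> card D" using independent_span_bound[of D C] C D by auto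
 then have "B = C" using B C D assms(4) by (metis card_seteq le_trans)
 then show ?thesis using B C V by auto
qed

lemma fin_dim_space_image:
 assumes "fin_dim_space V" "linear_map_on V f" shows "fin_dim_space (f ` V)"
proof -
 obtain B where B: "finite B" "V = span B" using assms(1) by (auto simp: fin_dim_space_def)
 have sub: "B \<subseteq> V" using B span_superset by auto
 have "f ` V \<subseteq> span (f ` B)"
 proof
  fix y assume "y \<in> f ` V"
  then obtain x where x: "x \<in> span B" "y = f x" using B(2) by blast
  from x(1) obtain u where u: "x = (\<Sum>v\<in>B. u v *\<^sub>R v)" using span_finite[OF B(1)] by auto
  have "f x = (\<Sum>v\<in>B. f (u v *\<^sub>R v))" unfolding u
   by (rule linear_map_on_sum[OF assms(2)]) (use B sub subspace_scale in auto)
  also have "\<dots> = (\<Sum>v\<in>B. u v *\<^sub>R f v)"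
   by (rule sum.cong) (use sub linear_map_on_scale[OF assms(2)] in auto)
  finally have "f x = (\<Sum>v\<in>B. u v *\<^sub>R f v)" .
  then show "y \<in> span (f ` B)" unfolding x(2)
   by (simp add: span_base span_scale span_sum)
 qed
 moreover have "span (f ` B) \<subseteq> f ` V"
  using sub subspace_image_on[OF assms(2)] B by (intro span_minimal) auto
 ultimately show ?thesis using B by (auto simp: fin_dim_space_def)
qed

lemma fin_dim_space_prod:
 assumes "fin_dim_space V" "fin_dim_space W" shows "fin_dim_space (V \<times> W)"
proof -
 obtain B C where BC: "finite B" "finite C" "V = span B" "W = span C"
  using assms by (auto simp: fin_dim_space_def)
 let ?D = "(\<lambda>x. (x, 0)) ` B \<union> (\<lambda>y. (0, y)) ` C"
 have sV: "(\<lambda>x. (x, 0)) ` V \<subseteq> span ?D"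
 proof -
  have "(\<lambda>x. (x, 0)) ` span B \<subseteq> span ((\<lambda>x. (x, 0)) ` B)"
   by (subst linear_span_image[symmetric]) (auto intro!: linearI)
  then show ?thesis using BC span_mono[of "(\<lambda>x. (x, 0)) ` B" ?D] by auto
 qed
 have sW: "(\<lambda>x. (0, x)) ` W \<subseteq> span ?D"
 proof -
  have "(\<lambda>x. (0, x)) ` span C \<subseteq> span ((\<lambda>x. (0, x)) ` C)"
   by (subst linear_span_image[symmetric]) (auto intro!: linearI)
  then show ?thesis using BC span_mono[of "(\<lambda>x. (0, x)) ` C" ?D] by auto
 qed
 have "V \<times> W \<subseteq> span ?D"
 proof
  fix z assume z: "z \<in> V \<times> W"
  then have "(fst z, 0) \<in> span ?D" "(0, snd z) \<in> span ?D" using sV sW by auto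
  then have "(fst z, 0) + (0, snd z) \<in> span ?D" by (rule span_add)
  then show "z \<in> span ?D" by simp
 qed
 moreover have "span ?D \<subseteq> V \<times> W"
  unfolding BC by (intro span_minimal subspace_Times) (auto intro: span_base span_zero)
 ultimately show ?thesis using BC by (auto simp: fin_dim_space_def intro!: exI[of _ ?D])
qed

section \<open>The Fitting decomposition\<close>

lemma bounded_mono_stationary:
 fixes d :: "nat \<Rightarrow> nat"
 assumes "\<And>k. d k \<le> d (Suc k)" "\<And>k. d k \<le> n"
 shows "\<exists>k\<le>n. d k = d (Suc k)"
proof (rule ccontr)
 assume "\<not> ?thesis"
 then have *: "d k < d (Suc k)" if "k \<le> n" for k using that assms(1)[of k] by (metis le_neq_implies_less)
 have "k \<le> Suc n ==> k \<le> d k" for k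
 proof (induction k)
  case (Suc k)
  then show ?case using *[of k] by linarith
 qed simp
 then show False using assms(2)[of "Suc n"] by (metis not_less_eq_eq order_refl order_trans)
qed

text \<open>
 The generalized kernel and the stable image of \<open>X\<close>. The space \<open>W\<close> is their direct sum.
\<close>

definition fit_null :: "'v::real_vector set \<Rightarrow> ('v \<Rightarrow> 'v) \<Rightarrow> 'v set" where
 "fit_null W X = {x \<in> W. (X ^^ dim W) x = 0}"

definition fit_range :: "'v::real_vector set \<Rightarrow> ('v \<Rightarrow> 'v) \<Rightarrow> 'v set" where
 "fit_range W X = (X ^^ dim W) ` W"

context
 fixes W :: "'v::real_vector set" and X :: "'v \<Rightarrow> 'v"
 assumes W: "fin_dim_space W" and lin: "linear_map_on W X" and inv: "X ` W \<subseteq> W"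
begin

lemma fit_sub: "subspace W" using fin_dim_space_subspace W by auto

lemma subspace_fit_null: "subspace (fit_null W X)"
 unfolding fit_null_def by (rule subspace_kernel_on[OF linear_map_on_funpow(1)[OF lin inv] fit_sub])

lemma subspace_fit_range: "subspace (fit_range W X)"
 unfolding fit_range_def by (rule subspace_image_on[OF linear_map_on_funpow(1)[OF lin inv] fit_sub])

lemma fit_range_subset: "fit_range W X \<subseteq> W"
 unfolding fit_range_def by (rule linear_map_on_funpow(2)[OF lin inv])

lemma fit_nullI:
 assumes x: "x \<in> W" and k: "(X ^^ k) x = 0" shows "x \<in> fit_null W X"
proof -
 define F where "F j = {x \<in> W. (X ^^ j) x = 0}" for j
 have sub: "subspace (F j)" "F j \<subseteq> W" for j
  unfolding F_def using subspace_kernel_on[OF linear_map_on_funpow(1)[OF lin inv] fit_sub] by auto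
 have mono: "F j \<subseteq> F (Suc j)" for j using linear_map_on_zero[OF lin fit_sub] by (auto simp: F_def)
 have step: "F (Suc (Suc j)) \<subseteq> F (Suc j)" if "F (Suc j) \<subseteq> F j" for j
 proof
  fix y assume y: "y \<in> F (Suc (Suc j))"
  then have "X y \<in> F (Suc j)" using inv by (auto simp: F_def funpow_Suc_right simp del: funpow.simps)
  then have "X y \<in> F j" using that by auto
  then show "y \<in> F (Suc j)" using y by (auto simp: F_def funpow_Suc_right simp del: funpow.simps)
 qed
 have "dim (F j) \<le> dim (F (Suc j))" "dim (F j) \<le> dim W" for j
  using fin_dim_space_dim_mono[OF fin_dim_space_mono[OF W sub(1) sub(2)] mono]
   fin_dim_space_dim_mono[OF W sub(2)] by auto
 then obtain j where j: "j \<le> dim W" "dim (F j) = dim (F (Suc j))"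
  using bounded_mono_stationary[of "\<lambda>j. dim (F j)" "dim W"] by blast
 then have "F j = F (Suc j)"
  using fin_dim_space_dim_eq[of "F (Suc j)" "F j"] fin_dim_space_mono[OF W] sub mono by auto
 then have st: "F (Suc (j + i)) \<subseteq> F (j + i)" for i
  by (induction i) (use step in auto)
 have st2: "F (j + i) \<subseteq> F j" for i by (induction i) (use st in auto)
 have mono2: "i \<le> l ==> F i \<subseteq> F l" for i l using mono by (metis lift_Suc_mono_le)
 have "x \<in> F (j + k)" using mono2[of k "j + k"] x k by (auto simp: F_def)
 then have "x \<in> F (dim W)" using st2 mono2[OF j(1)] by auto
 then show ?thesis by (auto simp: F_def fit_null_def)
qed

lemma fit_null_invariant: "X ` fit_null W X \<subseteq> fit_null W X"
proof
 fix y assume "y \<in> X ` fit_null W X"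
 then obtain x where x: "x \<in> W" "(X ^^ dim W) x = 0" "y = X x" unfolding fit_null_def by blast
 have "(X ^^ dim W) y = X ((X ^^ dim W) x)" unfolding x(3) by (rule funpow_swap1[symmetric])
 then have "(X ^^ dim W) y = 0" using x(2) linear_map_on_zero[OF lin fit_sub] by simp
 then show "y \<in> fit_null W X" using x(1,3) inv by (auto simp: fit_null_def)
qed

lemma fit_range_stable: "(X ^^ (dim W + i)) ` W = fit_range W X"
proof -
 define F where "F j = (X ^^ j) ` W" for j
 have sub: "subspace (F j)" "F j \<subseteq> W" for j
  unfolding F_def using subspace_image_on[OF linear_map_on_funpow(1)[OF lin inv] fit_sub]
   linear_map_on_funpow(2)[OF lin inv] by auto
 have suc: "F (Suc j) = X ` F j" for j by (auto simp: F_def)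
 have mono: "F (Suc j) \<subseteq> F j" for j
  using inv unfolding F_def funpow_Suc_right image_comp[symmetric] by (rule image_mono)
 have "dim W - dim (F j) \<le> dim W - dim (F (Suc j))" for j
  using fin_dim_space_dim_mono[OF fin_dim_space_mono[OF W sub(1) sub(2)] mono] by (rule diff_le_mono2)
 then obtain j where j: "j \<le> dim W" "dim W - dim (F j) = dim W - dim (F (Suc j))"
  using bounded_mono_stationary[of "\<lambda>j. dim W - dim (F j)" "dim W"] by auto
 then have "dim (F j) \<le> dim (F (Suc j))"
  using fin_dim_space_dim_mono[OF W sub(2), of j] fin_dim_space_dim_mono[OF W sub(2), of "Suc j"] by linarith
 then have "F (Suc j) = F j"
  using fin_dim_space_dim_eq[of "F j" "F (Suc j)"] fin_dim_space_mono[OF W] sub mono by auto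
 then have "F (j + i) = F j" for i by (induction i) (use suc in auto)
 then have "F (dim W + i) = F (dim W)" for i using j(1) by (metis add.assoc le_add_diff_inverse)
 then show ?thesis by (simp add: F_def fit_range_def)
qed

lemma fit_range_surj: "X ` fit_range W X = fit_range W X"
proof -
 have "(X ^^ (dim W + 1)) ` W = X ` (X ^^ dim W) ` W" by (simp add: image_comp)
 then show ?thesis using fit_range_stable[of 1] by (simp add: fit_range_def)
qed

lemma fit_disjoint: assumes "x \<in> fit_null W X" "x \<in> fit_range W X" shows "x = 0"
proof -
 obtain y where y: "y \<in> W" "x = (X ^^ dim W) y" using assms by (auto simp: fit_range_def)
 then have "(X ^^ (dim W + dim W)) y = 0" using assms by (auto simp: fit_null_def funpow_add)
 then have "y \<in> fit_null W X" using fit_nullI y by blast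
 then show ?thesis using y by (auto simp: fit_null_def)
qed

lemma fit_decomp: assumes "x \<in> W" shows "\<exists>a\<in>fit_null W X. \<exists>b\<in>fit_range W X. x = a + b"
proof -
 have "(X ^^ dim W) x \<in> (X ^^ (dim W + dim W)) ` W"
  using fit_range_stable[of "dim W"] assms by (auto simp: fit_range_def)
 then obtain y where y: "y \<in> W" "(X ^^ dim W) x = (X ^^ (dim W + dim W)) y" by auto
 define b where "b = (X ^^ dim W) y"
 have b: "b \<in> fit_range W X" "b \<in> W"
  using y linear_map_on_funpow(2)[OF lin inv] by (auto simp: b_def fit_range_def)
 have "(X ^^ dim W) (x - b) = 0"
  using y linear_map_on_diff[OF linear_map_on_funpow(1)[OF lin inv] fit_sub assms b(2)]
  by (simp add: b_def funpow_add)
 then have "x - b \<in> fit_null W X"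
  using assms b subspace_diff[OF fit_sub] by (auto simp: fit_null_def)
 then show ?thesis using b by (intro bexI[of _ "x - b"] bexI[of _ b]) auto
qed

lemma fit_range_inj: "inj_on X (fit_range W X)"
proof -
 have "x = 0" if "x \<in> fit_range W X" "X x = 0" for x
  using that fit_disjoint fit_nullI[of x 1] fit_range_subset by auto
 then show ?thesis
  using inj_on_linear_iff[OF linear_map_on_subset[OF lin fit_range_subset] subspace_fit_range] by auto
qed

end

lemma fin_dim_inj_imp_surj:
 assumes W: "fin_dim_space W" and lin: "linear_map_on W X" and inv: "X ` W \<subseteq> W" and inj: "inj_on X W"
 shows "X ` W = W"
proof -
 have sub: "subspace W" using W fin_dim_space_subspace by auto
 have "(X ^^ k) x = 0 ==> x \<in> W ==> x = 0" for k x
 proof (induction k arbitrary: x)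
  case (Suc k)
  then have "X x = 0" using inv by (auto simp: funpow_Suc_right simp del: funpow.simps)
  then show ?case using inj Suc inj_on_linear_iff[OF lin sub] by auto
 qed auto
 then have "fit_null W X \<subseteq> {0}" by (auto simp: fit_null_def)
 then have "W \<subseteq> fit_range W X" using fit_decomp[OF W lin inv] by fastforce
 then show ?thesis
  using fit_range_subset[OF W lin inv] fit_range_surj[OF W lin inv] by auto
qed

section \<open>Jordan decomposition of complexified endomorphisms\<close>

interpretation cs: vector_space "cscale :: complex \<Rightarrow> 'v::real_vector \<times> 'v \<Rightarrow> 'v \<times> 'v"
 by unfold_locales (auto simp: cscale_def prod_eq_iff algebra_simps)

lemma cscale_of_real: "cscale (of_real r) x = r *\<^sub>R x"
 by (simp add: cscale_def prod_eq_iff)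

lemma cs_subspace_real: "cs.subspace W ==> subspace W"
 by (simp add: cs.subspace_def subspace_def flip: cscale_of_real)

lemma cs_subspace_Times: "subspace H ==> cs.subspace (H \<times> H)"
 by (rule cs.subspaceI)
  (auto simp: cscale_def subspace_0 subspace_add subspace_diff subspace_scale zero_prod_def)

lemma clinear_endo_linear:
 "clinear_endo W f ==> linear_map_on W f"
 unfolding clinear_endo_def linear_map_on_def by (metis cscale_of_real)

lemma clinear_endoD:
 assumes "clinear_endo W f"
 shows "x \<in> W ==> f x \<in> W" "x \<in> W ==> y \<in> W ==> f (x + y) = f x + f y"
  "x \<in> W ==> f (cscale c x) = cscale c (f x)" "f ` W \<subseteq> W"
 using assms by (auto simp: clinear_endo_def)

lemma cscale_funpow:
 assumes "clinear_endo W f" "x \<in> W" shows "(f ^^ n) (cscale c x) = cscale c ((f ^^ n) x)" "(f ^^ n) x \<in> W"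
proof -
 have "(f ^^ n) x \<in> W \<and> (f ^^ n) (cscale c x) = cscale c ((f ^^ n) x)"
  by (induction n) (use assms clinear_endoD[OF assms(1)] in auto)
 then show "(f ^^ n) (cscale c x) = cscale c ((f ^^ n) x)" "(f ^^ n) x \<in> W" by auto
qed

lemma fin_dim_space_relation:
 assumes W: "fin_dim_space W" and v: "\<And>i. v i \<in> W"
 shows "\<exists>c::nat \<Rightarrow> real. (\<Sum>i\<le>dim W. c i *\<^sub>R v i) = 0 \<and> (\<exists>i\<le>dim W. c i \<noteq> 0)"
proof (cases "inj_on v {..dim W}")
 case False
 then obtain i j where ij: "i \<le> dim W" "j \<le> dim W" "i \<noteq> j" "v i = v j" by (auto simp: inj_on_def)
 define c where "c k = (if k = i then 1 else if k = j then -1 else 0 :: real)" for k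
 have "(\<Sum>k\<le>dim W. c k *\<^sub>R v k) = (\<Sum>k\<in>{i, j}. c k *\<^sub>R v k)"
  by (rule sum.mono_neutral_right) (use ij in \<open>auto simp: c_def\<close>)
 also have "\<dots> = 0" using ij by (simp add: c_def)
 finally show ?thesis using ij by (intro exI[of _ c]) (auto simp: c_def)
next
 case True
 obtain B where B: "finite B" "span B = W" "card B = dim W" using fin_dim_space_basis[OF W] by auto
 have "\<not> independent (v ` {..dim W})"
 proof
  assume "independent (v ` {..dim W})"
  then have "card (v ` {..dim W}) \<le> card B" using independent_span_bound[of B] B v by auto
  then show False using card_image[OF True] B by simp
 qed
 then obtain u where u: "\<exists>x\<in>v ` {..dim W}. u x \<noteq> 0" "(\<Sum>x\<in>v ` {..dim W}. u x *\<^sub>R x) = 0"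
  using dependent_finite[of "v ` {..dim W}"] by auto
 have "(\<Sum>i\<le>dim W. u (v i) *\<^sub>R v i) = 0"
  using u(2) sum.reindex[OF True, of "\<lambda>x. u x *\<^sub>R x"] by simp
 then show ?thesis using u(1) by (intro exI[of _ "\<lambda>i. u (v i)"]) auto
qed

text \<open>
 A nonzero polynomial \<open>p\<close> of least degree with \<open>p(f) x = 0\<close> has a root \<open>l\<close>, so it is
 \<open>(X - l) q\<close>, and \<open>q(f) x\<close> is an eigenvector with eigenvalue \<open>l\<close>.
\<close>

lemma exists_eigenvector:
 fixes W :: "('v::real_vector \<times> 'v) set"
 assumes W: "fin_dim_space W" "cs.subspace W" and f: "clinear_endo W f" and x: "x \<in> W" "x \<noteq> 0"
 shows "\<exists>l y. y \<in> W \<and> y \<noteq> 0 \<and> f y = cscale l y"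
proof -
 define A where "A p = (\<Sum>i\<le>degree p. cscale (coeff p i) ((f ^^ i) x))" for p :: "complex poly"
 have fx: "(f ^^ i) x \<in> W" for i using cscale_funpow(2)[OF f x(1)] .
 have A_W: "A p \<in> W" for p
  unfolding A_def by (intro cs.subspace_sum[OF W(2)] cs.subspace_scale[OF W(2)] fx)
 have A_eq: "A p = (\<Sum>i\<le>N. cscale (coeff p i) ((f ^^ i) x))" if "degree p \<le> N" for p N
  unfolding A_def by (rule sum.mono_neutral_left) (use that in \<open>auto simp: coeff_eq_0\<close>)
 obtain c :: "nat \<Rightarrow> real" where c: "(\<Sum>i\<le>dim W. c i *\<^sub>R (f ^^ i) x) = 0" "\<exists>i\<le>dim W. c i \<noteq> 0"
  using fin_dim_space_relation[OF W(1), of "\<lambda>i. (f ^^ i) x"] fx by auto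
 define p0 where "p0 = (\<Sum>i\<le>dim W. monom (of_real (c i)) i :: complex poly)"
 have cp0: "coeff p0 i = (if i \<le> dim W then of_real (c i) else 0)" for i
  by (auto simp: p0_def coeff_sum)
 have "degree p0 \<le> dim W" by (rule degree_le) (auto simp: cp0)
 then have "A p0 = (\<Sum>i\<le>dim W. c i *\<^sub>R (f ^^ i) x)" by (simp add: A_eq cp0 cscale_of_real)
 then have "p0 \<noteq> 0 \<and> A p0 = 0" using c cp0 by (metis coeff_0 of_real_eq_0_iff)
 then obtain p where p: "p \<noteq> 0" "A p = 0" and
  least: "\<And>q. q \<noteq> 0 ==> A q = 0 ==> degree p \<le> degree q"
  using ex_has_least_nat[of "\<lambda>p. p \<noteq> 0 \<and> A p = 0" p0 degree] by auto
 have "degree p \<noteq> 0"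
 proof
  assume "degree p = 0"
  then have "cscale (coeff p 0) x = 0" "coeff p 0 \<noteq> 0"
   using p(2) leading_coeff_0_iff[of p] p(1) by (simp_all add: A_def)
  then show False using x cs.scale_eq_0_iff by blast
 qed
 then have "\<not> constant (poly p)" by (simp add: constant_degree)
 then obtain l where "poly p l = 0" using fundamental_theorem_of_algebra by blast
 then obtain q where q: "p = [:-l, 1:] * q" by (auto simp: poly_eq_0_iff_dvd elim: dvdE)
 have q0: "q \<noteq> 0" using p q by auto
 have deg: "degree p = Suc (degree q)" unfolding q using q0 by (subst degree_mult_eq) auto
 have "A q \<noteq> 0" using least[OF q0] deg by auto
 have co: "coeff p i = - l * coeff q i + coeff (pCons 0 q) i" for i by (simp add: q)
 have "A p = (\<Sum>i\<le>Suc (degree q). cscale (- l * coeff q i) ((f ^^ i) x)) +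
   (\<Sum>i\<le>Suc (degree q). cscale (coeff (pCons 0 q) i) ((f ^^ i) x))"
  unfolding A_def deg co cs.scale_left_distrib sum.distrib ..
 also have "(\<Sum>i\<le>Suc (degree q). cscale (- l * coeff q i) ((f ^^ i) x)) =
   cscale (- l) (\<Sum>i\<le>Suc (degree q). cscale (coeff q i) ((f ^^ i) x))"
  by (simp only: cs.scale_sum_right cs.scale_scale)
 also have "\<dots> = - cscale l (A q)" by (subst A_eq[symmetric]) (auto simp: cs.scale_minus_left)
 also have "(\<Sum>i\<le>Suc (degree q). cscale (coeff (pCons 0 q) i) ((f ^^ i) x)) =
   (\<Sum>i\<le>degree q. cscale (coeff q i) ((f ^^ Suc i) x))"
  by (subst sum.atMost_Suc_shift) simp
 also have "\<dots> = (\<Sum>i\<le>degree q. f (cscale (coeff q i) ((f ^^ i) x)))"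
  using clinear_endoD(3)[OF f fx] by simp
 also have "\<dots> = f (A q)" unfolding A_def
  by (rule linear_map_on_sum[symmetric, OF clinear_endo_linear[OF f] cs_subspace_real[OF W(2)]])
   (rule cs.subspace_scale[OF W(2) fx])
 finally have "f (A q) = cscale l (A q)" using p by simp
 then show ?thesis using A_W \<open>A q \<noteq> 0\<close> by blast
qed

lemma jordan_decomposition_exists_on:
 fixes W :: "('v::real_vector \<times> 'v) set"
 assumes "fin_dim_space W" "cs.subspace W" "clinear_endo W f" "inj_on f W"
 shows "\<exists>Ms Mu. clinear_endo W Ms \<and> clinear_endo W Mu \<and> semisimple_on W Ms \<and> unipotent_on W Mu \<and>
   (\<forall>x\<in>W. f x = Ms (Mu x) \<and> f x = Mu (Ms x))"
 using assms
proof (induction "dim W" arbitrary: W rule: less_induct)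
 case less
 note W = less.prems(1,2) and f = less.prems(3) and inj = less.prems(4)
 have sub: "subspace W" using cs_subspace_real W by auto
 note linf = clinear_endo_linear[OF f]
 show ?case
 proof (cases "W \<subseteq> {0}")
  case True
  then have "W = {0}" using subspace_0[OF sub] by auto
  then show ?thesis using linear_map_on_zero[OF linf sub] cs.span_zero
   by (intro exI[of _ "\<lambda>x. x"])
    (auto simp: clinear_endo_def semisimple_on_def unipotent_on_def intro!: exI[of _ 1])
 next
  case False
  then obtain x where "x \<in> W" "x \<noteq> 0" by auto
  then obtain l y where y: "y \<in> W" "y \<noteq> 0" "f y = cscale l y" using exists_eigenvector[OF W f] by blast
  have l0: "l \<noteq> 0"
  proof
   assume "l = 0" then have "f y = 0" using y by simp
   then show False using inj y inj_on_linear_iff[OF linf sub] by auto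
  qed
  define X where "X x = f x - cscale l x" for x
  have cX: "clinear_endo W X"
   unfolding clinear_endo_def X_def using clinear_endoD[OF f] W(2)
   by (auto simp: cs.subspace_diff cs.subspace_scale cs.scale_right_distrib cs.scale_right_diff_distrib mult.commute)
  note linX = clinear_endo_linear[OF cX] and invX = clinear_endoD(4)[OF cX]
  define K I where "K = fit_null W X" and "I = fit_range W X"
  have subK: "subspace K" and subI: "subspace I" and IW: "I \<subseteq> W" and KW: "K \<subseteq> W"
   using subspace_fit_null[OF W(1) linX invX] subspace_fit_range[OF W(1) linX invX]
    fit_range_subset[OF W(1) linX invX] by (auto simp: K_def I_def fit_null_def)
  have cK: "cs.subspace K" and cI: "cs.subspace I"
  proof -
   show "cs.subspace K"
    using subK W(2) cscale_funpow[OF cX]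
    by (auto simp: cs.subspace_def subspace_def K_def fit_null_def)
   have "cscale c x \<in> I" if xI: "x \<in> I" for c x
   proof -
    obtain y where "y \<in> W" "x = (X ^^ dim W) y" using xI unfolding I_def fit_range_def by blast
    then show ?thesis using cscale_funpow[OF cX] cs.subspace_scale[OF W(2)]
     unfolding I_def fit_range_def by (metis image_eqI)
   qed
   then show "cs.subspace I" using subI by (auto simp: cs.subspace_def subspace_def)
  qed
  have yK: "y \<in> K" using fit_nullI[OF W(1) linX invX, of y 1] y by (auto simp: K_def X_def)
  have KI0: "x = 0" if "x \<in> K" "x \<in> I" for x
   using fit_disjoint[OF W(1) linX invX] that by (auto simp: K_def I_def)
  have dimI: "dim I < dim W"
  proof (rule ccontr)
   assume "\<not> dim I < dim W"
   then have "I = W" using fin_dim_space_dim_eq[OF W(1) subI IW] by auto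
   then show False using KI0 yK y by auto
  qed
  have f_eq: "f x = X x + cscale l x" for x by (simp add: X_def)
  have fI: "f x \<in> I" if "x \<in> I" for x
   unfolding f_eq using fit_range_surj[OF W(1) linX invX] that cI
   by (intro cs.subspace_add cs.subspace_scale) (auto simp: I_def)
  have fK: "f x \<in> K" if "x \<in> K" for x
   unfolding f_eq using fit_null_invariant[OF W(1) linX invX] that cK
   by (intro cs.subspace_add cs.subspace_scale) (auto simp: K_def)
  have "clinear_endo I f" using f fI IW unfolding clinear_endo_def by blast
  then obtain Ms' Mu' where cMs': "clinear_endo I Ms'" and cMu': "clinear_endo I Mu'"
   and ss': "semisimple_on I Ms'" and un': "unipotent_on I Mu'"
   and fac': "\<And>x. x \<in> I ==> f x = Ms' (Mu' x) \<and> f x = Mu' (Ms' x)"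
   using less.hyps[OF dimI fin_dim_space_mono[OF W(1) subI IW] cI] inj_on_subset[OF inj IW] by blast
  define p where "p x = (SOME i. i \<in> I \<and> x - i \<in> K)" for x
  have p: "p (k + i) = i" if "k \<in> K" "i \<in> I" for k i
  proof -
   have "p (k + i) \<in> I \<and> k + i - p (k + i) \<in> K"
    unfolding p_def by (rule someI[of _ i]) (use that in auto)
   then have "i - p (k + i) \<in> I" "(k + i - p (k + i)) - k \<in> K"
    using subspace_diff[OF subI that(2), of "p (k + i)"]
     subspace_diff[OF subK _ that(1), of "k + i - p (k + i)"] by blast+
   then show ?thesis using KI0[of "i - p (k + i)"] by (simp add: algebra_simps)
  qed
  define Ms where "Ms x = cscale l (x - p x) + Ms' (p x)" for x
  define Mu where "Mu x = cscale (inverse l) (f (x - p x)) + Mu' (p x)" for x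
  have Ms: "Ms (k + i) = cscale l k + Ms' i" and Mu: "Mu (k + i) = cscale (inverse l) (f k) + Mu' i"
   if "k \<in> K" "i \<in> I" for k i using p[OF that] by (auto simp: Ms_def Mu_def)
  have K0: "0 \<in> K" "0 \<in> I" using subK subI subspace_0 by auto
  have z': "Ms' 0 = 0" "Mu' 0 = 0" "f 0 = 0"
   using linear_map_on_zero[OF clinear_endo_linear[OF cMs'] subI]
    linear_map_on_zero[OF clinear_endo_linear[OF cMu'] subI] linear_map_on_zero[OF linf sub] by auto
  have dec: "\<exists>k\<in>K. \<exists>i\<in>I. x = k + i" if "x \<in> W" for x
   using fit_decomp[OF W(1) linX invX that] by (simp add: K_def I_def)
  note closure = cs.subspace_add[OF cK] cs.subspace_add[OF cI] cs.subspace_scale[OF cK]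
   cs.subspace_scale[OF cI] fK fI clinear_endoD(1)[OF cMs'] clinear_endoD(1)[OF cMu']
  have MsK: "Ms k = cscale l k" "Mu k = cscale (inverse l) (f k)" if "k \<in> K" for k
   using Ms[OF that K0(2)] Mu[OF that K0(2)] z' by auto
  have MsI: "Ms i = Ms' i" "Mu i = Mu' i" if "i \<in> I" for i
   using Ms[OF K0(1) that] Mu[OF K0(1) that] z' by auto
  have cMs: "clinear_endo W Ms" and cMu: "clinear_endo W Mu"
  proof -
   have KIW: "k + i \<in> W" if "k \<in> K" "i \<in> I" for k i
    using that KW IW by (intro subspace_add[OF sub]) (meson subsetD)+
   have "Ms x \<in> W" "Mu x \<in> W" "Ms (cscale c x) = cscale c (Ms x)" "Mu (cscale c x) = cscale c (Mu x)"
    if x: "x \<in> W" for c x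
   proof -
    obtain k i where ki: "k \<in> K" "i \<in> I" "x = k + i" using dec[OF x] by auto
    have k': "cscale c k \<in> K" "cscale c i \<in> I" using ki closure by auto
    show "Ms x \<in> W" "Mu x \<in> W" using ki Ms Mu closure KIW by auto
    show "Ms (cscale c x) = cscale c (Ms x)" "Mu (cscale c x) = cscale c (Mu x)"
     unfolding ki(3) cs.scale_right_distrib Ms[OF k'] Mu[OF k'] Ms[OF ki(1,2)] Mu[OF ki(1,2)]
     using clinear_endoD(3)[OF cMs' ki(2)] clinear_endoD(3)[OF cMu' ki(2)]
      clinear_endoD(3)[OF f subsetD[OF KW ki(1)]] by (auto simp: cs.scale_right_distrib mult.commute)
   qed
   moreover have "Ms (x + y) = Ms x + Ms y" "Mu (x + y) = Mu x + Mu y" if x: "x \<in> W" "y \<in> W" for x y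
   proof -
    obtain k i where ki: "k \<in> K" "i \<in> I" "x = k + i" using dec x by meson
    obtain k2 i2 where ki2: "k2 \<in> K" "i2 \<in> I" "y = k2 + i2" using dec x by meson
    have s: "k + k2 \<in> K" "i + i2 \<in> I" using ki ki2 closure by auto
    have xy: "x + y = (k + k2) + (i + i2)" using ki ki2 by simp
    show "Ms (x + y) = Ms x + Ms y"
     unfolding xy Ms[OF s] unfolding ki(3) ki2(3) Ms[OF ki(1,2)] Ms[OF ki2(1,2)]
      clinear_endoD(2)[OF cMs' ki(2) ki2(2)] cs.scale_right_distrib by simp
    have "f (k + k2) = f k + f k2" using clinear_endoD(2)[OF f subsetD[OF KW ki(1)] subsetD[OF KW ki2(1)]] .
    then show "Mu (x + y) = Mu x + Mu y"
     unfolding xy Mu[OF s] unfolding ki(3) ki2(3) Mu[OF ki(1,2)] Mu[OF ki2(1,2)]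
      clinear_endoD(2)[OF cMu' ki(2) ki2(2)] by (simp add: cs.scale_right_distrib)
   qed
   ultimately show "clinear_endo W Ms" "clinear_endo W Mu" unfolding clinear_endo_def by blast+
  qed
  have "semisimple_on W Ms"
   unfolding semisimple_on_def
  proof
   fix x assume "x \<in> W"
   then obtain k i where ki: "k \<in> K" "i \<in> I" "x = k + i" using dec by meson
   have "k \<in> cs.span {x \<in> W. \<exists>l. Ms x = cscale l x}"
    using ki KW MsK by (intro cs.span_base) auto
   moreover have "i \<in> cs.span {x \<in> W. \<exists>l. Ms x = cscale l x}"
   proof (rule subsetD[OF cs.span_mono])
    show "i \<in> cs.span {x \<in> I. \<exists>l. Ms' x = cscale l x}"
     by (rule subsetD[OF ss'[unfolded semisimple_on_def] ki(2)])
    show "{x \<in> I. \<exists>l. Ms' x = cscale l x} \<subseteq> {x \<in> W. \<exists>l. Ms x = cscale l x}"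
    proof safe
     fix a b l assume a: "(a, b) \<in> I" "Ms' (a, b) = cscale l (a, b)"
     then show "(a, b) \<in> W" "\<exists>l. Ms (a, b) = cscale l (a, b)"
      using MsI(1)[OF a(1)] subsetD[OF IW a(1)] by auto
    qed
   qed
   ultimately show "x \<in> cs.span {x \<in> W. \<exists>l. Ms x = cscale l x}"
    unfolding ki(3) by (rule cs.span_add)
  qed
  moreover have "unipotent_on W Mu"
  proof -
   define D where "D y = Mu y - y" for y
   obtain n1 where n1: "\<And>x. x \<in> I ==> ((\<lambda>y. Mu' y - y) ^^ n1) x = 0"
    using un' by (auto simp: unipotent_on_def)
   have DI: "(D ^^ n) i = ((\<lambda>y. Mu' y - y) ^^ n) i \<and> (D ^^ n) i \<in> I" if "i \<in> I" for n i
   proof (induction n)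
    case (Suc n)
    have z: "((\<lambda>y. Mu' y - y) ^^ n) i \<in> I" using Suc by metis
    have "D (((\<lambda>y. Mu' y - y) ^^ n) i) = Mu' (((\<lambda>y. Mu' y - y) ^^ n) i) - ((\<lambda>y. Mu' y - y) ^^ n) i"
     unfolding D_def MsI(2)[OF z] ..
    moreover have "\<dots> \<in> I" by (rule subspace_diff[OF subI clinear_endoD(1)[OF cMu' z] z])
    ultimately show ?case using Suc by simp
   qed (use that in simp)
   have DK: "(D ^^ n) k = cscale (inverse l ^ n) ((X ^^ n) k) \<and> (X ^^ n) k \<in> K" if k: "k \<in> K" for n k
   proof (induction n)
    case (Suc n)
    have XnK: "(X ^^ n) k \<in> K" using Suc by simp
    then have "X ((X ^^ n) k) \<in> K" using fit_null_invariant[OF W(1) linX invX] by (auto simp: K_def)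
    moreover have "D (cscale c u) = cscale (c * inverse l) (X u)" if u: "u \<in> K" for c u
    proof -
     have "f (cscale c u) = cscale c (f u)" using clinear_endoD(3)[OF f subsetD[OF KW u]] .
     then have "D (cscale c u) = cscale (c * inverse l) (f u) - cscale c u"
      unfolding D_def using MsK(2)[of "cscale c u"] u closure by (simp add: mult.commute)
     moreover have "cscale c u = cscale (c * inverse l) (cscale l u)" using l0 by simp
     ultimately show ?thesis unfolding X_def cs.scale_right_diff_distrib by metis
    qed
    ultimately show ?case using Suc XnK by (auto simp: mult.commute)
   qed (use k in auto)
   have linD: "linear_map_on W D" "D ` W \<subseteq> W"
   proof -
    show "linear_map_on W D"
     using clinear_endo_linear[OF cMu] by (simp add: linear_map_on_def D_def scaleR_diff_right)
    show "D ` W \<subseteq> W"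
     unfolding D_def by (rule image_subsetI) (rule subspace_diff[OF sub clinear_endoD(1)[OF cMu]])
   qed
   have "(D ^^ (n1 + dim W)) x = 0" if "x \<in> W" for x
   proof -
    obtain k i where ki: "k \<in> K" "i \<in> I" "x = k + i" using dec[OF \<open>x \<in> W\<close>] by auto
    have "(X ^^ dim W) k = 0" using ki(1) by (auto simp: K_def fit_null_def)
    then have "(D ^^ dim W) k = 0" using DK[OF ki(1), of "dim W"] by simp
    moreover have "(D ^^ n) 0 = 0" for n
     using linear_map_on_zero[OF linear_map_on_funpow(1)[OF linD] sub] .
    ultimately have "(D ^^ (n1 + dim W)) k = 0" by (simp add: funpow_add)
    moreover have "(D ^^ (dim W + n1)) i = 0"
     using DI[OF ki(2), of n1] n1[OF ki(2)] \<open>\<And>n. (D ^^ n) 0 = 0\<close> by (simp add: funpow_add)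
    ultimately show ?thesis
     using linear_map_on_add[OF linear_map_on_funpow(1)[OF linD] subsetD[OF KW ki(1)] subsetD[OF IW ki(2)],
       of "n1 + dim W"] ki(3)
     by (simp add: add.commute)
   qed
   then show ?thesis unfolding unipotent_on_def D_def by blast
  qed
  moreover have "f x = Ms (Mu x) \<and> f x = Mu (Ms x)" if "x \<in> W" for x
  proof -
   obtain k i where ki: "k \<in> K" "i \<in> I" "x = k + i" using dec[OF \<open>x \<in> W\<close>] by auto
   have f1: "f x = f k + f i"
    using clinear_endoD(2)[OF f subsetD[OF KW ki(1)] subsetD[OF IW ki(2)]] ki(3) by simp
   have k1: "cscale (inverse l) (f k) \<in> K" "cscale l k \<in> K" "Ms' i \<in> I" "Mu' i \<in> I" using ki closure by auto
   have "f (cscale l k) = cscale l (f k)" using clinear_endoD(3)[OF f subsetD[OF KW ki(1)]] .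
   then show ?thesis
    unfolding ki(3) Ms[OF ki(1,2)] Mu[OF ki(1,2)] Ms[OF k1(1,4)] Mu[OF k1(2,3)]
    using f1 fac'[OF ki(2)] l0 ki(3) by auto
  qed
  ultimately show ?thesis using cMs cMu by blast
 qed
qed

lemma clinear_endo_map_prod:
 assumes "linear_map_on H M" "subspace H" "M ` H \<subseteq> H" shows "clinear_endo (H \<times> H) (map_prod M M)"
 using assms
 by (auto simp: clinear_endo_def cscale_def linear_map_on_add linear_map_on_diff linear_map_on_scale
   subspace_scale)

lemma jordan_decomposition_exists:
 assumes "fin_dim_space H" "linear_iso H H M"
 shows "\<exists>Ms Mu. jordan_decomposition H M Ms Mu"
 unfolding jordan_decomposition_def
proof (rule jordan_decomposition_exists_on)
 have sub: "subspace H" using assms fin_dim_space_subspace by auto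
 show "fin_dim_space (H \<times> H)" using assms fin_dim_space_prod by auto
 show "cs.subspace (H \<times> H)" by (rule cs_subspace_Times[OF sub])
 show "clinear_endo (H \<times> H) (map_prod M M)"
  using clinear_endo_map_prod[OF _ sub] linear_isoD[OF assms(2)] by auto
 show "inj_on (map_prod M M) (H \<times> H)" using linear_isoD(2)[OF assms(2)] by (auto simp: inj_on_def)
qed

lemma map_prod_funpow:
 fixes f :: "'a \<Rightarrow> 'a" and g :: "'b \<Rightarrow> 'b"
 shows "map_prod f g ^^ n = map_prod (f ^^ n) (g ^^ n)"
 by (induction n) (auto simp: fun_eq_iff)

text \<open>
 For every Jordan decomposition the eigenspace \<open>ker (M\<^sub>s - 1)\<close> lies in the Fitting null component
 of \<open>M - 1\<close>, and the other eigenspaces of \<open>M\<^sub>s\<close> lie in its Fitting range, because \<open>M - 1\<close> is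
 injective on them. As the eigenspaces span, both inclusions are equalities.
\<close>

lemma jordan_decomposition_fitting:
 assumes H: "fin_dim_space H" and M: "linear_iso H H M" and jd: "jordan_decomposition H M Ms Mu"
 defines "K \<equiv> fit_null H (\<lambda>a. M a - a)" and "I \<equiv> fit_range H (\<lambda>a. M a - a)"
 shows "{x \<in> H \<times> H. Ms x = cscale 1 x} = K \<times> K"
  and "cs.span (\<Union>l\<in>- {1}. {x \<in> H \<times> H. Ms x = cscale l x}) = I \<times> I"
  and "\<And>x. x \<in> K \<times> K ==> Mu x = map_prod M M x"
proof -
 define X where "X a = M a - a" for a
 define W where "W = H \<times> H"
 define X2 where "X2 = map_prod X X"
 define E where "E l = {x \<in> W. Ms x = cscale l x}" for l
 have subH: "subspace H" using H fin_dim_space_subspace by auto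
 note linM = linear_isoD[OF M]
 have linX: "linear_map_on H X" and invX: "X ` H \<subseteq> H"
  using linM subspace_diff[OF subH] by (auto simp: X_def linear_map_on_def algebra_simps)
 have W: "fin_dim_space W" "cs.subspace W"
  using fin_dim_space_prod[OF H H] cs_subspace_Times[OF subH] by (auto simp: W_def)
 have sub: "subspace W" using cs_subspace_real W by auto
 have cMs: "clinear_endo W Ms" and cMu: "clinear_endo W Mu" and ss: "semisimple_on W Ms"
  and un: "unipotent_on W Mu"
  and fac: "\<And>x. x \<in> W ==> map_prod M M x = Ms (Mu x)" "\<And>x. x \<in> W ==> map_prod M M x = Mu (Ms x)"
  using jd unfolding jordan_decomposition_def W_def by blast+
 define D where "D y = Mu y - y" for y
 obtain n where n: "\<And>x. x \<in> W ==> (D ^^ n) x = 0"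
  using un unfolding unipotent_on_def D_def[abs_def] by blast
 have cE: "cs.subspace (E l)" for l
  using W(2) clinear_endoD[OF cMs] linear_map_on_zero[OF clinear_endo_linear[OF cMs] sub]
  by (auto simp: cs.subspace_def E_def cs.scale_right_distrib mult.commute)
 have MuE: "Mu x \<in> E l" if "x \<in> E l" for x l
 proof -
  have x: "x \<in> W" "Ms x = cscale l x" using that by (auto simp: E_def)
  have "Ms (Mu x) = Mu (Ms x)" using fac[OF x(1)] by simp
  also have "\<dots> = cscale l (Mu x)" unfolding x(2) by (rule clinear_endoD(3)[OF cMu x(1)])
  finally show ?thesis using clinear_endoD(1)[OF cMu x(1)] by (simp add: E_def)
 qed
 have DE: "D x \<in> E l" if "x \<in> E l" for x l
  using MuE[OF that] that cs.subspace_diff[OF cE] by (auto simp: D_def)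
 have X2: "X2 x = map_prod M M x - x" for x by (simp add: X2_def X_def prod_eq_iff)
 have E1: "E 1 \<subseteq> K \<times> K"
 proof
  fix x assume x: "x \<in> E 1"
  have "(D ^^ j) x = (X2 ^^ j) x \<and> (D ^^ j) x \<in> E 1" for j
  proof (induction j)
   case (Suc j)
   then have "(D ^^ j) x \<in> E 1" by blast
   then have "X2 ((D ^^ j) x) = D ((D ^^ j) x)" using fac(2)[of "(D ^^ j) x"] by (simp add: X2 D_def E_def)
   then show ?case using Suc DE[of "(D ^^ j) x"] by (metis funpow.simps(2) o_apply)
  qed (use x in auto)
  then have "(X2 ^^ n) x = 0" using n x by (metis E_def mem_Collect_eq)
  then have "(X ^^ n) (fst x) = 0" "(X ^^ n) (snd x) = 0"
   by (auto simp: X2_def map_prod_funpow prod_eq_iff)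
  moreover have "fst x \<in> H" "snd x \<in> H" using x by (auto simp: E_def W_def)
  ultimately have "fst x \<in> K" "snd x \<in> K"
   using fit_nullI[OF H linX invX] unfolding K_def X_def[abs_def] by auto
  then show "x \<in> K \<times> K" by (simp add: mem_Times_iff)
 qed
 have El: "E l \<subseteq> I \<times> I" if l: "l \<noteq> 1" for l
 proof -
  have sE: "subspace (E l)" using cs_subspace_real[OF cE] .
  have fE: "fin_dim_space (E l)" using fin_dim_space_mono[OF W(1) sE] by (auto simp: E_def)
  have X2E: "X2 x = cscale l (Mu x) - x" if "x \<in> E l" for x
  proof -
   have x: "x \<in> W" "Ms x = cscale l x" using that by (auto simp: E_def)
   show ?thesis unfolding X2 fac(2)[OF x(1)] x(2) clinear_endoD(3)[OF cMu x(1)] ..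
  qed
  have inv: "X2 ` E l \<subseteq> E l"
  proof (rule image_subsetI)
   fix x assume x: "x \<in> E l"
   show "X2 x \<in> E l" unfolding X2E[OF x]
    by (rule cs.subspace_diff[OF cE cs.subspace_scale[OF cE MuE[OF x]] x])
  qed
  have lin: "linear_map_on (E l) X2"
   using linear_map_on_subset[OF clinear_endo_linear[OF clinear_endo_map_prod[OF linX subH invX]], of "E l"]
   by (auto simp: X2_def E_def W_def)
  have "x = 0" if x: "x \<in> E l" "X2 x = 0" for x
  proof -
   have eq: "cscale l (Mu x) = x" using X2E[OF x(1)] x(2) by simp
   have xW: "x \<in> W" using x by (auto simp: E_def)
   show ?thesis
   proof (cases "l = 0")
    case True then show ?thesis using eq by simp
   next
    case False
    have "Mu x = cscale (inverse l) (cscale l (Mu x))" using False by simp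
    then have Dx: "D x = cscale (inverse l - 1) x" unfolding eq by (simp add: D_def cs.scale_left_diff_distrib)
    have "(D ^^ j) x = cscale ((inverse l - 1) ^ j) x" for j
    proof (induction j)
     case (Suc j)
     have "D (cscale c x) = cscale c (D x)" for c
      using clinear_endoD(3)[OF cMu xW] by (simp add: D_def cs.scale_right_diff_distrib)
     then show ?case using Suc Dx by (simp add: mult.commute)
    qed simp
    then have "cscale ((inverse l - 1) ^ n) x = 0" using n[OF xW] by simp
    moreover have "inverse l - 1 \<noteq> 0" using l by (metis eq_iff_diff_eq_0 inverse_eq_1_iff)
    ultimately show ?thesis using cs.scale_eq_0_iff power_not_zero by blast
   qed
  qed
  then have "inj_on X2 (E l)" using inj_on_linear_iff[OF lin sE] by auto
  then have surj: "X2 ` E l = E l" using fin_dim_inj_imp_surj[OF fE lin inv] by auto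
  have "(X2 ^^ j) ` E l = E l" for j
  proof (induction j)
   case (Suc j)
   have "(X2 ^^ Suc j) ` E l = X2 ` (X2 ^^ j) ` E l" by (simp add: image_comp)
   then show ?case using Suc surj by simp
  qed simp
  then have "E l = (X2 ^^ dim H) ` E l" by simp
  also have "\<dots> \<subseteq> (X2 ^^ dim H) ` (H \<times> H)" by (intro image_mono) (auto simp: E_def W_def)
  also have "\<dots> \<subseteq> I \<times> I" unfolding X2_def map_prod_funpow I_def fit_range_def X_def[abs_def] by auto
  finally show ?thesis .
 qed
 have subI: "subspace I" and KI0: "\<And>x. x \<in> K ==> x \<in> I ==> x = 0"
  and subK: "subspace K"
  using subspace_fit_range[OF H linX invX] subspace_fit_null[OF H linX invX] fit_disjoint[OF H linX invX]
  by (auto simp: I_def K_def X_def[abs_def])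
 define R where "R = cs.span (\<Union>l\<in>- {1}. E l)"
 have RI: "R \<subseteq> I \<times> I"
  unfolding R_def using El cs_subspace_Times[OF subI] by (intro cs.span_minimal) auto
 have KW: "K \<times> K \<subseteq> W" "I \<times> I \<subseteq> W"
  using fit_range_subset[OF H linX invX] by (auto simp: K_def I_def W_def fit_null_def X_def[abs_def])
 have dec: "\<exists>a\<in>E 1. \<exists>b\<in>R. x = a + b" if "x \<in> W" for x
 proof -
  have "{x \<in> W. \<exists>l. Ms x = cscale l x} \<subseteq> E 1 \<union> (\<Union>l\<in>- {1}. E l)"
  proof
   fix z assume "z \<in> {x \<in> W. \<exists>l. Ms x = cscale l x}"
   then obtain l where "z \<in> E l" by (auto simp: E_def)
   then show "z \<in> E 1 \<union> (\<Union>l\<in>- {1}. E l)" by (cases "l = 1") blast+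
  qed
  then have "x \<in> cs.span (E 1 \<union> (\<Union>l\<in>- {1}. E l))"

   by (rule subsetD[OF cs.span_mono subsetD[OF ss[unfolded semisimple_on_def] that]])
  then obtain a b where "x = a + b" "a \<in> cs.span (E 1)" "b \<in> R"

   unfolding cs.span_Un R_def by blast
  moreover have "cs.span (E 1) = E 1" using cE cs.span_eq_iff by blast
  ultimately show ?thesis by auto
 qed
 have KI2: "z = 0" if "z \<in> K \<times> K" "z \<in> I \<times> I" for z
  using that KI0 by (auto simp: prod_eq_iff)
 have EK: "E 1 = K \<times> K"
 proof (rule antisym[OF E1], rule)
  fix x assume x: "x \<in> K \<times> K"
  then obtain a b where ab: "a \<in> E 1" "b \<in> R" "x = a + b" using dec KW by blast
  have "x - a \<in> K \<times> K"

   by (rule subspace_diff[OF cs_subspace_real[OF cs_subspace_Times[OF subK]] x subsetD[OF E1 ab(1)]])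
  then have "b = 0" using KI2[of b] ab subsetD[OF RI ab(2)] by simp
  then show "x \<in> E 1" using ab by simp
 qed
 have "R = I \<times> I"
 proof (rule antisym[OF RI], rule)
  fix x assume x: "x \<in> I \<times> I"
  then obtain a b where ab: "a \<in> E 1" "b \<in> R" "x = a + b" using dec KW by blast
  have "x - b \<in> I \<times> I"

   by (rule subspace_diff[OF cs_subspace_real[OF cs_subspace_Times[OF subI]] x subsetD[OF RI ab(2)]])
  then have "a = 0" using KI2[of a] ab subsetD[OF E1 ab(1)] by simp
  then show "x \<in> R" using ab by simp
 qed
 then show "cs.span (\<Union>l\<in>- {1}. {x \<in> H \<times> H. Ms x = cscale l x}) = I \<times> I"
  by (simp add: R_def E_def W_def)
 show EK': "{x \<in> H \<times> H. Ms x = cscale 1 x} = K \<times> K" using EK by (simp add: E_def W_def)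
 show "Mu x = map_prod M M x" if "x \<in> K \<times> K" for x
 proof -
  have "x \<in> E 1" using that EK by blast
  then have "x \<in> W" "Ms x = x" by (auto simp: E_def)
  then show ?thesis using fac(2)[of x] by simp
 qed
qed

unbundle no vec_syntax
unbundle fps_syntax

section \<open>Power series in a nilpotent endomorphism\<close>

text \<open>
 The power series \<open>F\<close> in \<open>X\<close>, cut off at degree \<open>d\<close>. Where \<open>X\<^sup>d\<close> vanishes, this is multiplicative in \<open>F\<close>.
\<close>

definition fps_act :: "nat \<Rightarrow> ('v::real_vector \<Rightarrow> 'v) \<Rightarrow> real fps \<Rightarrow> 'v \<Rightarrow> 'v" where
 "fps_act d X F x = (\<Sum>k<d. (F $ k) *\<^sub>R (X ^^ k) x)"

locale nilpotent_endo =
 fixes K :: "'v::real_vector set" and X :: "'v \<Rightarrow> 'v" and d :: nat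
 assumes subK: "subspace K" and linX: "linear_map_on K X" and invX: "X ` K \<subseteq> K"
  and nilX: "\<And>x. x \<in> K ==> (X ^^ d) x = 0"
begin

lemma powK: "x \<in> K ==> (X ^^ k) x \<in> K"
 using linear_map_on_funpow(2)[OF linX invX] by auto

lemma pow_zero: "x \<in> K ==> d \<le> k ==> (X ^^ k) x = 0"
 using nilX[of "(X ^^ (k - d)) x"] powK by (metis funpow_add le_add_diff_inverse o_apply)

lemma act_closed: "x \<in> K ==> fps_act d X F x \<in> K"
 unfolding fps_act_def by (intro subspace_sum[OF subK] subspace_scale[OF subK] powK)

lemma act_linear: "linear_map_on K (fps_act d X F)"
 using linear_map_on_funpow(1)[OF linX invX]
 by (simp add: fps_act_def linear_map_on_def scaleR_add_right sum.distrib scaleR_sum_right mult.commute)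

lemma act_add: "fps_act d X (F + G) x = fps_act d X F x + fps_act d X G x"
 by (simp add: fps_act_def scaleR_add_left sum.distrib)

lemma act_diff: "fps_act d X (F - G) x = fps_act d X F x - fps_act d X G x"
 by (simp add: fps_act_def scaleR_diff_left sum_subtractf)

lemma act_one: assumes "x \<in> K" shows "fps_act d X 1 x = x"
proof (cases d)
 case 0
 then show ?thesis using nilX[OF assms] by (simp add: fps_act_def)
next
 case (Suc n)
 have "fps_act d X 1 x = (\<Sum>k\<in>{0}. ((1::real fps) $ k) *\<^sub>R (X ^^ k) x)"
  unfolding fps_act_def by (rule sum.mono_neutral_right) (use Suc in auto)
 then show ?thesis by simp
qed

lemma act_X: assumes "x \<in> K" shows "fps_act d X fps_X x = X x"
proof -
 have "fps_act d X fps_X x = (\<Sum>k<Suc (Suc d). ((fps_X::real fps) $ k) *\<^sub>R (X ^^ k) x)"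
  unfolding fps_act_def by (rule sum.mono_neutral_left) (use pow_zero[OF assms] in auto)
 also have "\<dots> = (\<Sum>k\<in>{1}. ((fps_X::real fps) $ k) *\<^sub>R (X ^^ k) x)"
  by (rule sum.mono_neutral_right) auto
 finally show ?thesis by simp
qed

lemma act_mult: assumes x: "x \<in> K" shows "fps_act d X (F * G) x = fps_act d X F (fps_act d X G x)"
proof -
 have "fps_act d X F (fps_act d X G x) = (\<Sum>k<d. \<Sum>l<d. (F $ k * G $ l) *\<^sub>R (X ^^ (k + l)) x)"
 proof -
  have "(X ^^ k) (fps_act d X G x) = (\<Sum>l<d. (G $ l) *\<^sub>R (X ^^ (k + l)) x)" for k
  proof -
   have "(X ^^ k) (fps_act d X G x) = (\<Sum>l<d. (X ^^ k) ((G $ l) *\<^sub>R (X ^^ l) x))"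
    unfolding fps_act_def
    by (rule linear_map_on_sum[OF linear_map_on_funpow(1)[OF linX invX] subK])
     (intro subspace_scale[OF subK] powK x)
   then show ?thesis
    using linear_map_on_scale[OF linear_map_on_funpow(1)[OF linX invX] powK[OF x]]
    by (simp add: funpow_add)
  qed
  then show ?thesis unfolding fps_act_def[of d X F] by (simp add: scaleR_sum_right)
 qed
 also have "\<dots> = (\<Sum>(k, l)\<in>{..<d} \<times> {..<d}. (F $ k * G $ l) *\<^sub>R (X ^^ (k + l)) x)"
  by (simp add: sum.cartesian_product)
 also have "\<dots> = (\<Sum>(k, l)\<in>{(k, l). k + l < d}. (F $ k * G $ l) *\<^sub>R (X ^^ (k + l)) x)"
  by (rule sum.mono_neutral_right) (auto intro!: pow_zero[OF x] simp: not_less)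
 also have "\<dots> = (\<Sum>n<d. \<Sum>k\<le>n. (F $ k * G $ (n - k)) *\<^sub>R (X ^^ n) x)"
  by (subst sum.triangle_reindex) simp
 also have "\<dots> = fps_act d X (F * G) x"
  by (simp add: fps_act_def fps_mult_nth scaleR_sum_left atMost_atLeast0)
 finally show ?thesis ..
qed

lemma act_power: "x \<in> K ==> fps_act d X (G ^ i) x = (fps_act d X G ^^ i) x"
proof (induction i)
 case (Suc i)
 then show ?case using act_mult[of x G "G ^ i"] by simp
qed (simp add: act_one)

lemma act_compose:
 assumes x: "x \<in> K" and G: "G $ 0 = 0"
 shows "fps_act d X (F oo G) x = (\<Sum>k<d. (F $ k) *\<^sub>R (fps_act d X G ^^ k) x)"
proof -
 have "(F oo G) $ n = (\<Sum>i<d. F $ i * (G ^ i) $ n)" if "n < d" for n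
  unfolding fps_compose_nth
  by (rule sum.mono_neutral_left) (use that startsby_zero_power_prefix[OF G] in auto)
 then have "fps_act d X (F oo G) x = (\<Sum>n<d. \<Sum>i<d. (F $ i * (G ^ i) $ n) *\<^sub>R (X ^^ n) x)"
  by (simp add: fps_act_def scaleR_sum_left)
 also have "\<dots> = (\<Sum>i<d. (F $ i) *\<^sub>R fps_act d X (G ^ i) x)"
  by (subst sum.swap) (simp add: fps_act_def scaleR_sum_right)
 finally show ?thesis by (simp add: act_power[OF x])
qed

end

text \<open>
 With \<open>N = ln (1 + x)\<close> this is \<open>(exp N - 1) / N = x / ln (1 + x)\<close>. It expresses \<open>(M - id) / N\<close> as a
 power series in \<open>M - id\<close>.
\<close>

definition exp_quot_fps :: "real fps" where
 "exp_quot_fps = Abs_fps (\<lambda>n. 1 / fact (n + 1)) oo fps_ln 1"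

lemma exp_quot_fps_mult_ln: "exp_quot_fps * fps_ln 1 = fps_X"
proof -
 let ?g = "Abs_fps (\<lambda>n. 1 / fact (n + 1)) :: real fps"
 have g: "?g * fps_X = fps_exp 1 - 1"
  by (rule fps_ext) (auto simp: fps_mult_fps_X_commute not_less gr0_conv_Suc)
 have "exp_quot_fps * fps_ln 1 = (?g * fps_X) oo fps_ln 1"
  by (simp add: exp_quot_fps_def fps_compose_mult_distrib)
 also have "\<dots> = (fps_exp 1 - 1) oo fps_inv (fps_exp 1 - 1)"
  unfolding g by (subst fps_ln_fps_exp_inv) auto
 also have "\<dots> = fps_X" by (rule fps_inv_right) auto
 finally show ?thesis .
qed

lemma exp_quot_fps_0: "exp_quot_fps $ 0 = 1"
 by (simp add: exp_quot_fps_def fps_compose_nth)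

text \<open>
 Substituting \<open>- x / (1 + x)\<close> for \<open>x\<close> turns \<open>1 + x\<close> into its inverse and hence changes the sign
 of \<open>ln (1 + x)\<close>.
\<close>

lemma exp_quot_fps_compose:
 "exp_quot_fps oo (inverse (1 + fps_X) - 1) = exp_quot_fps * inverse (1 + fps_X)"
proof -
 define u :: "real fps" where "u = inverse (1 + fps_X)"
 have u0: "u $ 0 = 1" by (simp add: u_def)
 then have j0: "(u - 1) $ 0 = 0" by simp
 have u1: "u * (1 + fps_X) = 1" unfolding u_def by (rule inverse_mult_eq_1) simp
 have iu: "inverse u = 1 + fps_X" unfolding u_def by (rule fps_inverse_idempotent) simp
 have "fps_deriv (fps_ln 1 oo (u - 1)) = (u oo (u - 1)) * fps_deriv u"
  using fps_compose_deriv[OF j0, of "fps_ln 1"] by (simp add: fps_ln_deriv u_def)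
 also have "u oo (u - 1) = inverse ((1 + fps_X) oo (u - 1))"
  unfolding u_def by (rule fps_inverse_compose) auto
 also have "(1 + fps_X) oo (u - 1) = u" using j0 by (simp add: fps_compose_add_distrib)
 also have "fps_deriv u = - (u ^ 2)" unfolding u_def by (subst fps_inverse_deriv) auto
 also have "inverse u * - (u ^ 2) = - (u * (1 + fps_X) * u)"
  by (simp add: iu power2_eq_square algebra_simps)
 also have "\<dots> = fps_deriv (- fps_ln 1)" unfolding u1 by (simp add: fps_ln_deriv u_def)
 finally have ln: "fps_ln 1 oo (u - 1) = - fps_ln (1::real)"
  unfolding fps_deriv_eq_iff using j0 by (simp add: fps_compose_nth)
 have "(exp_quot_fps oo (u - 1)) * (fps_ln 1 oo (u - 1)) = fps_X oo (u - 1)"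
  using exp_quot_fps_mult_ln j0 by (metis fps_compose_mult_distrib)
 then have "(exp_quot_fps oo (u - 1)) * (- fps_ln 1) = u - 1" using j0 ln by simp
 also have "u - 1 = - (fps_X * u)" using u1 by (simp add: algebra_simps)
 also have "\<dots> = exp_quot_fps * u * (- fps_ln 1)"
  unfolding exp_quot_fps_mult_ln[symmetric] by (simp add: algebra_simps)
 finally have "exp_quot_fps oo (u - 1) = exp_quot_fps * u"
 proof -
  assume *: "(exp_quot_fps oo (u - 1)) * (- fps_ln 1) = exp_quot_fps * u * (- fps_ln 1)"
  have "- fps_ln (1::real) \<noteq> 0"
   using exp_quot_fps_mult_ln by (metis fps_X_neq_zero mult_zero_right neg_equal_0_iff_equal)
  then show ?thesis using * by (metis mult_right_cancel)
 qed
 then show ?thesis by (simp add: u_def)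
qed

text \<open>
 If \<open>B\<close> is invariant under \<open>M = 1 + X\<close>, then \<open>- X / (1 + X)\<close> is the left adjoint of \<open>X\<close>, and so
 the left adjoint of \<open>h(X)\<close> is \<open>h(- X / (1 + X))\<close>.
\<close>

lemma (in nilpotent_endo) exp_quot_adjoint:
 fixes B :: "'v \<Rightarrow> 'v \<Rightarrow> real"
 assumes B: "bilinear_form_on K K B" and inv: "\<And>x y. x \<in> K ==> y \<in> K ==> B (x + X x) (y + X y) = B x y"
  and x: "x \<in> K" and y: "y \<in> K"
 shows "B (x + X x) (fps_act d X exp_quot_fps y) = B (fps_act d X exp_quot_fps x) y"
proof -
 define u :: "real fps" where "u = inverse (1 + fps_X)"
 define J where "J = fps_act d X (u - 1)"
 have u1: "(1 + fps_X) * u = 1" "u * (1 + fps_X) = 1"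
  unfolding u_def by (simp_all add: inverse_mult_eq_1 inverse_mult_eq_1')
 have linB: "linear_map_on K (B a)" "linear_map_on K (\<lambda>a. B a b)" if "a \<in> K" "b \<in> K" for a b
  using B that by (auto simp: bilinear_form_on_def)
 have act1X: "fps_act d X (1 + fps_X) a = a + X a" if "a \<in> K" for a
  using that by (simp add: act_add act_one act_X)
 have XK: "X a \<in> K" if "a \<in> K" for a using invX that by auto
 have JK: "J a \<in> K" if "a \<in> K" for a using that act_closed by (simp add: J_def)
 have adj: "B a (X b) = B (J a) b" if a: "a \<in> K" and b: "b \<in> K" for a b
 proof -
  define c where "c = fps_act d X u a"
  have c: "c \<in> K" using act_closed a by (simp add: c_def)
  have "c + X c = a" using act_mult[OF a, of "1 + fps_X" u] c a by (simp add: c_def u1 act_one flip: act1X)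
  then have "B a (b + X b) = B c b" using inv[OF c b] by simp
  moreover have "B a (b + X b) = B a b + B a (X b)" using linear_map_on_add[OF linB(1)[OF a b]] b XK by blast
  moreover have "B (J a) b = B c b - B a b"
   unfolding J_def act_diff act_one[OF a] c_def[symmetric]
   by (rule linear_map_on_diff[OF linB(2)[OF a b] subK c a])
  ultimately show ?thesis by simp
 qed
 have JpK: "(J ^^ k) a \<in> K" if "a \<in> K" for a k by (induction k) (use that JK in auto)
 have adjk: "B a ((X ^^ k) b) = B ((J ^^ k) a) b" if a: "a \<in> K" and b: "b \<in> K" for a b k
  using a
 proof (induction k arbitrary: a)
  case (Suc k)
  have "B a ((X ^^ Suc k) b) = B (J a) ((X ^^ k) b)" using adj[OF Suc.prems powK[OF b]] by simp
  also have "\<dots> = B ((J ^^ Suc k) a) b" using Suc.IH[OF JK[OF Suc.prems]] by (simp add: funpow_swap1)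
  finally show ?case .
 qed simp
 define z where "z = x + X x"
 have z: "z \<in> K" using x XK subspace_add[OF subK] by (auto simp: z_def)
 have "B z (fps_act d X exp_quot_fps y) = (\<Sum>k<d. B z ((exp_quot_fps $ k) *\<^sub>R (X ^^ k) y))"
  unfolding fps_act_def
  by (rule linear_map_on_sum[OF linB(1)[OF z y] subK]) (intro subspace_scale[OF subK] powK y)
 also have "\<dots> = (\<Sum>k<d. exp_quot_fps $ k * B ((J ^^ k) z) y)"
  using linear_map_on_scale[OF linB(1)[OF z y] powK[OF y]] adjk[OF z y] by simp
 also have "\<dots> = (\<Sum>k<d. B ((exp_quot_fps $ k) *\<^sub>R (J ^^ k) z) y)"
  using linear_map_on_scale[OF linB(2)[OF z y] JpK[OF z]] by simp
 also have "\<dots> = B (\<Sum>k<d. (exp_quot_fps $ k) *\<^sub>R (J ^^ k) z) y"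
  by (rule linear_map_on_sum[symmetric, OF linB(2)[OF z y] subK]) (intro subspace_scale[OF subK] JpK z)
 also have "(\<Sum>k<d. (exp_quot_fps $ k) *\<^sub>R (J ^^ k) z) = fps_act d X (exp_quot_fps oo (u - 1)) z"
  unfolding J_def by (rule act_compose[symmetric, OF z]) (simp add: u_def)
 also have "\<dots> = fps_act d X (exp_quot_fps * u * (1 + fps_X)) x"
  unfolding u_def exp_quot_fps_compose act_mult[OF x] act1X[OF x] z_def ..
 also have "\<dots> = fps_act d X exp_quot_fps x" by (simp add: u1 mult.assoc)
 finally show ?thesis by (simp add: z_def)
qed

section \<open>The inverse of \<open>\<nu>\<close>\<close>

definition fit_proj :: "'v::real_vector set \<Rightarrow> ('v \<Rightarrow> 'v) \<Rightarrow> 'v \<Rightarrow> 'v" where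
 "fit_proj W X b = (SOME i. i \<in> fit_range W X \<and> b - i \<in> fit_null W X)"

lemma fit_proj:
 assumes "fin_dim_space W" "linear_map_on W X" "X ` W \<subseteq> W" "k \<in> fit_null W X" "i \<in> fit_range W X"
 shows "fit_proj W X (k + i) = i"
proof -
 let ?p = "fit_proj W X (k + i)"
 have p: "?p \<in> fit_range W X" "k + i - ?p \<in> fit_null W X"
  using someI[of "\<lambda>j. j \<in> fit_range W X \<and> k + i - j \<in> fit_null W X" i] assms
  by (auto simp: fit_proj_def)
 have "i - ?p \<in> fit_range W X" "(k + i - ?p) - k \<in> fit_null W X"
  using subspace_diff[OF subspace_fit_range[OF assms(1-3)] assms(5) p(1)]
   subspace_diff[OF subspace_fit_null[OF assms(1-3)] p(2) assms(4)] by auto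
 then show ?thesis using fit_disjoint[OF assms(1-3), of "i - ?p"] by (simp add: algebra_simps)
qed

text \<open>
 The inverse of \<open>\<nu>\<close> without complexification: it is \<open>M - id\<close> on the Fitting range of \<open>M - id\<close>, and
 \<open>- (M - id) / N\<close> on its Fitting null component, where \<open>M = M\<^sub>u\<close>.
\<close>

definition nu_inv :: "'v::real_vector set \<Rightarrow> ('v \<Rightarrow> 'v) \<Rightarrow> 'v \<Rightarrow> 'v" where
 "nu_inv H M b = (let X = \<lambda>a. M a - a; i = fit_proj H X b
   in X i - fps_act (dim H) X exp_quot_fps (b - i))"

locale endo_space =
 fixes H :: "'v::real_vector set" and M :: "'v \<Rightarrow> 'v"
 assumes H: "fin_dim_space H" and M: "linear_iso H H M"
begin

definition X where "X a = M a - a"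
abbreviation "K \<equiv> fit_null H X"
abbreviation "I \<equiv> fit_range H X"
definition T where "T = fps_act (dim H) X exp_quot_fps"

lemma subH: "subspace H" using H fin_dim_space_subspace by auto

lemmas linM = linear_isoD[OF M]

lemma linX: "linear_map_on H X"
 using linM(1) by (simp add: X_def linear_map_on_def scaleR_diff_right)

lemma invX: "X ` H \<subseteq> H"
 using linM(4) subspace_diff[OF subH] by (auto simp: X_def)

lemma KH: "K \<subseteq> H" by (auto simp: fit_null_def)
lemma IH: "I \<subseteq> H" using fit_range_subset[OF H linX invX] .
lemma subK: "subspace K" using subspace_fit_null[OF H linX invX] .
lemma subI: "subspace I" using subspace_fit_range[OF H linX invX] .

sublocale nil: nilpotent_endo K X "dim H"
 using subK linear_map_on_subset[OF linX KH] fit_null_invariant[OF H linX invX]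
 by unfold_locales (auto simp: fit_null_def)

lemma M_eq: "M a = a + X a" by (simp add: X_def)

lemma decomp: assumes "b \<in> H" obtains k i where "k \<in> K" "i \<in> I" "b = k + i"
 using fit_decomp[OF H linX invX assms] by blast

lemma KI_zero: "x \<in> K ==> x \<in> I ==> x = 0" using fit_disjoint[OF H linX invX] .

lemma nu_inv_add: "k \<in> K ==> i \<in> I ==> nu_inv H M (k + i) = X i - T k"
 using fit_proj[OF H linX invX, of k i] by (simp add: nu_inv_def T_def X_def[abs_def])

lemma X_I: "i \<in> I ==> X i \<in> I" using fit_range_surj[OF H linX invX] by auto
lemma X_K: "k \<in> K ==> X k \<in> K" using nil.invX by auto
lemma T_K: "k \<in> K ==> T k \<in> K" using nil.act_closed by (simp add: T_def)
lemma T_linear: "linear_map_on K T" unfolding T_def by (rule nil.act_linear)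

lemma T_inverse: "k \<in> K ==> T (fps_act (dim H) X (inverse exp_quot_fps) k) = k"
  "k \<in> K ==> fps_act (dim H) X (inverse exp_quot_fps) (T k) = k"
 using nil.act_mult[of k exp_quot_fps "inverse exp_quot_fps"] nil.act_mult[of k "inverse exp_quot_fps" exp_quot_fps]
  exp_quot_fps_0
 by (auto simp: T_def inverse_mult_eq_1 inverse_mult_eq_1' nil.act_one)

lemma zero_KI: "0 \<in> K" "0 \<in> I" "T 0 = 0" "X 0 = 0"
 using subspace_0[OF subK] subspace_0[OF subI] linear_map_on_zero[OF T_linear subK]
  linear_map_on_zero[OF linX subH] by auto

lemma nu_inv_I: "i \<in> I ==> nu_inv H M i = X i"
 using nu_inv_add[of 0 i] zero_KI by simp

lemma nu_inv_K: "k \<in> K ==> nu_inv H M k = - T k"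
 using nu_inv_add[of k 0] zero_KI by simp

lemma nu_inv_linear: "linear_map_on H (nu_inv H M)"
 unfolding linear_map_on_def
proof (safe)
 fix x y assume x: "x \<in> H" and y: "y \<in> H"
 obtain k i where ki: "k \<in> K" "i \<in> I" "x = k + i" using decomp[OF x] .
 obtain k' i' where ki': "k' \<in> K" "i' \<in> I" "y = k' + i'" using decomp[OF y] .
 have xy: "x + y = (k + k') + (i + i')" using ki ki' by simp
 have "X (i + i') = X i + X i'" "T (k + k') = T k + T k'"
  using linear_map_on_add[OF linX subsetD[OF IH ki(2)] subsetD[OF IH ki'(2)]]
   linear_map_on_add[OF T_linear ki(1) ki'(1)] by auto
 then show "nu_inv H M (x + y) = nu_inv H M x + nu_inv H M y"
  unfolding xy nu_inv_add[OF subspace_add[OF subK ki(1) ki'(1)] subspace_add[OF subI ki(2) ki'(2)]]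
  unfolding ki(3) ki'(3) nu_inv_add[OF ki(1,2)] nu_inv_add[OF ki'(1,2)] by simp
next
 fix c x assume x: "x \<in> H"
 obtain k i where ki: "k \<in> K" "i \<in> I" "x = k + i" using decomp[OF x] .
 have "X (c *\<^sub>R i) = c *\<^sub>R X i" "T (c *\<^sub>R k) = c *\<^sub>R T k"
  using linear_map_on_scale[OF linX subsetD[OF IH ki(2)]] linear_map_on_scale[OF T_linear ki(1)] by auto
 then show "nu_inv H M (c *\<^sub>R x) = c *\<^sub>R nu_inv H M x"
  unfolding ki(3) scaleR_add_right nu_inv_add[OF ki(1,2)]
   nu_inv_add[OF subspace_scale[OF subK ki(1)] subspace_scale[OF subI ki(2)]]
  by (simp add: scaleR_diff_right)
qed

lemma nu_inv_iso: "linear_iso H H (nu_inv H M)"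
 unfolding linear_iso_def bij_betw_def
proof (intro conjI nu_inv_linear)
 have "x = 0" if x: "x \<in> H" "nu_inv H M x = 0" for x
 proof -
  obtain k i where ki: "k \<in> K" "i \<in> I" "x = k + i" using decomp[OF x(1)] .
  have "X i = T k" using x(2) nu_inv_add[OF ki(1,2)] ki by simp
  then have "X i = 0" "T k = 0" using KI_zero[of "T k"] T_K[OF ki(1)] X_I[OF ki(2)] by auto
  then have "i = 0" "k = 0"
   using inj_onD[OF fit_range_inj[OF H linX invX], of i 0] ki(2) zero_KI
    T_inverse(2)[OF ki(1)] T_inverse(2)[OF zero_KI(1)] by auto
  then show ?thesis using ki by simp
 qed
 then show "inj_on (nu_inv H M) H" using inj_on_linear_iff[OF nu_inv_linear subH] by auto
 have "nu_inv H M x \<in> H" if x: "x \<in> H" for x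
 proof -
  obtain k i where ki: "k \<in> K" "i \<in> I" "x = k + i" using decomp[OF x] .
  then show ?thesis
   unfolding ki(3) nu_inv_add[OF ki(1,2)]
   using subspace_diff[OF subH subsetD[OF IH X_I[OF ki(2)]] subsetD[OF KH T_K[OF ki(1)]]] by simp
 qed
 then have sub: "nu_inv H M ` H \<subseteq> H" by auto
 show "nu_inv H M ` H = H"
  by (rule fin_dim_inj_imp_surj[OF H nu_inv_linear sub \<open>inj_on (nu_inv H M) H\<close>])
qed

lemma
 shows H_one_eq: "H_one H M = K \<times> K" and H_ne_one_eq: "H_ne_one H M = I \<times> I"
  and unipotent_part_eq: "x \<in> K \<times> K ==> unipotent_part H M x = map_prod M M x"
proof -
 obtain Mu where "jordan_decomposition H M (semisimple_part H M) Mu"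
  unfolding semisimple_part_def using someI_ex[OF jordan_decomposition_exists[OF H M]] by blast
 note * = jordan_decomposition_fitting[OF H M this, folded X_def[abs_def]]
 show "H_one H M = K \<times> K" using *(1) by (simp add: H_one_def gen_eigenspace_def)
 show "H_ne_one H M = I \<times> I" using *(2) by (simp add: H_ne_one_def gen_eigenspace_def)
 have "\<exists>Mu Ms. jordan_decomposition H M Ms Mu" using jordan_decomposition_exists[OF H M] by blast
 then obtain Ms where "jordan_decomposition H M Ms (unipotent_part H M)"
  unfolding unipotent_part_def using someI_ex[of "\<lambda>Mu. \<exists>Ms. jordan_decomposition H M Ms Mu"] by blast
 from jordan_decomposition_fitting(3)[OF H M this, folded X_def[abs_def]]
 show "x \<in> K \<times> K ==> unipotent_part H M x = map_prod M M x" .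
qed

lemma nilp_log_eq:
 assumes x: "x \<in> K \<times> K"
 shows "nilp_log H M x = map_prod (fps_act (dim H) X (fps_ln 1)) (fps_act (dim H) X (fps_ln 1)) x"
proof -
 have pow: "((\<lambda>y. unipotent_part H M y - y) ^^ k) x = map_prod (X ^^ k) (X ^^ k) x \<and>
   map_prod (X ^^ k) (X ^^ k) x \<in> K \<times> K" for k
 proof (induction k)
  case (Suc k)
  have "map_prod (X ^^ Suc k) (X ^^ Suc k) x \<in> K \<times> K" using x nil.powK by (auto simp del: funpow.simps)
  moreover have "unipotent_part H M (map_prod (X ^^ k) (X ^^ k) x) - map_prod (X ^^ k) (X ^^ k) x
    = map_prod (X ^^ Suc k) (X ^^ Suc k) x"
   unfolding unipotent_part_eq[OF conjunct2[OF Suc]] by (simp add: prod_eq_iff X_def[symmetric])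
  moreover have "((\<lambda>y. unipotent_part H M y - y) ^^ Suc k) x
    = unipotent_part H M (map_prod (X ^^ k) (X ^^ k) x) - map_prod (X ^^ k) (X ^^ k) x"
   using Suc by simp
  ultimately show ?case by metis
 qed (use x in auto)
 have c: "fps_act (dim H) X (fps_ln 1) a = (\<Sum>k = 1..dim H. ((- 1) ^ (k + 1) / real k) *\<^sub>R (X ^^ k) a)"
  if "a \<in> K" for a
 proof -
  have "fps_act (dim H) X (fps_ln 1) a = (\<Sum>k<Suc (dim H). (fps_ln 1 $ k) *\<^sub>R (X ^^ k) a)"
   unfolding fps_act_def by (rule sum.mono_neutral_left) (use nil.pow_zero[OF that] in auto)
  also have "\<dots> = (\<Sum>k = 1..dim H. (fps_ln 1 $ k) *\<^sub>R (X ^^ k) a)"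
   by (rule sum.mono_neutral_right) (auto simp: fps_ln_nth not_less_eq_eq)
  also have "\<dots> = (\<Sum>k = 1..dim H. ((- 1) ^ (k + 1) / real k) *\<^sub>R (X ^^ k) a)"
   by (rule sum.cong) (auto simp: fps_ln_nth minus_one_power_iff)
  finally show ?thesis .
 qed
 have "fst x \<in> K" "snd x \<in> K" using x by auto
 then show ?thesis
  unfolding nilp_log_def using pow c by (auto simp: prod_eq_iff fst_sum snd_sum)
qed

lemma exp_quot_eq:
 assumes x: "x \<in> K \<times> K" shows "exp_quot H M x = map_prod T T x"
proof -
 let ?N = "fps_act (dim H) X (fps_ln 1)"
 have NK: "(?N ^^ k) a \<in> K" if "a \<in> K" for a k
  by (induction k) (use that nil.act_closed in auto)
 have pow: "(nilp_log H M ^^ k) x = map_prod (?N ^^ k) (?N ^^ k) x" for k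
 proof (induction k)
  case (Suc k)
  have "map_prod (?N ^^ k) (?N ^^ k) x \<in> K \<times> K" using x NK by auto
  then show ?case using nilp_log_eq Suc by (cases x) simp
 qed simp
 have T: "T a = (\<Sum>k = 1..dim H. (1 / fact k) *\<^sub>R (?N ^^ (k - 1)) a)" if "a \<in> K" for a
 proof -
  have "T a = (\<Sum>k<dim H. (1 / fact (k + 1)) *\<^sub>R (?N ^^ k) a)"
   unfolding T_def exp_quot_fps_def by (subst nil.act_compose[OF that]) auto
  also have "\<dots> = (\<Sum>k = 1..dim H. (1 / fact k) *\<^sub>R (?N ^^ (k - 1)) a)"
   by (rule sum.reindex_bij_witness[of _ "\<lambda>k. k - 1" Suc]) auto
  finally show ?thesis .
 qed
 have "fst x \<in> K" "snd x \<in> K" using x by auto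
 then show ?thesis
  unfolding exp_quot_def using pow T by (auto simp: prod_eq_iff fst_sum snd_sum)
qed

text \<open>
 The Jordan decomposition enters \<open>\<nu>\<close> only through the two Fitting components of \<open>M - id\<close>, which
 complexify to \<open>H_one\<close> and \<open>H_ne_one\<close>.
\<close>

lemma nu_eq:
 assumes x: "x \<in> H \<times> H" shows "nu H M (map_prod (nu_inv H M) (nu_inv H M) x) = x"
proof -
 obtain a b where ab: "x = (a, b)" "a \<in> H" "b \<in> H" using x by auto
 obtain k i where ki: "k \<in> K" "i \<in> I" "a = k + i" using decomp[OF ab(2)] .
 obtain k' i' where ki': "k' \<in> K" "i' \<in> I" "b = k' + i'" using decomp[OF ab(3)] .
 let ?x1 = "(- T k, - T k')" and ?x2 = "(X i, X i')"
 have x1: "?x1 \<in> K \<times> K" and x2: "?x2 \<in> I \<times> I"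
  using ki ki' T_K X_I subspace_neg[OF subK] by auto
 have nx: "map_prod (nu_inv H M) (nu_inv H M) x = ?x1 + ?x2"
  using ki ki' nu_inv_add ab by simp
 have inj1: "inj_on (exp_quot H M) (K \<times> K)"
 proof (rule inj_onI)
  fix u v assume u: "u \<in> K \<times> K" and v: "v \<in> K \<times> K" and eq: "exp_quot H M u = exp_quot H M v"
  then have "T (fst u) = T (fst v)" "T (snd u) = T (snd v)"
   using exp_quot_eq by (auto simp: prod_eq_iff)
  then show "u = v" using u v T_inverse(2) by (metis mem_Times_iff prod_eq_iff)
 qed
 have inv1: "inv_into (K \<times> K) (exp_quot H M) ?x1 = (- k, - k')"
  by (rule inv_into_f_eq[OF inj1])
   (use ki ki' exp_quot_eq[of "(- k, - k')"] subspace_neg[OF subK] linear_map_on_neg[OF T_linear] in auto)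
 have inj2: "inj_on (\<lambda>u. map_prod M M u - u) (I \<times> I)"
  using fit_range_inj[OF H linX invX] by (auto simp: inj_on_def X_def)
 have inv2: "inv_into (I \<times> I) (\<lambda>u. map_prod M M u - u) ?x2 = (i, i')"
  by (rule inv_into_f_eq[OF inj2]) (use ki ki' in \<open>auto simp: X_def\<close>)
 have uniq: "y1 = ?x1 \<and> y2 = ?x2" if "y1 \<in> K \<times> K" "y2 \<in> I \<times> I" "?x1 + ?x2 = y1 + y2" for y1 y2
 proof -
  have "y1 - ?x1 = ?x2 - y2" using that(3) by (metis add_diff_cancel_left' add_diff_eq diff_add_cancel diff_add_eq)
  moreover have "y1 - ?x1 \<in> K \<times> K" "?x2 - y2 \<in> I \<times> I"
   using subspace_diff[OF cs_subspace_real[OF cs_subspace_Times[OF subK]] that(1) x1]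
    subspace_diff[OF cs_subspace_real[OF cs_subspace_Times[OF subI]] x2 that(2)] by auto
  ultimately have "fst (y1 - ?x1) = 0" "snd (y1 - ?x1) = 0"
   using KI_zero[of "fst (y1 - ?x1)"] KI_zero[of "snd (y1 - ?x1)"] by (metis mem_Times_iff)+
  then have "y1 - ?x1 = 0" unfolding prod_eq_iff[of "y1 - ?x1"] by simp
  then have "y1 = ?x1" by (rule eq_iff_diff_eq_0[THEN iffD2])
  moreover have "?x1 + ?x2 = ?x1 + y2" using that(3) calculation by (rule subst[rotated, where P = "\<lambda>z. ?x1 + ?x2 = z + y2"])
  ultimately show ?thesis by (metis add_left_cancel)
 qed
 show ?thesis
  unfolding nu_def nx H_one_eq H_ne_one_eq
 proof (rule the_equality)
  show "\<exists>x1\<in>K \<times> K. \<exists>x2\<in>I \<times> I. ?x1 + ?x2 = x1 + x2 \<and>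
    x = inv_into (I \<times> I) (\<lambda>u. map_prod M M u - u) x2 - inv_into (K \<times> K) (exp_quot H M) x1"
   by (rule bexI[OF _ x1], rule bexI[OF _ x2]) (use inv1 inv2 ki ki' ab in simp)
  show "y = x" if "\<exists>x1\<in>K \<times> K. \<exists>x2\<in>I \<times> I. ?x1 + ?x2 = x1 + x2 \<and>
    y = inv_into (I \<times> I) (\<lambda>u. map_prod M M u - u) x2 - inv_into (K \<times> K) (exp_quot H M) x1" for y
  proof -
   have "y = inv_into (I \<times> I) (\<lambda>u. map_prod M M u - u) ?x2 - inv_into (K \<times> K) (exp_quot H M) ?x1"
    using that uniq by blast
   then show ?thesis using inv1 inv2 ki ki' ab by simp
  qed
 qed
qed

lemma L_nor_eq:
 assumes S: "bilinear_form_on H H S" and a: "a \<in> H" and b: "b \<in> H"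
 shows "L_nor H M S a b = - S a (nu_inv H M b)"
proof -
 note lin = linear_isoD[OF nu_inv_iso]
 let ?n = "map_prod (nu_inv H M) (nu_inv H M)"
 have sur: "H \<times> H = ?n ` (H \<times> H)" using map_prod_surj_on[OF lin(3) lin(3)] by simp
 have "nu H M u = nu H M v ==> u = v" if u: "u \<in> H \<times> H" and v: "v \<in> H \<times> H" for u v
 proof -
  obtain u' v' where "u' \<in> H \<times> H" "u = ?n u'" "v' \<in> H \<times> H" "v = ?n v'"
   using u v sur by (metis (no_types, lifting) imageE)
  then show "nu H M u = nu H M v ==> u = v" using nu_eq by metis
 qed
 then have inj: "inj_on (nu H M) (H \<times> H)" by (rule inj_onI)
 have b0: "(b, 0) \<in> H \<times> H" using b subspace_0[OF subH] by auto
 have "inv_into (H \<times> H) (nu H M) (b, 0) = ?n (b, 0)"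
  using inv_into_f_eq[OF inj _ nu_eq[OF b0]] b0 lin(4) by auto
 moreover have "nu_inv H M 0 = 0" using linear_map_on_zero[OF nu_inv_linear subH] .
 moreover have "S 0 0 = 0"
  using S linear_map_on_zero[OF _ subH] subspace_0[OF subH] by (auto simp: bilinear_form_on_def)
 ultimately show ?thesis by (simp add: L_nor_def cform_def)
qed

end

section \<open>Correspondences of isomorphism classes\<close>

lemma class_correspondenceI:
 assumes A: "equiv A R" and B: "equiv B S"
  and total: "\<And>x. x \<in> A ==> \<exists>y. K x y" and range: "\<And>x y. x \<in> A ==> K x y ==> y \<in> B"
  and wd: "\<And>x x' y y'. (x, x') \<in> R ==> K x y ==> K x' y' ==> (y, y') \<in> S"
  and inj: "\<And>x x' y y'. x \<in> A ==> x' \<in> A ==> K x y ==> K x' y' ==> (y, y') \<in> S ==> (x, x') \<in> R"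
  and surj: "\<And>y. y \<in> B ==> \<exists>x\<in>A. \<exists>y'. K x y' \<and> (y', y) \<in> S"
 shows "class_correspondence A R B S K"
proof -
 define F where "F X = {y'. \<exists>x\<in>X. \<exists>y. K x y \<and> (y, y') \<in> S}" for X
 have F: "F (R `` {x}) = S `` {y}" if x: "x \<in> A" and y: "K x y" for x y
 proof (intro set_eqI iffI)
  fix z assume "z \<in> F (R `` {x})"
  then obtain x' y' where "(x, x') \<in> R" "K x' y'" "(y', z) \<in> S" by (auto simp: F_def)
  then show "z \<in> S `` {y}" using wd[OF _ y] B by (meson Image_singleton_iff equivE transD)
 next
  fix z assume "z \<in> S `` {y}"
  then show "z \<in> F (R `` {x})" using equiv_class_self[OF A x] y by (auto simp: F_def)
 qed
 have "bij_betw F (A // R) (B // S)"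
 proof (rule bij_betw_imageI)
  show "inj_on F (A // R)"
  proof (rule inj_onI)
   fix X X' assume X: "X \<in> A // R" "X' \<in> A // R" "F X = F X'"
   obtain x x' where x: "x \<in> A" "X = R `` {x}" "x' \<in> A" "X' = R `` {x'}"
    using X by (auto elim!: quotientE)
   obtain y y' where y: "K x y" "K x' y'" using total x by meson
   then have "(y, y') \<in> S" using X(3) F x eq_equiv_class[OF _ B] range[OF x(3) y(2)] by metis
   then show "X = X'" using inj[OF x(1,3) y] equiv_class_eq[OF A] x by simp
  qed
  show "F ` (A // R) = B // S"
  proof (intro equalityI subsetI)
   fix Y assume "Y \<in> F ` (A // R)"
   then obtain x where x: "x \<in> A" "Y = F (R `` {x})" by (auto elim!: quotientE)
   obtain y where y: "K x y" using total x by meson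
   then show "Y \<in> B // S" using F x range[OF x(1) y] by (auto intro: quotientI)
  next
   fix Y assume "Y \<in> B // S"
   then obtain y where y: "y \<in> B" "Y = S `` {y}" by (auto elim!: quotientE)
   obtain x y' where x: "x \<in> A" "K x y'" "(y', y) \<in> S" using surj[OF y(1)] by auto
   then have "Y = F (R `` {x})" using F[OF x(1,2)] y equiv_class_eq[OF B] by simp
   then show "Y \<in> F ` (A // R)" using x(1) by (auto intro: quotientI)
  qed
 qed
 then show ?thesis
  unfolding class_correspondence_def F_def[abs_def] using A B total range wd by blast
qed

section \<open>The monodromy of a Seifert form\<close>

lemma linear_map_on_eq_on_span:
 assumes "finite B" "linear_map_on (span B) f" "linear_map_on (span B) g" "\<And>b. b \<in> B ==> f b = g b"
  and x: "x \<in> span B"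
 shows "f x = g x"
proof -
 obtain u where u: "x = (\<Sum>v\<in>B. u v *\<^sub>R v)" using x span_finite[OF assms(1)] by auto
 have *: "h x = (\<Sum>v\<in>B. u v *\<^sub>R h v)" if h: "linear_map_on (span B) h" for h :: "'a \<Rightarrow> 'b"
 proof -
  have "h x = (\<Sum>v\<in>B. h (u v *\<^sub>R v))" unfolding u
   by (rule linear_map_on_sum[OF h subspace_span]) (auto intro: span_base span_scale)
  also have "\<dots> = (\<Sum>v\<in>B. u v *\<^sub>R h v)"
   by (rule sum.cong) (auto simp: linear_map_on_scale[OF h span_base])
  finally show ?thesis .
 qed
 show ?thesis using *[OF assms(2)] *[OF assms(3)] assms(4) by simp
qed

lemma bilinear_form_onD:
 assumes "bilinear_form_on V W B"
 shows "a \<in> V ==> linear_map_on W (B a)" "b \<in> W ==> linear_map_on V (\<lambda>a. B a b)"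
 using assms by (auto simp: bilinear_form_on_def)

lemma nondegenerate_representation:
 fixes L :: "'v::real_vector \<Rightarrow> 'v \<Rightarrow> real"
 assumes H: "fin_dim_space H" and L: "bilinear_form_on H H L" "nondegenerate_on H H L"
  and \<phi>: "linear_map_on H \<phi>"
 shows "\<exists>c\<in>H. \<forall>b\<in>H. L c b = \<phi> b"
proof -
 obtain B where B: "finite B" "independent B" "span B = H" using fin_dim_space_basis[OF H] by auto
 have BH: "b \<in> B ==> b \<in> H" for b using B span_base by auto
 have sub: "subspace H" using H fin_dim_space_subspace by auto
 define \<Phi> where "\<Phi> a = (\<Sum>b\<in>B. L a b *\<^sub>R b)" for a
 have lin: "linear_map_on H \<Phi>"
  using bilinear_form_onD(2)[OF L(1) BH]
  by (auto simp: linear_map_on_def \<Phi>_def scaleR_add_left sum.distrib scaleR_sum_right)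
 have \<Phi>H: "\<Phi> ` H \<subseteq> H"
  unfolding \<Phi>_def by (intro image_subsetI subspace_sum[OF sub] subspace_scale[OF sub] BH)
 have agree: "(\<forall>b\<in>H. f b = g b)" if "linear_map_on H f" "linear_map_on H g" "\<forall>b\<in>B. f b = g b"
  for f g :: "'v \<Rightarrow> real"
  using linear_map_on_eq_on_span[OF B(1), of f g] that B(3) by auto
 have "a = 0" if a: "a \<in> H" "\<Phi> a = 0" for a
 proof -
  have "\<forall>b\<in>B. L a b = 0"
   using independentD[OF B(2) B(1) order_refl, of "L a"] a(2) by (auto simp: \<Phi>_def)
  then have "\<forall>b\<in>H. L a b = 0"
   using agree[OF bilinear_form_onD(1)[OF L(1) a(1)], of "\<lambda>_. 0"] by (simp add: linear_map_on_def)
  then show ?thesis using L(2) a by (auto simp: nondegenerate_on_def)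
 qed
 then have "inj_on \<Phi> H" using inj_on_linear_iff[OF lin sub] by auto
 then have surj: "\<Phi> ` H = H" using fin_dim_inj_imp_surj[OF H lin \<Phi>H] by auto
 have "(\<Sum>b\<in>B. \<phi> b *\<^sub>R b) \<in> H" by (intro subspace_sum[OF sub] subspace_scale[OF sub] BH)
 then obtain c where c: "c \<in> H" "\<Phi> c = (\<Sum>b\<in>B. \<phi> b *\<^sub>R b)" using surj by (metis imageE)
 then have "(\<Sum>b\<in>B. (L c b - \<phi> b) *\<^sub>R b) = 0" by (simp add: \<Phi>_def scaleR_diff_left sum_subtractf)
 then have "\<forall>b\<in>B. L c b - \<phi> b = 0"
  using independentD[OF B(2) B(1) order_refl, of "\<lambda>b. L c b - \<phi> b"] by blast
 then have "\<forall>b\<in>H. L c b = \<phi> b"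
  using agree[OF bilinear_form_onD(1)[OF L(1) c(1)] \<phi>] by simp
 then show ?thesis using c by auto
qed

locale seifert_form =
 fixes H :: "'v::real_vector set" and L :: "'v \<Rightarrow> 'v \<Rightarrow> real"
 assumes H: "fin_dim_space H" and bil: "bilinear_form_on H H L" and nondeg: "nondegenerate_on H H L"
begin

lemma subH: "subspace H" using H fin_dim_space_subspace by auto

lemmas L_add = linear_map_on_add[OF bilinear_form_onD(1)[OF bil]] linear_map_on_add[OF bilinear_form_onD(2)[OF bil]]
lemmas L_scale = linear_map_on_scale[OF bilinear_form_onD(1)[OF bil]] linear_map_on_scale[OF bilinear_form_onD(2)[OF bil]]
lemmas L_diff = linear_map_on_diff[OF bilinear_form_onD(1)[OF bil] subH]
 linear_map_on_diff[OF bilinear_form_onD(2)[OF bil] subH]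

lemma left_cancel: assumes "a \<in> H" "a' \<in> H" "\<And>b. b \<in> H ==> L a b = L a' b" shows "a = a'"
proof -
 have "\<forall>b\<in>H. L (a - a') b = 0" using L_diff(2) assms by simp
 then have "a - a' = 0" using nondeg subspace_diff[OF subH assms(1,2)] by (auto simp: nondegenerate_on_def)
 then show ?thesis by simp
qed

lemma right_cancel: assumes "b \<in> H" "b' \<in> H" "\<And>a. a \<in> H ==> L a b = L a b'" shows "b = b'"
proof -
 have "\<forall>a\<in>H. L a (b - b') = 0" using L_diff(1) assms by simp
 then have "b - b' = 0" using nondeg subspace_diff[OF subH assms(1,2)] by (auto simp: nondegenerate_on_def)
 then show ?thesis by simp
qed

lemma monodromy:
 shows "linear_iso H H (Seifert_monodromy H L)"
  and "a \<in> H ==> b \<in> H ==> L (Seifert_monodromy H L a) b = L b a"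
proof -
 have "\<exists>c. c \<in> H \<and> (\<forall>b\<in>H. L c b = L b a)" if "a \<in> H" for a
  using nondegenerate_representation[OF H bil nondeg bilinear_form_onD(2)[OF bil that]] by auto
 then obtain M0 where M0: "\<And>a. a \<in> H ==> M0 a \<in> H \<and> (\<forall>b\<in>H. L (M0 a) b = L b a)" by metis
 define M where "M = restrict M0 H"
 have M: "M a \<in> H" "b \<in> H ==> L (M a) b = L b a" if "a \<in> H" for a b using M0 that by (auto simp: M_def)
 have lin: "linear_map_on H M"
  unfolding linear_map_on_def
 proof safe
  fix x y assume xy: "x \<in> H" "y \<in> H"
  show "M (x + y) = M x + M y"
   by (rule left_cancel) (use xy M subspace_add[OF subH] L_add in simp_all)
 next
  fix c x assume x: "x \<in> H"
  show "M (c *\<^sub>R x) = c *\<^sub>R M x"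
   by (rule left_cancel) (use x M subspace_scale[OF subH] L_scale in simp_all)
 qed
 have "inj_on M H"
 proof (rule inj_onI)
  fix x y assume "x \<in> H" "y \<in> H" "M x = M y"
  then show "x = y" using right_cancel[of x y] M by metis
 qed
 moreover have "M ` H = H" using fin_dim_inj_imp_surj[OF H lin _ calculation] M by auto
 ultimately have iso: "linear_iso H H M" using lin by (auto simp: linear_iso_def bij_betw_def)
 have "Seifert_monodromy H L = M"
  unfolding Seifert_monodromy_def
 proof (rule the_equality)
  show "M \<in> extensional H \<and> linear_iso H H M \<and> (\<forall>a\<in>H. \<forall>b\<in>H. L (M a) b = L b a)"
   using iso M by (auto simp: M_def)
  fix M' assume M': "M' \<in> extensional H \<and> linear_iso H H M' \<and> (\<forall>a\<in>H. \<forall>b\<in>H. L (M' a) b = L b a)"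
  show "M' = M"
  proof (rule extensionalityI[of _ H])
   fix x assume x: "x \<in> H"
   show "M' x = M x"
    by (rule left_cancel) (use x M M' linear_isoD(4)[of H H M'] in auto)
  qed (use M' in \<open>auto simp: M_def\<close>)
 qed
 then show "linear_iso H H (Seifert_monodromy H L)"
  "a \<in> H ==> b \<in> H ==> L (Seifert_monodromy H L a) b = L b a" using iso M by auto
qed

lemma monodromy_unique:
 assumes "a \<in> H" "c \<in> H" "\<And>b. b \<in> H ==> L c b = L b a"
 shows "Seifert_monodromy H L a = c"
 by (rule left_cancel) (use assms monodromy linear_isoD(4)[OF monodromy(1)] in auto)

lemma monodromy_invariant:
 assumes "a \<in> H" "b \<in> H"
 shows "L (Seifert_monodromy H L a) (Seifert_monodromy H L b) = L a b"
 using assms monodromy(2) linear_isoD(4)[OF monodromy(1)] by simp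

end

lemma eigenvalues_in_circle_scale:
 assumes f: "eigenvalues_in_circle H f" and g: "\<And>a. a \<in> H ==> g a = e *\<^sub>R f a" and e: "e * e = (1::real)"
 shows "eigenvalues_in_circle H g"
 unfolding eigenvalues_in_circle_def
proof (intro allI impI)
 fix l assume "eigenvalue_on H g l"
 then obtain x where x: "x \<in> H \<times> H" "x \<noteq> 0" "map_prod g g x = cscale l x"
  by (auto simp: eigenvalue_on_def)
 have "map_prod g g x = e *\<^sub>R map_prod f f x" using x(1) g by (auto simp: prod_eq_iff)
 then have "cscale (of_real e) (map_prod f f x) = cscale l x" using x(3) by (simp add: cscale_of_real)
 then have "cscale (of_real e * of_real e) (map_prod f f x) = cscale (of_real e * l) x"
  by (metis cs.scale_scale)
 moreover have "of_real e * of_real e = (1::complex)" using e by (metis of_real_1 of_real_mult)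
 ultimately have "map_prod f f x = cscale (of_real e * l) x" by simp
 then have "cmod (of_real e * l) = 1"
  using f x(1,2) unfolding eigenvalues_in_circle_def eigenvalue_on_def by blast
 moreover have "\<bar>e\<bar> = 1" using e by (metis abs_mult_self_eq abs_one abs_square_eq_1 power2_eq_square)
 ultimately show "cmod l = 1" by (simp add: norm_mult)
qed

lemma minus_one_powi: "(- 1) powi (m + 1) = - ((- 1) powi m :: 'a::field)" "(- 1) powi m * (- 1) powi m = (1 :: 'a)"
 by (auto simp: power_int_add power_int_minus_one_mult_self)

section \<open>Seifert forms and invariant forms\<close>

context endo_space
begin

lemma M_X: assumes "a \<in> H" shows "X (M a) = M (X a)"
 using linear_map_on_diff[OF linM(1) subH linM(4)[OF assms] assms] by (simp add: X_def)

lemma M_K: "k \<in> K ==> M k \<in> K"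
 using subspace_add[OF subK _ X_K, of k k] M_eq[of k] by simp
lemma M_I: "i \<in> I ==> M i \<in> I"
 using subspace_add[OF subI _ X_I, of i i] M_eq[of i] by simp

lemma M_T: assumes k: "k \<in> K" shows "T (M k) = M (T k)"
proof -
 have M: "M a = fps_act (dim H) X (1 + fps_X) a" if "a \<in> K" for a
  using that M_eq[of a] by (simp add: nil.act_add nil.act_one nil.act_X)
 show ?thesis
  unfolding M[OF k] M[OF T_K[OF k]] unfolding T_def
  using nil.act_mult[OF k, of exp_quot_fps "1 + fps_X"] nil.act_mult[OF k, of "1 + fps_X" exp_quot_fps]
  by (simp add: mult.commute)
qed

lemma M_nu_inv: assumes b: "b \<in> H" shows "nu_inv H M (M b) = M (nu_inv H M b)"
proof -
 obtain k i where ki: "k \<in> K" "i \<in> I" "b = k + i" using decomp[OF b] .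
 have kH: "k \<in> H" "i \<in> H" using ki KH IH by auto
 have "nu_inv H M (M b) = nu_inv H M (M k + M i)" using linear_map_on_add[OF linM(1) kH] ki by simp
 also have "\<dots> = X (M i) - T (M k)" by (rule nu_inv_add[OF M_K[OF ki(1)] M_I[OF ki(2)]])
 also have "\<dots> = M (X i - T k)"
  using linear_map_on_diff[OF linM(1) subH subsetD[OF IH X_I[OF ki(2)]] subsetD[OF KH T_K[OF ki(1)]]]
   M_X[OF kH(2)] M_T[OF ki(1)] by simp
 also have "X i - T k = nu_inv H M b" using nu_inv_add[OF ki(1,2)] ki(3) by simp
 finally show ?thesis .
qed

lemma invariant_orthogonal_aux:
 fixes B :: "'v \<Rightarrow> 'v \<Rightarrow> real"
 assumes B: "bilinear_form_on H H B" and inv: "\<And>a b. a \<in> H ==> b \<in> H ==> B (M a) (M b) = B a b"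
  and k: "k \<in> K" and i: "i \<in> I"
 shows "B k i = 0"
proof -
 have lin: "linear_map_on H (B a)" "linear_map_on H (\<lambda>a. B a b)" if "a \<in> H" "b \<in> H" for a b
  using bilinear_form_onD[OF B] that by auto
 have "x \<in> H ==> (X ^^ j) x = 0 ==> i \<in> I ==> B x i = 0" for x i j
 proof (induction j arbitrary: x i)
  case 0
  then show ?case using linear_map_on_zero[OF lin(2) subH] IH by auto
 next
  case (Suc j)
  obtain u where u: "u \<in> H" "x = M u" using linM(3) Suc.prems by blast
  have "i \<in> X ` I" using fit_range_surj[OF H linX invX] Suc.prems by simp
  then obtain i' where i': "i' \<in> I" "i = X i'" by blast
  have i'H: "i' \<in> H" "X i' \<in> H" "X u \<in> H" using i' u IH invX by auto
  have XjH: "(X ^^ n) a \<in> H" if "a \<in> H" for n a using linear_map_on_funpow(2)[OF linX invX] that by auto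
  have "(X ^^ n) (M u) = M ((X ^^ n) u)" for n
   by (induction n) (use M_X[OF XjH[OF u(1)]] in auto)
  then have "M ((X ^^ Suc j) u) = M 0"
   using Suc.prems u linear_map_on_zero[OF linM(1) subH] by metis
  then have "(X ^^ Suc j) u = 0"
   using inj_onD[OF linM(2)] XjH[OF u(1)] subspace_0[OF subH] by blast
  then have "B (X u) i' = 0" using Suc.IH[OF i'H(3) _ i'(1)] by (simp add: funpow_swap1)
  moreover have "B (M u) (M i') = B (M u) i' + B (M u) (X i')"
   using linear_map_on_add[OF lin(1) i'H(1,2)] linM(4)[OF u(1)] i'H M_eq by metis
  moreover have "B (M u) i' = B u i' + B (X u) i'"
   using linear_map_on_add[OF lin(2) u(1) i'H(3)] i'H M_eq by metis
  ultimately show ?case using inv[OF u(1) i'H(1)] u(2) i'(2) by simp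
 qed
 then show ?thesis using k i by (auto simp: fit_null_def)
qed

lemma invariant_split:
 fixes B :: "'v \<Rightarrow> 'v \<Rightarrow> real"
 assumes B: "bilinear_form_on H H B" and inv: "\<And>a b. a \<in> H ==> b \<in> H ==> B (M a) (M b) = B a b"
  and k: "k \<in> K" "k' \<in> K" and i: "i \<in> I" "i' \<in> I"
 shows "B (k + i) (k' + i') = B k k' + B i i'"
proof -
 have kH: "k \<in> H" "k' \<in> H" "i \<in> H" "i' \<in> H" using k i KH IH by auto
 have "bilinear_form_on H H (\<lambda>a b. B b a)" using B by (auto simp: bilinear_form_on_def)
 then have "B i k' = 0" using invariant_orthogonal_aux[of "\<lambda>a b. B b a"] inv k i by blast
 moreover have "B k i' = 0" by (rule invariant_orthogonal_aux[OF B inv k(1) i(2)])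
 moreover have "k' + i' \<in> H" using kH subspace_add[OF subH] by auto
 ultimately show ?thesis
  using linear_map_on_add[OF bilinear_form_onD(2)[OF B] kH(1,3)] kH
   linear_map_on_add[OF bilinear_form_onD(1)[OF B] kH(2,4)] by simp
qed

lemma invariant_T:
 fixes B :: "'v \<Rightarrow> 'v \<Rightarrow> real"
 assumes B: "bilinear_form_on H H B" and inv: "\<And>a b. a \<in> H ==> b \<in> H ==> B (M a) (M b) = B a b"
  and k: "k \<in> K" "k' \<in> K"
 shows "B (M k) (T k') = B (T k) k'"
proof -
 have "bilinear_form_on K K B"
  using B KH linear_map_on_subset[OF _ KH] by (auto simp: bilinear_form_on_def)
 moreover have "B (x + X x) (y + X y) = B x y" if "x \<in> K" "y \<in> K" for x y
  using inv[of x y] that KH M_eq[of x] M_eq[of y] by auto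
 ultimately show ?thesis using nil.exp_quot_adjoint[of B k k'] k M_eq[of k] by (simp add: T_def)
qed

text \<open>
 On the Fitting range the left adjoint of \<open>M - id\<close> for an invariant form is \<open>- (M - id) / M\<close>, and on
 the null component that of \<open>(M - id) / N\<close> is \<open>(M - id) / (N M)\<close>. The opposite symmetries of \<open>S\<close> on the two
 components compensate the different signs.
\<close>

lemma L_nor_monodromy:
 assumes S: "bilinear_form_on H H S" and inv: "\<And>a b. a \<in> H ==> b \<in> H ==> S (M a) (M b) = S a b"
  and symI: "\<And>a b. a \<in> I ==> b \<in> I ==> S b a = - e * S a b"
  and symK: "\<And>a b. a \<in> K ==> b \<in> K ==> S b a = e * S a b"
  and e: "e * e = 1" and a: "a \<in> H" and b: "b \<in> H"
 shows "L_nor H M S (e *\<^sub>R M a) b = L_nor H M S b a"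
proof -
 obtain k i where ki: "k \<in> K" "i \<in> I" "a = k + i" using decomp[OF a] .
 obtain k' i' where ki': "k' \<in> K" "i' \<in> I" "b = k' + i'" using decomp[OF b] .
 have kH: "k \<in> H" "i \<in> H" "k' \<in> H" "i' \<in> H" using ki ki' KH IH by auto
 note linS = bilinear_form_onD[OF S]
 have L: "- S (k1 + i1) (nu_inv H M (k2 + i2)) = S k1 (T k2) - S i1 (X i2)"
  if "k1 \<in> K" "i1 \<in> I" "k2 \<in> K" "i2 \<in> I" for k1 i1 k2 i2
 proof -
  have "nu_inv H M (k2 + i2) = - T k2 + X i2" using nu_inv_add[OF that(3,4)] by simp
  then have "S (k1 + i1) (nu_inv H M (k2 + i2)) = S k1 (- T k2) + S i1 (X i2)"
   using invariant_split[OF S inv that(1) _ that(2) X_I[OF that(4)], of "- T k2"]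
    subspace_neg[OF subK T_K[OF that(3)]] by simp
  moreover have "S k1 (- T k2) = - S k1 (T k2)"
   using linear_map_on_neg[OF linS(1)] T_K[OF that(3)] that KH by auto
  ultimately show ?thesis by simp
 qed
 have Ma: "e *\<^sub>R M a = e *\<^sub>R M k + e *\<^sub>R M i"
  using linear_map_on_add[OF linM(1) kH(1,2)] ki(3) by (simp add: scaleR_add_right)
 have eM: "e *\<^sub>R M k \<in> K" "e *\<^sub>R M i \<in> I" "e *\<^sub>R M a \<in> H"
  using M_K M_I ki subspace_scale[OF subK] subspace_scale[OF subI] subspace_scale[OF subH] linM(4) a by auto
 have "L_nor H M S (e *\<^sub>R M a) b = S (e *\<^sub>R M k) (T k') - S (e *\<^sub>R M i) (X i')"
  unfolding L_nor_eq[OF S eM(3) b] unfolding Ma ki'(3) by (rule L[OF eM(1,2) ki'(1,2)])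
 also have "S (e *\<^sub>R M k) (T k') = e * S (T k) k'"
 proof -
  have "S (e *\<^sub>R M k) (T k') = e * S (M k) (T k')"
   using linear_map_on_scale[OF linS(2), of "T k'" "M k" e] T_K[OF ki'(1)] M_K[OF ki(1)] KH by auto
  then show ?thesis using invariant_T[OF S inv ki(1) ki'(1)] by simp
 qed
 also have "e * S (T k) k' = S k' (T k)" by (rule symK[symmetric, OF T_K[OF ki(1)] ki'(1)])
 also have "S (e *\<^sub>R M i) (X i') = S i' (X i)"
 proof -
  have MiH: "M i \<in> H" "M i' \<in> H" using linM(4) kH by auto
  have "S (e *\<^sub>R M i) (X i') = e * S (M i) (X i')"
   using linear_map_on_scale[OF linS(2) MiH(1)] X_I[OF ki'(2)] IH by auto
  also have "S (M i) (X i') = S i i' - S (M i) i'"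
   using linear_map_on_diff[OF linS(1)[OF MiH(1)] subH MiH(2) kH(4)] inv[OF kH(2,4)] by (simp add: X_def)
  also have "S i i' = - e * S i' i" by (rule symI[OF ki'(2) ki(2)])
  also have "S (M i) i' = - e * S i' (M i)" by (rule symI[OF ki'(2) M_I[OF ki(2)]])
  also have "e * (- e * S i' i - - e * S i' (M i)) = (e * e) * (S i' (M i) - S i' i)" by (simp add: algebra_simps)
  also have "\<dots> = S i' (X i)"
   using linear_map_on_diff[OF linS(1)[OF kH(4)] subH MiH(1) kH(2)] e by (simp add: X_def)
  finally show ?thesis .
 qed
 also have "S k' (T k) - S i' (X i) = L_nor H M S b a"
  unfolding L_nor_eq[OF S b a] unfolding ki(3) ki'(3) by (rule L[symmetric, OF ki'(1,2) ki(1,2)])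
 finally show ?thesis .
qed

text \<open>
 Conversely, a form \<open>L\<close> with \<open>L (e M a) b = L b a\<close> gives back the invariant form
 \<open>S a b = - L a (\<nu> b)\<close>.
\<close>

definition S_form :: "('v \<Rightarrow> 'v \<Rightarrow> real) \<Rightarrow> 'v \<Rightarrow> 'v \<Rightarrow> real" where
 "S_form L a b = - L a (inv_into H (nu_inv H M) b)"

lemma S_form_nu_inv: "b \<in> H ==> S_form L a (nu_inv H M b) = - L a b"
 by (simp add: S_form_def linear_isoD(2)[OF nu_inv_iso])

lemma nu_inv_surj: assumes "b \<in> H" obtains c where "c \<in> H" "b = nu_inv H M c"
 using linear_isoD(3)[OF nu_inv_iso] assms by blast

lemma S_form_bilinear: assumes "bilinear_form_on H H L" shows "bilinear_form_on H H (S_form L)"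
proof -
 note inv = linear_isoD[OF linear_iso_inv[OF nu_inv_iso subH]]
 have "linear_map_on H (S_form L a)" if "a \<in> H" for a
  using linear_map_on_comp[OF inv(1) _ bilinear_form_onD(1)[OF assms that]] inv(3)
  by (auto simp: S_form_def[abs_def] linear_map_on_def)
 moreover have "linear_map_on H (\<lambda>a. S_form L a b)" if "b \<in> H" for b
  using bilinear_form_onD(2)[OF assms inv(4)[OF that]]
  by (auto simp: S_form_def linear_map_on_def)
 ultimately show ?thesis by (auto simp: bilinear_form_on_def)
qed

lemma S_form_nondegenerate:
 assumes L: "nondegenerate_on H H L" shows "nondegenerate_on H H (S_form L)"
 unfolding nondegenerate_on_def
proof (intro conjI ballI impI)
 fix a assume a: "a \<in> H" "\<forall>b\<in>H. S_form L a b = 0"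
 then have "\<forall>b\<in>H. L a b = 0"
  using S_form_nu_inv linear_isoD(4)[OF nu_inv_iso] by (metis neg_equal_0_iff_equal)
 then show "a = 0" using a L by (auto simp: nondegenerate_on_def)
next
 fix b assume b: "b \<in> H" "\<forall>a\<in>H. S_form L a b = 0"
 obtain c where c: "c \<in> H" "b = nu_inv H M c" using nu_inv_surj[OF b(1)] .
 then have "\<forall>a\<in>H. L a c = 0" using b S_form_nu_inv by (metis neg_equal_0_iff_equal)
 then have "c = 0" using c L by (auto simp: nondegenerate_on_def)
 then show "b = 0" using c linear_map_on_zero[OF nu_inv_linear subH] by simp
qed

lemma S_form_invariant:
 assumes inv: "\<And>a b. a \<in> H ==> b \<in> H ==> L (M a) (M b) = L a b" and a: "a \<in> H" and b: "b \<in> H"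
 shows "S_form L (M a) (M b) = S_form L a b"
proof -
 obtain c where c: "c \<in> H" "b = nu_inv H M c" using nu_inv_surj[OF b] .
 show ?thesis
  unfolding c(2) M_nu_inv[OF c(1), symmetric] S_form_nu_inv[OF linM(4)[OF c(1)]] S_form_nu_inv[OF c(1)]
   inv[OF a c(1)] ..
qed

lemma S_form_symmetric:
 assumes L: "bilinear_form_on H H L" and inv: "\<And>a b. a \<in> H ==> b \<in> H ==> L (M a) (M b) = L a b"
  and mono: "\<And>a b. a \<in> H ==> b \<in> H ==> L (M a) b = e * L b a" and e: "e * e = 1"
 shows "a \<in> I ==> b \<in> I ==> S_form L b a = - e * S_form L a b"
  and "a \<in> K ==> b \<in> K ==> S_form L b a = e * S_form L a b"
proof -
 assume "a \<in> I" "b \<in> I"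
 then have "a \<in> X ` I" "b \<in> X ` I" using fit_range_surj[OF H linX invX] by simp_all
 then obtain c d where cd: "c \<in> I" "d \<in> I" "a = X d" "b = X c" by blast
 have cH: "c \<in> H" "d \<in> H" "M c \<in> H" "M d \<in> H" using cd IH linM(4) by auto
 have Sab: "S_form L (X d) (X c) = - (e * L c d - L d c)" if "c \<in> I" "d \<in> I" for c d
 proof -
  have H': "c \<in> H" "d \<in> H" using that IH by auto
  have "S_form L (X d) (X c) = - L (X d) c"
   using S_form_nu_inv[OF H'(1)] nu_inv_I[OF that(1)] by simp
  then show ?thesis
   using linear_map_on_diff[OF bilinear_form_onD(2)[OF L H'(1)] subH linM(4)[OF H'(2)] H'(2)]
    mono[OF H'(2,1)] by (simp add: X_def)
 qed
 have "- e * S_form L a b = (e * e) * L c d - e * L d c"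
  unfolding cd Sab[OF cd(1,2)] by (simp add: algebra_simps)
 then show "S_form L b a = - e * S_form L a b" unfolding cd Sab[OF cd(2,1)] using e by simp
next
 assume ab: "a \<in> K" "b \<in> K"
 define c d where "c = fps_act (dim H) X (inverse exp_quot_fps) b" and "d = fps_act (dim H) X (inverse exp_quot_fps) a"
 have cd: "c \<in> K" "d \<in> K" "a = T d" "b = T c"
  using ab T_inverse(1) nil.act_closed by (auto simp: c_def d_def)
 have S: "S_form L (T d) (T c) = L (T d) c" if cd: "c \<in> K" "d \<in> K" for c d
 proof -
  have mc: "- c \<in> K" using cd subspace_neg[OF subK] by auto
  have "nu_inv H M (- c) = T c" using nu_inv_K[OF mc] linear_map_on_neg[OF T_linear cd(1)] by simp
  then have "S_form L (T d) (T c) = - L (T d) (- c)" using S_form_nu_inv[of "- c"] mc KH by auto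
  also have "\<dots> = L (T d) c"
   using linear_map_on_neg[OF bilinear_form_onD(1)[OF L subsetD[OF KH T_K[OF cd(2)]]] subsetD[OF KH cd(1)]]
   by simp
  finally show ?thesis .
 qed
 have "S_form L a b = L (M d) (T c)" unfolding cd S[OF cd(1,2)] using invariant_T[OF L inv cd(2,1)] by simp
 also have "\<dots> = e * L (T c) d" using mono cd T_K KH by auto
 also have "\<dots> = e * S_form L b a" unfolding cd S[OF cd(2,1)] ..
 finally have "e * S_form L a b = (e * e) * S_form L b a" by simp
 then show "S_form L b a = e * S_form L a b" using e by simp
qed

end

lemma cform_symmetric_iff:
 fixes S :: "'v::real_vector \<Rightarrow> 'v \<Rightarrow> real"
 assumes "bilinear_form_on H H S" "subspace H" "subspace V"
 shows "(\<forall>x\<in>V \<times> V. \<forall>y\<in>V \<times> V. cform S y x = of_real e * cform S x y) \<longleftrightarrow>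
  (\<forall>a\<in>V. \<forall>b\<in>V. S b a = e * S a b)"
proof
 assume *: "\<forall>x\<in>V \<times> V. \<forall>y\<in>V \<times> V. cform S y x = of_real e * cform S x y"
 have S0: "S 0 0 = 0"
  using linear_map_on_zero[OF bilinear_form_onD(1)[OF assms(1)] assms(2)] subspace_0[OF assms(2)] by auto
 show "\<forall>a\<in>V. \<forall>b\<in>V. S b a = e * S a b"
 proof (intro ballI)
  fix a b assume ab: "a \<in> V" "b \<in> V"
  have "cform S (b, 0) (a, 0) = of_real e * cform S (a, 0) (b, 0)"
   by (rule *[THEN bspec, THEN bspec]) (use ab subspace_0[OF assms(3)] in blast)+
  from arg_cong[OF this, of Re] show "S b a = e * S a b" by (simp add: cform_def S0)
 qed
next
 assume *: "\<forall>a\<in>V. \<forall>b\<in>V. S b a = e * S a b"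
 show "\<forall>x\<in>V \<times> V. \<forall>y\<in>V \<times> V. cform S y x = of_real e * cform S x y"
 proof (intro ballI)
  fix x y assume "x \<in> V \<times> V" "y \<in> V \<times> V"
  then have "fst x \<in> V" "snd x \<in> V" "fst y \<in> V" "snd y \<in> V" by auto
  then have "S (fst y) (fst x) = e * S (fst x) (fst y)" "S (snd y) (snd x) = e * S (snd x) (snd y)"
   "S (fst y) (snd x) = e * S (snd x) (fst y)" "S (snd y) (fst x) = e * S (fst x) (snd y)"
   using * by blast+
  then show "cform S y x = of_real e * cform S x y" by (simp add: cform_def complex_eq_iff algebra_simps)
 qed
qed

lemma (in endo_space) alpha_data_iff:
 "(H, M, S) \<in> alpha_data m \<longleftrightarrow> eigenvalues_in_circle H M \<and> bilinear_form_on H H S \<and> nondegenerate_on H H S \<and>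
   (\<forall>a\<in>H. \<forall>b\<in>H. S (M a) (M b) = S a b) \<and>
   (\<forall>a\<in>I. \<forall>b\<in>I. S b a = - ((- 1) powi (m + 1)) * S a b) \<and>
   (\<forall>a\<in>K. \<forall>b\<in>K. S b a = (- 1) powi (m + 1) * S a b)"
proof -
 have c: "(- 1 :: complex) powi m = of_real (- ((- 1) powi (m + 1)))" for m
  by (simp add: minus_one_powi)
 have c2: "(- 1 :: complex) powi m = of_real ((- 1) powi m)" for m by simp
 have *: "(H, M, S) \<in> alpha_data m \<longleftrightarrow> eigenvalues_in_circle H M \<and> bilinear_form_on H H S \<and> nondegenerate_on H H S \<and>
   (\<forall>a\<in>H. \<forall>b\<in>H. S (M a) (M b) = S a b) \<and>
   (\<forall>x\<in>I \<times> I. \<forall>y\<in>I \<times> I. cform S y x = of_real (- ((- 1) powi (m + 1))) * cform S x y) \<and>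
   (\<forall>x\<in>K \<times> K. \<forall>y\<in>K \<times> K. cform S y x = of_real ((- 1) powi (m + 1)) * cform S x y)"
  unfolding alpha_data_def mem_Collect_eq prod.case H_one_eq H_ne_one_eq c[of m] c2[of "m + 1"]
  using H M by blast
 show ?thesis
  unfolding * using cform_symmetric_iff[OF _ subH subI, of S] cform_symmetric_iff[OF _ subH subK, of S] by blast
qed

lemma dim_image_le_on:
 assumes "fin_dim_space V" "linear_map_on V f" shows "dim (f ` V) \<le> dim V"
proof -
 obtain B where B: "finite B" "span B = V" "card B = dim V" using fin_dim_space_basis[OF assms(1)] by auto
 have "f ` V \<subseteq> span (f ` B)"
 proof
  fix y assume "y \<in> f ` V"
  then obtain x where x: "x \<in> span B" "y = f x" using B(2) by blast
  from x(1) obtain u where u: "x = (\<Sum>v\<in>B. u v *\<^sub>R v)" using span_finite[OF B(1)] by auto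
  have "f x = (\<Sum>v\<in>B. f (u v *\<^sub>R v))" unfolding u
   by (rule linear_map_on_sum[OF assms(2)]) (use B in \<open>auto intro: span_base span_scale\<close>)
  also have "\<dots> = (\<Sum>v\<in>B. u v *\<^sub>R f v)"
   by (rule sum.cong) (use B span_base linear_map_on_scale[OF assms(2)] in auto)
  finally have "f x = (\<Sum>v\<in>B. u v *\<^sub>R f v)" .
  then show "y \<in> span (f ` B)" unfolding x(2) by (simp add: span_base span_scale span_sum)
 qed
 then have "dim (f ` V) \<le> card (f ` B)" using B by (intro dim_le_card) auto
 then show ?thesis using card_image_le[OF B(1), of f] B by simp
qed

lemma linear_iso_dim:
 assumes "fin_dim_space V" "linear_iso V W f" shows "fin_dim_space W" "dim W = dim V"
proof -
 note f = linear_isoD[OF assms(2)]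
 show W: "fin_dim_space W" using fin_dim_space_image[OF assms(1) f(1)] f(3) by simp
 have g: "linear_iso W V (inv_into V f)" using linear_iso_inv[OF assms(2)] fin_dim_space_subspace[OF assms(1)] by auto
 show "dim W = dim V"
  using dim_image_le_on[OF assms(1) f(1)] dim_image_le_on[OF W linear_isoD(1)[OF g]] f(3) linear_isoD(3)[OF g]
  by simp
qed

text \<open>All ingredients of \<open>\<nu>\<close> are defined in terms of \<open>M\<close>, so isomorphisms commute with \<open>\<nu>\<close>.\<close>

lemma nu_inv_natural:
 assumes "endo_space H M" "endo_space H' M'" and f: "linear_iso H H' f"
  and fM: "\<And>a. a \<in> H ==> f (M a) = M' (f a)" and b: "b \<in> H"
 shows "f (nu_inv H M b) = nu_inv H' M' (f b)"
proof -
 interpret A: endo_space H M by fact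
 interpret B: endo_space H' M' by fact
 note linf = linear_isoD[OF f]
 have dim: "dim H' = dim H" using linear_iso_dim[OF A.H f] by auto
 have fX: "f (A.X a) = B.X (f a)" if "a \<in> H" for a
  using linear_map_on_diff[OF linf(1) A.subH A.linM(4)[OF that] that] fM[OF that] by (simp add: A.X_def B.X_def)
 have XH: "(A.X ^^ n) a \<in> H" if "a \<in> H" for a n
  using linear_map_on_funpow(2)[OF A.linX A.invX] that by auto
 have fXn: "f ((A.X ^^ n) a) = (B.X ^^ n) (f a)" if "a \<in> H" for a n
  by (induction n) (use fX[OF XH[OF that]] in auto)
 obtain k i where ki: "k \<in> A.K" "i \<in> A.I" "b = k + i" using A.decomp[OF b] .
 have kH: "k \<in> H" "i \<in> H" using ki A.KH A.IH by auto
 have fk: "f k \<in> B.K"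
  using ki(1) fXn[OF kH(1), of "dim H"] linear_map_on_zero[OF linf(1) A.subH] linf(4) dim
  by (auto simp: fit_null_def)
 have fi: "f i \<in> B.I"
 proof -
  obtain c where "c \<in> H" "i = (A.X ^^ dim H) c" using ki(2) unfolding fit_range_def by blast
  then show ?thesis using fXn[of c "dim H"] linf(4) dim by (auto simp: fit_range_def)
 qed
 have fT: "f (A.T k) = B.T (f k)"
 proof -
  have "f (A.T k) = (\<Sum>n<dim H. f ((exp_quot_fps $ n) *\<^sub>R (A.X ^^ n) k))"
   unfolding A.T_def fps_act_def
   by (rule linear_map_on_sum[OF linf(1) A.subH]) (intro subspace_scale[OF A.subH] XH kH)
  also have "\<dots> = B.T (f k)"
   using linear_map_on_scale[OF linf(1) XH[OF kH(1)]] fXn[OF kH(1)]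
   by (simp add: B.T_def fps_act_def dim)
  finally show ?thesis .
 qed
 have "f (nu_inv H M b) = f (A.X i) - f (A.T k)"
  unfolding ki(3) A.nu_inv_add[OF ki(1,2)]
  using linear_map_on_diff[OF linf(1) A.subH] A.X_I[OF ki(2)] A.T_K[OF ki(1)] A.IH A.KH by blast
 also have "\<dots> = nu_inv H' M' (f k + f i)" unfolding B.nu_inv_add[OF fk fi] fX[OF kH(2)] fT ..
 also have "f k + f i = f b" using linear_map_on_add[OF linf(1) kH] ki(3) by simp
 finally show ?thesis .
qed

section \<open>From alpha to beta\<close>

lemma equiv_alpha_iso: "equiv (alpha_data m) (alpha_iso m)"
proof (rule equivI)
 show "alpha_iso m \<subseteq> alpha_data m \<times> alpha_data m" by (auto simp: alpha_iso_def)
 show "refl_on (alpha_data m) (alpha_iso m)"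
  unfolding refl_on_def alpha_iso_def using linear_iso_id by fastforce
 show "sym (alpha_iso m)"
 proof (rule symI)
  fix x y assume "(x, y) \<in> alpha_iso m"
  then obtain H M S H' M' S' f where xy: "x = (H, M, S)" "y = (H', M', S')" "x \<in> alpha_data m" "y \<in> alpha_data m"
   and f: "linear_iso H H' f" and fM: "\<forall>a\<in>H. f (M a) = M' (f a)" and fS: "\<forall>a\<in>H. \<forall>b\<in>H. S' (f a) (f b) = S a b"
   by (auto simp: alpha_iso_def)
  have sub: "subspace H" and M: "linear_iso H H M" using xy by (auto simp: alpha_data_def fin_dim_space_subspace)
  note g = linear_isoD[OF linear_iso_inv[OF f sub]] and F = linear_isoD[OF f]
  have inv: "f (inv_into H f b) = b" if "b \<in> H'" for b using that F by (auto simp: f_inv_into_f)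
  have "inv_into H f (M' b) = M (inv_into H f b)" if "b \<in> H'" for b
   by (rule inv_into_f_eq[OF F(2)]) (use fM g(4)[OF that] inv[OF that] linear_isoD(4)[OF M] in auto)
  moreover have "S (inv_into H f a) (inv_into H f b) = S' a b" if "a \<in> H'" "b \<in> H'" for a b
   using fS g(4) inv that by metis
  ultimately show "(y, x) \<in> alpha_iso m"
   using xy linear_iso_inv[OF f sub] unfolding alpha_iso_def by blast
 qed
 show "trans (alpha_iso m)"
 proof (rule transI)
  fix x y z assume "(x, y) \<in> alpha_iso m" "(y, z) \<in> alpha_iso m"
  then obtain H M S H' M' S' H'' M'' S'' f g where xyz: "x = (H, M, S)" "y = (H', M', S')" "z = (H'', M'', S'')"
   "x \<in> alpha_data m" "z \<in> alpha_data m"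
   and f: "linear_iso H H' f" "\<forall>a\<in>H. f (M a) = M' (f a)" "\<forall>a\<in>H. \<forall>b\<in>H. S' (f a) (f b) = S a b"
   and g: "linear_iso H' H'' g" "\<forall>a\<in>H'. g (M' a) = M'' (g a)" "\<forall>a\<in>H'. \<forall>b\<in>H'. S'' (g a) (g b) = S' a b"
   by (auto simp: alpha_iso_def)
  have "\<forall>a\<in>H. g (f (M a)) = M'' (g (f a))" "\<forall>a\<in>H. \<forall>b\<in>H. S'' (g (f a)) (g (f b)) = S a b"
   using f g linear_isoD(4)[OF f(1)] by auto
  then show "(x, z) \<in> alpha_iso m"
   using xyz linear_iso_comp[OF f(1) g(1)] unfolding alpha_iso_def by blast
 qed
qed

lemma equiv_beta_iso: "equiv beta_data beta_iso"
proof (rule equivI)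
 show "beta_iso \<subseteq> beta_data \<times> beta_data" by (auto simp: beta_iso_def)
 show "refl_on beta_data beta_iso"
  unfolding refl_on_def beta_iso_def using linear_iso_id by fastforce
 show "sym beta_iso"
 proof (rule symI)
  fix x y assume "(x, y) \<in> beta_iso"
  then obtain H L H' L' f where xy: "x = (H, L)" "y = (H', L')" "x \<in> beta_data" "y \<in> beta_data"
   and f: "linear_iso H H' f" and fL: "\<forall>a\<in>H. \<forall>b\<in>H. L' (f a) (f b) = L a b"
   by (auto simp: beta_iso_def)
  have sub: "subspace H" using xy by (auto simp: beta_data_def fin_dim_space_subspace)
  note g = linear_isoD[OF linear_iso_inv[OF f sub]] and F = linear_isoD[OF f]
  have inv: "f (inv_into H f b) = b" if "b \<in> H'" for b using that F by (auto simp: f_inv_into_f)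
  have "L (inv_into H f a) (inv_into H f b) = L' a b" if "a \<in> H'" "b \<in> H'" for a b
   using fL g(4) inv that by metis
  then show "(y, x) \<in> beta_iso"
   using xy linear_iso_inv[OF f sub] unfolding beta_iso_def by blast
 qed
 show "trans beta_iso"
 proof (rule transI)
  fix x y z assume "(x, y) \<in> beta_iso" "(y, z) \<in> beta_iso"
  then obtain H L H' L' H'' L'' f g where xyz: "x = (H, L)" "y = (H', L')" "z = (H'', L'')"
   "x \<in> beta_data" "z \<in> beta_data"
   and f: "linear_iso H H' f" "\<forall>a\<in>H. \<forall>b\<in>H. L' (f a) (f b) = L a b"
   and g: "linear_iso H' H'' g" "\<forall>a\<in>H'. \<forall>b\<in>H'. L'' (g a) (g b) = L' a b"
   by (auto simp: beta_iso_def)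
  have "\<forall>a\<in>H. \<forall>b\<in>H. L'' (g (f a)) (g (f b)) = L a b" using f g linear_isoD(4)[OF f(1)] by auto
  then show "(x, z) \<in> beta_iso"
   using xyz linear_iso_comp[OF f(1) g(1)] unfolding beta_iso_def by blast
 qed
qed

lemma alpha_data_endo_space: "(H, M, S) \<in> alpha_data m ==> endo_space H M"
 by (auto simp: alpha_data_def endo_space_def)

lemma beta_data_seifert_form: "(H, L) \<in> beta_data ==> seifert_form H L"
 by (auto simp: beta_data_def seifert_form_def)

lemma alpha_to_beta_data:
 assumes x: "(H, M, S) \<in> alpha_data m"
 shows "(H, L_nor H M S) \<in> beta_data"
  and "\<And>a. a \<in> H ==> Seifert_monodromy H (L_nor H M S) a = (- 1) powi (m + 1) *\<^sub>R M a"
proof -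
 interpret endo_space H M using x by (rule alpha_data_endo_space)
 let ?L = "L_nor H M S"
 let ?e = "(- 1) powi (m + 1) :: real"
 have S: "bilinear_form_on H H S" "nondegenerate_on H H S" "eigenvalues_in_circle H M"
  and inv: "\<And>a b. a \<in> H ==> b \<in> H ==> S (M a) (M b) = S a b"
  and sym: "\<And>a b. a \<in> I ==> b \<in> I ==> S b a = - ?e * S a b" "\<And>a b. a \<in> K ==> b \<in> K ==> S b a = ?e * S a b"
  using x unfolding alpha_data_iff by blast+
 note n = linear_isoD[OF nu_inv_iso]
 have lin1: "linear_map_on H (\<lambda>b. - S a (nu_inv H M b))" if "a \<in> H" for a
  using linear_map_on_comp[OF n(1) _ bilinear_form_onD(1)[OF S(1) that]] n(3) by (auto simp: linear_map_on_def)
 have lin2: "linear_map_on H (\<lambda>a. - S a (nu_inv H M b))" if "b \<in> H" for b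
  using bilinear_form_onD(2)[OF S(1) n(4)[OF that]] by (auto simp: linear_map_on_def)
 have bil: "bilinear_form_on H H ?L"
  using lin1 lin2 L_nor_eq[OF S(1)]
  by (simp add: bilinear_form_on_def linear_map_on_def subspace_add[OF subH] subspace_scale[OF subH])
 have nd: "nondegenerate_on H H ?L"
  unfolding nondegenerate_on_def
 proof (intro conjI ballI impI)
  fix a assume a: "a \<in> H" "\<forall>b\<in>H. ?L a b = 0"
  then have "\<forall>b\<in>H. S a (nu_inv H M b) = 0" using L_nor_eq[OF S(1)] by auto
  then have "\<forall>b\<in>H. S a b = 0" using nu_inv_surj by metis
  then show "a = 0" using S(2) a by (auto simp: nondegenerate_on_def)
 next
  fix b assume b: "b \<in> H" "\<forall>a\<in>H. ?L a b = 0"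
  then have "\<forall>a\<in>H. S a (nu_inv H M b) = 0" using L_nor_eq[OF S(1)] by auto
  then have "nu_inv H M b = 0" using S(2) n(4)[OF b(1)] by (auto simp: nondegenerate_on_def)
  then show "b = 0" using inj_on_linear_iff[OF n(1) subH] n(2) b(1) by blast
 qed
 interpret L: seifert_form H ?L using H bil nd by unfold_locales
 have e: "?e * ?e = 1" by (rule minus_one_powi)
 show mono: "Seifert_monodromy H ?L a = ?e *\<^sub>R M a" if a: "a \<in> H" for a
  by (rule L.monodromy_unique[OF a])
   (use subspace_scale[OF subH linM(4)[OF a]] L_nor_monodromy[OF S(1) inv sym e a] in auto)
 have "eigenvalues_in_circle H (Seifert_monodromy H ?L)"
  by (rule eigenvalues_in_circle_scale[OF S(3) mono e])
 then show "(H, ?L) \<in> beta_data" using H bil nd by (auto simp: beta_data_def)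
qed

text \<open>
 The inverse construction is \<open>S_form\<close>; injectivity on isomorphism classes holds because \<open>\<nu>\<close> is
 determined by \<open>M\<close>, and \<open>M\<close> is up to the sign \<open>(-1)\<^sup>m\<^sup>+\<^sup>1\<close> the monodromy of \<open>L\<close>.
\<close>

theorem alpha_beta_correspondence:
 "class_correspondence (alpha_data m :: 'v::real_vector alpha set) (alpha_iso m) beta_data beta_iso alpha_to_beta"
proof (rule class_correspondenceI[OF equiv_alpha_iso equiv_beta_iso])
 fix x :: "'v alpha" show "\<exists>y. alpha_to_beta x y" by (auto simp: alpha_to_beta_def split: prod.split)
next
 fix x :: "'v alpha" and y assume "x \<in> alpha_data m" "alpha_to_beta x y"
 then show "y \<in> beta_data" using alpha_to_beta_data(1) by (cases x) (auto simp: alpha_to_beta_def)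
next
 fix x x' :: "'v alpha" and y y'
 assume xx: "(x, x') \<in> alpha_iso m" and y: "alpha_to_beta x y" and y': "alpha_to_beta x' y'"
 obtain H M S H' M' S' f where x: "x = (H, M, S)" "x' = (H', M', S')" "(H, M, S) \<in> alpha_data m"
   "(H', M', S') \<in> alpha_data m"
  and f: "linear_iso H H' f" and fM: "\<And>a. a \<in> H ==> f (M a) = M' (f a)"
  and fS: "\<forall>a\<in>H. \<forall>b\<in>H. S' (f a) (f b) = S a b"
  using xx by (auto simp: alpha_iso_def)
 interpret A: endo_space H M using x(3) by (rule alpha_data_endo_space)
 interpret B: endo_space H' M' using x(4) by (rule alpha_data_endo_space)
 have S: "bilinear_form_on H H S" "bilinear_form_on H' H' S'" using x(3,4) by (auto simp: alpha_data_def)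
 have "L_nor H' M' S' (f a) (f b) = L_nor H M S a b" if ab: "a \<in> H" "b \<in> H" for a b
 proof -
  have fab: "f a \<in> H'" "f b \<in> H'" using linear_isoD(4)[OF f] ab by auto
  have "f (nu_inv H M b) = nu_inv H' M' (f b)"
   by (rule nu_inv_natural[OF A.endo_space_axioms B.endo_space_axioms f fM ab(2)])
  moreover have "S' (f a) (f (nu_inv H M b)) = S a (nu_inv H M b)"
   using fS ab linear_isoD(4)[OF A.nu_inv_iso] by blast
  ultimately show ?thesis
   unfolding A.L_nor_eq[OF S(1) ab] B.L_nor_eq[OF S(2) fab] by simp
 qed
 then show "(y, y') \<in> beta_iso"
  using y y' x f alpha_to_beta_data(1)[OF x(3)] alpha_to_beta_data(1)[OF x(4)]
  by (auto simp: alpha_to_beta_def beta_iso_def)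
next
 fix x x' :: "'v alpha" and y y'
 assume xin: "x \<in> alpha_data m" "x' \<in> alpha_data m" and y: "alpha_to_beta x y" "alpha_to_beta x' y'"
  and yy: "(y, y') \<in> beta_iso"
 obtain H M S H' M' S' where x: "x = (H, M, S)" "x' = (H', M', S')" by (metis prod_cases3)
 have xa: "(H, M, S) \<in> alpha_data m" "(H', M', S') \<in> alpha_data m" using xin x by auto
 obtain f where f: "linear_iso H H' f"
  and fL: "\<forall>a\<in>H. \<forall>b\<in>H. L_nor H' M' S' (f a) (f b) = L_nor H M S a b"
  using yy y x by (auto simp: alpha_to_beta_def beta_iso_def)
 interpret A: endo_space H M using xa(1) by (rule alpha_data_endo_space)
 interpret B: endo_space H' M' using xa(2) by (rule alpha_data_endo_space)
 interpret LA: seifert_form H "L_nor H M S" using alpha_to_beta_data(1)[OF xa(1)] by (rule beta_data_seifert_form)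
 interpret LB: seifert_form H' "L_nor H' M' S'" using alpha_to_beta_data(1)[OF xa(2)] by (rule beta_data_seifert_form)
 note F = linear_isoD[OF f]
 let ?e = "(- 1) powi (m + 1) :: real"
 have S: "bilinear_form_on H H S" "bilinear_form_on H' H' S'" using xa by (auto simp: alpha_data_def)
 have fM: "f (M a) = M' (f a)" if a: "a \<in> H" for a
 proof -
  have "Seifert_monodromy H' (L_nor H' M' S') (f a) = f (Seifert_monodromy H (L_nor H M S) a)"
  proof (rule LB.monodromy_unique)
   show "f a \<in> H'" "f (Seifert_monodromy H (L_nor H M S) a) \<in> H'"
    using F(4) a linear_isoD(4)[OF LA.monodromy(1)] by auto
   fix b assume "b \<in> H'"
   then obtain c where c: "c \<in> H" "b = f c" using F(3) by blast
   show "L_nor H' M' S' (f (Seifert_monodromy H (L_nor H M S) a)) b = L_nor H' M' S' b (f a)"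
    unfolding c(2) using fL c a LA.monodromy(2) linear_isoD(4)[OF LA.monodromy(1)] by simp
  qed
  then have "?e *\<^sub>R M' (f a) = f (?e *\<^sub>R M a)"
   using alpha_to_beta_data(2)[OF xa(1) a] alpha_to_beta_data(2)[OF xa(2) F(4)[OF a]] by simp
  then have "?e *\<^sub>R M' (f a) = ?e *\<^sub>R f (M a)"
   using linear_map_on_scale[OF F(1) A.linM(4)[OF a]] by simp
  then show ?thesis by simp
 qed
 have "S' (f a) (f b) = S a b" if ab: "a \<in> H" "b \<in> H" for a b
 proof -
  obtain c where c: "c \<in> H" "b = nu_inv H M c" using A.nu_inv_surj[OF ab(2)] .
  have n: "f (nu_inv H M c) = nu_inv H' M' (f c)"
   by (rule nu_inv_natural[OF A.endo_space_axioms B.endo_space_axioms f fM c(1)])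
  have "S' (f a) (f b) = - L_nor H' M' S' (f a) (f c)"
   unfolding c(2) n using B.L_nor_eq[OF S(2) F(4)[OF ab(1)] F(4)[OF c(1)]] by simp
  also have "\<dots> = - L_nor H M S a c" using fL ab c by simp
  also have "\<dots> = S a b" using A.L_nor_eq[OF S(1) ab(1) c(1)] c(2) by simp
  finally show ?thesis .
 qed
 then show "(x, x') \<in> alpha_iso m" using x xa f fM by (auto simp: alpha_iso_def)
next
 fix y :: "'v beta" assume yB: "y \<in> beta_data"
 obtain H L where y: "y = (H, L)" by (cases y)
 interpret L: seifert_form H L using yB y beta_data_seifert_form by auto
 let ?e = "(- 1) powi (m + 1) :: real"
 have e: "?e * ?e = 1" by (rule minus_one_powi)
 define M where "M a = ?e *\<^sub>R Seifert_monodromy H L a" for a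
 note mon = linear_isoD[OF L.monodromy(1)]
 have Mlin: "linear_map_on H M" using mon(1) by (auto simp: M_def linear_map_on_def scaleR_add_right)
 have MH: "M ` H \<subseteq> H" using mon(4) subspace_scale[OF L.subH] by (auto simp: M_def)
 have "inj_on M H" using mon(2) by (auto simp: M_def inj_on_def)
 then have "linear_iso H H M"
  using Mlin fin_dim_inj_imp_surj[OF L.H Mlin MH] by (auto simp: linear_iso_def bij_betw_def)
 then interpret endo_space H M using L.H by unfold_locales
 have mono: "L (M a) b = ?e * L b a" if "a \<in> H" "b \<in> H" for a b
  using that L.L_scale(2)[OF _ mon(4)] L.monodromy(2) by (simp add: M_def)
 have inv: "L (M a) (M b) = L a b" if "a \<in> H" "b \<in> H" for a b
 proof -
  have "L (M a) (M b) = ?e * L (M b) a" using mono that linM(4) by auto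
  also have "\<dots> = (?e * ?e) * L a b" using mono[OF that(2,1)] by (simp add: mult.assoc)
  finally show ?thesis using e by simp
 qed
 have "eigenvalues_in_circle H M"
  by (rule eigenvalues_in_circle_scale[of H "Seifert_monodromy H L" M ?e])
   (use yB y e in \<open>auto simp: M_def beta_data_def\<close>)
 then have xA: "(H, M, S_form L) \<in> alpha_data m"
  unfolding alpha_data_iff
  using S_form_bilinear[OF L.bil] S_form_nondegenerate[OF L.nondeg] S_form_invariant[of L, OF inv]
   S_form_symmetric[OF L.bil inv mono e] by blast
 have "L_nor H M (S_form L) a b = L a b" if "a \<in> H" "b \<in> H" for a b
  using L_nor_eq[OF S_form_bilinear[OF L.bil] that] S_form_nu_inv[OF that(2)] by simp
 then have "((H, L_nor H M (S_form L)), y) \<in> beta_iso"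
  using yB y alpha_to_beta_data(1)[OF xA] linear_iso_id[of H] by (force simp: beta_iso_def)
 then show "\<exists>x\<in>alpha_data m. \<exists>y'. alpha_to_beta x y' \<and> (y', y) \<in> beta_iso"
  using xA by (intro bexI[of _ "(H, M, S_form L)"]) (auto simp: alpha_to_beta_def)
qed

section \<open>Smooth functions on open subsets of the plane\<close>

lemma frechet_derivative_cong_open:
 assumes "open U" "z \<in> U" "\<And>w. w \<in> U ==> f w = g w"
 shows "frechet_derivative f (at z) = frechet_derivative g (at z)"
  and "f differentiable (at z) \<longleftrightarrow> g differentiable (at z)"
proof -
 have "(f has_derivative D) (at z) \<longleftrightarrow> (g has_derivative D) (at z)" for D
  using has_derivative_transform_within_open[of f D z UNIV U g]
   has_derivative_transform_within_open[of g D z UNIV U f] assms by auto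
 then show "frechet_derivative f (at z) = frechet_derivative g (at z)"
  "f differentiable (at z) \<longleftrightarrow> g differentiable (at z)"
  by (auto simp: frechet_derivative_def differentiable_def)
qed

lemma Ck_on_cong:
 assumes "open U" "\<And>w. w \<in> U ==> f w = g w" "Ck_on k U f" shows "Ck_on k U g"
 using assms(2,3)
proof (induction k arbitrary: f g)
 case 0
 then show ?case using continuous_on_cong[of U U f g] by simp
next
 case (Suc k)
 have "Ck_on k U (\<lambda>z. frechet_derivative g (at z) v)" for v
  by (rule Suc.IH[of "\<lambda>z. frechet_derivative f (at z) v"])
   (use Suc.prems frechet_derivative_cong_open(1)[OF assms(1), of _ f g] in auto)
 then show ?case using Suc.prems frechet_derivative_cong_open(2)[OF assms(1), of _ f g] by auto
qed

lemma Ck_on_subset: "Ck_on k U f ==> V \<subseteq> U ==> Ck_on k V f"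
 by (induction k arbitrary: f) (auto intro: continuous_on_subset)

lemma Ck_on_local:
 assumes "open U" "\<And>z. z \<in> U ==> \<exists>V. open V \<and> z \<in> V \<and> Ck_on k (U \<inter> V) f" shows "Ck_on k U f"
 using assms(2)
proof (induction k arbitrary: f)
 case 0
 have "isCont f z" if "z \<in> U" for z
 proof -
  obtain V where V: "open V" "z \<in> V" "Ck_on 0 (U \<inter> V) f" using 0[OF \<open>z \<in> U\<close>] by blast
  have "open (U \<inter> V)" using assms(1) V(1) by blast
  then show ?thesis using V that by (simp add: continuous_on_eq_continuous_at)
 qed
 then show ?case by (simp add: continuous_at_imp_continuous_on)
next
 case (Suc k)
 have "f differentiable (at z)" if "z \<in> U" for z using Suc.prems[OF that] that by auto
 moreover have "Ck_on k U (\<lambda>z. frechet_derivative f (at z) v)" for v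
 proof (rule Suc.IH)
  fix z assume "z \<in> U"
  from Suc.prems[OF this] obtain V where "open V" "z \<in> V" "Ck_on (Suc k) (U \<inter> V) f" by blast
  then show "\<exists>V. open V \<and> z \<in> V \<and> Ck_on k (U \<inter> V) (\<lambda>z. frechet_derivative f (at z) v)" by auto
 qed
 ultimately show ?case by simp
qed

lemma Ck_on_Suc_imp: "Ck_on (Suc k) U f ==> Ck_on k U f"
proof (induction k arbitrary: f)
 case 0
 then show ?case by (auto intro!: continuous_at_imp_continuous_on differentiable_imp_continuous_within)
next
 case (Suc k)
 then show ?case by (metis Ck_on.simps(2))
qed

lemma Ck_on_SucI:
 assumes "open U" "\<And>z. z \<in> U ==> (f has_derivative D z) (at z)" "\<And>v. Ck_on k U (\<lambda>z. D z v)"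
 shows "Ck_on (Suc k) U f"
proof -
 have "D z v = frechet_derivative f (at z) v" if "z \<in> U" for z v
  using frechet_derivative_at[OF assms(2)[OF that]] by simp
 then have "Ck_on k U (\<lambda>z. frechet_derivative f (at z) v)" for v
  by (intro Ck_on_cong[OF assms(1) _ assms(3)[of v]])
 then show ?thesis using assms(2) by (auto simp: differentiable_def)
qed

lemma Ck_on_SucD:
 assumes "Ck_on (Suc k) U f" "z \<in> U"
 shows "(f has_derivative frechet_derivative f (at z)) (at z)"
 using assms frechet_derivative_works by auto

lemma Ck_on_const: "open U ==> Ck_on k U (\<lambda>_. c)"
proof (induction k arbitrary: c)
 case (Suc k)
 show ?case by (rule Ck_on_SucI[where D = "\<lambda>_ _. 0"]) (use Suc in auto)
qed simp

lemma Ck_on_add: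
 assumes "open U" shows "Ck_on k U f ==> Ck_on k U g ==> Ck_on k U (\<lambda>z. f z + g z)"
proof (induction k arbitrary: f g)
 case (Suc k)
 show ?case
  by (rule Ck_on_SucI[OF assms has_derivative_add[OF Ck_on_SucD[OF Suc.prems(1)] Ck_on_SucD[OF Suc.prems(2)]]])
   (use Suc in auto)
qed (auto intro: continuous_intros)

lemma Ck_on_mult:
 assumes "open U" shows "Ck_on k U f ==> Ck_on k U g ==> Ck_on k U (\<lambda>z. f z * g z)"
proof (induction k arbitrary: f g)
 case (Suc k)
 have "Ck_on k U f" "Ck_on k U g" using Suc.prems Ck_on_Suc_imp by blast+
 then show ?case
  by (intro Ck_on_SucI[OF assms has_derivative_mult[OF Ck_on_SucD[OF Suc.prems(1)] Ck_on_SucD[OF Suc.prems(2)]]]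
    Ck_on_add[OF assms] Suc.IH) (use Suc.prems in auto)
qed (auto intro: continuous_intros)

lemma smooth_on_cong: "open U ==> (\<And>w. w \<in> U ==> f w = g w) ==> smooth_on U f ==> smooth_on U g"
 unfolding smooth_on_def by (intro allI) (rule Ck_on_cong[of U f g], auto)

lemma smooth_on_subset: "smooth_on U f ==> V \<subseteq> U ==> smooth_on V f"
 unfolding smooth_on_def by (meson Ck_on_subset)

lemma smooth_on_local:
 assumes "open U" "\<And>z. z \<in> U ==> \<exists>V. open V \<and> z \<in> V \<and> smooth_on (U \<inter> V) f" shows "smooth_on U f"
 unfolding smooth_on_def
proof (intro allI Ck_on_local[OF assms(1)])
 fix k z assume "z \<in> U"
 from assms(2)[OF this] obtain V where "open V" "z \<in> V" "smooth_on (U \<inter> V) f" by blast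
 then show "\<exists>V. open V \<and> z \<in> V \<and> Ck_on k (U \<inter> V) f" by (auto simp: smooth_on_def)
qed

lemma smooth_on_const: "open U ==> smooth_on U (\<lambda>_. c)"
 by (simp add: smooth_on_def Ck_on_const)

lemma smooth_on_add: "open U ==> smooth_on U f ==> smooth_on U g ==> smooth_on U (\<lambda>z. f z + g z)"
 by (simp add: smooth_on_def Ck_on_add)

lemma smooth_on_mult: "open U ==> smooth_on U f ==> smooth_on U g ==> smooth_on U (\<lambda>z. f z * g z)"
 by (simp add: smooth_on_def Ck_on_mult)

lemma smooth_on_sum:
 "open U ==> (\<And>i. i \<in> I ==> smooth_on U (f i)) ==> smooth_on U (\<lambda>z. \<Sum>i\<in>I. f i z)"
 by (induction I rule: infinite_finite_induct) (auto intro: smooth_on_const smooth_on_add)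

lemma smooth_on_minus: "open U ==> smooth_on U f ==> smooth_on U (\<lambda>z. - f z)"
 using smooth_on_mult[of U "\<lambda>_. -1" f] smooth_on_const[of U "-1"] by simp

lemma smooth_on_has_derivative:
 "smooth_on U f ==> z \<in> U ==> (f has_derivative frechet_derivative f (at z)) (at z)"
 by (rule Ck_on_SucD[of 0 U]) (simp_all add: smooth_on_def del: Ck_on.simps)

lemma smooth_on_frechet_derivative: "smooth_on U f ==> smooth_on U (\<lambda>z. frechet_derivative f (at z) v)"
 unfolding smooth_on_def by (metis Ck_on.simps(2))

lemma smooth_on_continuous: "smooth_on U f ==> continuous_on U f"
 unfolding smooth_on_def by (metis Ck_on.simps(1))

text \<open>
 Both mixed second derivatives are values of the same second difference quotient, at points that
 tend to \<open>z\<close>.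
\<close>

lemma second_difference:
 assumes f: "smooth_on U f" and s: "s > 0"
  and U: "\<And>x y. 0 \<le> x ==> x \<le> s ==> 0 \<le> y ==> y \<le> s ==> z + x *\<^sub>R u + y *\<^sub>R v \<in> U"
 shows "\<exists>x y. 0 \<le> x \<and> x \<le> s \<and> 0 \<le> y \<and> y \<le> s \<and>
  f (z + s *\<^sub>R u + s *\<^sub>R v) - f (z + s *\<^sub>R u) - f (z + s *\<^sub>R v) + f z =
  s * s * frechet_derivative (\<lambda>w. frechet_derivative f (at w) u) (at (z + x *\<^sub>R u + y *\<^sub>R v)) v"
proof -
 have lin: "frechet_derivative g (at w) (c *\<^sub>R a) = c * frechet_derivative g (at w) a"
  if "smooth_on U g" "w \<in> U" for g w c a
  using linear_scale[OF has_derivative_linear[OF smooth_on_has_derivative[OF that]]] by simp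
 have chain: "((\<lambda>t. g (p + t *\<^sub>R a)) has_real_derivative frechet_derivative g (at (p + x *\<^sub>R a)) a) (at x)"
  if g: "smooth_on U g" and p: "p + x *\<^sub>R a \<in> U" for g p a x
 proof -
  have "((\<lambda>t. g (p + t *\<^sub>R a)) has_derivative (\<lambda>h. frechet_derivative g (at (p + x *\<^sub>R a)) (h *\<^sub>R a))) (at x)"
   by (rule has_derivative_compose[where f = "\<lambda>t. p + t *\<^sub>R a" and g = g, OF _ smooth_on_has_derivative[OF g p]])
    (auto intro!: derivative_eq_intros)
  then show ?thesis unfolding lin[OF g p] has_field_derivative_def
   by (rule back_subst[of "\<lambda>D. ((\<lambda>t. g (p + t *\<^sub>R a)) has_derivative D) (at x)"]) (rule ext, rule mult.commute)
 qed
 define Du where "Du w = frechet_derivative f (at w) u" for w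
 have Du: "smooth_on U Du" unfolding Du_def by (rule smooth_on_frechet_derivative[OF f])
 define \<phi> where "\<phi> t = f ((z + s *\<^sub>R v) + t *\<^sub>R u) - f (z + t *\<^sub>R u)" for t
 have \<phi>: "(\<phi> has_real_derivative (Du ((z + s *\<^sub>R v) + t *\<^sub>R u) - Du (z + t *\<^sub>R u))) (at t)"
  if "0 \<le> t" "t \<le> s" for t
  unfolding \<phi>_def Du_def
  by (intro DERIV_diff chain[OF f]) (use U[of t s] U[of t 0] that s in \<open>auto simp: add_ac\<close>)
 obtain x where x: "0 < x" "x < s" "\<phi> s - \<phi> 0 = (s - 0) * (Du ((z + s *\<^sub>R v) + x *\<^sub>R u) - Du (z + x *\<^sub>R u))"
  using MVT2[OF s, of \<phi> "\<lambda>t. Du ((z + s *\<^sub>R v) + t *\<^sub>R u) - Du (z + t *\<^sub>R u)"] \<phi> by auto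
 have D2: "((\<lambda>t. Du ((z + x *\<^sub>R u) + t *\<^sub>R v)) has_real_derivative
   frechet_derivative Du (at (z + x *\<^sub>R u + t *\<^sub>R v)) v) (at t)" if "0 \<le> t" "t \<le> s" for t
  by (rule chain[OF Du]) (use U[of x t] that x in auto)
 obtain y where y: "0 < y" "y < s" "Du ((z + x *\<^sub>R u) + s *\<^sub>R v) - Du ((z + x *\<^sub>R u) + 0 *\<^sub>R v) =
   (s - 0) * frechet_derivative Du (at (z + x *\<^sub>R u + y *\<^sub>R v)) v"
  using MVT2[OF s, of "\<lambda>t. Du ((z + x *\<^sub>R u) + t *\<^sub>R v)"
    "\<lambda>t. frechet_derivative Du (at (z + x *\<^sub>R u + t *\<^sub>R v)) v"] D2 by auto
 have "\<phi> s - \<phi> 0 = s * s * frechet_derivative Du (at (z + x *\<^sub>R u + y *\<^sub>R v)) v"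
  using x(3) y(3) by (simp add: add_ac)
 moreover have "\<phi> s - \<phi> 0 = f (z + s *\<^sub>R u + s *\<^sub>R v) - f (z + s *\<^sub>R u) - f (z + s *\<^sub>R v) + f z"
  by (simp add: \<phi>_def add_ac)
 ultimately show ?thesis
  using x y unfolding Du_def[abs_def] by (intro exI[of _ x] exI[of _ y]) auto
qed

lemma smooth_on_symmetric_second_derivative:
 assumes U: "open U" and f: "smooth_on U f" and z: "z \<in> U"
 shows "frechet_derivative (\<lambda>w. frechet_derivative f (at w) u) (at z) v =
  frechet_derivative (\<lambda>w. frechet_derivative f (at w) v) (at z) u"
proof (rule ccontr)
 define g where "g u v w = frechet_derivative (\<lambda>w. frechet_derivative f (at w) u) (at w) v" for u v w
 assume "\<not> ?thesis"
 then have ne: "g u v z \<noteq> g v u z" by (simp add: g_def)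
 have cu: "isCont (g u v) z" "isCont (g v u) z"
  unfolding g_def using smooth_on_continuous[OF smooth_on_frechet_derivative[OF smooth_on_frechet_derivative[OF f]]]
   U z by (auto simp: continuous_on_eq_continuous_at)
 define e where "e = \<bar>g u v z - g v u z\<bar> / 2"
 have e: "e > 0" using ne by (simp add: e_def)
 obtain d1 where d1: "d1 > 0" "\<And>w. dist w z < d1 ==> dist (g u v w) (g u v z) < e"
  using cu(1) e unfolding continuous_at_eps_delta by meson
 obtain d2 where d2: "d2 > 0" "\<And>w. dist w z < d2 ==> dist (g v u w) (g v u z) < e"
  using cu(2) e unfolding continuous_at_eps_delta by meson
 obtain d3 where d3: "d3 > 0" "ball z d3 \<subseteq> U" using U z open_contains_ball by blast
 define d where "d = min d1 (min d2 d3)"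
 have d: "d > 0" using d1 d2 d3 by (simp add: d_def)
 define s where "s = d / (2 * (norm u + norm v + 1))"
 have pos: "norm u + norm v + 1 > 0" by (simp add: add_nonneg_pos)
 have s: "s > 0" using d pos by (simp add: s_def)
 have near: "dist (z + x *\<^sub>R a + y *\<^sub>R b) z < d"
  if "0 \<le> x" "x \<le> s" "0 \<le> y" "y \<le> s" "norm a + norm b = norm u + norm v" for x y a b
 proof -
  have "dist (z + x *\<^sub>R a + y *\<^sub>R b) z \<le> x * norm a + y * norm b"
   using norm_triangle_ineq[of "x *\<^sub>R a" "y *\<^sub>R b"] that by (simp add: dist_norm add_ac)
  also have "\<dots> \<le> s * norm a + s * norm b" by (intro add_mono mult_right_mono that) auto
  also have "\<dots> = s * (norm u + norm v)" using that(5) by (simp flip: distrib_left)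
  also have "\<dots> < s * (2 * (norm u + norm v + 1))"
   by (intro mult_strict_left_mono s) (smt (verit) norm_ge_zero)
  also have "\<dots> = d" unfolding s_def using pos by simp
  finally show ?thesis .
 qed
 have UI: "z + x *\<^sub>R a + y *\<^sub>R b \<in> U"
  if "0 \<le> x" "x \<le> s" "0 \<le> y" "y \<le> s" "norm a + norm b = norm u + norm v" for x y a b
  using near[OF that] d3 by (auto simp: d_def dist_commute mem_ball subset_iff)
 obtain x y where xy: "0 \<le> x" "x \<le> s" "0 \<le> y" "y \<le> s" and 1:
  "f (z + s *\<^sub>R u + s *\<^sub>R v) - f (z + s *\<^sub>R u) - f (z + s *\<^sub>R v) + f z =
   s * s * g u v (z + x *\<^sub>R u + y *\<^sub>R v)"
  using second_difference[OF f s, of z u v] UI unfolding g_def by auto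
 obtain x' y' where xy': "0 \<le> x'" "x' \<le> s" "0 \<le> y'" "y' \<le> s" and 2:
  "f (z + s *\<^sub>R v + s *\<^sub>R u) - f (z + s *\<^sub>R v) - f (z + s *\<^sub>R u) + f z =
   s * s * g v u (z + x' *\<^sub>R v + y' *\<^sub>R u)"
  using second_difference[OF f s, of z v u] UI[of _ _ v u] unfolding g_def by (auto simp: add.commute)
 have "s * s * g u v (z + x *\<^sub>R u + y *\<^sub>R v) = s * s * g v u (z + x' *\<^sub>R v + y' *\<^sub>R u)"
 proof -
  have eq: "z + s *\<^sub>R v + s *\<^sub>R u = z + s *\<^sub>R u + s *\<^sub>R v" by (simp add: add_ac)
  show ?thesis unfolding 1[symmetric] 2[symmetric] eq by simp
 qed
 then have "g u v (z + x *\<^sub>R u + y *\<^sub>R v) = g v u (z + x' *\<^sub>R v + y' *\<^sub>R u)" using s by simp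
 moreover have "dist (g u v (z + x *\<^sub>R u + y *\<^sub>R v)) (g u v z) < e"
  by (rule d1(2)) (use near[OF xy, of u v] in \<open>simp add: d_def\<close>)
 moreover have "dist (g v u (z + x' *\<^sub>R v + y' *\<^sub>R u)) (g v u z) < e"
  by (rule d2(2)) (use near[OF xy', of v u] in \<open>simp add: d_def\<close>)
 ultimately have "dist (g u v z) (g v u z) < 2 * e"
  by (smt (verit) dist_commute dist_triangle)
 then show False by (simp add: e_def dist_real_def)
qed

section \<open>Linear differential equations depending on a parameter\<close>

lemma series_has_real_derivative:
 fixes f :: "nat \<Rightarrow> real \<Rightarrow> real"
 assumes S: "convex S" and f: "\<And>n x. x \<in> S ==> (f n has_real_derivative f' n x) (at x within S)"
  and bd: "\<And>n x. x \<in> S ==> \<bar>f' n x\<bar> \<le> B n" "summable B"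
  and sm: "\<And>x. x \<in> S ==> summable (\<lambda>n. f n x)" and x: "x \<in> S"
 shows "((\<lambda>x. \<Sum>n. f n x) has_real_derivative (\<Sum>n. f' n x)) (at x within S)"
proof -
 have "uniform_limit S (\<lambda>n x. \<Sum>i<n. f' i x) (\<lambda>x. \<Sum>i. f' i x) sequentially"
  by (rule Weierstrass_m_test[OF _ bd(2)]) (use bd(1) in auto)
 from has_field_derivative_series[OF S f this x sm[OF x]]
 obtain g where g: "\<And>x. x \<in> S ==> (\<lambda>n. f n x) sums g x"
   "\<And>x. x \<in> S ==> (g has_real_derivative (\<Sum>i. f' i x)) (at x within S)" by blast
 have "(\<Sum>n. f n y) = g y" if "y \<in> S" for y using sums_unique[OF g(1)[OF that]] by simp
 then show ?thesis using has_field_derivative_transform_within[OF g(2)[OF x] zero_less_one x] by metis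
qed

locale rectangle =
 fixes a a' c c' :: real
 assumes le: "a \<le> a'" "c \<le> c'"
begin

definition J :: "(real \<Rightarrow> real \<Rightarrow> real) \<Rightarrow> real \<Rightarrow> real \<Rightarrow> real" where
 "J f x y = integral {c..y} (f x)"

abbreviation "cont f \<equiv> continuous_on ({a..a'} \<times> {c..c'}) (\<lambda>(x, y). f x y :: real)"

lemma cont_x: assumes "cont f" "x \<in> {a..a'}" shows "continuous_on {c..c'} (f x)"
proof -
 have "continuous_on {c..c'} (\<lambda>y. (\<lambda>(x, y). f x y) (x, y))"
  by (rule continuous_on_compose2[OF assms(1)]) (use assms(2) in \<open>auto intro!: continuous_intros\<close>)
 then show ?thesis by simp
qed

lemma cont_bound: assumes "cont f" shows "\<exists>K\<ge>0. \<forall>x\<in>{a..a'}. \<forall>y\<in>{c..c'}. \<bar>f x y\<bar> \<le> K"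
proof -
 have "bounded ((\<lambda>(x, y). f x y) ` ({a..a'} \<times> {c..c'}))"
  by (intro compact_imp_bounded compact_continuous_image assms compact_Times compact_Icc)
 then obtain K where K: "\<And>p. p \<in> (\<lambda>(x, y). f x y) ` ({a..a'} \<times> {c..c'}) ==> norm p \<le> K"
  unfolding bounded_iff by blast
 have "\<forall>x\<in>{a..a'}. \<forall>y\<in>{c..c'}. \<bar>f x y\<bar> \<le> max K 0"
  using K by (fastforce simp: le_max_iff_disj)
 then show ?thesis by (intro exI[of _ "max K 0"]) auto
qed

lemma J_bound:
 assumes f: "cont f" and K: "\<And>x y. x \<in> {a..a'} ==> y \<in> {c..c'} ==> \<bar>f x y\<bar> \<le> K"
  and x: "x \<in> {a..a'}" and y: "y \<in> {c..c'}"
 shows "\<bar>J f x y\<bar> \<le> K * (c' - c)"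
proof -
 have K0: "K \<ge> 0" using K[OF x y] by linarith
 have "norm (integral {c..y} (f x)) \<le> K * (y - c)"
  by (rule integral_bound) (use x y K continuous_on_subset[OF cont_x[OF f x]] in auto)
 also have "\<dots> \<le> K * (c' - c)" using y K0 by (intro mult_left_mono) auto
 finally show ?thesis by (simp add: J_def)
qed

lemma J_deriv_y:
 assumes "cont f" "x \<in> {a..a'}" "y \<in> {c..c'}"
 shows "(J f x has_real_derivative f x y) (at y within {c..c'})"
 unfolding J_def[abs_def] by (rule integral_has_real_derivative[OF cont_x[OF assms(1,2)] assms(3)])

lemma J_start: "J f x c = 0" by (simp add: J_def)

lemma J_deriv_x:
 assumes f: "cont f" and f': "cont f'"
  and d: "\<And>x y. x \<in> {a..a'} ==> y \<in> {c..c'} ==> ((\<lambda>x. f x y) has_real_derivative f' x y) (at x within {a..a'})"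
  and x: "x \<in> {a..a'}" and y: "y \<in> {c..c'}"
 shows "((\<lambda>x. J f x y) has_real_derivative J f' x y) (at x within {a..a'})"
proof -
 have "((\<lambda>x. integral (cbox c y) (f x)) has_real_derivative integral (cbox c y) (f' x)) (at x within {a..a'})"
 proof (rule leibniz_rule_field_derivative)
  show "f x integrable_on cbox c y" if "x \<in> {a..a'}" for x
   using integrable_continuous_real[OF continuous_on_subset[OF cont_x[OF f that]]] y by auto
  show "continuous_on ({a..a'} \<times> cbox c y) (\<lambda>(x, t). f' x t)"
   by (rule continuous_on_subset[OF f']) (use y in auto)
 qed (use d x y in auto)
 then show ?thesis by (simp add: J_def)
qed

lemma J_cont: assumes f: "cont f" shows "cont (J f)"
proof -
 obtain K where K: "K \<ge> 0" "\<And>x y. x \<in> {a..a'} ==> y \<in> {c..c'} ==> \<bar>f x y\<bar> \<le> K"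
  using cont_bound[OF f] by auto
 have lip: "\<bar>J f x y - J f x y0\<bar> \<le> K * \<bar>y - y0\<bar>" if "x \<in> {a..a'}" "y \<in> {c..c'}" "y0 \<in> {c..c'}" for x y y0
  using field_differentiable_bound[of "{c..c'}" "J f x" "f x" K y y0] J_deriv_y[OF f that(1)] K(2)[OF that(1)] that
  by auto
 have cx: "continuous_on {a..a'} (\<lambda>x. J f x y)" if y: "y \<in> {c..c'}" for y
 proof -
  have "continuous_on {a..a'} (\<lambda>x. integral (cbox c y) (f x))"
   by (rule integral_continuous_on_param) (rule continuous_on_subset[OF f], use y in auto)
  then show ?thesis by (simp add: J_def)
 qed
 show ?thesis
  unfolding continuous_on_iff
 proof (intro ballI allI impI)
  fix p :: "real \<times> real" and e :: real assume p: "p \<in> {a..a'} \<times> {c..c'}" and e: "e > 0"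
  obtain x0 y0 where p0: "p = (x0, y0)" "x0 \<in> {a..a'}" "y0 \<in> {c..c'}" using p by auto
  obtain d where d: "d > 0" "\<And>x. x \<in> {a..a'} ==> dist x x0 < d ==> dist (J f x y0) (J f x0 y0) < e / 2"
   using cx[OF p0(3)] p0(2) e unfolding continuous_on_iff by (meson half_gt_zero)
  define d' where "d' = min d (e / (2 * (K + 1)))"
  have d': "d' > 0" using d e K by (simp add: d'_def)
  have "dist (J f x y) (J f x0 y0) < e" if q: "x \<in> {a..a'}" "y \<in> {c..c'}" "dist (x, y) (x0, y0) < d'" for x y
  proof -
   have "dist x x0 < d'" "\<bar>y - y0\<bar> < d'"
    using q(3) dist_fst_le[of "(x, y)" "(x0, y0)"] dist_snd_le[of "(x, y)" "(x0, y0)"] by (auto simp: dist_real_def)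
   then have 1: "dist x x0 < d" "\<bar>y - y0\<bar> < e / (2 * (K + 1))" by (auto simp: d'_def)
   have "\<bar>y - y0\<bar> * (2 * (K + 1)) < e" using 1(2) K by (simp add: pos_less_divide_eq)
   then have "(K + 1) * \<bar>y - y0\<bar> < e / 2" by (simp add: algebra_simps)
   moreover have "K * \<bar>y - y0\<bar> \<le> (K + 1) * \<bar>y - y0\<bar>" by (intro mult_right_mono) auto
   ultimately have "\<bar>J f x y - J f x y0\<bar> < e / 2" using lip[OF q(1,2) p0(3)] by linarith
   then show ?thesis using d(2)[OF q(1) 1(1)] unfolding dist_real_def by linarith
  qed
  then show "\<exists>d>0. \<forall>q\<in>{a..a'} \<times> {c..c'}. dist q p < d -->
    dist (case q of (x, y) \<Rightarrow> J f x y) (case p of (x, y) \<Rightarrow> J f x y) < e"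
   using d' p0(1) by (intro exI[of _ d']) auto
 qed
qed

lemma cont_series:
 assumes f: "\<And>k. cont (f k)" and bd: "\<And>k x y. x \<in> {a..a'} ==> y \<in> {c..c'} ==> \<bar>f k x y\<bar> \<le> B k" "summable B"
 shows "cont (\<lambda>x y. \<Sum>k. f k x y)"
proof -
 have "uniform_limit ({a..a'} \<times> {c..c'}) (\<lambda>n p. \<Sum>k<n. f k (fst p) (snd p)) (\<lambda>p. \<Sum>k. f k (fst p) (snd p)) sequentially"
  by (rule Weierstrass_m_test[OF _ bd(2)]) (use bd(1) in auto)
 then have "continuous_on ({a..a'} \<times> {c..c'}) (\<lambda>p. \<Sum>k. f k (fst p) (snd p))"
  by (rule uniform_limit_theorem[rotated])
   (use f in \<open>auto intro!: always_eventually continuous_on_sum simp: case_prod_beta'\<close>)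
 then show ?thesis by (simp add: case_prod_beta')
qed

lemma cont_sum_mult:
 assumes "\<And>j. j < n ==> cont (f j)" "\<And>j. j < n ==> cont (g j)"
 shows "cont (\<lambda>x y. \<Sum>j<n. f j x y * g j x y)"
 using assms unfolding case_prod_beta' by (intro continuous_on_sum continuous_on_mult) auto

text \<open>
 The solution is the sum of the iterated integrals \<open>\<phi> k\<close>. The bound on the height of the rectangle
 makes their sizes, and those of their derivatives in the parameter, decrease geometrically.
\<close>

lemma parameter_ode:
 fixes b b' :: "nat \<Rightarrow> nat \<Rightarrow> real \<Rightarrow> real \<Rightarrow> real" and g g' :: "nat \<Rightarrow> real \<Rightarrow> real"
 assumes b: "\<And>i j. i < n ==> j < n ==> cont (b i j)" and b': "\<And>i j. i < n ==> j < n ==> cont (b' i j)"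
  and db: "\<And>i j x y. i < n ==> j < n ==> x \<in> {a..a'} ==> y \<in> {c..c'} ==>
   ((\<lambda>x. b i j x y) has_real_derivative b' i j x y) (at x within {a..a'})"
  and bK: "\<And>i j x y. i < n ==> j < n ==> x \<in> {a..a'} ==> y \<in> {c..c'} ==> \<bar>b i j x y\<bar> \<le> K \<and> \<bar>b' i j x y\<bar> \<le> K"
  and g: "\<And>i. i < n ==> continuous_on {a..a'} (g i)" and g': "\<And>i. i < n ==> continuous_on {a..a'} (g' i)"
  and dg: "\<And>i x. i < n ==> x \<in> {a..a'} ==> (g i has_real_derivative g' i x) (at x within {a..a'})"
  and small: "4 * (n * K) * (c' - c) \<le> 1"
 obtains \<Phi> \<Psi> :: "nat \<Rightarrow> real \<Rightarrow> real \<Rightarrow> real" where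
  "\<And>i. i < n ==> cont (\<Phi> i)" "\<And>i. i < n ==> cont (\<Psi> i)"
  "\<And>i x. i < n ==> x \<in> {a..a'} ==> \<Phi> i x c = g i x" "\<And>i x. i < n ==> x \<in> {a..a'} ==> \<Psi> i x c = g' i x"
  "\<And>i x y. i < n ==> x \<in> {a..a'} ==> y \<in> {c..c'} ==>
   (\<Phi> i x has_real_derivative (\<Sum>j<n. b i j x y * \<Phi> j x y)) (at y within {c..c'})"
  "\<And>i x y. i < n ==> x \<in> {a..a'} ==> y \<in> {c..c'} ==>
   ((\<lambda>x. \<Phi> i x y) has_real_derivative \<Psi> i x y) (at x within {a..a'})"
  "\<And>i x y. i < n ==> x \<in> {a..a'} ==> y \<in> {c..c'} ==>
   (\<Psi> i x has_real_derivative (\<Sum>j<n. b' i j x y * \<Phi> j x y) + (\<Sum>j<n. b i j x y * \<Psi> j x y)) (at y within {c..c'})"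
proof -
 define it where "it f = (\<lambda>i. J (\<lambda>x y. \<Sum>j<n. b i j x y * f j x y))" for f :: "nat \<Rightarrow> real \<Rightarrow> real \<Rightarrow> real"
 define \<phi> where "\<phi> = rec_nat (\<lambda>i x y. g i x) (\<lambda>_. it)"
 have \<phi>0: "\<phi> 0 = (\<lambda>i x y. g i x)" and \<phi>S: "\<phi> (Suc k) i = J (\<lambda>x y. \<Sum>j<n. b i j x y * \<phi> k j x y)" for k i
  by (simp_all add: \<phi>_def it_def)
 define \<xi> where "\<xi> = rec_nat (\<lambda>i x y. g' i x)
  (\<lambda>k f i. J (\<lambda>x y. (\<Sum>j<n. b' i j x y * \<phi> k j x y) + (\<Sum>j<n. b i j x y * f j x y)))"
 have \<xi>0: "\<xi> 0 = (\<lambda>i x y. g' i x)" and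
  \<xi>S: "\<xi> (Suc k) i = J (\<lambda>x y. (\<Sum>j<n. b' i j x y * \<phi> k j x y) + (\<Sum>j<n. b i j x y * \<xi> k j x y))" for k i
  by (simp_all add: \<xi>_def)
 have g_cont: "cont (\<lambda>x y. g i x)" "cont (\<lambda>x y. g' i x)" if "i < n" for i
  unfolding case_prod_beta'
  by (rule continuous_on_compose2[OF g[OF that]], auto intro!: continuous_intros)
   (rule continuous_on_compose2[OF g'[OF that]], auto intro!: continuous_intros)
 have \<phi>c: "cont (\<phi> k i)" if "i < n" for k i
  using that
 proof (induction k arbitrary: i)
  case 0 then show ?case using g_cont by (simp add: \<phi>0)
 next
  case (Suc k) then show ?case unfolding \<phi>S by (intro J_cont cont_sum_mult b)
 qed
 have cont_add: "cont (\<lambda>x y. u x y + v x y)" if "cont u" "cont v" for u v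
  using that unfolding case_prod_beta' by (rule continuous_on_add)
 have \<xi>c: "cont (\<xi> k i)" if "i < n" for k i
  using that
 proof (induction k arbitrary: i)
  case 0 then show ?case using g_cont by (simp add: \<xi>0)
 next
  case (Suc k) then show ?case unfolding \<xi>S by (intro J_cont cont_add cont_sum_mult b b' \<phi>c)
 qed
 have "\<exists>Ci\<ge>0. \<forall>x\<in>{a..a'}. \<bar>g i x\<bar> \<le> Ci \<and> \<bar>g' i x\<bar> \<le> Ci" if i: "i < n" for i
 proof -
  obtain K1 K2 where "\<forall>x\<in>{a..a'}. \<forall>y\<in>{c..c'}. \<bar>g i x\<bar> \<le> K1" "\<forall>x\<in>{a..a'}. \<forall>y\<in>{c..c'}. \<bar>g' i x\<bar> \<le> K2" "0 \<le> K1"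
   using cont_bound[OF g_cont(1)[OF i]] cont_bound[OF g_cont(2)[OF i]] by blast
  then have "\<forall>x\<in>{a..a'}. \<bar>g i x\<bar> \<le> max K1 K2 \<and> \<bar>g' i x\<bar> \<le> max K1 K2" using le by fastforce
  then show ?thesis using \<open>0 \<le> K1\<close> by (intro exI[of _ "max K1 K2"]) auto
 qed
 then obtain Ci where Ci: "\<And>i. i < n ==> Ci i \<ge> 0 \<and> (\<forall>x\<in>{a..a'}. \<bar>g i x\<bar> \<le> Ci i \<and> \<bar>g' i x\<bar> \<le> Ci i)" by metis
 define C where "C = (\<Sum>i<n. Ci i)"
 have C: "\<bar>g i x\<bar> \<le> C" "\<bar>g' i x\<bar> \<le> C" if "i < n" "x \<in> {a..a'}" for i x
 proof -
  have "Ci i \<le> C" unfolding C_def by (rule member_le_sum) (use that Ci in auto)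
  then show "\<bar>g i x\<bar> \<le> C" "\<bar>g' i x\<bar> \<le> C" using Ci that by force+
 qed
 have C0: "C \<ge> 0" unfolding C_def by (rule sum_nonneg) (use Ci in auto)
 have sumbd: "\<bar>\<Sum>j<n. p j * q j\<bar> \<le> n * K * r" if "\<And>j. j < n ==> \<bar>p j\<bar> \<le> K" "\<And>j. j < n ==> \<bar>q j\<bar> \<le> r"
  for p q :: "nat \<Rightarrow> real" and r
 proof -
  have "\<bar>\<Sum>j<n. p j * q j\<bar> \<le> (\<Sum>j<n. \<bar>p j * q j\<bar>)" by (rule sum_abs)
  also have "\<dots> \<le> (\<Sum>j<n. K * r)"
  proof (rule sum_mono)
   fix j assume "j \<in> {..<n}"
   then have "\<bar>p j\<bar> \<le> K" "\<bar>q j\<bar> \<le> r" using that by auto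
   then show "\<bar>p j * q j\<bar> \<le> K * r" unfolding abs_mult by (intro mult_mono) auto
  qed
  finally show ?thesis by (simp add: mult.assoc)
 qed
 have bd: "\<bar>\<phi> k i x y\<bar> \<le> C * (1 / 2) ^ k \<and> \<bar>\<xi> k i x y\<bar> \<le> C * (1 / 2) ^ k"
  if "i < n" "x \<in> {a..a'}" "y \<in> {c..c'}" for k i x y
  using that
 proof (induction k arbitrary: i x y)
  case 0 then show ?case using C by (simp add: \<phi>0 \<xi>0)
 next
  case (Suc k)
  let ?r = "C * (1 / 2) ^ k"
  have r0: "?r \<ge> 0" using C0 by simp
  have s1: "\<bar>\<Sum>j<n. b i j x y * \<phi> k j x y\<bar> \<le> n * K * ?r" "\<bar>\<Sum>j<n. b' i j x y * \<phi> k j x y\<bar> \<le> n * K * ?r"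
   "\<bar>\<Sum>j<n. b i j x y * \<xi> k j x y\<bar> \<le> n * K * ?r" if "x \<in> {a..a'}" "y \<in> {c..c'}" for x y
   using Suc.IH Suc.prems bK that by (auto intro!: sumbd)
  have s2: "\<bar>(\<Sum>j<n. b' i j x y * \<phi> k j x y) + (\<Sum>j<n. b i j x y * \<xi> k j x y)\<bar> \<le> 2 * (n * K * ?r)"
   if "x \<in> {a..a'}" "y \<in> {c..c'}" for x y
   using s1(2)[OF that] s1(3)[OF that] by linarith
  have "4 * (n * K) * (c' - c) * ?r \<le> 1 * ?r" by (rule mult_right_mono[OF small r0])
  then have sm: "2 * (n * K * ?r) * (c' - c) \<le> C * (1 / 2) ^ Suc k" by (simp add: algebra_simps)
  have "\<bar>\<phi> (Suc k) i x y\<bar> \<le> n * K * ?r * (c' - c)"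
   unfolding \<phi>S by (rule J_bound[OF _ s1(1)]) (use Suc.prems b \<phi>c in \<open>auto intro!: cont_sum_mult\<close>)
  moreover have "0 \<le> n * K * ?r * (c' - c)" using calculation by linarith
  moreover have "\<bar>\<xi> (Suc k) i x y\<bar> \<le> 2 * (n * K * ?r) * (c' - c)"
   unfolding \<xi>S by (rule J_bound[OF _ s2]) (use Suc.prems b b' \<phi>c \<xi>c in \<open>auto intro!: cont_add cont_sum_mult\<close>)
  ultimately show ?case using sm by linarith
 qed
 have sB: "summable (\<lambda>k. C * (1 / 2) ^ k)" by (intro summable_mult summable_geometric) auto
 have dx: "((\<lambda>x. \<phi> k i x y) has_real_derivative \<xi> k i x y) (at x within {a..a'})"
  if "i < n" "x \<in> {a..a'}" "y \<in> {c..c'}" for k i x y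
  using that
 proof (induction k arbitrary: i x y)
  case 0 then show ?case using dg by (simp add: \<phi>0 \<xi>0)
 next
  case (Suc k)
  have "((\<lambda>x. \<Sum>j<n. b i j x y * \<phi> k j x y) has_real_derivative
    (\<Sum>j<n. b' i j x y * \<phi> k j x y) + (\<Sum>j<n. b i j x y * \<xi> k j x y)) (at x within {a..a'})"
   if "x \<in> {a..a'}" "y \<in> {c..c'}" for x y
   unfolding sum.distrib[symmetric]
   by (rule DERIV_sum, rule DERIV_cong, rule DERIV_mult)
    (use that Suc.prems db Suc.IH in \<open>auto simp: mult.commute\<close>)
  then show ?case
   unfolding \<phi>S \<xi>S using Suc.prems b b' \<phi>c \<xi>c
   by (intro J_deriv_x cont_add cont_sum_mult) auto
 qed
 define \<Phi> where "\<Phi> i x y = (\<Sum>k. \<phi> k i x y)" for i x y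
 define \<Psi> where "\<Psi> i x y = (\<Sum>k. \<xi> k i x y)" for i x y
 have smb: "summable (\<lambda>k. \<phi> k i x y)" "summable (\<lambda>k. \<xi> k i x y)" if "i < n" "x \<in> {a..a'}" "y \<in> {c..c'}" for i x y
  by (rule summable_comparison_test'[OF sB, of 0], use bd[OF that] in simp)+
 have tail: "summable (\<lambda>k. if k = 0 then 0 else M * (1 / 2) ^ (k - 1) :: real)" for M
 proof -
  have "summable (\<lambda>k. M * (1 / 2 :: real) ^ k)" by (intro summable_mult summable_geometric) auto
  then show ?thesis by (subst summable_Suc_iff[symmetric]) simp
 qed
 show thesis
 proof
  show "cont (\<Phi> i)" if "i < n" for i
   unfolding \<Phi>_def by (rule cont_series[OF \<phi>c[OF that] _ sB]) (use bd that in auto)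
  show "cont (\<Psi> i)" if "i < n" for i
   unfolding \<Psi>_def by (rule cont_series[OF \<xi>c[OF that] _ sB]) (use bd that in auto)
  show "\<Phi> i x c = g i x" if "i < n" "x \<in> {a..a'}" for i x
  proof -
   have "\<phi> k i x c = 0" if "k \<notin> {0}" for k using that by (cases k) (simp_all add: \<phi>S J_start)
   then have "(\<lambda>k. \<phi> k i x c) sums (\<phi> 0 i x c)"
    using sums_finite[of "{0}" "\<lambda>k. \<phi> k i x c"] by simp
   then show ?thesis by (simp add: \<Phi>_def sums_iff \<phi>0)
  qed
  show "\<Psi> i x c = g' i x" if "i < n" "x \<in> {a..a'}" for i x
  proof -
   have "\<xi> k i x c = 0" if "k \<notin> {0}" for k using that by (cases k) (simp_all add: \<xi>S J_start)
   then have "(\<lambda>k. \<xi> k i x c) sums (\<xi> 0 i x c)"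
    using sums_finite[of "{0}" "\<lambda>k. \<xi> k i x c"] by simp
   then show ?thesis by (simp add: \<Psi>_def sums_iff \<xi>0)
  qed
  show "((\<lambda>x. \<Phi> i x y) has_real_derivative \<Psi> i x y) (at x within {a..a'})"
   if "i < n" "x \<in> {a..a'}" "y \<in> {c..c'}" for i x y
   unfolding \<Phi>_def \<Psi>_def
   by (rule series_has_real_derivative[OF _ dx _ sB]) (use that bd smb in auto)
  have S\<phi>: "(\<lambda>k. \<Sum>j<n. p j * \<phi> k j x y) sums (\<Sum>j<n. p j * \<Phi> j x y)"
   if "x \<in> {a..a'}" "y \<in> {c..c'}" for p x y
   unfolding \<Phi>_def using smb that by (intro sums_sum sums_mult summable_sums) auto
  have S\<xi>: "(\<lambda>k. \<Sum>j<n. p j * \<xi> k j x y) sums (\<Sum>j<n. p j * \<Psi> j x y)"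
   if "x \<in> {a..a'}" "y \<in> {c..c'}" for p x y
   unfolding \<Psi>_def using smb that by (intro sums_sum sums_mult summable_sums) auto
  have bd1: "\<bar>\<Sum>j<n. b i j x y * \<phi> k j x y\<bar> \<le> n * K * (C * (1 / 2) ^ k)"
   "\<bar>\<Sum>j<n. b' i j x y * \<phi> k j x y\<bar> \<le> n * K * (C * (1 / 2) ^ k)"
   "\<bar>\<Sum>j<n. b i j x y * \<xi> k j x y\<bar> \<le> n * K * (C * (1 / 2) ^ k)"
   if "i < n" "x \<in> {a..a'}" "y \<in> {c..c'}" for i x y k
   using bd bK that by (auto intro!: sumbd)
  show "(\<Phi> i x has_real_derivative (\<Sum>j<n. b i j x y * \<Phi> j x y)) (at y within {c..c'})"
   if i: "i < n" and x: "x \<in> {a..a'}" and y: "y \<in> {c..c'}" for i x y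
  proof -
   define d where "d k y = (if k = 0 then 0 else \<Sum>j<n. b i j x y * \<phi> (k - 1) j x y)" for k y
   have "(\<phi> k i x has_real_derivative d k y) (at y within {c..c'})" if "y \<in> {c..c'}" for k y
   proof (cases k)
    case 0 then show ?thesis by (simp add: \<phi>0 d_def)
   next
    case (Suc l)
    have "(J (\<lambda>x y. \<Sum>j<n. b i j x y * \<phi> l j x y) x has_real_derivative (\<Sum>j<n. b i j x y * \<phi> l j x y)) (at y within {c..c'})"
     by (rule J_deriv_y) (use i x that b \<phi>c in \<open>auto intro!: cont_sum_mult\<close>)
    then show ?thesis by (simp add: Suc \<phi>S d_def)
   qed
   moreover have "\<bar>d k y\<bar> \<le> (if k = 0 then 0 else (n * K * C) * (1 / 2) ^ (k - 1))" if "y \<in> {c..c'}" for k y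
    using bd1(1)[OF i x that] by (auto simp: d_def mult.assoc)
   ultimately have "((\<lambda>y. \<Sum>k. \<phi> k i x y) has_real_derivative (\<Sum>k. d k y)) (at y within {c..c'})"
    by (intro series_has_real_derivative[OF _ _ _ tail[of "n * K * C"]]) (use i x y smb in auto)
   moreover have "(\<Sum>k. d k y) = (\<Sum>j<n. b i j x y * \<Phi> j x y)"
   proof -
    have "(\<lambda>k. d (Suc k) y) sums (\<Sum>j<n. b i j x y * \<Phi> j x y)"
     using S\<phi>[OF x y, of "\<lambda>j. b i j x y"] by (simp add: d_def)
    then have "(\<lambda>k. d k y) sums ((\<Sum>j<n. b i j x y * \<Phi> j x y) + d 0 y)"
     using sums_Suc_iff[of "\<lambda>k. d k y"] by blast
    then show ?thesis by (simp add: sums_iff d_def)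
   qed
   ultimately show ?thesis by (simp add: \<Phi>_def[abs_def])
  qed
  show "(\<Psi> i x has_real_derivative (\<Sum>j<n. b' i j x y * \<Phi> j x y) + (\<Sum>j<n. b i j x y * \<Psi> j x y)) (at y within {c..c'})"
   if i: "i < n" and x: "x \<in> {a..a'}" and y: "y \<in> {c..c'}" for i x y
  proof -
   define d where "d k y = (if k = 0 then 0 else (\<Sum>j<n. b' i j x y * \<phi> (k - 1) j x y) + (\<Sum>j<n. b i j x y * \<xi> (k - 1) j x y))" for k y
   have "(\<xi> k i x has_real_derivative d k y) (at y within {c..c'})" if "y \<in> {c..c'}" for k y
   proof (cases k)
    case 0 then show ?thesis by (simp add: \<xi>0 d_def)
   next
    case (Suc l)
    have "(J (\<lambda>x y. (\<Sum>j<n. b' i j x y * \<phi> l j x y) + (\<Sum>j<n. b i j x y * \<xi> l j x y)) x has_real_derivative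
      (\<Sum>j<n. b' i j x y * \<phi> l j x y) + (\<Sum>j<n. b i j x y * \<xi> l j x y)) (at y within {c..c'})"
     by (rule J_deriv_y) (use i x that b b' \<phi>c \<xi>c in \<open>auto intro!: cont_add cont_sum_mult\<close>)
    then show ?thesis by (simp add: Suc \<xi>S d_def)
   qed
   moreover have "\<bar>d k y\<bar> \<le> (if k = 0 then 0 else (2 * (n * K * C)) * (1 / 2) ^ (k - 1))" if "y \<in> {c..c'}" for k y
    using bd1(2)[OF i x that, of "k - 1"] bd1(3)[OF i x that, of "k - 1"]
    by (auto simp: d_def mult.assoc intro!: order_trans[OF abs_triangle_ineq])
   ultimately have "((\<lambda>y. \<Sum>k. \<xi> k i x y) has_real_derivative (\<Sum>k. d k y)) (at y within {c..c'})"
    by (intro series_has_real_derivative[OF _ _ _ tail[of "2 * (n * K * C)"]]) (use i x y smb in auto)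
   moreover have "(\<Sum>k. d k y) = (\<Sum>j<n. b' i j x y * \<Phi> j x y) + (\<Sum>j<n. b i j x y * \<Psi> j x y)"
   proof -
    have "(\<lambda>k. d (Suc k) y) sums ((\<Sum>j<n. b' i j x y * \<Phi> j x y) + (\<Sum>j<n. b i j x y * \<Psi> j x y))"
     using sums_add[OF S\<phi>[OF x y, of "\<lambda>j. b' i j x y"] S\<xi>[OF x y, of "\<lambda>j. b i j x y"]] by (simp add: d_def)
    then have "(\<lambda>k. d k y) sums ((\<Sum>j<n. b' i j x y * \<Phi> j x y) + (\<Sum>j<n. b i j x y * \<Psi> j x y) + d 0 y)"
     using sums_Suc_iff[of "\<lambda>k. d k y"] by blast
    then show ?thesis by (simp add: sums_iff d_def)
   qed
   ultimately show ?thesis by (simp add: \<Psi>_def[abs_def])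
  qed
 qed
qed

text \<open>Uniqueness for the homogeneous system, on an interval that is short in the same sense.\<close>

lemma ode_zero:
 fixes W :: "nat \<Rightarrow> real \<Rightarrow> real"
 assumes K: "\<And>i j y. i < n ==> j < n ==> y \<in> {c..c'} ==> \<bar>b i j y\<bar> \<le> K"
  and W: "\<And>i y. i < n ==> y \<in> {c..c'} ==> (W i has_real_derivative (\<Sum>j<n. b i j y * W j y)) (at y within {c..c'})"
  and W0: "\<And>i. i < n ==> W i c = 0" and small: "4 * (n * K) * (c' - c) \<le> 1"
  and i: "i < n" and y: "y \<in> {c..c'}"
 shows "W i y = 0"
proof -
 have "continuous_on {c..c'} (W i)" if "i < n" for i
  by (rule DERIV_continuous_on) (rule W[OF that])
 then have "bounded (W i ` {c..c'})" if "i < n" for i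
  using that by (intro compact_imp_bounded compact_continuous_image compact_Icc)
 then have "\<exists>m. \<forall>y\<in>{c..c'}. \<bar>W i y\<bar> \<le> m" if "i < n" for i
  using that by (simp add: bounded_iff)
 then obtain m where m: "\<And>i y. i < n ==> y \<in> {c..c'} ==> \<bar>W i y\<bar> \<le> m i" by metis
 define r where "r = (\<Sum>i<n. m i)"
 have r: "\<bar>W i y\<bar> \<le> r" if "i < n" "y \<in> {c..c'}" for i y
 proof -
  have "m i \<le> r" unfolding r_def
   by (rule member_le_sum) (use that m y in \<open>auto intro: order_trans[OF abs_ge_zero]\<close>)
  then show ?thesis using m[OF that] by simp
 qed
 have r0: "r \<ge> 0" using r[OF i y] by linarith
 have K0: "K \<ge> 0" using K[OF i i y] by linarith
 have "\<bar>W i y\<bar> \<le> r * (1 / 2) ^ k" if "i < n" "y \<in> {c..c'}" for i y k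
  using that
 proof (induction k arbitrary: i y)
  case 0 then show ?case using r by simp
 next
  case (Suc k)
  have bdd: "\<bar>\<Sum>j<n. b i j y * W j y\<bar> \<le> n * K * (r * (1 / 2) ^ k)" if y: "y \<in> {c..c'}" for y
  proof -
   have "\<bar>\<Sum>j<n. b i j y * W j y\<bar> \<le> (\<Sum>j<n. \<bar>b i j y * W j y\<bar>)" by (rule sum_abs)
   also have "\<dots> \<le> (\<Sum>j<n. K * (r * (1 / 2) ^ k))"
    unfolding abs_mult by (intro sum_mono mult_mono) (use K Suc y K0 in auto)
   finally show ?thesis by (simp add: mult.assoc)
  qed
  have "norm (W i y - W i c) \<le> n * K * (r * (1 / 2) ^ k) * norm (y - c)"
   by (rule field_differentiable_bound[of "{c..c'}" _ "\<lambda>y. \<Sum>j<n. b i j y * W j y"])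
    (use W Suc.prems bdd le in auto)
  also have "\<dots> \<le> n * K * (r * (1 / 2) ^ k) * (c' - c)"
   using Suc.prems K0 r0 by (intro mult_left_mono) auto
  also have "4 * (n * K) * (c' - c) * (r * (1 / 2) ^ k) \<le> 1 * (r * (1 / 2) ^ k)"
   by (rule mult_right_mono[OF small]) (use r0 in auto)
  then have "n * K * (r * (1 / 2) ^ k) * (c' - c) \<le> r * (1 / 2) ^ Suc k"
  proof -
   assume "4 * (n * K) * (c' - c) * (r * (1 / 2) ^ k) \<le> 1 * (r * (1 / 2) ^ k)"
   then have "4 * (n * K * (r * (1 / 2) ^ k) * (c' - c)) \<le> r * (1 / 2) ^ k" by (simp add: algebra_simps)
   moreover have "0 \<le> r * (1 / 2) ^ k" using r0 by simp
   ultimately show ?thesis by simp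
  qed
  finally show ?case using W0 Suc.prems by simp
 qed
 moreover have "(\<lambda>k. r * (1 / 2) ^ k) \<longlonglongrightarrow> r * 0"
  by (intro tendsto_mult tendsto_const LIMSEQ_realpow_zero) auto
 ultimately have "\<bar>W i y\<bar> \<le> 0" using i y by (intro LIMSEQ_le_const) auto
 then show ?thesis by simp
qed

end

section \<open>Flat sections of an integrable linear system in the plane\<close>

lemma continuous_on_Complex_comp:
 assumes "continuous_on R h" "\<And>x y. x \<in> {a..a'} ==> y \<in> {c..c'} ==> Complex x y \<in> R"
 shows "continuous_on ({a..a'} \<times> {c..c'}) (\<lambda>(x, y). h (Complex x y))"
 unfolding case_prod_beta'
 by (rule continuous_on_compose2[OF assms(1)]) (use assms(2) in \<open>auto simp: Complex_eq intro!: continuous_intros\<close>)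

lemma Complex_partial_derivatives:
 assumes "smooth_on U h" "Complex x y \<in> U"
 shows "((\<lambda>x. h (Complex x y)) has_real_derivative frechet_derivative h (at (Complex x y)) 1) (at x within S)"
  and "((\<lambda>y. h (Complex x y)) has_real_derivative frechet_derivative h (at (Complex x y)) \<i>) (at y within S)"
proof -
 let ?D = "frechet_derivative h (at (Complex x y))"
 note D = smooth_on_has_derivative[OF assms]
 have lin: "?D (t *\<^sub>R v) = t * ?D v" for t v using linear_scale[OF has_derivative_linear[OF D]] by simp
 have "((\<lambda>x. h (Complex x y)) has_derivative (\<lambda>t. ?D (of_real t))) (at x within S)"
  by (rule has_derivative_compose[where f = "\<lambda>x. Complex x y" and g = h, OF _ D])
   (auto simp: Complex_eq intro!: derivative_eq_intros)
 moreover have "?D (of_real t) = ?D 1 * t" for t using lin[of t 1] by (simp add: scaleR_conv_of_real)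
 ultimately show "((\<lambda>x. h (Complex x y)) has_real_derivative ?D 1) (at x within S)"
  unfolding has_field_derivative_def by simp
 have "((\<lambda>y. h (Complex x y)) has_derivative (\<lambda>t. ?D (\<i> * of_real t))) (at y within S)"
  by (rule has_derivative_compose[where f = "\<lambda>y. Complex x y" and g = h, OF _ D])
   (auto simp: Complex_eq intro!: derivative_eq_intros)
 moreover have "?D (\<i> * of_real t) = ?D \<i> * t" for t using lin[of t \<i>] by (simp add: scaleR_conv_of_real mult.commute)
 ultimately show "((\<lambda>y. h (Complex x y)) has_real_derivative ?D \<i>) (at y within S)"
  unfolding has_field_derivative_def by simp
qed

context rectangle
begin

definition "R = cbox (Complex a c) (Complex a' c')"
definition "Rint = box (Complex a c) (Complex a' c')"

lemma in_R: "z \<in> R \<longleftrightarrow> Re z \<in> {a..a'} \<and> Im z \<in> {c..c'}"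
 by (auto simp: R_def in_cbox_complex_iff)

lemma in_Rint: "z \<in> Rint \<longleftrightarrow> Re z \<in> {a<..<a'} \<and> Im z \<in> {c<..<c'}"
 by (auto simp: Rint_def in_box_complex_iff)

text \<open>
 Solve along the lower edge, and then along all vertical lines. The defect \<open>W\<close> of the horizontal
 equation vanishes on the lower edge and, by integrability, solves the vertical equation, so it is
 zero.
\<close>

lemma integrable_system_solution:
 fixes Bx By :: "nat \<Rightarrow> nat \<Rightarrow> complex \<Rightarrow> real" and g :: "nat \<Rightarrow> real"
 assumes U: "open U" "R \<subseteq> U"
  and sB: "\<And>i j. i < n ==> j < n ==> smooth_on U (Bx i j)" "\<And>i j. i < n ==> j < n ==> smooth_on U (By i j)"
  and bK: "\<And>i j z. i < n ==> j < n ==> z \<in> R ==> \<bar>Bx i j z\<bar> \<le> K \<and> \<bar>By i j z\<bar> \<le> K \<and>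
   \<bar>frechet_derivative (By i j) (at z) 1\<bar> \<le> K" and K0: "K \<ge> 0"
  and small: "4 * (n * K) * (a' - a) \<le> 1" "4 * (n * K) * (c' - c) \<le> 1"
  and integrable: "\<And>i j z. i < n ==> j < n ==> z \<in> U ==>
   frechet_derivative (By i j) (at z) 1 + (\<Sum>k<n. By i k z * Bx k j z) =
   frechet_derivative (Bx i j) (at z) \<i> + (\<Sum>k<n. Bx i k z * By k j z)"
 shows "\<exists>\<phi>. \<forall>i<n. \<phi> i (Complex a c) = g i \<and> continuous_on R (\<phi> i) \<and> smooth_on Rint (\<phi> i) \<and>
  (\<forall>z\<in>Rint. (\<phi> i has_derivative (\<lambda>v. Re v * (\<Sum>j<n. Bx i j z * \<phi> j z) + Im v * (\<Sum>j<n. By i j z * \<phi> j z))) (at z))"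
proof -
 have RI: "Complex x y \<in> R" if "x \<in> {a..a'}" "y \<in> {c..c'}" for x y using that by (simp add: in_R)
 have UI: "Complex x y \<in> U" if "x \<in> {a..a'}" "y \<in> {c..c'}" for x y using RI[OF that] U by auto
 have contU: "cont (\<lambda>x y. h (Complex x y))" if "smooth_on U h" for h
  by (rule continuous_on_Complex_comp[OF smooth_on_continuous[OF that] UI])
 interpret E: rectangle 0 1 a a' by unfold_locales (use le in auto)
 have cE: "E.cont (\<lambda>x t. Bx i j (Complex t c))" if "i < n" "j < n" for i j
  unfolding case_prod_beta'
  by (rule continuous_on_compose2[OF smooth_on_continuous[OF sB(1)[OF that]]])
   (use UI le in \<open>auto simp: Complex_eq intro!: continuous_intros\<close>)
 obtain \<Phi>1 where \<Phi>1: "\<And>i. i < n ==> E.cont (\<Phi>1 i)" "\<And>i x. i < n ==> x \<in> {0..1} ==> \<Phi>1 i x a = g i"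
  "\<And>i x y. i < n ==> x \<in> {0..1} ==> y \<in> {a..a'} ==>
   (\<Phi>1 i x has_real_derivative (\<Sum>j<n. Bx i j (Complex y c) * \<Phi>1 j x y)) (at y within {a..a'})"
 proof (rule E.parameter_ode[of n "\<lambda>i j x t. Bx i j (Complex t c)" "\<lambda>_ _ _ _. 0" K "\<lambda>i x. g i" "\<lambda>_ _. 0"])
  show "\<bar>Bx i j (Complex y c)\<bar> \<le> K \<and> \<bar>0\<bar> \<le> K" if "i < n" "j < n" "x \<in> {0..1}" "y \<in> {a..a'}" for i j x y
   using bK[OF that(1,2) RI[of y c]] that K0 le by auto
 qed (use cE small(1) in \<open>auto intro!: continuous_intros derivative_eq_intros simp: case_prod_beta'\<close>)
 define G where "G i t = \<Phi>1 i 0 t" for i t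
 have dG: "(G i has_real_derivative (\<Sum>j<n. Bx i j (Complex t c) * G j t)) (at t within {a..a'})"
  if "i < n" "t \<in> {a..a'}" for i t
  using \<Phi>1(3)[OF that(1) _ that(2), of 0] by (simp add: G_def[abs_def])
 have cG: "continuous_on {a..a'} (G i)" if "i < n" for i
  by (rule DERIV_continuous_on) (rule dG[OF that])
 have cBe: "continuous_on {a..a'} (\<lambda>t. Bx i j (Complex t c))" if "i < n" "j < n" for i j
  by (rule continuous_on_compose2[OF smooth_on_continuous[OF sB(1)[OF that]]])
   (use UI le in \<open>auto simp: Complex_eq intro!: continuous_intros\<close>)
 obtain \<Phi> \<Psi> where c\<Phi>: "\<And>i. i < n ==> cont (\<Phi> i)" and c\<Psi>: "\<And>i. i < n ==> cont (\<Psi> i)"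
  and \<Phi>0: "\<And>i x. i < n ==> x \<in> {a..a'} ==> \<Phi> i x c = G i x"
  and \<Psi>0: "\<And>i x. i < n ==> x \<in> {a..a'} ==> \<Psi> i x c = (\<Sum>j<n. Bx i j (Complex x c) * G j x)"
  and dy: "\<And>i x y. i < n ==> x \<in> {a..a'} ==> y \<in> {c..c'} ==>
   (\<Phi> i x has_real_derivative (\<Sum>j<n. By i j (Complex x y) * \<Phi> j x y)) (at y within {c..c'})"
  and dx: "\<And>i x y. i < n ==> x \<in> {a..a'} ==> y \<in> {c..c'} ==>
   ((\<lambda>x. \<Phi> i x y) has_real_derivative \<Psi> i x y) (at x within {a..a'})"
  and dxy: "\<And>i x y. i < n ==> x \<in> {a..a'} ==> y \<in> {c..c'} ==>
   (\<Psi> i x has_real_derivative (\<Sum>j<n. frechet_derivative (By i j) (at (Complex x y)) 1 * \<Phi> j x y) +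
    (\<Sum>j<n. By i j (Complex x y) * \<Psi> j x y)) (at y within {c..c'})"
 proof (rule parameter_ode[of n "\<lambda>i j x y. By i j (Complex x y)"
    "\<lambda>i j x y. frechet_derivative (By i j) (at (Complex x y)) 1" K G "\<lambda>i t. \<Sum>j<n. Bx i j (Complex t c) * G j t"])
  show "((\<lambda>x. By i j (Complex x y)) has_real_derivative frechet_derivative (By i j) (at (Complex x y)) 1) (at x within {a..a'})"
   if "i < n" "j < n" "x \<in> {a..a'}" "y \<in> {c..c'}" for i j x y
   by (rule Complex_partial_derivatives(1)[OF sB(2)[OF that(1,2)] UI[OF that(3,4)]])
  show "cont (\<lambda>x y. By i j (Complex x y))" if "i < n" "j < n" for i j by (rule contU[OF sB(2)[OF that]])
  show "cont (\<lambda>x y. frechet_derivative (By i j) (at (Complex x y)) 1)" if "i < n" "j < n" for i j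
   by (rule contU[OF smooth_on_frechet_derivative[OF sB(2)[OF that]]])
  show "\<bar>By i j (Complex x y)\<bar> \<le> K \<and> \<bar>frechet_derivative (By i j) (at (Complex x y)) 1\<bar> \<le> K"
   if "i < n" "j < n" "x \<in> {a..a'}" "y \<in> {c..c'}" for i j x y
   using bK[OF that(1,2) RI[OF that(3,4)]] by auto
  show "continuous_on {a..a'} (\<lambda>t. \<Sum>j<n. Bx i j (Complex t c) * G j t)" if "i < n" for i
   by (intro continuous_on_sum continuous_on_mult cBe cG) (use that in auto)
 qed (use cG dG small(2) in auto)
 have W: "\<Psi> i x y = (\<Sum>j<n. Bx i j (Complex x y) * \<Phi> j x y)"
  if i: "i < n" and x: "x \<in> {a..a'}" and y: "y \<in> {c..c'}" for i x y
 proof -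
  define W where "W i y = \<Psi> i x y - (\<Sum>j<n. Bx i j (Complex x y) * \<Phi> j x y)" for i y
  have "W i y = 0"
  proof (rule ode_zero[of n "\<lambda>i j y. By i j (Complex x y)" K W])
   show "\<bar>By i j (Complex x y)\<bar> \<le> K" if "i < n" "j < n" "y \<in> {c..c'}" for i j y
    using bK[OF that(1,2) RI[OF x that(3)]] by auto
   show "W i c = 0" if "i < n" for i using \<Psi>0[OF that x] \<Phi>0[OF _ x] by (simp add: W_def)
   show "(W i has_real_derivative (\<Sum>j<n. By i j (Complex x y) * W j y)) (at y within {c..c'})"
    if i: "i < n" and y: "y \<in> {c..c'}" for i y
   proof -
    let ?z = "Complex x y"
    have "((\<lambda>y. Bx i j (Complex x y) * \<Phi> j x y) has_real_derivative
      (frechet_derivative (Bx i j) (at ?z) \<i> * \<Phi> j x y + Bx i j ?z * (\<Sum>k<n. By j k ?z * \<Phi> k x y))) (at y within {c..c'})"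
     if j: "j < n" for j
     by (rule DERIV_cong, rule DERIV_mult, rule Complex_partial_derivatives(2)[OF sB(1)[OF i j] UI[OF x y]],
       rule dy[OF j x y]) (simp add: mult.commute)
    then have "(W i has_real_derivative
      ((\<Sum>j<n. frechet_derivative (By i j) (at ?z) 1 * \<Phi> j x y) + (\<Sum>j<n. By i j ?z * \<Psi> j x y)) -
      (\<Sum>j<n. frechet_derivative (Bx i j) (at ?z) \<i> * \<Phi> j x y + Bx i j ?z * (\<Sum>k<n. By j k ?z * \<Phi> k x y)))
      (at y within {c..c'})"
     unfolding W_def by (intro DERIV_diff dxy[OF i x y] DERIV_sum) auto
    moreover have "((\<Sum>j<n. frechet_derivative (By i j) (at ?z) 1 * \<Phi> j x y) + (\<Sum>j<n. By i j ?z * \<Psi> j x y)) -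
      (\<Sum>j<n. frechet_derivative (Bx i j) (at ?z) \<i> * \<Phi> j x y + Bx i j ?z * (\<Sum>k<n. By j k ?z * \<Phi> k x y))
      = (\<Sum>j<n. By i j ?z * W j y)"
    proof -
     have swap: "(\<Sum>j<n. p j * (\<Sum>k<n. q j k * \<Phi> k x y)) = (\<Sum>j<n. (\<Sum>k<n. p k * q k j) * \<Phi> j x y)"
      for p :: "nat \<Rightarrow> real" and q
      unfolding sum_distrib_left sum_distrib_right by (subst sum.swap) (simp add: mult_ac)
     have "(\<Sum>j<n. By i j ?z * W j y) = (\<Sum>j<n. By i j ?z * \<Psi> j x y) -
       (\<Sum>j<n. (\<Sum>k<n. By i k ?z * Bx k j ?z) * \<Phi> j x y)"
      unfolding W_def right_diff_distrib sum_subtractf swap ..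
     moreover have "(\<Sum>j<n. (\<Sum>k<n. By i k ?z * Bx k j ?z) * \<Phi> j x y) =
       (\<Sum>j<n. frechet_derivative (Bx i j) (at ?z) \<i> * \<Phi> j x y + (\<Sum>k<n. Bx i k ?z * By k j ?z) * \<Phi> j x y
        - frechet_derivative (By i j) (at ?z) 1 * \<Phi> j x y)"
     proof (rule sum.cong[OF refl])
      fix j assume "j \<in> {..<n}"
      then have "(\<Sum>k<n. By i k ?z * Bx k j ?z) = frechet_derivative (Bx i j) (at ?z) \<i> +
        (\<Sum>k<n. Bx i k ?z * By k j ?z) - frechet_derivative (By i j) (at ?z) 1"
       using integrable[OF i _ UI[OF x y], of j] by simp
      then show "(\<Sum>k<n. By i k ?z * Bx k j ?z) * \<Phi> j x y =
        frechet_derivative (Bx i j) (at ?z) \<i> * \<Phi> j x y + (\<Sum>k<n. Bx i k ?z * By k j ?z) * \<Phi> j x y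
        - frechet_derivative (By i j) (at ?z) 1 * \<Phi> j x y"
       by (simp only: left_diff_distrib distrib_right)
     qed
     ultimately show ?thesis unfolding sum.distrib sum_subtractf swap by simp
    qed
    ultimately show ?thesis by simp
   qed
  qed (use i y small(2) in auto)
  then show ?thesis by (simp add: W_def)
 qed
 define \<phi> where "\<phi> i z = \<Phi> i (Re z) (Im z)" for i z
 have der: "(\<phi> i has_derivative (\<lambda>v. Re v * (\<Sum>j<n. Bx i j z * \<phi> j z) + Im v * (\<Sum>j<n. By i j z * \<phi> j z))) (at z)"
  if i: "i < n" and z: "z \<in> Rint" for i z
 proof -
  obtain x y where xy: "z = Complex x y" "x \<in> {a<..<a'}" "y \<in> {c<..<c'}"
   using z by (cases z) (auto simp: in_Rint)
  define d where "d x y = (\<Sum>j<n. By i j (Complex x y) * \<Phi> j x y)" for x y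
  have cd: "cont d"
   unfolding d_def by (rule cont_sum_mult) (use contU[OF sB(2)[OF i]] c\<Phi> in auto)
  have op: "open ({a<..<a'} \<times> {c<..<c'})" by (intro open_Times) auto
  have "isCont (\<lambda>(x, y). d x y) (x, y)"
  proof (rule continuous_on_interior[OF cd])
   have "{a<..<a'} \<times> {c<..<c'} \<subseteq> interior ({a..a'} \<times> {c..c'})" by (rule interior_maximal[OF _ op]) auto
   then show "(x, y) \<in> interior ({a..a'} \<times> {c..c'})" using xy by auto
  qed
  then have cont': "isCont (\<lambda>(x, y). blinfun_mult_right (d x y)) (x, y)"
   unfolding case_prod_beta' by (rule bounded_linear.continuous[OF bounded_linear_blinfun_mult_right])
  have "((\<lambda>(x, y). \<Phi> i x y) has_derivative (\<lambda>(tx, ty). \<Psi> i x y * tx + blinfun_mult_right (d x y) ty))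
    (at (x, y) within {a<..<a'} \<times> {c<..<c'})"
  proof (rule has_derivative_partialsI)
   show "((\<lambda>x. \<Phi> i x y) has_derivative (*) (\<Psi> i x y)) (at x within {a<..<a'})"
   proof -
    have "((\<lambda>x. \<Phi> i x y) has_real_derivative \<Psi> i x y) (at x within {a<..<a'})"
     by (rule DERIV_subset[OF dx[OF i]]) (use xy in auto)
    then show ?thesis by (simp add: has_field_derivative_def)
   qed
   show "(\<Phi> i x has_derivative blinfun_apply (blinfun_mult_right (d x y))) (at y within {c<..<c'})"
    if "x \<in> {a<..<a'}" "y \<in> {c<..<c'}" for x y
   proof -
    have "(\<Phi> i x has_real_derivative d x y) (at y within {c<..<c'})"
     unfolding d_def by (rule DERIV_subset[OF dy[OF i]]) (use that in auto)
    then show ?thesis by (simp add: has_field_derivative_def)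
   qed
   show "continuous (at (x, y) within {a<..<a'} \<times> {c<..<c'}) (\<lambda>(x, y). blinfun_mult_right (d x y))"
    using continuous_at_imp_continuous_at_within[OF cont'] .
  qed (use xy in auto)
  then have D: "((\<lambda>(x, y). \<Phi> i x y) has_derivative (\<lambda>(tx, ty). \<Psi> i x y * tx + d x y * ty)) (at (x, y))"
   using at_within_open[OF _ op, of "(x, y)"] xy by (simp add: case_prod_beta')
  have "((\<lambda>z. (Re z, Im z)) has_derivative (\<lambda>v. (Re v, Im v))) (at z)"
   by (intro has_derivative_Pair bounded_linear_imp_has_derivative bounded_linear_Re bounded_linear_Im)
  from has_derivative_compose[OF this, of "\<lambda>(x, y). \<Phi> i x y" "\<lambda>(tx, ty). \<Psi> i x y * tx + d x y * ty"] D
  have "(\<phi> i has_derivative (\<lambda>v. \<Psi> i x y * Re v + d x y * Im v)) (at z)"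
   by (simp add: \<phi>_def[abs_def] xy(1))
  moreover have "\<Psi> i x y = (\<Sum>j<n. Bx i j z * \<phi> j z)" using W[OF i] xy by (auto simp: \<phi>_def)
  moreover have "d x y = (\<Sum>j<n. By i j z * \<phi> j z)" by (simp add: d_def \<phi>_def xy(1))
  ultimately show ?thesis by (simp add: mult.commute)
 qed
 have oR: "open Rint" unfolding Rint_def by (rule open_box)
 have RU: "Rint \<subseteq> U" using U(2) by (auto simp: in_Rint in_R subset_iff)
 have "Ck_on k Rint (\<phi> i)" if "i < n" for k i
  using that
 proof (induction k arbitrary: i)
  case 0
  have "isCont (\<phi> i) z" if "z \<in> Rint" for z using has_derivative_continuous[OF der[OF 0 that]] .
  then show ?case by (simp add: continuous_at_imp_continuous_on)
 next
  case (Suc k)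
  have sub: "Ck_on k Rint h" if "smooth_on U h" for h
   using smooth_on_subset[OF that RU] by (auto simp: smooth_on_def)
  have sum: "Ck_on k Rint (\<lambda>z. \<Sum>j\<in>J. B j z * \<phi> j z)" if "finite J" "J \<subseteq> {..<n}" "\<And>j. j < n ==> smooth_on U (B j)" for B J
   using that(1,2)
  proof (induction J)
   case (insert j J)
   have "Ck_on k Rint (\<lambda>z. B j z * \<phi> j z)" using insert.prems by (intro Ck_on_mult[OF oR] sub that(3) Suc.IH) auto
   then have "Ck_on k Rint (\<lambda>z. B j z * \<phi> j z + (\<Sum>j\<in>J. B j z * \<phi> j z))"
    using insert by (intro Ck_on_add[OF oR]) auto
   then show ?case using insert.hyps by simp
  qed (simp add: Ck_on_const[OF oR])
  show ?case
  proof (rule Ck_on_SucI[OF oR der[OF Suc.prems]])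
   show "Ck_on k Rint (\<lambda>z. Re v * (\<Sum>j<n. Bx i j z * \<phi> j z) + Im v * (\<Sum>j<n. By i j z * \<phi> j z))" for v
    by (intro Ck_on_add[OF oR] Ck_on_mult[OF oR] Ck_on_const[OF oR] sum sB Suc.prems) auto
  qed
 qed
 then have "smooth_on Rint (\<phi> i)" if "i < n" for i using that by (simp add: smooth_on_def)
 moreover have "continuous_on R (\<phi> i)" if "i < n" for i
 proof -
  have "continuous_on R (\<lambda>z. (\<lambda>(x, y). \<Phi> i x y) (Re z, Im z))"
   by (rule continuous_on_compose2[OF c\<Phi>[OF that]]) (auto simp: in_R intro!: continuous_intros)
  then show ?thesis by (simp add: \<phi>_def[abs_def])
 qed
 moreover have "\<phi> i (Complex a c) = g i" if "i < n" for i
  using \<Phi>0[OF that, of a] \<Phi>1(2)[OF that, of 0] le by (simp add: \<phi>_def G_def)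
 ultimately show ?thesis using der by blast
qed

end

text \<open>
 The transposed system has the solution matrix \<open>\<psi>\<close>; since \<open>\<psi> \<phi>\<close> is constant and is the identity
 matrix in one point, \<open>\<psi>\<close> is a smooth inverse of \<open>\<phi>\<close>.
\<close>

lemma integrable_system_frame:
 fixes Ax Ay :: "nat \<Rightarrow> nat \<Rightarrow> complex \<Rightarrow> real"
 assumes U: "open U" "z0 \<in> U"
  and sA: "\<And>i j. i < n ==> j < n ==> smooth_on U (Ax i j)" "\<And>i j. i < n ==> j < n ==> smooth_on U (Ay i j)"
  and flat: "\<And>i j z. i < n ==> j < n ==> z \<in> U ==>
   frechet_derivative (Ay i j) (at z) 1 + (\<Sum>k<n. Ax i k z * Ay k j z) =
   frechet_derivative (Ax i j) (at z) \<i> + (\<Sum>k<n. Ay i k z * Ax k j z)"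
 obtains W \<phi> \<psi> where "open W" "connected W" "z0 \<in> W" "W \<subseteq> U"
  "\<And>k i. k < n ==> i < n ==> smooth_on W (\<phi> k i)" "\<And>k i. k < n ==> i < n ==> smooth_on W (\<psi> k i)"
  "\<And>k i z. k < n ==> i < n ==> z \<in> W ==>
   (\<phi> k i has_derivative (\<lambda>v. - (Re v * (\<Sum>j<n. Ax i j z * \<phi> k j z) + Im v * (\<Sum>j<n. Ay i j z * \<phi> k j z)))) (at z)"
  "\<And>k i z. k < n ==> i < n ==> z \<in> W ==>
   (\<psi> k i has_derivative (\<lambda>v. Re v * (\<Sum>j<n. Ax j i z * \<psi> k j z) + Im v * (\<Sum>j<n. Ay j i z * \<psi> k j z))) (at z)"
  "\<And>k l z. k < n ==> l < n ==> z \<in> W ==> (\<Sum>i<n. \<psi> l i z * \<phi> k i z) = (if k = l then 1 else 0)"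
proof -
 obtain e where e: "e > 0" "cball z0 e \<subseteq> U" using U open_contains_cball by blast
 define h where "h i j z = \<bar>Ax i j z\<bar> + \<bar>Ay i j z\<bar> + \<bar>frechet_derivative (Ay i j) (at z) 1\<bar>" for i j z
 have "\<exists>m. \<forall>z\<in>cball z0 e. h i j z \<le> m" if "i < n" "j < n" for i j
 proof -
  have "continuous_on (cball z0 e) (h i j)"
   unfolding h_def[abs_def]
   by (intro continuous_intros continuous_on_subset[OF smooth_on_continuous e(2)] sA smooth_on_frechet_derivative that)
  then have "bounded (h i j ` cball z0 e)" by (intro compact_imp_bounded compact_continuous_image) auto
  then obtain m where "\<forall>z\<in>cball z0 e. norm (h i j z) \<le> m" by (auto simp: bounded_iff)
  then show ?thesis by (intro exI[of _ m]) force
 qed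
 then obtain m where m: "\<And>i j z. i < n ==> j < n ==> z \<in> cball z0 e ==> h i j z \<le> m i j" by metis
 define K where "K = (\<Sum>i<n. \<Sum>j<n. \<bar>m i j\<bar>)"
 have K0: "K \<ge> 0" unfolding K_def by (intro sum_nonneg) auto
 have K: "h i j z \<le> K" if "i < n" "j < n" "z \<in> cball z0 e" for i j z
 proof -
  have "\<bar>m i j\<bar> \<le> (\<Sum>j<n. \<bar>m i j\<bar>)" by (rule member_le_sum) (use that in auto)
  also have "\<dots> \<le> K" unfolding K_def by (rule member_le_sum) (use that in \<open>auto intro: sum_nonneg\<close>)
  finally show ?thesis using m[OF that] by linarith
 qed
 define \<delta> where "\<delta> = min (e / 2) (1 / (8 * (n * K + 1)))"
 have nK: "n * K \<ge> 0" using K0 by simp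
 have \<delta>: "\<delta> > 0" "\<delta> \<le> e / 2" using e nK by (auto simp: \<delta>_def)
 have \<delta>': "4 * (n * K) * (2 * \<delta>) \<le> 1"
 proof -
  have "\<delta> \<le> 1 / (8 * (n * K + 1))" by (simp add: \<delta>_def)
  then have "\<delta> * (8 * (n * K + 1)) \<le> 1" using nK by (simp add: pos_le_divide_eq)
  then show ?thesis using \<delta>(1) by (simp add: algebra_simps)
 qed
 interpret rectangle "Re z0 - \<delta>" "Re z0 + \<delta>" "Im z0 - \<delta>" "Im z0 + \<delta>"
  by unfold_locales (use \<delta> in auto)
 have RB: "R \<subseteq> cball z0 e"
 proof
  fix z assume z: "z \<in> R"
  have "cmod (z - z0) \<le> \<bar>Re (z - z0)\<bar> + \<bar>Im (z - z0)\<bar>" by (rule cmod_le)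
  also have "\<dots> \<le> e" using z \<delta> by (auto simp: in_R)
  finally show "z \<in> cball z0 e" by (simp add: dist_norm norm_minus_commute)
 qed
 have RU: "R \<subseteq> U" using RB e by auto
 have hK: "\<bar>Ax i j z\<bar> \<le> K" "\<bar>Ay i j z\<bar> \<le> K" "\<bar>frechet_derivative (Ay i j) (at z) 1\<bar> \<le> K"
  if "i < n" "j < n" "z \<in> R" for i j z
  using K[OF that(1,2)] RB that unfolding h_def by fastforce+
 have neg: "frechet_derivative (\<lambda>z. - f z) (at z) v = - frechet_derivative f (at z) v" if "smooth_on U f" "z \<in> U" for f z v
  using frechet_derivative_at[OF has_derivative_minus[OF smooth_on_has_derivative[OF that]]] by metis
 have sm: "4 * (n * K) * ((Re z0 + \<delta>) - (Re z0 - \<delta>)) \<le> 1" "4 * (n * K) * ((Im z0 + \<delta>) - (Im z0 - \<delta>)) \<le> 1"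
  using \<delta>' by (simp_all add: algebra_simps)
 let ?p = "Complex (Re z0 - \<delta>) (Im z0 - \<delta>)"
 define P where "P B B' k \<phi> \<longleftrightarrow> (\<forall>i<n. \<phi> i ?p = (if i = k then 1 else 0) \<and> continuous_on R (\<phi> i) \<and> smooth_on Rint (\<phi> i) \<and>
  (\<forall>z\<in>Rint. (\<phi> i has_derivative (\<lambda>v. Re v * (\<Sum>j<n. B i j z * \<phi> j z) + Im v * (\<Sum>j<n. B' i j z * \<phi> j z))) (at z)))"
  for B B' :: "nat \<Rightarrow> nat \<Rightarrow> complex \<Rightarrow> real" and k :: nat and \<phi>
 have "\<exists>\<phi>. P (\<lambda>i j z. - Ax i j z) (\<lambda>i j z. - Ay i j z) k \<phi>" for k
  unfolding P_def
 proof (rule integrable_system_solution[OF U(1) RU _ _ _ K0 sm])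
  show "\<bar>- Ax i j z\<bar> \<le> K \<and> \<bar>- Ay i j z\<bar> \<le> K \<and> \<bar>frechet_derivative (\<lambda>z. - Ay i j z) (at z) 1\<bar> \<le> K"
   if "i < n" "j < n" "z \<in> R" for i j z
   using hK[OF that] neg[OF sA(2)[OF that(1,2)] subsetD[OF RU that(3)], of 1] by simp
  show "frechet_derivative (\<lambda>z. - Ay i j z) (at z) 1 + (\<Sum>k<n. - Ay i k z * - Ax k j z) =
   frechet_derivative (\<lambda>z. - Ax i j z) (at z) \<i> + (\<Sum>k<n. - Ax i k z * - Ay k j z)"
   if "i < n" "j < n" "z \<in> U" for i j z
   using flat[OF that] neg[OF sA(2)[OF that(1,2)] that(3)] neg[OF sA(1)[OF that(1,2)] that(3)] by simp
 qed (auto intro!: smooth_on_minus[OF U(1)] sA)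
 then obtain \<phi> where \<phi>P: "\<And>k. P (\<lambda>i j z. - Ax i j z) (\<lambda>i j z. - Ay i j z) k (\<phi> k)" by metis
 have \<phi>: "\<phi> k i ?p = (if i = k then 1 else 0)" "continuous_on R (\<phi> k i)" "smooth_on Rint (\<phi> k i)"
  "z \<in> Rint ==> (\<phi> k i has_derivative
   (\<lambda>v. Re v * (\<Sum>j<n. - Ax i j z * \<phi> k j z) + Im v * (\<Sum>j<n. - Ay i j z * \<phi> k j z))) (at z)" if "i < n" for k i z
  using \<phi>P[of k] that unfolding P_def by blast+
 have "\<exists>\<psi>. P (\<lambda>i j. Ax j i) (\<lambda>i j. Ay j i) k \<psi>" for k
  unfolding P_def
 proof (rule integrable_system_solution[OF U(1) RU _ _ _ K0 sm])
  show "frechet_derivative (Ay j i) (at z) 1 + (\<Sum>k<n. Ay k i z * Ax j k z) =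
   frechet_derivative (Ax j i) (at z) \<i> + (\<Sum>k<n. Ax k i z * Ay j k z)"
   if "i < n" "j < n" "z \<in> U" for i j z
   using flat[OF that(2,1,3)] by (simp add: mult.commute)
 qed (use sA hK in auto)
 then obtain \<psi> where \<psi>P: "\<And>k. P (\<lambda>i j. Ax j i) (\<lambda>i j. Ay j i) k (\<psi> k)" by metis
 have \<psi>: "\<psi> k i ?p = (if i = k then 1 else 0)" "continuous_on R (\<psi> k i)" "smooth_on Rint (\<psi> k i)"
  "z \<in> Rint ==> (\<psi> k i has_derivative
   (\<lambda>v. Re v * (\<Sum>j<n. Ax j i z * \<psi> k j z) + Im v * (\<Sum>j<n. Ay j i z * \<psi> k j z))) (at z)" if "i < n" for k i z
  using \<psi>P[of k] that unfolding P_def by blast+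
 have z0R: "z0 \<in> Rint" using \<delta> by (auto simp: in_Rint)
 have convR: "convex Rint" "open Rint" unfolding Rint_def by (rule convex_box(2), rule open_box)
 have clR: "closure Rint = R" unfolding Rint_def R_def
  by (rule closure_box) (use z0R in \<open>auto simp: Rint_def\<close>)
 have dual: "(\<Sum>i<n. \<psi> l i z * \<phi> k i z) = (if k = l then 1 else 0)" if kl: "k < n" "l < n" and z: "z \<in> Rint" for k l z
 proof -
  define s where "s z = (\<Sum>i<n. \<psi> l i z * \<phi> k i z)" for z
  have "(s has_derivative (\<lambda>v. 0)) (at z)" if z: "z \<in> Rint" for z
  proof -
   have "(s has_derivative (\<lambda>v. \<Sum>i<n. \<psi> l i z * (Re v * (\<Sum>j<n. - Ax i j z * \<phi> k j z) + Im v * (\<Sum>j<n. - Ay i j z * \<phi> k j z))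
     + (Re v * (\<Sum>j<n. Ax j i z * \<psi> l j z) + Im v * (\<Sum>j<n. Ay j i z * \<psi> l j z)) * \<phi> k i z)) (at z)"
    unfolding s_def[abs_def] by (intro has_derivative_sum has_derivative_mult \<psi>(4) \<phi>(4)) (use z in auto)
   moreover have "(\<Sum>i<n. \<psi> l i z * (Re v * (\<Sum>j<n. - Ax i j z * \<phi> k j z) + Im v * (\<Sum>j<n. - Ay i j z * \<phi> k j z))
     + (Re v * (\<Sum>j<n. Ax j i z * \<psi> l j z) + Im v * (\<Sum>j<n. Ay j i z * \<psi> l j z)) * \<phi> k i z) = 0" for v
   proof -
    have sw: "(\<Sum>i<n. (\<Sum>j<n. B j i z * \<psi> l j z) * \<phi> k i z) = (\<Sum>i<n. \<psi> l i z * (\<Sum>j<n. B i j z * \<phi> k j z))"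
     for B :: "nat \<Rightarrow> nat \<Rightarrow> complex \<Rightarrow> real"
     unfolding sum_distrib_left sum_distrib_right by (subst sum.swap) (simp add: mult_ac)
    have "(\<Sum>i<n. \<psi> l i z * (Re v * (\<Sum>j<n. - Ax i j z * \<phi> k j z) + Im v * (\<Sum>j<n. - Ay i j z * \<phi> k j z))
     + (Re v * (\<Sum>j<n. Ax j i z * \<psi> l j z) + Im v * (\<Sum>j<n. Ay j i z * \<psi> l j z)) * \<phi> k i z) =
     Re v * ((\<Sum>i<n. (\<Sum>j<n. Ax j i z * \<psi> l j z) * \<phi> k i z) - (\<Sum>i<n. \<psi> l i z * (\<Sum>j<n. Ax i j z * \<phi> k j z))) +
     Im v * ((\<Sum>i<n. (\<Sum>j<n. Ay j i z * \<psi> l j z) * \<phi> k i z) - (\<Sum>i<n. \<psi> l i z * (\<Sum>j<n. Ay i j z * \<phi> k j z)))"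
    proof -
     have gen: "(\<Sum>i<n. p i * (Re v * - q i + Im v * - r i) + (Re v * s i + Im v * t i) * u i) =
       Re v * ((\<Sum>i<n. s i * u i) - (\<Sum>i<n. p i * q i)) + Im v * ((\<Sum>i<n. t i * u i) - (\<Sum>i<n. p i * r i))"
      for p q r s t u :: "nat \<Rightarrow> real"
      unfolding right_diff_distrib sum_distrib_left sum_subtractf[symmetric] sum.distrib[symmetric]
      by (rule sum.cong) (simp_all add: algebra_simps)
     show ?thesis unfolding mult_minus_left sum_negf by (rule gen)
    qed
    then show ?thesis unfolding sw by simp
   qed
   ultimately show ?thesis by simp
  qed
  then have const: "s w = s z" if "w \<in> Rint" for w
   using has_derivative_zero_unique[OF convR(1), of s w z] that z has_derivative_at_withinI by blast
  have "continuous_on (closure Rint) s"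
   unfolding clR s_def[abs_def] by (intro continuous_on_sum continuous_on_mult \<phi>(2) \<psi>(2)) auto
  moreover have "?p \<in> closure Rint" unfolding clR using \<delta> by (simp add: in_R)
  ultimately have "s ?p = s z" using continuous_constant_on_closure[of Rint s "s z" ?p] const by blast
  moreover have "s ?p = (\<Sum>i<n. if i = l then (if i = k then 1 else 0) else 0)"
   unfolding s_def by (rule sum.cong) (use \<phi>(1) \<psi>(1) in auto)
  ultimately show ?thesis using kl by (simp add: s_def)
 qed
 show thesis
 proof (rule that[of Rint \<phi> \<psi>])
  show "Rint \<subseteq> U" using RU by (auto simp: in_Rint in_R subset_iff)
  show "(\<phi> k i has_derivative (\<lambda>v. - (Re v * (\<Sum>j<n. Ax i j z * \<phi> k j z) + Im v * (\<Sum>j<n. Ay i j z * \<phi> k j z)))) (at z)"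
   if "k < n" "i < n" "z \<in> Rint" for k i z
   using \<phi>(4)[OF that(2,3), of k] by (simp add: sum_negf)
 qed (use convR z0R \<phi> \<psi> dual convex_connected in auto)
qed

section \<open>Local flat frames\<close>

lemma independent_family_coeffs:
 assumes "inj_on b {..<r}" "independent (b ` {..<r})" "(\<Sum>i<r. c i *\<^sub>R b i) = 0" "i < (r::nat)"
 shows "c i = 0"
proof -
 define u where "u v = c (inv_into {..<r} b v)" for v
 have u: "u (b i) = c i" if "i < r" for i using assms(1) that by (simp add: u_def)
 have "(\<Sum>v\<in>b ` {..<r}. u v *\<^sub>R v) = (\<Sum>i<r. u (b i) *\<^sub>R b i)"
  using sum.reindex[OF assms(1), of "\<lambda>v. u v *\<^sub>R v"] by simp
 also have "\<dots> = 0" using assms(3) u by simp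
 finally have "u (b i) = 0"
  using independentD[OF assms(2) finite_imageI[OF finite_lessThan] order_refl, of u "b i"] assms(4) by blast
 then show ?thesis using u assms(4) by simp
qed

lemma span_family:
 assumes "a \<in> span (b ` {..<r::nat})" "inj_on b {..<r}" shows "\<exists>c. a = (\<Sum>i<r. c i *\<^sub>R b i)"
proof -
 obtain u where "a = (\<Sum>v\<in>b ` {..<r}. u v *\<^sub>R v)" using assms(1) span_finite[of "b ` {..<r}"] by auto
 then have "a = (\<Sum>i<r. u (b i) *\<^sub>R b i)" using sum.reindex[OF assms(2), of "\<lambda>v. u v *\<^sub>R v"] by simp
 then show ?thesis by (intro exI[of _ "\<lambda>i. u (b i)"])
qed

definition crd :: "nat \<Rightarrow> (nat \<Rightarrow> complex \<Rightarrow> 'v::real_vector) \<Rightarrow> complex \<Rightarrow> 'v \<Rightarrow> nat \<Rightarrow> real" where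
 "crd r e z a = (SOME f. a = (\<Sum>i<r. f i *\<^sub>R e i z))"

text \<open>
 A \<open>flat_frame\<close> of rank \<open>r\<close> on \<open>W\<close> is a frame of flat sections \<open>\<epsilon> j\<close> with its coordinate
 functionals \<open>co j\<close>. In these coordinates the connection is the componentwise derivative.
\<close>

definition flat_frame ::
 "'v::real_vector vbundle \<Rightarrow> complex set \<Rightarrow> nat \<Rightarrow> (nat \<Rightarrow> complex \<Rightarrow> 'v) \<Rightarrow> (nat \<Rightarrow> complex \<Rightarrow> 'v \<Rightarrow> real) \<Rightarrow> bool" where
 "flat_frame E W r \<epsilon> co \<longleftrightarrow> open_punctured W \<and>
  (\<forall>z\<in>W. \<forall>j<r. \<epsilon> j z \<in> fibre E z) \<and>
  (\<forall>z\<in>W. \<forall>j<r. linear_map_on (fibre E z) (co j z)) \<and>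
  (\<forall>z\<in>W. \<forall>j<r. \<forall>k<r. co j z (\<epsilon> k z) = (if j = k then 1 else 0)) \<and>
  (\<forall>z\<in>W. \<forall>a\<in>fibre E z. (\<Sum>j<r. co j z a *\<^sub>R \<epsilon> j z) = a) \<and>
  (\<forall>U s. open U \<and> U \<subseteq> W \<and> (\<forall>z\<in>U. s z \<in> fibre E z) -->
    (smooth_section E U s \<longleftrightarrow> (\<forall>j<r. smooth_on U (\<lambda>z. co j z (s z))))) \<and>
  (\<forall>U s. open U \<and> U \<subseteq> W \<and> smooth_section E U s -->
    (\<forall>z\<in>U. \<forall>v. nabla E s z v = (\<Sum>j<r. frechet_derivative (\<lambda>z. co j z (s z)) (at z) v *\<^sub>R \<epsilon> j z)))"

lemma flat_frameD:
 assumes "flat_frame E W r \<epsilon> co"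
 shows "open W" "0 \<notin> W" "z \<in> W ==> j < r ==> \<epsilon> j z \<in> fibre E z"
  "z \<in> W ==> j < r ==> linear_map_on (fibre E z) (co j z)"
  "z \<in> W ==> j < r ==> k < r ==> co j z (\<epsilon> k z) = (if j = k then 1 else 0)"
  "z \<in> W ==> a \<in> fibre E z ==> (\<Sum>j<r. co j z a *\<^sub>R \<epsilon> j z) = a"
  "open U ==> U \<subseteq> W ==> (\<And>z. z \<in> U ==> s z \<in> fibre E z) ==>
    smooth_section E U s \<longleftrightarrow> (\<forall>j<r. smooth_on U (\<lambda>z. co j z (s z)))"
  "open U ==> U \<subseteq> W ==> smooth_section E U s ==> z \<in> U ==>
    nabla E s z v = (\<Sum>j<r. frechet_derivative (\<lambda>z. co j z (s z)) (at z) v *\<^sub>R \<epsilon> j z)"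
proof -
 note c1 = conjunct2[OF assms[unfolded flat_frame_def]]
 note c2 = conjunct2[OF c1] note c3 = conjunct2[OF c2] note c4 = conjunct2[OF c3] note c5 = conjunct2[OF c4]
 show "open W" "0 \<notin> W" using conjunct1[OF assms[unfolded flat_frame_def]] by (simp_all add: open_punctured_def)
 show "z \<in> W ==> j < r ==> \<epsilon> j z \<in> fibre E z" by (rule conjunct1[OF c1, rule_format])
 show "z \<in> W ==> j < r ==> linear_map_on (fibre E z) (co j z)" by (rule conjunct1[OF c2, rule_format])
 show "z \<in> W ==> j < r ==> k < r ==> co j z (\<epsilon> k z) = (if j = k then 1 else 0)"
  by (rule conjunct1[OF c3, rule_format])
 show "z \<in> W ==> a \<in> fibre E z ==> (\<Sum>j<r. co j z a *\<^sub>R \<epsilon> j z) = a" by (rule conjunct1[OF c4, rule_format])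
 show "smooth_section E U s \<longleftrightarrow> (\<forall>j<r. smooth_on U (\<lambda>z. co j z (s z)))"
  if "open U" "U \<subseteq> W" "\<And>z. z \<in> U ==> s z \<in> fibre E z"
  using spec[OF spec[OF conjunct1[OF c5], of U], of s] that by simp
 show "nabla E s z v = (\<Sum>j<r. frechet_derivative (\<lambda>z. co j z (s z)) (at z) v *\<^sub>R \<epsilon> j z)"
  if "open U" "U \<subseteq> W" "smooth_section E U s" "z \<in> U"
  using spec[OF spec[OF conjunct2[OF c5], of U], of s] that by simp
qed

lemma flat_frame_co_sum:
 assumes "flat_frame E W r \<epsilon> co" "z \<in> W" "subspace (fibre E z)" "j < r"
 shows "co j z (\<Sum>k<r. c k *\<^sub>R \<epsilon> k z) = c j"
proof -
 note ff = flat_frameD[OF assms(1)]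
 have "co j z (\<Sum>k<r. c k *\<^sub>R \<epsilon> k z) = (\<Sum>k<r. co j z (c k *\<^sub>R \<epsilon> k z))"
  by (rule linear_map_on_sum[OF ff(4)[OF assms(2,4)] assms(3)])
   (use ff(3)[OF assms(2)] subspace_scale[OF assms(3)] in auto)
 also have "\<dots> = (\<Sum>k<r. if k = j then c k else 0)"
  by (rule sum.cong) (use linear_map_on_scale[OF ff(4)[OF assms(2,4)] ff(3)[OF assms(2)]] ff(5)[OF assms(2,4)] in auto)
 finally show ?thesis using assms(4) by simp
qed

locale vbun =
 fixes E :: "'v::real_vector vbundle"
 assumes vb: "vector_bundle E"
begin

lemma frame_at: assumes "z \<noteq> 0" obtains V r e where "(V, r, e) \<in> frames E" "z \<in> V"
 using vb assms unfolding vector_bundle_def by blast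

lemma frameD:
 assumes "(V, r, e) \<in> frames E"
 shows "open V" "0 \<notin> V" "z \<in> V ==> inj_on (\<lambda>i. e i z) {..<r}"
  "z \<in> V ==> independent ((\<lambda>i. e i z) ` {..<r})" "z \<in> V ==> span ((\<lambda>i. e i z) ` {..<r}) = fibre E z"
  "j < r ==> smooth_section E V (e j)"
proof -
 have *: "open_punctured V \<and>
    (\<forall>z\<in>V. inj_on (\<lambda>i. e i z) {..<r} \<and> independent ((\<lambda>i. e i z) ` {..<r}) \<and>
        span ((\<lambda>i. e i z) ` {..<r}) = fibre E z) \<and> (\<forall>j<r. smooth_section E V (e j))"
  using bspec[OF conjunct2[OF vb[unfolded vector_bundle_def]] assms] by simp
 then show "open V" "0 \<notin> V" unfolding open_punctured_def by simp_all
 note pt = bspec[OF conjunct1[OF conjunct2[OF *]]]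
 show "z \<in> V ==> inj_on (\<lambda>i. e i z) {..<r}" by (rule pt[THEN conjunct1])
 show "z \<in> V ==> independent ((\<lambda>i. e i z) ` {..<r})" by (rule pt[THEN conjunct2, THEN conjunct1])
 show "z \<in> V ==> span ((\<lambda>i. e i z) ` {..<r}) = fibre E z" by (rule pt[THEN conjunct2, THEN conjunct2])
 show "j < r ==> smooth_section E V (e j)" using conjunct2[OF conjunct2[OF *]] by simp
qed

lemma fin_dim_fibre: assumes "z \<noteq> 0" shows "fin_dim_space (fibre E z)"
proof -
 obtain V r e where "(V, r, e) \<in> frames E" "z \<in> V" using frame_at[OF assms] .
 from frameD(5)[OF this] show ?thesis unfolding fin_dim_space_def by (metis finite_imageI finite_lessThan)
qed

lemma subspace_fibre: "z \<noteq> 0 ==> subspace (fibre E z)"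
 using fin_dim_fibre fin_dim_space_subspace by blast

context
 fixes V r e assumes fr: "(V, r, e) \<in> frames E"
begin

lemma e_fibre: "z \<in> V ==> i < r ==> e i z \<in> fibre E z"
 using frameD(5)[OF fr] by (metis imageI lessThan_iff span_base)

lemma crd_sum: assumes "z \<in> V" "a \<in> fibre E z" shows "(\<Sum>i<r. crd r e z a i *\<^sub>R e i z) = a"
proof -
 have "a \<in> span ((\<lambda>i. e i z) ` {..<r})" using assms frameD(5)[OF fr] by simp
 then have "\<exists>c. a = (\<Sum>i<r. c i *\<^sub>R e i z)" using frameD(3)[OF fr assms(1)] by (rule span_family)
 then have "a = (\<Sum>i<r. (SOME f. a = (\<Sum>i<r. f i *\<^sub>R e i z)) i *\<^sub>R e i z)" by (rule someI_ex)
 then show ?thesis unfolding crd_def by (rule sym)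
qed

lemma crd_unique: assumes "z \<in> V" "i < r" shows "crd r e z (\<Sum>i<r. f i *\<^sub>R e i z) i = f i"
proof -
 let ?a = "\<Sum>i<r. f i *\<^sub>R e i z"
 have "?a \<in> fibre E z"
 proof -
  have "subspace (fibre E z)" using frameD(2)[OF fr] assms(1) by (intro subspace_fibre) metis
  then show ?thesis by (intro subspace_sum subspace_scale) (use e_fibre[OF assms(1)] in auto)
 qed
 from crd_sum[OF assms(1) this] have "(\<Sum>i<r. (crd r e z ?a i - f i) *\<^sub>R e i z) = 0"
  unfolding scaleR_diff_left sum_subtractf by simp
 from independent_family_coeffs[OF frameD(3)[OF fr assms(1)] frameD(4)[OF fr assms(1)] this assms(2)]
 show ?thesis by simp
qed

lemma crd_linear: assumes z: "z \<in> V" and i: "i < r" shows "linear_map_on (fibre E z) (\<lambda>a. crd r e z a i)"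
 unfolding linear_map_on_def
proof (intro conjI allI ballI)
 fix x y assume "x \<in> fibre E z" "y \<in> fibre E z"
 then have "x + y = (\<Sum>i<r. (crd r e z x i + crd r e z y i) *\<^sub>R e i z)"
  using crd_sum[OF z, of x] crd_sum[OF z, of y] by (simp add: scaleR_add_left sum.distrib)
 then show "crd r e z (x + y) i = crd r e z x i + crd r e z y i" using crd_unique[OF z i] by simp
next
 fix c x assume "x \<in> fibre E z"
 then have x: "(\<Sum>i<r. crd r e z x i *\<^sub>R e i z) = x" using crd_sum[OF z, of x] by simp
 have "c *\<^sub>R (\<Sum>i<r. crd r e z x i *\<^sub>R e i z) = (\<Sum>i<r. (c * crd r e z x i) *\<^sub>R e i z)"
  by (simp add: scaleR_sum_right)
 then have "c *\<^sub>R x = (\<Sum>i<r. (c * crd r e z x i) *\<^sub>R e i z)" unfolding x .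
 then show "crd r e z (c *\<^sub>R x) i = c *\<^sub>R crd r e z x i" using crd_unique[OF z i] by simp
qed

lemma smooth_section_crd:
 assumes "open U" "smooth_section E U s" "i < r" shows "smooth_on (U \<inter> V) (\<lambda>z. crd r e z (s z) i)"
proof -
 obtain f where f: "\<forall>i<r. smooth_on (U \<inter> V) (f i)" "\<forall>z \<in> U \<inter> V. s z = (\<Sum>i<r. f i z *\<^sub>R e i z)"
  using assms(2) fr unfolding smooth_section_def by blast
 have op: "open (U \<inter> V)" using assms(1) frameD(1)[OF fr] by blast
 show ?thesis
  by (rule smooth_on_cong[OF op, of "f i"]) (use f crd_unique assms(3) in auto)
qed

lemma smooth_section_from_crd:
 assumes U: "open U" "U \<subseteq> V" and s: "\<And>z. z \<in> U ==> s z \<in> fibre E z"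
  and sm: "\<And>i. i < r ==> smooth_on U (\<lambda>z. crd r e z (s z) i)"
 shows "smooth_section E U s"
 unfolding smooth_section_def
proof (safe)
 fix V' r' e' assume "(V', r', e') \<in> frames E"
 have "\<exists>g. (\<forall>i<r'. smooth_on (V \<inter> V') (g i)) \<and> (\<forall>z\<in>V \<inter> V'. e j z = (\<Sum>i<r'. g i z *\<^sub>R e' i z))" if "j < r" for j
  using frameD(6)[OF fr that] \<open>(V', r', e') \<in> frames E\<close> unfolding smooth_section_def by blast
 then obtain g where g: "\<And>i j. j < r ==> i < r' ==> smooth_on (V \<inter> V') (g j i)"
  "\<And>j z. j < r ==> z \<in> V \<inter> V' ==> e j z = (\<Sum>i<r'. g j i z *\<^sub>R e' i z)" by metis
 have op: "open (U \<inter> V')" using U(1) frameD(1)[OF \<open>(V', r', e') \<in> frames E\<close>] by blast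
 let ?f = "\<lambda>i z. \<Sum>j<r. crd r e z (s z) j * g j i z"
 have "smooth_on (U \<inter> V') (?f i)" if "i < r'" for i
  by (intro smooth_on_sum[OF op] smooth_on_mult[OF op])
   (use that U(2) in \<open>auto intro!: smooth_on_subset[OF sm] smooth_on_subset[OF g(1)]\<close>)
 moreover have "s z = (\<Sum>i<r'. ?f i z *\<^sub>R e' i z)" if z: "z \<in> U \<inter> V'" for z
 proof -
  have "s z = (\<Sum>j<r. crd r e z (s z) j *\<^sub>R e j z)"
   by (rule crd_sum[symmetric]) (use s U(2) z in auto)
  also have "\<dots> = (\<Sum>j<r. \<Sum>i<r'. (crd r e z (s z) j * g j i z) *\<^sub>R e' i z)"
   by (rule sum.cong) (use g(2)[of _ z] z U(2) in \<open>auto simp: scaleR_sum_right\<close>)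
  also have "\<dots> = (\<Sum>i<r'. ?f i z *\<^sub>R e' i z)" by (subst sum.swap) (simp add: scaleR_sum_left)
  finally show ?thesis .
 qed
 ultimately show "\<exists>f. (\<forall>i<r'. smooth_on (U \<inter> V') (f i)) \<and> (\<forall>z\<in>U \<inter> V'. s z = (\<Sum>i<r'. f i z *\<^sub>R e' i z))"
  by (intro exI[of _ ?f]) blast
qed

end

lemma smooth_section_fibre:
 assumes "smooth_section E U s" "z \<in> U" "z \<noteq> 0" shows "s z \<in> fibre E z"
proof -
 obtain V r e where fr: "(V, r, e) \<in> frames E" "z \<in> V" using frame_at[OF assms(3)] .
 then obtain f where "\<forall>z \<in> U \<inter> V. s z = (\<Sum>i<r. f i z *\<^sub>R e i z)" using assms(1) unfolding smooth_section_def by blast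
 then have "s z = (\<Sum>i<r. f i z *\<^sub>R e i z)" using assms fr by blast
 then show ?thesis
  using e_fibre[OF fr] by (metis (no_types, lifting) lessThan_iff subspace_sum subspace_scale subspace_fibre[OF assms(3)])
qed

lemma smooth_section_subset:
 assumes "smooth_section E U s" "U' \<subseteq> U" shows "smooth_section E U' s"
 unfolding smooth_section_def
proof safe
 fix V r e assume "(V, r, e) \<in> frames E"
 then obtain f where f: "\<forall>i<r. smooth_on (U \<inter> V) (f i)" "\<forall>z \<in> U \<inter> V. s z = (\<Sum>i<r. f i z *\<^sub>R e i z)"
  using assms(1) unfolding smooth_section_def by blast
 then show "\<exists>f. (\<forall>i<r. smooth_on (U' \<inter> V) (f i)) \<and> (\<forall>z\<in>U' \<inter> V. s z = (\<Sum>i<r. f i z *\<^sub>R e i z))"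
  using assms(2) by (intro exI[of _ f]) (blast intro: smooth_on_subset)
qed

lemma smooth_section_cong:
 assumes "smooth_section E U s" "\<And>z. z \<in> U ==> s z = t z" shows "smooth_section E U t"
 using assms unfolding smooth_section_def by fastforce

lemma smooth_section_local:
 assumes U: "open_punctured U"
  and loc: "\<And>z. z \<in> U ==> \<exists>B. open B \<and> z \<in> B \<and> smooth_section E (U \<inter> B) s"
 shows "smooth_section E U s"
 unfolding smooth_section_def
proof safe
 fix V r e assume fr: "(V, r, e) \<in> frames E"
 have oU: "open U" "0 \<notin> U" using U by (auto simp: open_punctured_def)
 have op: "open (U \<inter> V)" using oU frameD(1)[OF fr] by blast
 have "smooth_on (U \<inter> V) (\<lambda>z. crd r e z (s z) i)" if i: "i < r" for i
 proof (rule smooth_on_local[OF op])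
  fix z assume "z \<in> U \<inter> V"
  then obtain B where B: "open B" "z \<in> B" "smooth_section E (U \<inter> B) s" using loc by blast
  have "smooth_on ((U \<inter> B) \<inter> V) (\<lambda>z. crd r e z (s z) i)"
   by (rule smooth_section_crd[OF fr _ B(3) i]) (use oU B in auto)
  moreover have "(U \<inter> B) \<inter> V = U \<inter> V \<inter> B" by auto
  ultimately show "\<exists>B. open B \<and> z \<in> B \<and> smooth_on (U \<inter> V \<inter> B) (\<lambda>z. crd r e z (s z) i)"
   using B(1,2) by (intro exI[of _ B]) simp
 qed
 moreover have "s z = (\<Sum>i<r. crd r e z (s z) i *\<^sub>R e i z)" if z: "z \<in> U \<inter> V" for z
 proof -
  obtain B where "z \<in> B" "smooth_section E (U \<inter> B) s" using loc z by blast
  then have "s z \<in> fibre E z" using smooth_section_fibre[of "U \<inter> B" s z] z oU by auto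
  then show ?thesis using crd_sum[OF fr, of z "s z"] z by simp
 qed
 ultimately show "\<exists>f. (\<forall>i<r. smooth_on (U \<inter> V) (f i)) \<and> (\<forall>z\<in>U \<inter> V. s z = (\<Sum>i<r. f i z *\<^sub>R e i z))"
  by (intro exI[of _ "\<lambda>i z. crd r e z (s z) i"]) blast
qed

end

locale fbun =
 fixes E :: "'v::real_vector vbundle"
 assumes fb: "flat_bundle E"
begin

sublocale vbun E using fb by unfold_locales (simp add: flat_bundle_def)

lemma nablaD:
 assumes "open_punctured U" "smooth_section E U s"
 shows "smooth_section E U (\<lambda>z. nabla E s z v)" "z \<in> U ==> linear (nabla E s z)"
  "(\<And>z. z \<in> U ==> t z = s z) ==> z \<in> U ==> nabla E t z v = nabla E s z v"
  "smooth_section E U t ==> z \<in> U ==> nabla E (\<lambda>w. s w + t w) z v = nabla E s z v + nabla E t z v"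
  "smooth_on U f ==> z \<in> U ==> nabla E (\<lambda>w. f w *\<^sub>R s w) z v =
           f z *\<^sub>R nabla E s z v + frechet_derivative f (at z) v *\<^sub>R s z"
  "z \<in> U ==> nabla E (\<lambda>w. nabla E s w v) z u = nabla E (\<lambda>w. nabla E s w u) z v"
proof -
 have con: "connection E" using fb by (simp add: flat_bundle_def)
 note c = con[unfolded connection_def, rule_format, OF conjI[OF assms]]
 show "smooth_section E U (\<lambda>z. nabla E s z v)" "z \<in> U ==> linear (nabla E s z)"
  "(\<And>z. z \<in> U ==> t z = s z) ==> z \<in> U ==> nabla E t z v = nabla E s z v"
  "smooth_section E U t ==> z \<in> U ==> nabla E (\<lambda>w. s w + t w) z v = nabla E s z v + nabla E t z v"
  "smooth_on U f ==> z \<in> U ==> nabla E (\<lambda>w. f w *\<^sub>R s w) z v =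
           f z *\<^sub>R nabla E s z v + frechet_derivative f (at z) v *\<^sub>R s z"
  using c by blast+
 show "z \<in> U ==> nabla E (\<lambda>w. nabla E s w v) z u = nabla E (\<lambda>w. nabla E s w u) z v"
  using fb assms unfolding flat_bundle_def by blast
qed

text \<open>In a local frame, the connection is the componentwise derivative plus a matrix.\<close>

lemma nabla_frame_sum:
 assumes fr: "(V, r, e) \<in> frames E" and U: "open U" "U \<subseteq> V"
  and f: "\<And>i. i < r ==> smooth_on U (f i)" and z: "z \<in> U" and n: "n \<le> r"
 shows "smooth_section E U (\<lambda>w. \<Sum>i<n. f i w *\<^sub>R e i w)"
  and "nabla E (\<lambda>w. \<Sum>i<n. f i w *\<^sub>R e i w) z v =
   (\<Sum>i<n. f i z *\<^sub>R nabla E (e i) z v + frechet_derivative (f i) (at z) v *\<^sub>R e i z)"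
proof -
 have oU: "open_punctured U" using U frameD(2)[OF fr] by (auto simp: open_punctured_def)
 have V0: "z \<noteq> 0" if "z \<in> V" for z using frameD(2)[OF fr] that by auto
 have sect: "smooth_section E U (\<lambda>w. \<Sum>i<n. f i w *\<^sub>R e i w)" if "n \<le> r" for n
 proof (rule smooth_section_from_crd[OF fr U])
  show "(\<Sum>i<n. f i z *\<^sub>R e i z) \<in> fibre E z" if "z \<in> U" for z
   using e_fibre[OF fr] that U \<open>n \<le> r\<close> V0
   by (intro subspace_sum subspace_scale subspace_fibre) auto
  fix i assume i: "i < r"
  have eq: "(\<Sum>i<n. f i z *\<^sub>R e i z) = (\<Sum>i<r. (if i < n then f i z else 0) *\<^sub>R e i z)" for z
   by (rule sum.mono_neutral_cong_left) (use that in auto)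
  have "smooth_on U (\<lambda>z. if i < n then f i z else 0)"
   by (cases "i < n") (use f[OF i] smooth_on_const[OF U(1)] in auto)
  then show "smooth_on U (\<lambda>z. crd r e z (\<Sum>i<n. f i z *\<^sub>R e i z) i)"
   by (rule smooth_on_cong[OF U(1), rotated]) (use crd_unique[OF fr _ i] U(2) eq in auto)
 qed
 show "smooth_section E U (\<lambda>w. \<Sum>i<n. f i w *\<^sub>R e i w)" by (rule sect[OF n])
 show "nabla E (\<lambda>w. \<Sum>i<n. f i w *\<^sub>R e i w) z v =
   (\<Sum>i<n. f i z *\<^sub>R nabla E (e i) z v + frechet_derivative (f i) (at z) v *\<^sub>R e i z)"
  using n
 proof (induction n)
  case 0
  have s0: "smooth_section E U (\<lambda>w. 0)" using sect[of 0] by simp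
  show ?case using nablaD(5)[OF oU s0 smooth_on_const[OF U(1), of 0] z, of v] by simp
 next
  case (Suc n)
  have ei: "smooth_section E U (e n)"
   by (rule smooth_section_subset[OF frameD(6)[OF fr] U(2)]) (use Suc.prems in auto)
  have sn: "smooth_section E U (\<lambda>w. f n w *\<^sub>R e n w)"
  proof (rule smooth_section_from_crd[OF fr U])
   show "f n z *\<^sub>R e n z \<in> fibre E z" if "z \<in> U" for z
    using e_fibre[OF fr] that U Suc.prems V0 by (intro subspace_scale subspace_fibre) auto
   fix i assume i: "i < r"
   have eq: "f n z *\<^sub>R e n z = (\<Sum>i<r. (if i = n then f i z else 0) *\<^sub>R e i z)" for z
    using Suc.prems by (simp add: if_distrib[of "\<lambda>c. c *\<^sub>R _"] cong: if_cong)
   have "smooth_on U (\<lambda>z. if i = n then f i z else 0)"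
    by (cases "i = n") (use f[OF i] smooth_on_const[OF U(1)] in auto)
   then show "smooth_on U (\<lambda>z. crd r e z (f n z *\<^sub>R e n z) i)"
    by (rule smooth_on_cong[OF U(1), rotated]) (use crd_unique[OF fr _ i] U(2) eq in auto)
  qed
  have "nabla E (\<lambda>w. (\<Sum>i<n. f i w *\<^sub>R e i w) + f n w *\<^sub>R e n w) z v =
    nabla E (\<lambda>w. \<Sum>i<n. f i w *\<^sub>R e i w) z v + nabla E (\<lambda>w. f n w *\<^sub>R e n w) z v"
   by (rule nablaD(4)[OF oU sect sn z]) (use Suc.prems in auto)
  also have "nabla E (\<lambda>w. f n w *\<^sub>R e n w) z v = f n z *\<^sub>R nabla E (e n) z v + frechet_derivative (f n) (at z) v *\<^sub>R e n z"
   by (rule nablaD(5)[OF oU ei f z]) (use Suc.prems in auto)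
  finally show ?case using Suc by simp
 qed
qed

lemma nabla_frame:
 assumes fr: "(V, r, e) \<in> frames E" and U: "open U" "U \<subseteq> V" and s: "smooth_section E U s" and z: "z \<in> U"
 shows "nabla E s z v = (\<Sum>i<r. crd r e z (s z) i *\<^sub>R nabla E (e i) z v +
   frechet_derivative (\<lambda>w. crd r e w (s w) i) (at z) v *\<^sub>R e i z)"
proof -
 have oU: "open_punctured U" using U frameD(2)[OF fr] by (auto simp: open_punctured_def)
 have UV: "U \<inter> V = U" using U by auto
 have sm: "smooth_on U (\<lambda>w. crd r e w (s w) i)" if "i < r" for i
  using smooth_section_crd[OF fr U(1) s that] UV by simp
 have "nabla E (\<lambda>w. \<Sum>i<r. crd r e w (s w) i *\<^sub>R e i w) z v = nabla E s z v"
 proof (rule nablaD(3)[OF oU s _ z])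
  fix w assume w: "w \<in> U"
  then have "s w \<in> fibre E w" using smooth_section_fibre[OF s w] oU by (auto simp: open_punctured_def)
  then show "(\<Sum>i<r. crd r e w (s w) i *\<^sub>R e i w) = s w" using crd_sum[OF fr, of w "s w"] w U by blast
 qed
 then show ?thesis using nabla_frame_sum(2)[OF fr U sm z order_refl] by simp
qed

theorem flat_frame_exists:
 assumes z0: "z0 \<noteq> 0" obtains W r \<epsilon> co where "flat_frame E W r \<epsilon> co" "z0 \<in> W"
proof -
 obtain V r e where fr: "(V, r, e) \<in> frames E" "z0 \<in> V" using frame_at[OF z0] .
 have V: "open V" "0 \<notin> V" "open_punctured V" using frameD[OF fr(1)] by (auto simp: open_punctured_def)
 have V0: "z \<noteq> 0" if "z \<in> V" for z using V(2) that by auto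
 define A where "A j i v z = crd r e z (nabla E (e j) z v) i" for i j v z
 have ne: "smooth_section E V (\<lambda>z. nabla E (e j) z v)" if "j < r" for j v
  by (rule nablaD(1)[OF V(3) frameD(6)[OF fr(1) that]])
 have nef: "nabla E (e j) z v \<in> fibre E z" if "j < r" "z \<in> V" for j z v
  by (rule smooth_section_fibre[OF ne[OF that(1)] that(2) V0[OF that(2)]])
 have sA: "smooth_on V (A j i v)" if "i < r" "j < r" for i j v
  using smooth_section_crd[OF fr(1) V(1) ne[OF that(2)] that(1)] by (simp add: A_def[abs_def])
 have Alin: "A j i v z = Re v * A j i 1 z + Im v * A j i \<i> z" if ij: "i < r" "j < r" and z: "z \<in> V" for i j v z
 proof -
  have lin: "linear (nabla E (e j) z)" by (rule nablaD(2)[OF V(3) frameD(6)[OF fr(1) ij(2)] z])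
  have v: "v = Re v *\<^sub>R 1 + Im v *\<^sub>R \<i>" by (simp add: complex_eq_iff)
  have "nabla E (e j) z v = Re v *\<^sub>R nabla E (e j) z 1 + Im v *\<^sub>R nabla E (e j) z \<i>"
   by (subst v) (simp only: linear_add[OF lin] linear_scale[OF lin])
  then show ?thesis
   using linear_map_on_add[OF crd_linear[OF fr(1) z ij(1)]] linear_map_on_scale[OF crd_linear[OF fr(1) z ij(1)]]
    nef[OF ij(2) z] subspace_scale[OF subspace_fibre[OF V0[OF z]]] by (simp add: A_def)
 qed
 have nabla: "nabla E s z v = (\<Sum>l<r. ((\<Sum>i<r. crd r e z (s z) i * A i l v z) +
   frechet_derivative (\<lambda>w. crd r e w (s w) l) (at z) v) *\<^sub>R e l z)"
  if U: "open U" "U \<subseteq> V" and s: "smooth_section E U s" and z: "z \<in> U" for U s z v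
 proof -
  have zV: "z \<in> V" using U z by auto
  have "(\<Sum>i<r. crd r e z (s z) i *\<^sub>R nabla E (e i) z v) = (\<Sum>i<r. \<Sum>l<r. (crd r e z (s z) i * A i l v z) *\<^sub>R e l z)"
  proof (rule sum.cong[OF refl])
   fix i assume "i \<in> {..<r}"
   then have "nabla E (e i) z v = (\<Sum>l<r. A i l v z *\<^sub>R e l z)"
    using crd_sum[OF fr(1) zV nef[OF _ zV, of i v]] by (simp add: A_def)
   then show "crd r e z (s z) i *\<^sub>R nabla E (e i) z v = (\<Sum>l<r. (crd r e z (s z) i * A i l v z) *\<^sub>R e l z)"
    by (simp add: scaleR_sum_right)
  qed
  also have "\<dots> = (\<Sum>l<r. (\<Sum>i<r. crd r e z (s z) i * A i l v z) *\<^sub>R e l z)"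
   by (subst sum.swap) (simp add: scaleR_sum_left)
  finally show ?thesis
   unfolding nabla_frame[OF fr(1) U s z] by (simp add: sum.distrib scaleR_add_left)
 qed
 have flat: "frechet_derivative (A j l \<i>) (at z) 1 + (\<Sum>i<r. A i l 1 z * A j i \<i> z) =
   frechet_derivative (A j l 1) (at z) \<i> + (\<Sum>i<r. A i l \<i> z * A j i 1 z)"
  if jl: "l < r" "j < r" and z: "z \<in> V" for j l z
 proof -
  have c: "crd r e z (nabla E (\<lambda>w. nabla E (e j) w v) z u) l =
    (\<Sum>i<r. A j i v z * A i l u z) + frechet_derivative (A j l v) (at z) u" for u v
   unfolding nabla[OF V(1) order_refl ne[OF jl(2)] z] crd_unique[OF fr(1) z jl(1)] by (simp add: A_def[abs_def])
  show ?thesis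
   using nablaD(6)[OF V(3) frameD(6)[OF fr(1) jl(2)] z, of \<i> 1] c[of \<i> 1] c[of 1 \<i>]
   by (simp add: mult.commute)
 qed
 obtain W \<phi> \<psi> where W': "open W" "connected W" "z0 \<in> W" "W \<subseteq> V"
  and s\<phi>: "\<And>k i. k < r ==> i < r ==> smooth_on W (\<phi> k i)" and s\<psi>: "\<And>k i. k < r ==> i < r ==> smooth_on W (\<psi> k i)"
  and "\<And>k i z. k < r ==> i < r ==> z \<in> W ==>
   (\<phi> k i has_derivative (\<lambda>v. - (Re v * (\<Sum>j<r. A j i 1 z * \<phi> k j z) + Im v * (\<Sum>j<r. A j i \<i> z * \<phi> k j z)))) (at z)"
  and d\<psi>: "\<And>k i z. k < r ==> i < r ==> z \<in> W ==>
   (\<psi> k i has_derivative (\<lambda>v. Re v * (\<Sum>j<r. A i j 1 z * \<psi> k j z) + Im v * (\<Sum>j<r. A i j \<i> z * \<psi> k j z))) (at z)"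
  and dual: "\<And>k l z. k < r ==> l < r ==> z \<in> W ==> (\<Sum>i<r. \<psi> l i z * \<phi> k i z) = (if k = l then 1 else 0)"
 proof -
  assume *: thesis if "open W" "connected W" "z0 \<in> W" "W \<subseteq> V"
   "\<And>k i. k < r ==> i < r ==> smooth_on W (\<phi> k i)" "\<And>k i. k < r ==> i < r ==> smooth_on W (\<psi> k i)"
   "\<And>k i z. k < r ==> i < r ==> z \<in> W ==>
    (\<phi> k i has_derivative (\<lambda>v. - (Re v * (\<Sum>j<r. A j i 1 z * \<phi> k j z) + Im v * (\<Sum>j<r. A j i \<i> z * \<phi> k j z)))) (at z)"
   "\<And>k i z. k < r ==> i < r ==> z \<in> W ==>
    (\<psi> k i has_derivative (\<lambda>v. Re v * (\<Sum>j<r. A i j 1 z * \<psi> k j z) + Im v * (\<Sum>j<r. A i j \<i> z * \<psi> k j z))) (at z)"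
   "\<And>k l z. k < r ==> l < r ==> z \<in> W ==> (\<Sum>i<r. \<psi> l i z * \<phi> k i z) = (if k = l then 1 else 0)"
   for W \<phi> \<psi>
  show thesis
   by (rule integrable_system_frame[of V z0 r "\<lambda>i j. A j i 1" "\<lambda>i j. A j i \<i>"])
    (fact V(1) fr(2) sA flat *)+
 qed
 have W: "open W" "z0 \<in> W" "W \<subseteq> V" using W' by auto
 have W0: "z \<in> V" "z \<noteq> 0" if "z \<in> W" for z using that W V0 by auto
 define \<epsilon> where "\<epsilon> k z = (\<Sum>i<r. \<phi> k i z *\<^sub>R e i z)" for k z
 define co where "co l z a = (\<Sum>i<r. \<psi> l i z * crd r e z a i)" for l z a
 have \<epsilon>f: "\<epsilon> k z \<in> fibre E z" if "z \<in> W" for k z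
  unfolding \<epsilon>_def using e_fibre[OF fr(1) W0(1)[OF that]]
  by (intro subspace_sum subspace_scale subspace_fibre[OF W0(2)[OF that]]) auto
 have colin: "linear_map_on (fibre E z) (co l z)" if "z \<in> W" for l z
  using crd_linear[OF fr(1) W0(1)[OF that]] unfolding co_def linear_map_on_def
  by (simp add: sum.distrib sum_distrib_left distrib_left mult.left_commute)
 have co\<epsilon>: "co l z (\<epsilon> k z) = (if l = k then 1 else 0)" if "z \<in> W" "l < r" "k < r" for l k z
  unfolding co_def \<epsilon>_def using crd_unique[OF fr(1) W0(1)[OF that(1)]] dual[OF that(3,2,1)] by auto
 have coexp: "(\<Sum>k<r. co k z a *\<^sub>R \<epsilon> k z) = a" if z: "z \<in> W" and a: "a \<in> fibre E z" for z a
 proof -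
  have sub: "subspace (fibre E z)" by (rule subspace_fibre[OF W0(2)[OF z]])
  have coS: "co l z (\<Sum>k<r. c k *\<^sub>R \<epsilon> k z) = c l" if "l < r" for c l
  proof -
   have "co l z (\<Sum>k<r. c k *\<^sub>R \<epsilon> k z) = (\<Sum>k<r. co l z (c k *\<^sub>R \<epsilon> k z))"
    by (rule linear_map_on_sum[OF colin[OF z] sub]) (intro subspace_scale[OF sub] \<epsilon>f[OF z])
   also have "\<dots> = (\<Sum>k<r. if k = l then c k else 0)"
    by (rule sum.cong) (use linear_map_on_scale[OF colin[OF z] \<epsilon>f[OF z]] co\<epsilon>[OF z that] in auto)
   finally show ?thesis using that by simp
  qed
  let ?B = "(\<lambda>k. \<epsilon> k z) ` {..<r}"
  have inj: "inj_on (\<lambda>k. \<epsilon> k z) {..<r}"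
  proof (rule inj_onI)
   fix k l assume kl: "k \<in> {..<r}" "l \<in> {..<r}" "\<epsilon> k z = \<epsilon> l z"
   then have "co k z (\<epsilon> k z) = co k z (\<epsilon> l z)" by simp
   then show "k = l" using co\<epsilon>[OF z, of k k] co\<epsilon>[OF z, of k l] kl by (auto split: if_splits)
  qed
  have ind: "independent ?B"
  proof (rule independent_if_scalars_zero)
   fix f x assume f: "(\<Sum>x\<in>?B. f x *\<^sub>R x) = 0" and x: "x \<in> ?B"
   obtain l where l: "l < r" "x = \<epsilon> l z" using x by auto
   have "(\<Sum>k<r. f (\<epsilon> k z) *\<^sub>R \<epsilon> k z) = 0" using f sum.reindex[OF inj, of "\<lambda>x. f x *\<^sub>R x"] by simp
   then have "f (\<epsilon> l z) = co l z 0" using coS[OF l(1), of "\<lambda>k. f (\<epsilon> k z)"] by simp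
   then show "f x = 0" using l linear_map_on_zero[OF colin[OF z] sub] by simp
  qed simp
  have "dim (fibre E z) = r"
  proof -
   have "dim (span ((\<lambda>i. e i z) ` {..<r})) = card ((\<lambda>i. e i z) ` {..<r})"
    by (rule dim_span_eq_card_independent[OF frameD(4)[OF fr(1) W0(1)[OF z]]])
   then show ?thesis using frameD(5)[OF fr(1) W0(1)[OF z]] card_image[OF frameD(3)[OF fr(1) W0(1)[OF z]]] by simp
  qed
  moreover have "dim (span ?B) = r" using dim_span_eq_card_independent[OF ind] card_image[OF inj] by simp
  moreover have "span ?B \<subseteq> fibre E z" by (rule span_minimal[OF _ sub]) (use \<epsilon>f[OF z] in auto)
  ultimately have "span ?B = fibre E z"
   using fin_dim_space_dim_eq[OF fin_dim_fibre[OF W0(2)[OF z]] subspace_span] by simp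
  then obtain c where c: "a = (\<Sum>k<r. c k *\<^sub>R \<epsilon> k z)" using span_family[of a "\<lambda>k. \<epsilon> k z" r] a inj by auto
  have "co l z a = c l" if "l < r" for l unfolding c by (rule coS[OF that])
  then have "(\<Sum>k<r. co k z a *\<^sub>R \<epsilon> k z) = (\<Sum>k<r. c k *\<^sub>R \<epsilon> k z)" by (intro sum.cong) auto
  then show ?thesis using c by simp
 qed
 have crdco: "crd r e z a i = (\<Sum>k<r. \<phi> k i z * co k z a)" if z: "z \<in> W" "a \<in> fibre E z" "i < r" for z a i
 proof -
  have "(\<Sum>i<r. (\<Sum>k<r. \<phi> k i z * co k z a) *\<^sub>R e i z) = (\<Sum>k<r. \<Sum>i<r. (\<phi> k i z * co k z a) *\<^sub>R e i z)"
   by (subst sum.swap) (simp add: scaleR_sum_left)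
  also have "\<dots> = a"
   using coexp[OF z(1,2)] unfolding \<epsilon>_def by (simp add: scaleR_sum_right mult.commute)
  finally have eq: "(\<Sum>i<r. (\<Sum>k<r. \<phi> k i z * co k z a) *\<^sub>R e i z) = a" .
  show ?thesis
   using crd_unique[OF fr(1) W0(1)[OF z(1)] z(3), of "\<lambda>i. \<Sum>k<r. \<phi> k i z * co k z a"] unfolding eq .
 qed
 have "flat_frame E W r \<epsilon> co"
  unfolding flat_frame_def
 proof (intro conjI allI ballI impI; (elim conjE)?)
  show "open_punctured W" using W V by (auto simp: open_punctured_def)
  fix U s assume U: "open U" "U \<subseteq> W" and s: "\<forall>z\<in>U. s z \<in> fibre E z"
  have UV: "U \<subseteq> V" "U \<inter> V = U" using U W by auto
  show "smooth_section E U s \<longleftrightarrow> (\<forall>j<r. smooth_on U (\<lambda>z. co j z (s z)))"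
  proof
   assume "smooth_section E U s"
   then have "smooth_on U (\<lambda>z. crd r e z (s z) i)" if "i < r" for i
    using smooth_section_crd[OF fr(1) U(1) _ that] UV(2) by metis
   then show "\<forall>j<r. smooth_on U (\<lambda>z. co j z (s z))"
    unfolding co_def by (auto intro!: smooth_on_sum[OF U(1)] smooth_on_mult[OF U(1)] smooth_on_subset[OF s\<psi> U(2)])
  next
   assume co: "\<forall>j<r. smooth_on U (\<lambda>z. co j z (s z))"
   show "smooth_section E U s"
   proof (rule smooth_section_from_crd[OF fr(1) U(1) UV(1)])
    fix i assume i: "i < r"
    have "smooth_on U (\<lambda>z. \<Sum>k<r. \<phi> k i z * co k z (s z))"
     using co i by (auto intro!: smooth_on_sum[OF U(1)] smooth_on_mult[OF U(1)] smooth_on_subset[OF s\<phi> U(2)])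
    then show "smooth_on U (\<lambda>z. crd r e z (s z) i)"
     by (rule smooth_on_cong[OF U(1), rotated]) (use crdco[OF _ _ i] s U in auto)
   qed (use s in auto)
  qed
 next
  fix U s z v assume U: "open U" "U \<subseteq> W" and s: "smooth_section E U s" and z: "z \<in> U"
  have UV: "U \<subseteq> V" "U \<inter> V = U" and zW: "z \<in> W" "z \<in> V" using U W z by auto
  define f where "f i w = crd r e w (s w) i" for i w
  have sf: "smooth_on U (f i)" if "i < r" for i
   using smooth_section_crd[OF fr(1) U(1) s that] UV(2) by (simp add: f_def[abs_def])
  have nab: "nabla E s z v = (\<Sum>l<r. ((\<Sum>i<r. f i z * A i l v z) + frechet_derivative (f l) (at z) v) *\<^sub>R e l z)"
   using nabla[OF U(1) UV(1) s z, of v] by (simp add: f_def[abs_def])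
  have oU: "open_punctured U" using U W V by (auto simp: open_punctured_def)
  have nf: "nabla E s z v \<in> fibre E z"
   by (rule smooth_section_fibre[OF nablaD(1)[OF oU s] z W0(2)[OF zW(1)]])
  have "co l z (nabla E s z v) = frechet_derivative (\<lambda>w. co l w (s w)) (at z) v" if l: "l < r" for l
  proof -
   have "((\<lambda>w. co l w (s w)) has_derivative (\<lambda>v. \<Sum>i<r. \<psi> l i z * frechet_derivative (f i) (at z) v +
     (Re v * (\<Sum>j<r. A i j 1 z * \<psi> l j z) + Im v * (\<Sum>j<r. A i j \<i> z * \<psi> l j z)) * f i z)) (at z)"
    unfolding co_def f_def[symmetric]
    by (intro has_derivative_sum has_derivative_mult d\<psi> l zW smooth_on_has_derivative[OF sf z]) auto
   from fun_cong[OF frechet_derivative_at[OF this], of v]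
   have "frechet_derivative (\<lambda>w. co l w (s w)) (at z) v = (\<Sum>i<r. \<psi> l i z * frechet_derivative (f i) (at z) v +
     (Re v * (\<Sum>j<r. A i j 1 z * \<psi> l j z) + Im v * (\<Sum>j<r. A i j \<i> z * \<psi> l j z)) * f i z)" by (rule sym)
   also have "\<dots> = (\<Sum>i<r. \<psi> l i z * frechet_derivative (f i) (at z) v + (\<Sum>j<r. \<psi> l j z * (f i z * A i j v z)))"
   proof (rule sum.cong[OF refl])
    fix i assume "i \<in> {..<r}"
    then have i: "i < r" by simp
    have "(\<Sum>j<r. \<psi> l j z * (f i z * A i j v z)) = (\<Sum>j<r. Re v * (A i j 1 z * \<psi> l j z) * f i z + Im v * (A i j \<i> z * \<psi> l j z) * f i z)"
    proof (rule sum.cong[OF refl])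
     fix j assume "j \<in> {..<r}"
     then have a: "A i j v z = Re v * A i j 1 z + Im v * A i j \<i> z" by (intro Alin[OF _ i zW(2)]) simp
     show "\<psi> l j z * (f i z * A i j v z) = Re v * (A i j 1 z * \<psi> l j z) * f i z + Im v * (A i j \<i> z * \<psi> l j z) * f i z"
      unfolding a by (simp add: distrib_left mult_ac)
    qed
    also have "\<dots> = (Re v * (\<Sum>j<r. A i j 1 z * \<psi> l j z) + Im v * (\<Sum>j<r. A i j \<i> z * \<psi> l j z)) * f i z"
     by (simp add: sum.distrib sum_distrib_left sum_distrib_right distrib_right)
    finally show "\<psi> l i z * frechet_derivative (f i) (at z) v +
      (Re v * (\<Sum>j<r. A i j 1 z * \<psi> l j z) + Im v * (\<Sum>j<r. A i j \<i> z * \<psi> l j z)) * f i z =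
      \<psi> l i z * frechet_derivative (f i) (at z) v + (\<Sum>j<r. \<psi> l j z * (f i z * A i j v z))" by simp
   qed
   also have "\<dots> = (\<Sum>j<r. \<psi> l j z * ((\<Sum>i<r. f i z * A i j v z) + frechet_derivative (f j) (at z) v))"
   proof -
    have "(\<Sum>i<r. \<Sum>j<r. \<psi> l j z * (f i z * A i j v z)) = (\<Sum>j<r. \<psi> l j z * (\<Sum>i<r. f i z * A i j v z))"
     by (subst sum.swap) (simp add: sum_distrib_left)
    then show ?thesis by (simp add: sum.distrib distrib_left)
   qed
   also have "\<dots> = co l z (nabla E s z v)"
    unfolding co_def nab using crd_unique[OF fr(1) zW(2)] by (intro sum.cong) auto
   finally show ?thesis ..
  qed
  then have "(\<Sum>j<r. frechet_derivative (\<lambda>z. co j z (s z)) (at z) v *\<^sub>R \<epsilon> j z) = (\<Sum>j<r. co j z (nabla E s z v) *\<^sub>R \<epsilon> j z)"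
   by (intro sum.cong) auto
  then show "nabla E s z v = (\<Sum>j<r. frechet_derivative (\<lambda>z. co j z (s z)) (at z) v *\<^sub>R \<epsilon> j z)"
   using coexp[OF zW(1) nf] by simp
 qed (use \<epsilon>f colin co\<epsilon> coexp in auto)
 then show thesis using that W(2) by blast
qed

end

section \<open>Flat sections along maps and parallel transport\<close>

text \<open>
 A section along a map \<open>c\<close> into the punctured plane that comes from a flat section near a point. This covers
 flat sections along paths as well as along the exponential map, where the monodromy disappears.
\<close>

definition lflat :: "'v::real_vector vbundle \<Rightarrow> ('a::topological_space \<Rightarrow> complex) \<Rightarrow> 'a set \<Rightarrow> ('a \<Rightarrow> 'v) \<Rightarrow> 'a \<Rightarrow> bool" where
 "lflat E c X \<sigma> x \<longleftrightarrow> (\<exists>U s. open_punctured U \<and> c x \<in> U \<and> flat_section E U s \<and>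
   (\<forall>\<^sub>F x' in nhds x. x' \<in> X --> \<sigma> x' = s (c x')))"

definition flat_along :: "'v::real_vector vbundle \<Rightarrow> ('a::topological_space \<Rightarrow> complex) \<Rightarrow> 'a set \<Rightarrow> ('a \<Rightarrow> 'v) \<Rightarrow> bool" where
 "flat_along E c X \<sigma> \<longleftrightarrow> (\<forall>x\<in>X. lflat E c X \<sigma> x)"

lemma flat_along_circle_iff: "flat_along_circle E z \<sigma> \<longleftrightarrow> flat_along E (\<lambda>t. z * cis t) UNIV \<sigma>"
 by (simp add: flat_along_circle_def flat_along_def lflat_def)

lemma lflat_subset:
 assumes "lflat E c X \<sigma> x" "Y \<subseteq> X" shows "lflat E c Y \<sigma> x"
proof -
 obtain U s where Us: "open_punctured U" "c x \<in> U" "flat_section E U s"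
  "\<forall>\<^sub>F x' in nhds x. x' \<in> X --> \<sigma> x' = s (c x')" using assms(1) unfolding lflat_def by metis
 from Us(4) have "\<forall>\<^sub>F x' in nhds x. x' \<in> Y --> \<sigma> x' = s (c x')"
  by (rule eventually_mono) (use assms(2) in auto)
 then show ?thesis using Us(1-3) unfolding lflat_def by blast
qed

lemma flat_along_subset: "flat_along E c X \<sigma> ==> Y \<subseteq> X ==> flat_along E c Y \<sigma>"
 unfolding flat_along_def by (meson lflat_subset subsetD)

lemma lflat_cong:
 assumes "lflat E c X \<sigma> x" "\<forall>\<^sub>F x' in nhds x. x' \<in> Y --> x' \<in> X \<and> \<tau> x' = \<sigma> x'" shows "lflat E c Y \<tau> x"
proof -
 obtain U s where Us: "open_punctured U" "c x \<in> U" "flat_section E U s"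
  "\<forall>\<^sub>F x' in nhds x. x' \<in> X --> \<sigma> x' = s (c x')" using assms(1) unfolding lflat_def by metis
 have "\<forall>\<^sub>F x' in nhds x. x' \<in> Y --> \<tau> x' = s (c x')"
  using Us(4) assms(2) by eventually_elim auto
 then show ?thesis using Us(1-3) unfolding lflat_def by blast
qed

lemma lflat_compose:
 assumes "lflat E c UNIV \<sigma> (g x)" "isCont g x" shows "lflat E (\<lambda>x. c (g x)) UNIV (\<lambda>x. \<sigma> (g x)) x"
proof -
 obtain U s where Us: "open_punctured U" "c (g x) \<in> U" "flat_section E U s"
  "\<forall>\<^sub>F y in nhds (g x). \<sigma> y = s (c y)" using assms(1) unfolding lflat_def by auto
 have "filterlim g (nhds (g x)) (nhds x)" using assms(2) by (simp add: isCont_def tendsto_at_iff_tendsto_nhds)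
 from eventually_compose_filterlim[OF Us(4) this] show ?thesis using Us(1-3) unfolding lflat_def by auto
qed

lemma continuous_on_eventually:
 assumes "continuous_on X c" "x \<in> X" "open B" "c x \<in> B"
 shows "\<forall>\<^sub>F x' in nhds x. x' \<in> X --> c x' \<in> B"
 using assms unfolding continuous_on_topological eventually_nhds by meson

context fbun
begin

lemma flat_frame_const_section:
 assumes ff: "flat_frame E W r \<epsilon> co" shows "flat_section E W (\<lambda>z. \<Sum>j<r. \<alpha> j *\<^sub>R \<epsilon> j z)"
proof -
 note f = flat_frameD[OF ff]
 have W0: "z \<noteq> 0" if "z \<in> W" for z using f(2) that by auto
 have fib: "(\<Sum>j<r. \<alpha> j *\<^sub>R \<epsilon> j z) \<in> fibre E z" if "z \<in> W" for z
  by (intro subspace_sum subspace_scale subspace_fibre[OF W0[OF that]]) (use f(3)[OF that] in auto)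
 have co: "co j z (\<Sum>j<r. \<alpha> j *\<^sub>R \<epsilon> j z) = \<alpha> j" if "z \<in> W" "j < r" for z j
  by (rule flat_frame_co_sum[OF ff that(1) subspace_fibre[OF W0[OF that(1)]] that(2)])
 have sm: "smooth_section E W (\<lambda>z. \<Sum>j<r. \<alpha> j *\<^sub>R \<epsilon> j z)"
 proof (rule iffD2[OF f(7)[OF f(1) order_refl fib]], assumption, intro allI impI)
  fix j assume "j < r"
  then show "smooth_on W (\<lambda>z. co j z (\<Sum>j<r. \<alpha> j *\<^sub>R \<epsilon> j z))"
   by (intro smooth_on_cong[OF f(1) _ smooth_on_const[OF f(1), of "\<alpha> j"]]) (use co in auto)
 qed
 have "nabla E (\<lambda>z. \<Sum>j<r. \<alpha> j *\<^sub>R \<epsilon> j z) z v = 0" if z: "z \<in> W" for z v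
  unfolding f(8)[OF f(1) order_refl sm z]
 proof (rule sum.neutral, rule ballI)
  fix j assume "j \<in> {..<r}"
  then have j: "j < r" by simp
  have "frechet_derivative (\<lambda>z. co j z (\<Sum>j<r. \<alpha> j *\<^sub>R \<epsilon> j z)) (at z) = frechet_derivative (\<lambda>_. \<alpha> j) (at z)"
   by (rule frechet_derivative_cong_open(1)[OF f(1) z]) (use co j in auto)
  then show "frechet_derivative (\<lambda>z. co j z (\<Sum>j<r. \<alpha> j *\<^sub>R \<epsilon> j z)) (at z) v *\<^sub>R \<epsilon> j z = 0" by simp
 qed
 then show ?thesis using sm by (simp add: flat_section_def)
qed

lemma flat_section_coords:
 assumes ff: "flat_frame E W r \<epsilon> co" and B: "open B" "convex B" "B \<subseteq> W" and s: "flat_section E B s"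
  and z: "z \<in> B" and w: "w \<in> B"
 shows "s w = (\<Sum>j<r. co j z (s z) *\<^sub>R \<epsilon> j w)"
proof -
 note f = flat_frameD[OF ff]
 have W0: "z \<noteq> 0" if "z \<in> B" for z using f(2) B(3) that by auto
 have sm: "smooth_section E B s" and nab: "nabla E s z v = 0" if "z \<in> B" for z v
  using s that z by (auto simp: flat_section_def)
 note sm = sm[OF z]
 have fib: "s z \<in> fibre E z" if "z \<in> B" for z by (rule smooth_section_fibre[OF sm that W0[OF that]])
 have smj: "smooth_on B (\<lambda>z. co j z (s z))" if "j < r" for j
  using f(7)[OF B(1,3) fib] sm that by blast
 have "((\<lambda>z. co j z (s z)) has_derivative (\<lambda>v. 0)) (at z)" if z: "z \<in> B" and j: "j < r" for z j
 proof -
  have zW: "z \<in> W" using z B by auto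
  have "frechet_derivative (\<lambda>z. co j z (s z)) (at z) v = 0" for v
  proof -
   have "(\<Sum>j<r. frechet_derivative (\<lambda>z. co j z (s z)) (at z) v *\<^sub>R \<epsilon> j z) = 0"
    using f(8)[OF B(1,3) sm z, of v] nab[OF z, of v] by simp
   then have "co j z 0 = frechet_derivative (\<lambda>z. co j z (s z)) (at z) v"
    using flat_frame_co_sum[OF ff zW subspace_fibre[OF W0[OF z]] j, of "\<lambda>j. frechet_derivative (\<lambda>z. co j z (s z)) (at z) v"]
    by simp
   then show ?thesis using linear_map_on_zero[OF f(4)[OF zW j] subspace_fibre[OF W0[OF z]]] by simp
  qed
  then have "frechet_derivative (\<lambda>z. co j z (s z)) (at z) = (\<lambda>v. 0)" by (rule ext)
  then show ?thesis using smooth_on_has_derivative[OF smj[OF j] z] by simp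
 qed
 then have "co j w (s w) = co j z (s z)" if "j < r" for j
  using has_derivative_zero_unique[OF B(2), of "\<lambda>z. co j z (s z)" w z] w z that has_derivative_at_withinI by blast
 then have "(\<Sum>j<r. co j z (s z) *\<^sub>R \<epsilon> j w) = (\<Sum>j<r. co j w (s w) *\<^sub>R \<epsilon> j w)" by (intro sum.cong) auto
 also have "\<dots> = s w" by (rule f(6)) (use fib w B in auto)
 finally show ?thesis ..
qed

lemma lflatD:
 assumes fl: "lflat E c X \<sigma> x" and ff: "flat_frame E W r \<epsilon> co" and c: "continuous_on X c"
  and x: "x \<in> X" "c x \<in> W"
 shows "\<forall>\<^sub>F x' in nhds x. x' \<in> X --> c x' \<in> W \<and> \<sigma> x' = (\<Sum>j<r. co j (c x) (\<sigma> x) *\<^sub>R \<epsilon> j (c x'))"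
proof -
 obtain U s where Us: "open_punctured U" "c x \<in> U" "flat_section E U s"
  and ev: "\<forall>\<^sub>F x' in nhds x. x' \<in> X --> \<sigma> x' = s (c x')" using fl unfolding lflat_def by metis
 have "open (U \<inter> W)" using Us(1) flat_frameD(1)[OF ff] by (auto simp: open_punctured_def)
 then obtain \<rho> where \<rho>: "\<rho> > 0" "ball (c x) \<rho> \<subseteq> U \<inter> W" using Us(2) x(2) open_contains_ball by (metis IntI)
 have sB: "flat_section E (ball (c x) \<rho>) s"
  using Us(3) \<rho>(2) smooth_section_subset unfolding flat_section_def by blast
 have sx: "\<sigma> x = s (c x)" using eventually_nhds_x_imp_x[OF ev] x(1) by blast
 have "\<forall>\<^sub>F x' in nhds x. x' \<in> X --> c x' \<in> ball (c x) \<rho>"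
  by (rule continuous_on_eventually[OF c x(1)]) (use \<rho> in auto)
 then show ?thesis using ev
 proof eventually_elim
  case (elim x')
  show ?case
  proof (intro impI conjI)
   assume "x' \<in> X"
   then have b: "c x' \<in> ball (c x) \<rho>" "\<sigma> x' = s (c x')" using elim by auto
   show "c x' \<in> W" using b(1) \<rho>(2) by blast
   show "\<sigma> x' = (\<Sum>j<r. co j (c x) (\<sigma> x) *\<^sub>R \<epsilon> j (c x'))"
    unfolding b(2) sx
    by (rule flat_section_coords[OF ff open_ball convex_ball _ sB _ b(1)]) (use \<rho> in auto)
  qed
 qed
qed

lemma lflatI:
 assumes "flat_frame E W r \<epsilon> co" "c x \<in> W"
  and "\<forall>\<^sub>F x' in nhds x. x' \<in> X --> \<sigma> x' = (\<Sum>j<r. \<alpha> j *\<^sub>R \<epsilon> j (c x'))"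
 shows "lflat E c X \<sigma> x"
 unfolding lflat_def
 by (rule exI[of _ W], rule exI[of _ "\<lambda>z. \<Sum>j<r. \<alpha> j *\<^sub>R \<epsilon> j z"])
  (use assms flat_frame_const_section[OF assms(1)] flat_frameD(1,2)[OF assms(1)] in \<open>auto simp: open_punctured_def\<close>)

lemma lflat_nonzero: assumes "lflat E c X \<sigma> x" shows "c x \<noteq> 0"
proof -
 obtain U where "open_punctured U" "c x \<in> U" using assms unfolding lflat_def by blast
 then show ?thesis unfolding open_punctured_def by metis
qed

lemma flat_along_fibre: assumes "flat_along E c X \<sigma>" "x \<in> X" shows "\<sigma> x \<in> fibre E (c x)"
proof -
 have l: "lflat E c X \<sigma> x" using assms by (auto simp: flat_along_def)
 obtain U s where Us: "open_punctured U" "c x \<in> U" "flat_section E U s"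
  and ev: "\<forall>\<^sub>F x' in nhds x. x' \<in> X --> \<sigma> x' = s (c x')" using l unfolding lflat_def by metis
 have "\<sigma> x = s (c x)" using eventually_nhds_x_imp_x[OF ev] assms(2) by blast
 then show ?thesis using smooth_section_fibre[of U s] Us(2,3) lflat_nonzero[OF l] by (simp add: flat_section_def)
qed

lemma flat_along_unique:
 assumes X: "connected X" "continuous_on X c" and fl: "flat_along E c X \<sigma>" "flat_along E c X \<tau>"
  and x0: "x0 \<in> X" "\<sigma> x0 = \<tau> x0" and x: "x \<in> X"
 shows "\<sigma> x = \<tau> x"
proof -
 have "\<forall>x\<in>X. eventually (\<lambda>y. (\<sigma> x = \<tau> x) = (\<sigma> y = \<tau> y)) (at x within X)"
 proof
  fix x assume x: "x \<in> X"
  have l: "lflat E c X \<sigma> x" "lflat E c X \<tau> x" using fl x by (auto simp: flat_along_def)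
  obtain W r \<epsilon> co where ff: "flat_frame E W r \<epsilon> co" "c x \<in> W"
   using flat_frame_exists[OF lflat_nonzero[OF l(1)]] .
  note f = flat_frameD[OF ff(1)]
  have "\<forall>\<^sub>F y in nhds x. y \<in> X --> (\<sigma> x = \<tau> x) = (\<sigma> y = \<tau> y)"
   using lflatD[OF l(1) ff(1) X(2) x ff(2)] lflatD[OF l(2) ff(1) X(2) x ff(2)]
  proof eventually_elim
   case (elim y)
   show ?case
   proof
    assume y: "y \<in> X"
    have yW: "c y \<in> W" and e: "\<sigma> y = (\<Sum>j<r. co j (c x) (\<sigma> x) *\<^sub>R \<epsilon> j (c y))" "\<tau> y = (\<Sum>j<r. co j (c x) (\<tau> x) *\<^sub>R \<epsilon> j (c y))"
     using elim y by blast+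
    show "(\<sigma> x = \<tau> x) = (\<sigma> y = \<tau> y)"
    proof
     assume "\<sigma> y = \<tau> y"
     have sub: "subspace (fibre E (c y))" using f(2) yW by (intro subspace_fibre) metis
     have "co j (c x) (\<sigma> x) = co j (c x) (\<tau> x)" if "j < r" for j
      using flat_frame_co_sum[OF ff(1) yW sub that, of "\<lambda>j. co j (c x) (\<sigma> x)"]
       flat_frame_co_sum[OF ff(1) yW sub that, of "\<lambda>j. co j (c x) (\<tau> x)"] e \<open>\<sigma> y = \<tau> y\<close> by simp
     then have "(\<Sum>j<r. co j (c x) (\<sigma> x) *\<^sub>R \<epsilon> j (c x)) = (\<Sum>j<r. co j (c x) (\<tau> x) *\<^sub>R \<epsilon> j (c x))"
      by (intro sum.cong) auto
     then show "\<sigma> x = \<tau> x"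
      using f(6)[OF ff(2) flat_along_fibre[OF fl(1) x]] f(6)[OF ff(2) flat_along_fibre[OF fl(2) x]] by simp
    qed (use e in simp)
   qed
  qed
  then show "eventually (\<lambda>y. (\<sigma> x = \<tau> x) = (\<sigma> y = \<tau> y)) (at x within X)"
   unfolding eventually_at_filter by eventually_elim auto
 qed
 from connected_local_const[OF X(1) x0(1) x this] show ?thesis using x0(2) by simp
qed

lemma flat_along_local_exists:
 assumes ff: "flat_frame E W r \<epsilon> co" and "\<And>x. x \<in> X ==> c x \<in> W"
 shows "flat_along E c X (\<lambda>x. \<Sum>j<r. \<alpha> j *\<^sub>R \<epsilon> j (c x))"
 unfolding flat_along_def
 by (intro ballI lflatI[where \<alpha> = \<alpha>, OF ff]) (use assms(2) in auto)

lemma flat_along_lincomb: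
 assumes c: "continuous_on X c" and fl: "flat_along E c X \<sigma>" "flat_along E c X \<tau>"
 shows "flat_along E c X (\<lambda>x. k *\<^sub>R \<sigma> x + \<tau> x)"
 unfolding flat_along_def
proof
 fix x assume x: "x \<in> X"
 have l: "lflat E c X \<sigma> x" "lflat E c X \<tau> x" using fl x by (auto simp: flat_along_def)
 obtain W r \<epsilon> co where ff: "flat_frame E W r \<epsilon> co" "c x \<in> W"
  using flat_frame_exists[OF lflat_nonzero[OF l(1)]] .
 have "\<forall>\<^sub>F x' in nhds x. x' \<in> X --> k *\<^sub>R \<sigma> x' + \<tau> x' =
   (\<Sum>j<r. (k * co j (c x) (\<sigma> x) + co j (c x) (\<tau> x)) *\<^sub>R \<epsilon> j (c x'))"
  using lflatD[OF l(1) ff(1) c x ff(2)] lflatD[OF l(2) ff(1) c x ff(2)]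
  by eventually_elim (simp add: scaleR_sum_right sum.distrib scaleR_add_left)
 then show "lflat E c X (\<lambda>x. k *\<^sub>R \<sigma> x + \<tau> x) x" by (rule lflatI[where c = c and x = x, OF ff])
qed

lemma flat_along_glue:
 fixes c :: "real \<Rightarrow> complex"
 assumes c: "continuous_on UNIV c" and st: "s \<le> t" "t \<le> u"
  and fl: "flat_along E c {s..t} \<sigma>" "flat_along E c {t..u} \<tau>" and eq: "\<sigma> t = \<tau> t"
 shows "flat_along E c {s..u} (\<lambda>y. if y \<le> t then \<sigma> y else \<tau> y)"
 unfolding flat_along_def
proof
 fix x assume x: "x \<in> {s..u}"
 have cc: "continuous_on X c" for X using c continuous_on_subset by blast
 consider "x < t" | "x > t" | "x = t" by linarith
 then show "lflat E c {s..u} (\<lambda>y. if y \<le> t then \<sigma> y else \<tau> y) x"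
 proof cases
  case 1
  then have l: "lflat E c {s..t} \<sigma> x" using fl(1) x by (auto simp: flat_along_def)
  have "\<forall>\<^sub>F x' in nhds x. x' < t" using 1 by (rule eventually_nhds_in_open[of "{..<t}", simplified])
  then show ?thesis by (intro lflat_cong[OF l]) (auto elim!: eventually_mono)
 next
  case 2
  then have l: "lflat E c {t..u} \<tau> x" using fl(2) x by (auto simp: flat_along_def)
  have "\<forall>\<^sub>F x' in nhds x. x' > t" using 2 by (rule eventually_nhds_in_open[of "{t<..}", simplified])
  then show ?thesis by (intro lflat_cong[OF l]) (auto elim!: eventually_mono)
 next
  case 3
  have l: "lflat E c {s..t} \<sigma> t" "lflat E c {t..u} \<tau> t" using fl st by (auto simp: flat_along_def)
  obtain W r \<epsilon> co where ff: "flat_frame E W r \<epsilon> co" "c t \<in> W"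
   using flat_frame_exists[OF lflat_nonzero[OF l(1)]] .
  have t: "t \<in> {s..t}" "t \<in> {t..u}" using st by auto
  have "\<forall>\<^sub>F x' in nhds t. x' \<in> {s..u} --> (if x' \<le> t then \<sigma> x' else \<tau> x') =
    (\<Sum>j<r. co j (c t) (\<sigma> t) *\<^sub>R \<epsilon> j (c x'))"
   using lflatD[OF l(1) ff(1) cc t(1) ff(2)] lflatD[OF l(2) ff(1) cc t(2) ff(2)]
   by eventually_elim (auto simp: eq)
  then show ?thesis unfolding 3 by (rule lflatI[where c = c and x = t, OF ff])
 qed
qed

lemma flat_along_interval_exists:
 fixes c :: "real \<Rightarrow> complex"
 assumes c: "continuous_on UNIV c" "\<And>t. c t \<noteq> 0" and "s \<le> t" and x: "x \<in> {s..t}" "a \<in> fibre E (c x)"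
 shows "\<exists>\<sigma>. flat_along E c {s..t} \<sigma> \<and> \<sigma> x = a"
proof -
 define P where "P s t \<longleftrightarrow> (\<forall>x\<in>{s..t}. \<forall>a\<in>fibre E (c x). \<exists>\<sigma>. flat_along E c {s..t} \<sigma> \<and> \<sigma> x = a)" for s t
 have "P s t"
 proof (rule Bolzano[OF \<open>s \<le> t\<close>])
  fix s t u assume P: "P s t" "P t u" "s \<le> t" "t \<le> u"
  show "P s u"
   unfolding P_def
  proof (intro ballI)
   fix x a assume x: "x \<in> {s..u}" and a: "a \<in> fibre E (c x)"
   show "\<exists>\<sigma>. flat_along E c {s..u} \<sigma> \<and> \<sigma> x = a"
   proof (cases "x \<le> t")
    case True
    then obtain \<sigma> where \<sigma>: "flat_along E c {s..t} \<sigma>" "\<sigma> x = a" using P(1) x a unfolding P_def by fastforce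
    then have "\<sigma> t \<in> fibre E (c t)" using flat_along_fibre[OF \<sigma>(1), of t] P(3) by auto
    then obtain \<tau> where \<tau>: "flat_along E c {t..u} \<tau>" "\<tau> t = \<sigma> t" using P(2,4) unfolding P_def by fastforce
    show ?thesis
     using flat_along_glue[OF c(1) P(3,4) \<sigma>(1) \<tau>(1) \<tau>(2)[symmetric]] \<sigma>(2) True
     by (intro exI[of _ "\<lambda>y. if y \<le> t then \<sigma> y else \<tau> y"]) auto
   next
    case False
    then obtain \<tau> where \<tau>: "flat_along E c {t..u} \<tau>" "\<tau> x = a" using P(2) x a unfolding P_def by fastforce
    then have "\<tau> t \<in> fibre E (c t)" using flat_along_fibre[OF \<tau>(1), of t] P(4) by auto
    then obtain \<sigma> where \<sigma>: "flat_along E c {s..t} \<sigma>" "\<sigma> t = \<tau> t" using P(1,3) unfolding P_def by fastforce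
    show ?thesis
     using flat_along_glue[OF c(1) P(3,4) \<sigma>(1) \<tau>(1) \<sigma>(2)] \<tau>(2) False
     by (intro exI[of _ "\<lambda>y. if y \<le> t then \<sigma> y else \<tau> y"]) auto
   qed
  qed
 next
  fix x
  obtain W r \<epsilon> co where ff: "flat_frame E W r \<epsilon> co" "c x \<in> W" using flat_frame_exists[OF c(2)] .
  note f = flat_frameD[OF ff(1)]
  have "open (c -` W)" using c(1) f(1) by (simp add: continuous_on_open_vimage)
  then obtain d where d: "d > 0" "ball x d \<subseteq> c -` W" using ff(2) open_contains_ball by (metis vimageI)
  show "\<exists>d>0. \<forall>s t. s \<le> x \<and> x \<le> t \<and> t - s < d --> P s t"
  proof (intro exI[of _ d] conjI allI impI d(1))
   fix s t assume st: "s \<le> x \<and> x \<le> t \<and> t - s < d"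
   have W: "c y \<in> W" if "y \<in> {s..t}" for y
   proof -
    have "y \<in> ball x d" using that st by (auto simp: dist_real_def)
    then show ?thesis using d(2) by auto
   qed
   show "P s t"
    unfolding P_def
   proof (intro ballI)
    fix y a assume y: "y \<in> {s..t}" and a: "a \<in> fibre E (c y)"
    show "\<exists>\<sigma>. flat_along E c {s..t} \<sigma> \<and> \<sigma> y = a"
     using flat_along_local_exists[OF ff(1), of "{s..t}" c "\<lambda>j. co j (c y) a"] W f(6)[OF W[OF y] a]
     by (intro exI[of _ "\<lambda>x. \<Sum>j<r. co j (c y) a *\<^sub>R \<epsilon> j (c x)"]) auto
   qed
  qed
 qed
 then show ?thesis using x unfolding P_def by blast
qed

lemma flat_along_line_exists:
 fixes c :: "real \<Rightarrow> complex"
 assumes c: "continuous_on UNIV c" "\<And>t. c t \<noteq> 0" and a: "a \<in> fibre E (c 0)"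
 shows "\<exists>\<sigma>. flat_along E c UNIV \<sigma> \<and> \<sigma> 0 = a"
proof -
 have cc: "continuous_on X c" for X using c continuous_on_subset by blast
 have "\<exists>\<sigma>. flat_along E c {- real n..real n} \<sigma> \<and> \<sigma> 0 = a" for n
  by (rule flat_along_interval_exists[OF c _ _ a]) auto
 then obtain \<sigma> where \<sigma>: "\<And>n. flat_along E c {- real n..real n} (\<sigma> n)" "\<And>n. \<sigma> n 0 = a" by metis
 have mono: "\<sigma> m y = \<sigma> n y" if "m \<le> n" "y \<in> {- real m..real m}" for m n y
  by (rule flat_along_unique[OF connected_Icc cc \<sigma>(1) flat_along_subset[OF \<sigma>(1)], of _ _ 0])
   (use that \<sigma>(2) in auto)
 define N where "N y = nat \<lceil>\<bar>y\<bar>\<rceil>" for y :: real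
 have N: "y \<in> {- real (N y)..real (N y)}" for y
 proof -
  have "\<bar>y\<bar> \<le> real (N y)" unfolding N_def by (simp add: of_nat_ceiling)
  then show ?thesis by auto
 qed
 define \<tau> where "\<tau> y = \<sigma> (N y) y" for y
 have "lflat E c UNIV \<tau> x" for x
 proof -
  define M where "M = Suc (N x)"
  have xM: "x \<in> {- real M<..<real M}" using N[of x] by (auto simp: M_def)
  have l: "lflat E c {- real M..real M} (\<sigma> M) x" using \<sigma>(1)[of M] xM by (auto simp: flat_along_def)
  have "\<forall>\<^sub>F y in nhds x. y \<in> {- real M<..<real M}" using xM by (intro eventually_nhds_in_open) auto
  then have "\<forall>\<^sub>F y in nhds x. y \<in> UNIV --> y \<in> {- real M..real M} \<and> \<tau> y = \<sigma> M y"
  proof eventually_elim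
   case (elim y)
   then have "\<bar>y\<bar> \<le> real M" by auto
   then have "N y \<le> M" unfolding N_def by (simp add: ceiling_le_iff nat_le_iff)
   then show ?case using elim mono[OF _ N[of y], of M] by (auto simp: \<tau>_def)
  qed
  then show ?thesis by (rule lflat_cong[OF l])
 qed
 moreover have "\<tau> 0 = a" by (simp add: \<tau>_def \<sigma>(2))
 ultimately show ?thesis by (auto simp: flat_along_def)
qed

text \<open>
 On the plane, transport first horizontally and then vertically. On each vertical line, the set of
 points near which the result is flat is open and closed.
\<close>

lemma flat_along_plane_exists:
 fixes c :: "complex \<Rightarrow> complex"
 assumes c: "continuous_on UNIV c" "\<And>t. c t \<noteq> 0" and b: "b \<in> fibre E (c 0)"
 shows "\<exists>\<sigma>. flat_along E c UNIV \<sigma> \<and> \<sigma> 0 = b"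
proof -
 have ch: "continuous_on UNIV (\<lambda>x. c (Complex x y))" and cv: "continuous_on X (\<lambda>y. c (Complex x y))" for x y X
  by (auto intro!: continuous_on_compose2[OF c(1)] continuous_intros simp: Complex_eq)
 have cc: "continuous_on X c" for X using c continuous_on_subset by blast
 obtain \<sigma>0 where \<sigma>0: "flat_along E (\<lambda>x. c (Complex x 0)) UNIV \<sigma>0" "\<sigma>0 0 = b"
  using flat_along_line_exists[OF ch[of 0] c(2)] b by (metis zero_complex.code)
 have "\<exists>\<tau>. flat_along E (\<lambda>y. c (Complex x y)) UNIV \<tau> \<and> \<tau> 0 = \<sigma>0 x" for x
  by (rule flat_along_line_exists[OF cv c(2)]) (use flat_along_fibre[OF \<sigma>0(1), of x] in auto)
 then obtain \<tau> where \<tau>: "\<And>x. flat_along E (\<lambda>y. c (Complex x y)) UNIV (\<tau> x)" "\<And>x. \<tau> x 0 = \<sigma>0 x" by metis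
 define \<sigma> where "\<sigma> u = \<tau> (Re u) (Im u)" for u
 define good where "good x y = lflat E c UNIV \<sigma> (Complex x y)" for x y
 have step: "\<exists>\<delta>>0. \<forall>y2. \<bar>y2 - y1\<bar> < \<delta> -->
   (\<forall>\<alpha>. (\<forall>\<^sub>F x in nhds x0. \<tau> x y2 = (\<Sum>j<r. \<alpha> j *\<^sub>R \<epsilon> j (c (Complex x y2)))) --> (\<forall>y. \<bar>y - y1\<bar> < \<delta> --> good x0 y))
   \<and> c (Complex x0 y2) \<in> W"
  if ff: "flat_frame E W r \<epsilon> co" "c (Complex x0 y1) \<in> W" for x0 y1 W r \<epsilon> co
 proof -
  have "open (c -` W)" using c(1) flat_frameD(1)[OF ff(1)] by (simp add: continuous_on_open_vimage)
  then obtain d where d: "d > 0" "ball (Complex x0 y1) d \<subseteq> c -` W" using ff(2) open_contains_ball by (metis vimageI)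
  have box: "c (Complex x y) \<in> W" if "\<bar>x - x0\<bar> < d / 2" "\<bar>y - y1\<bar> < d / 2" for x y
  proof -
   have "dist (Complex x0 y1) (Complex x y) \<le> \<bar>x0 - x\<bar> + \<bar>y1 - y\<bar>"
    using cmod_le[of "Complex x0 y1 - Complex x y"] by (simp add: dist_norm)
   also have "\<dots> < d" using that abs_minus_commute[of x x0] abs_minus_commute[of y y1] by linarith
   finally have "Complex x y \<in> ball (Complex x0 y1) d" by simp
   then show ?thesis using d(2) by auto
  qed
  have main: "good x0 y"
   if y2: "\<bar>y2 - y1\<bar> < d / 2" and ev: "\<forall>\<^sub>F x in nhds x0. \<tau> x y2 = (\<Sum>j<r. \<alpha> j *\<^sub>R \<epsilon> j (c (Complex x y2)))"
    and y: "\<bar>y - y1\<bar> < d / 2" for y2 y \<alpha>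
  proof -
   obtain e where e: "e > 0" "\<And>x. dist x x0 < e ==> \<tau> x y2 = (\<Sum>j<r. \<alpha> j *\<^sub>R \<epsilon> j (c (Complex x y2)))"
    using ev unfolding eventually_nhds_metric by blast
   define \<eta> where "\<eta> = min e (d / 2)"
   have eq: "\<tau> x y = (\<Sum>j<r. \<alpha> j *\<^sub>R \<epsilon> j (c (Complex x y)))" if x: "\<bar>x - x0\<bar> < \<eta>" and y: "\<bar>y - y1\<bar> < d / 2" for x y
   proof -
    let ?Y = "{y1 - d / 2<..<y1 + d / 2}"
    have Y: "z \<in> ?Y \<longleftrightarrow> \<bar>z - y1\<bar> < d / 2" for z unfolding greaterThanLessThan_iff by arith
    have W: "c (Complex x z) \<in> W" if "z \<in> ?Y" for z using box[of x z] x that by (simp add: Y \<eta>_def del: greaterThanLessThan_iff)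
    show ?thesis
    proof (rule flat_along_unique[of ?Y "\<lambda>y. c (Complex x y)" "\<tau> x" "\<lambda>y. \<Sum>j<r. \<alpha> j *\<^sub>R \<epsilon> j (c (Complex x y))" y2 y])
     show "flat_along E (\<lambda>y. c (Complex x y)) ?Y (\<tau> x)" by (rule flat_along_subset[OF \<tau>(1)]) simp
     show "flat_along E (\<lambda>y. c (Complex x y)) ?Y (\<lambda>y. \<Sum>j<r. \<alpha> j *\<^sub>R \<epsilon> j (c (Complex x y)))"
      by (rule flat_along_local_exists[OF ff(1) W])
     show "\<tau> x y2 = (\<Sum>j<r. \<alpha> j *\<^sub>R \<epsilon> j (c (Complex x y2)))"
      by (rule e(2)) (use x in \<open>simp add: \<eta>_def dist_real_def\<close>)
     show "y2 \<in> ?Y" "y \<in> ?Y" using y2 y Y by blast+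
    qed (use cv in auto)
   qed
   have "\<forall>\<^sub>F u in nhds (Complex x0 y). \<bar>Re u - x0\<bar> < \<eta> \<and> \<bar>Im u - y1\<bar> < d / 2"
    by (rule eventually_nhds_in_open[of "{u. \<bar>Re u - x0\<bar> < \<eta> \<and> \<bar>Im u - y1\<bar> < d / 2}", simplified mem_Collect_eq])
     (use y e d in \<open>auto simp: \<eta>_def intro!: open_Collect_conj open_Collect_less continuous_intros\<close>)
   then have "\<forall>\<^sub>F u in nhds (Complex x0 y). u \<in> UNIV --> \<sigma> u = (\<Sum>j<r. \<alpha> j *\<^sub>R \<epsilon> j (c u))"
    by eventually_elim (use eq in \<open>simp add: \<sigma>_def\<close>)
   moreover have "c (Complex x0 y) \<in> W" by (rule box) (use y d in auto)
   ultimately show ?thesis unfolding good_def by (intro lflatI[OF ff(1)])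
  qed
  show ?thesis
   by (rule exI[of _ "d / 2"]) (use main box d in auto)
 qed
 have frame: "\<exists>W r \<epsilon> co. flat_frame E W r \<epsilon> co \<and> c (Complex x y) \<in> W" for x y
  using flat_frame_exists[OF c(2)] by metis
 have good0: "good x0 0" for x0
 proof -
  obtain W r \<epsilon> co where ff: "flat_frame E W r \<epsilon> co" "c (Complex x0 0) \<in> W" using frame by blast
  have "lflat E (\<lambda>x. c (Complex x 0)) UNIV \<sigma>0 x0" using \<sigma>0(1) by (auto simp: flat_along_def)
  from lflatD[OF this ff(1) ch UNIV_I ff(2)]
  have "\<forall>\<^sub>F x in nhds x0. \<tau> x 0 = (\<Sum>j<r. co j (c (Complex x0 0)) (\<sigma>0 x0) *\<^sub>R \<epsilon> j (c (Complex x 0)))"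
   by eventually_elim (use \<tau>(2) in auto)
  note ev = this
  obtain \<delta> where \<delta>: "\<delta> > 0" and st: "\<forall>y2. \<bar>y2 - 0\<bar> < \<delta> -->
    (\<forall>\<alpha>. (\<forall>\<^sub>F x in nhds x0. \<tau> x y2 = (\<Sum>j<r. \<alpha> j *\<^sub>R \<epsilon> j (c (Complex x y2)))) --> (\<forall>y. \<bar>y - 0\<bar> < \<delta> --> good x0 y))
    \<and> c (Complex x0 y2) \<in> W"
   using step[OF ff] by (elim exE conjE) (rule that)
  have "\<bar>0 - 0 :: real\<bar> < \<delta>" using \<delta> by simp
  from st[rule_format, THEN conjunct1, rule_format, OF this ev this] show ?thesis .
 qed
 have "good x0 y" for x0 y
 proof -
  have "\<forall>y1\<in>UNIV. eventually (\<lambda>y. good x0 y1 = good x0 y) (at y1 within UNIV)"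
  proof
   fix y1 :: real
   obtain W r \<epsilon> co where ff: "flat_frame E W r \<epsilon> co" "c (Complex x0 y1) \<in> W" using frame by blast
   obtain \<delta> where \<delta>0: "\<delta> > 0" and st: "\<forall>y2. \<bar>y2 - y1\<bar> < \<delta> -->
    (\<forall>\<alpha>. (\<forall>\<^sub>F x in nhds x0. \<tau> x y2 = (\<Sum>j<r. \<alpha> j *\<^sub>R \<epsilon> j (c (Complex x y2)))) --> (\<forall>y. \<bar>y - y1\<bar> < \<delta> --> good x0 y))
    \<and> c (Complex x0 y2) \<in> W"
    using step[OF ff] by (elim exE conjE) (rule that)
   have \<delta>: "\<delta> > 0" "\<And>y2 \<alpha> y. \<bar>y2 - y1\<bar> < \<delta> ==>
     (\<forall>\<^sub>F x in nhds x0. \<tau> x y2 = (\<Sum>j<r. \<alpha> j *\<^sub>R \<epsilon> j (c (Complex x y2)))) ==> \<bar>y - y1\<bar> < \<delta> ==> good x0 y"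
     "\<And>y2. \<bar>y2 - y1\<bar> < \<delta> ==> c (Complex x0 y2) \<in> W"
    by (fact \<delta>0, rule st[rule_format, THEN conjunct1, rule_format], assumption+, rule st[rule_format, THEN conjunct2])
   have all: "good x0 y" if g: "good x0 y2" and y2: "\<bar>y2 - y1\<bar> < \<delta>" and y: "\<bar>y - y1\<bar> < \<delta>" for y2 y
   proof -
    let ?\<alpha> = "\<lambda>j. co j (c (Complex x0 y2)) (\<sigma> (Complex x0 y2))"
    have "\<forall>\<^sub>F u in nhds (Complex x0 y2). \<sigma> u = (\<Sum>j<r. ?\<alpha> j *\<^sub>R \<epsilon> j (c u))"
     using lflatD[OF g[unfolded good_def] ff(1) c(1) UNIV_I \<delta>(3)[OF y2]] by eventually_elim auto
    then obtain e where e: "e > 0" "\<And>u. dist u (Complex x0 y2) < e ==> \<sigma> u = (\<Sum>j<r. ?\<alpha> j *\<^sub>R \<epsilon> j (c u))"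
     unfolding eventually_nhds_metric by blast
    have "\<tau> x y2 = (\<Sum>j<r. ?\<alpha> j *\<^sub>R \<epsilon> j (c (Complex x y2)))" if "dist x x0 < e" for x
    proof -
     have "dist (Complex x y2) (Complex x0 y2) = dist x x0" by (simp add: dist_norm cmod_def)
     then show ?thesis using e(2)[of "Complex x y2"] that by (simp add: \<sigma>_def)
    qed
    then have "\<forall>\<^sub>F x in nhds x0. \<tau> x y2 = (\<Sum>j<r. ?\<alpha> j *\<^sub>R \<epsilon> j (c (Complex x y2)))"
     using e(1) unfolding eventually_nhds_metric by blast
    then show ?thesis by (rule \<delta>(2)[OF y2 _ y])
   qed
   have y1: "\<bar>y1 - y1\<bar> < \<delta>" using \<delta>0 by simp
   have "\<forall>y. dist y y1 < \<delta> --> good x0 y1 = good x0 y"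
    unfolding dist_real_def by (intro allI impI iffI) (erule all, rule y1, assumption, erule all, assumption, rule y1)
   then have "eventually (\<lambda>y. good x0 y1 = good x0 y) (nhds y1)"
    unfolding eventually_nhds_metric by (intro exI[of _ \<delta>] conjI \<delta>0)
   then show "eventually (\<lambda>y. good x0 y1 = good x0 y) (at y1 within UNIV)"
    unfolding eventually_at_filter by eventually_elim auto
  qed
  from connected_local_const[OF connected_UNIV UNIV_I UNIV_I this, of 0 y] show ?thesis using good0 by simp
 qed
 then have "flat_along E c UNIV \<sigma>" unfolding flat_along_def good_def by (metis complex.exhaust)
 moreover have "\<sigma> 0 = b" using \<tau>(2) \<sigma>0(2) by (simp add: \<sigma>_def)
 ultimately show ?thesis by blast
qed

lemma flat_lift_exists:
 assumes "b \<in> fibre E (exp w1)" shows "\<exists>\<sigma>. flat_along E exp UNIV \<sigma> \<and> \<sigma> w1 = b"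
proof -
 have "\<exists>\<sigma>. flat_along E (\<lambda>u. exp (w1 + u)) UNIV \<sigma> \<and> \<sigma> 0 = b"
  by (rule flat_along_plane_exists) (use assms in \<open>auto intro!: continuous_intros\<close>)
 then obtain \<sigma> where \<sigma>: "flat_along E (\<lambda>u. exp (w1 + u)) UNIV \<sigma>" "\<sigma> 0 = b" by blast
 have "lflat E (\<lambda>w. exp (w1 + (w - w1))) UNIV (\<lambda>w. \<sigma> (w - w1)) w" for w
  using \<sigma>(1) by (intro lflat_compose[where c = "\<lambda>u. exp (w1 + u)" and g = "\<lambda>w. w - w1"]) (auto simp: flat_along_def)
 then show ?thesis using \<sigma>(2) by (intro exI[of _ "\<lambda>w. \<sigma> (w - w1)"]) (simp add: flat_along_def)
qed

text \<open>\<open>T w\<close> is the flat transport from the fibre over \<open>1\<close> to the fibre over \<open>exp w\<close> along the path \<open>exp (t w)\<close>.\<close>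

definition T :: "complex \<Rightarrow> 'v \<Rightarrow> 'v" where
 "T w a = (SOME \<sigma>. flat_along E exp UNIV \<sigma> \<and> \<sigma> 0 = a) w"

lemma T_flat: assumes "a \<in> fibre E 1" shows "flat_along E exp UNIV (\<lambda>w. T w a)" "T 0 a = a"
proof -
 have "\<exists>\<sigma>. flat_along E exp UNIV \<sigma> \<and> \<sigma> 0 = a" using flat_lift_exists[of a 0] assms by simp
 from someI_ex[OF this] show "flat_along E exp UNIV (\<lambda>w. T w a)" "T 0 a = a" by (simp_all add: T_def)
qed

lemma cont_exp: "continuous_on X (exp :: complex \<Rightarrow> complex)" by (intro continuous_intros)

lemma flat_lift_eq:
 "flat_along E exp UNIV \<sigma> ==> flat_along E exp UNIV \<tau> ==> \<sigma> w0 = \<tau> w0 ==> \<sigma> w = \<tau> w"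
 by (rule flat_along_unique[OF connected_UNIV cont_exp, of \<sigma> \<tau> w0 w]) auto

lemma T_unique: assumes "flat_along E exp UNIV \<sigma>" shows "\<sigma> w = T w (\<sigma> 0)"
proof -
 have "\<sigma> 0 \<in> fibre E 1" using flat_along_fibre[OF assms, of 0] by simp
 from T_flat[OF this] show ?thesis using flat_lift_eq[OF assms, of "\<lambda>w. T w (\<sigma> 0)" 0 w] by simp
qed

lemma T_iso: "linear_iso (fibre E 1) (fibre E (exp w)) (T w)"
 unfolding linear_iso_def bij_betw_def
proof (intro conjI)
 show "linear_map_on (fibre E 1) (T w)"
  unfolding linear_map_on_def
 proof (intro conjI allI ballI)
  have lc: "T w (k *\<^sub>R x + y) = k *\<^sub>R T w x + T w y" if "x \<in> fibre E 1" "y \<in> fibre E 1" for k x y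
   using T_unique[OF flat_along_lincomb[OF cont_exp T_flat(1)[OF that(1)] T_flat(1)[OF that(2)]], of k w]
    T_flat(2)[OF that(1)] T_flat(2)[OF that(2)] by simp
  have z: "0 \<in> fibre E 1" using subspace_0[OF subspace_fibre] by simp
  have T0: "T w 0 = 0" using lc[OF z z, of 1] by simp
  show "T w (x + y) = T w x + T w y" if "x \<in> fibre E 1" "y \<in> fibre E 1" for x y using lc[OF that, of 1] by simp
  show "T w (k *\<^sub>R x) = k *\<^sub>R T w x" if "x \<in> fibre E 1" for k x using lc[OF that z, of k] T0 by simp
 qed
 show "inj_on (T w) (fibre E 1)"
 proof (rule inj_onI)
  fix x y assume xy: "x \<in> fibre E 1" "y \<in> fibre E 1" "T w x = T w y"
  then show "x = y"
   using flat_lift_eq[OF T_flat(1)[OF xy(1)] T_flat(1)[OF xy(2)], of w 0] T_flat(2) by simp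
 qed
 show "T w ` fibre E 1 = fibre E (exp w)"
 proof (intro equalityI subsetI)
  fix b assume "b \<in> T w ` fibre E 1"
  then obtain a where a: "a \<in> fibre E 1" "b = T w a" by blast
  show "b \<in> fibre E (exp w)" unfolding a(2) using flat_along_fibre[OF T_flat(1)[OF a(1)], of w] by simp
 next
  fix b assume "b \<in> fibre E (exp w)"
  then obtain \<sigma> where \<sigma>: "flat_along E exp UNIV \<sigma>" "\<sigma> w = b" using flat_lift_exists by blast
  have "\<sigma> 0 \<in> fibre E 1" using flat_along_fibre[OF \<sigma>(1), of 0] by simp
  then show "b \<in> T w ` fibre E 1" using T_unique[OF \<sigma>(1), of w] \<sigma>(2) by blast
 qed
qed

lemmas T_lin = linear_isoD[OF T_iso]

lemma T_surj: assumes "b \<in> fibre E (exp w)" obtains a where "a \<in> fibre E 1" "b = T w a"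
 using T_lin(3) assms by blast

lemma T_shift_period:
 assumes a: "a \<in> fibre E 1" shows "T (w + 2 * pi * \<i>) a = T w (T (2 * pi * \<i>) a)"
proof -
 have e: "exp (w + 2 * pi * \<i>) = exp w" for w :: complex
  using exp_plus_2pin[of w 1] by (simp add: mult_ac)
 have "lflat E (\<lambda>w. exp (w + 2 * pi * \<i>)) UNIV (\<lambda>w. T (w + 2 * pi * \<i>) a) w" for w
  using T_flat(1)[OF a]
  by (intro lflat_compose[where \<sigma> = "\<lambda>w. T w a" and g = "\<lambda>w. w + 2 * pi * \<i>"]) (auto simp: flat_along_def)
 then have "flat_along E (\<lambda>w. exp (w + 2 * pi * \<i>)) UNIV (\<lambda>w. T (w + 2 * pi * \<i>) a)" by (simp add: flat_along_def)
 then have "flat_along E exp UNIV (\<lambda>w. T (w + 2 * pi * \<i>) a)" unfolding e .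
 from T_unique[OF this, of w] show ?thesis by simp
qed

lemma flat_shift_T:
 assumes a: "a \<in> fibre E 1" shows "flat_shift E (exp w) \<theta> (T w a) = T (w + \<i> * \<theta>) a"
 unfolding flat_shift_def
proof (rule the_equality)
 have c: "exp (w + \<i> * complex_of_real t) = exp w * cis t" for t by (simp add: exp_add cis_conv_exp)
 have "lflat E (\<lambda>t. exp (w + \<i> * complex_of_real t)) UNIV (\<lambda>t. T (w + \<i> * complex_of_real t) a) t" for t
  using T_flat(1)[OF a]
  by (intro lflat_compose[where \<sigma> = "\<lambda>w. T w a" and g = "\<lambda>t. w + \<i> * complex_of_real t"])
   (auto simp: flat_along_def intro!: continuous_intros)
 then have fl: "flat_along_circle E (exp w) (\<lambda>t. T (w + \<i> * complex_of_real t) a)"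
  by (simp add: flat_along_circle_iff flat_along_def c)
 then show "\<exists>\<sigma>. flat_along_circle E (exp w) \<sigma> \<and> \<sigma> 0 = T w a \<and> \<sigma> \<theta> = T (w + \<i> * \<theta>) a"
  by (intro exI[of _ "\<lambda>t. T (w + \<i> * complex_of_real t) a"]) simp
 fix b assume "\<exists>\<sigma>. flat_along_circle E (exp w) \<sigma> \<and> \<sigma> 0 = T w a \<and> \<sigma> \<theta> = b"
 then obtain \<sigma> where \<sigma>: "flat_along_circle E (exp w) \<sigma>" "\<sigma> 0 = T w a" "\<sigma> \<theta> = b" by blast
 have "\<sigma> \<theta> = T (w + \<i> * complex_of_real \<theta>) a"
  by (rule flat_along_unique[OF connected_UNIV _ \<sigma>(1)[unfolded flat_along_circle_iff] fl[unfolded flat_along_circle_iff], of 0])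
   (use \<sigma>(2) in \<open>auto intro!: continuous_intros simp: cis_conv_exp\<close>)
 then show "b = T (w + \<i> * \<theta>) a" using \<sigma>(3) by simp
qed

lemma T_local:
 assumes ff: "flat_frame E W r \<epsilon> co" and w0: "exp w0 \<in> W"
 obtains \<rho> where "\<rho> > 0" "\<And>w. w \<in> ball w0 \<rho> ==> exp w \<in> W"
  "\<And>w a. w \<in> ball w0 \<rho> ==> a \<in> fibre E 1 ==> T w a = (\<Sum>j<r. co j (exp w0) (T w0 a) *\<^sub>R \<epsilon> j (exp w))"
proof -
 have "open (exp -` W)" using flat_frameD(1)[OF ff] by (intro open_vimage continuous_intros)
 then obtain \<rho> where \<rho>: "\<rho> > 0" "ball w0 \<rho> \<subseteq> exp -` W" using w0 open_contains_ball by (metis vimageI)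
 have W: "exp w \<in> W" if "w \<in> ball w0 \<rho>" for w using \<rho>(2) that by blast
 have "T w a = (\<Sum>j<r. co j (exp w0) (T w0 a) *\<^sub>R \<epsilon> j (exp w))" if w: "w \<in> ball w0 \<rho>" and a: "a \<in> fibre E 1" for w a
 proof (rule flat_along_unique[OF connected_ball cont_exp flat_along_subset[OF T_flat(1)[OF a] subset_UNIV]
    flat_along_local_exists[OF ff W]])
  show "w0 \<in> ball w0 \<rho>" using \<rho> by simp
  show "T w0 a = (\<Sum>j<r. co j (exp w0) (T w0 a) *\<^sub>R \<epsilon> j (exp w0))"
   using flat_frameD(6)[OF ff w0, of "T w0 a"] T_lin(4)[OF a] by simp
 qed (use w in auto)
 then show thesis using that[OF \<rho>(1) W] by blast
qed

end

section \<open>Bundle isomorphisms and flat pairings\<close>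

lemma exp_local_inverse:
 fixes w0 :: complex assumes "\<rho> > 0"
 shows "\<exists>B. open B \<and> exp w0 \<in> B \<and> (\<forall>z\<in>B. \<exists>w\<in>ball w0 \<rho>. exp w = z)"
proof -
 let ?l = "\<lambda>z. w0 + Ln (z / exp w0)"
 have "isCont ?l (exp w0)" by (intro continuous_intros) auto
 then obtain d where d: "d > 0" "\<And>z. dist z (exp w0) < d ==> dist (?l z) (?l (exp w0)) < \<rho>"
  using assms unfolding continuous_at_eps_delta by meson
 let ?B = "ball (exp w0) (min d (cmod (exp w0)))"
 have "\<exists>w\<in>ball w0 \<rho>. exp w = z" if z: "z \<in> ?B" for z
 proof
  have "z \<noteq> 0" using z by auto
  then show "exp (?l z) = z" by (simp add: exp_add)
  show "?l z \<in> ball w0 \<rho>" using d(2)[of z] z by (simp add: dist_commute)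
 qed
 then show ?thesis using d(1) by (intro exI[of _ ?B]) simp
qed

context fbun
begin

lemma T_local_ball:
 assumes ff: "flat_frame E W r \<epsilon> co" and w0: "exp w0 \<in> W"
 shows "\<exists>\<rho>. \<rho> > 0 \<and> (\<forall>w. w \<in> ball w0 \<rho> --> exp w \<in> W) \<and>
  (\<forall>w a. w \<in> ball w0 \<rho> --> a \<in> fibre E 1 --> T w a = (\<Sum>j<r. co j (exp w0) (T w0 a) *\<^sub>R \<epsilon> j (exp w)))"
proof (rule T_local[OF ff w0])
 fix \<rho> :: real assume "\<rho> > 0" and 1: "\<And>w. w \<in> ball w0 \<rho> ==> exp w \<in> W"
  and 2: "\<And>w a. w \<in> ball w0 \<rho> ==> a \<in> fibre E 1 ==> T w a = (\<Sum>j<r. co j (exp w0) (T w0 a) *\<^sub>R \<epsilon> j (exp w))"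
 then show ?thesis by (intro exI[of _ \<rho>] conjI allI impI) (fact | assumption)+
qed

end

text \<open>
 A bundle map with a constant matrix in suitable local flat frames.
\<close>

definition locally_constant_map ::
 "'v::real_vector vbundle \<Rightarrow> 'v vbundle \<Rightarrow> (complex \<Rightarrow> 'v \<Rightarrow> 'v) \<Rightarrow> bool" where
 "locally_constant_map E E' f \<longleftrightarrow>
  (\<forall>z. z \<noteq> 0 --> linear_map_on (fibre E z) (f z) \<and> f z ` fibre E z \<subseteq> fibre E' z) \<and>
  (\<forall>z0. z0 \<noteq> 0 --> (\<exists>W r \<epsilon> co W' r' \<epsilon>' co' B F. flat_frame E W r \<epsilon> co \<and> flat_frame E' W' r' \<epsilon>' co' \<and>
    open B \<and> z0 \<in> B \<and> B \<subseteq> W \<inter> W' \<and>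
    (\<forall>z\<in>B. \<forall>j<r. f z (\<epsilon> j z) = (\<Sum>k<r'. F k j *\<^sub>R \<epsilon>' k z))))"

lemma locally_constant_map_connection:
 assumes E: "fbun E" and E': "fbun E'" and f: "locally_constant_map E E' f"
  and U: "open_punctured U" and s: "smooth_section E U s"
 shows "smooth_section E' U (\<lambda>z. f z (s z))"
  and "z \<in> U ==> nabla E' (\<lambda>w. f w (s w)) z v = f z (nabla E s z v)"
proof -
 interpret E: fbun E by fact
 interpret E': fbun E' by fact
 have oU: "open U" "0 \<notin> U" using U by (auto simp: open_punctured_def)
 have lin: "linear_map_on (fibre E z) (f z)" "f z ` fibre E z \<subseteq> fibre E' z" if "z \<noteq> 0" for z
  using f that by (auto simp: locally_constant_map_def)
 have *: "\<exists>B. open B \<and> z0 \<in> B \<and> smooth_section E' (U \<inter> B) (\<lambda>z. f z (s z)) \<and>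
   nabla E' (\<lambda>w. f w (s w)) z0 v = f z0 (nabla E s z0 v)" if z0: "z0 \<in> U" for z0 v
 proof -
  have z00: "z0 \<noteq> 0" using oU z0 by auto
  obtain W r \<epsilon> co W' r' \<epsilon>' co' B F where ff: "flat_frame E W r \<epsilon> co" and ff': "flat_frame E' W' r' \<epsilon>' co'"
   and B: "open B" "z0 \<in> B" "B \<subseteq> W \<inter> W'"
   and F0: "\<forall>z\<in>B. \<forall>j<r. f z (\<epsilon> j z) = (\<Sum>k<r'. F k j *\<^sub>R \<epsilon>' k z)"
   using f[unfolded locally_constant_map_def, THEN conjunct2, rule_format, OF z00] by (elim exE conjE) (rule that)
  note F = F0[rule_format]
  note a = flat_frameD[OF ff] and a' = flat_frameD[OF ff']
  let ?B = "U \<inter> B"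
  have oB: "open ?B" "?B \<subseteq> W" "?B \<subseteq> W'" using oU B by auto
  have n0: "z \<noteq> 0" if "z \<in> ?B" for z using that oU by auto
  have sB: "smooth_section E ?B s" by (rule E.smooth_section_subset[OF s]) auto
  have sf: "s z \<in> fibre E z" if "z \<in> ?B" for z by (rule E.smooth_section_fibre[OF sB that n0[OF that]])
  have fco: "f z (\<Sum>j<r. c j *\<^sub>R \<epsilon> j z) = (\<Sum>k<r'. (\<Sum>j<r. F k j * c j) *\<^sub>R \<epsilon>' k z)" if z: "z \<in> ?B" for z c
  proof -
   have e: "\<epsilon> j z \<in> fibre E z" if "j < r" for j using a(3)[of z j] z oB that by auto
   have "f z (\<Sum>j<r. c j *\<^sub>R \<epsilon> j z) = (\<Sum>j<r. f z (c j *\<^sub>R \<epsilon> j z))"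
    by (rule linear_map_on_sum[OF lin(1)[OF n0[OF z]] E.subspace_fibre[OF n0[OF z]]])
     (use e E.subspace_fibre[OF n0[OF z]] subspace_scale in auto)
   also have "\<dots> = (\<Sum>j<r. \<Sum>k<r'. (F k j * c j) *\<^sub>R \<epsilon>' k z)"
    by (rule sum.cong) (use linear_map_on_scale[OF lin(1)[OF n0[OF z]] e] F z in \<open>auto simp: scaleR_sum_right mult.commute\<close>)
   also have "\<dots> = (\<Sum>k<r'. (\<Sum>j<r. F k j * c j) *\<^sub>R \<epsilon>' k z)"
    by (subst sum.swap) (simp add: scaleR_sum_left)
   finally show ?thesis .
  qed
  have co': "co' k z (f z (s z)) = (\<Sum>j<r. F k j * co j z (s z))" if z: "z \<in> ?B" and k: "k < r'" for z k
  proof -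
   have zW: "z \<in> W" "z \<in> W'" using z oB by auto
   have "f z (s z) = (\<Sum>k<r'. (\<Sum>j<r. F k j * co j z (s z)) *\<^sub>R \<epsilon>' k z)"
    using fco[OF z, of "\<lambda>j. co j z (s z)"] a(6)[OF zW(1) sf[OF z]] by simp
   then show ?thesis
    using flat_frame_co_sum[OF ff' zW(2) E'.subspace_fibre[OF n0[OF z]] k] by simp
  qed
  have smj: "smooth_on ?B (\<lambda>z. co j z (s z))" if "j < r" for j
   using iffD1[OF a(7)[OF oB(1,2) sf] sB] that by blast
  have sm': "smooth_section E' ?B (\<lambda>z. f z (s z))"
  proof (rule iffD2[OF a'(7)[OF oB(1,3)]])
   show "f z (s z) \<in> fibre E' z" if "z \<in> ?B" for z using lin(2)[OF n0[OF that]] sf[OF that] by blast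
   show "\<forall>k<r'. smooth_on ?B (\<lambda>z. co' k z (f z (s z)))"
   proof (intro allI impI)
    fix k assume k: "k < r'"
    have "smooth_on ?B (\<lambda>z. \<Sum>j<r. F k j * co j z (s z))"
     by (intro smooth_on_sum[OF oB(1)] smooth_on_mult[OF oB(1)] smooth_on_const[OF oB(1)] smj) auto
    then show "smooth_on ?B (\<lambda>z. co' k z (f z (s z)))"
     by (rule smooth_on_cong[OF oB(1), rotated]) (use co'[OF _ k] in simp)
   qed
  qed
  have zB: "z0 \<in> ?B" using z0 B by auto
  have fd: "frechet_derivative (\<lambda>z. co' k z (f z (s z))) (at z0) v =
    (\<Sum>j<r. F k j * frechet_derivative (\<lambda>z. co j z (s z)) (at z0) v)" if k: "k < r'" for k
  proof -
   have "((\<lambda>z. \<Sum>j<r. F k j * co j z (s z)) has_derivative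
     (\<lambda>v. \<Sum>j<r. F k j * frechet_derivative (\<lambda>z. co j z (s z)) (at z0) v)) (at z0)"
    by (intro has_derivative_sum has_derivative_mult_right smooth_on_has_derivative[OF smj zB]) auto
   from fun_cong[OF frechet_derivative_at[OF this], of v]
   show ?thesis using frechet_derivative_cong_open(1)[OF oB(1) zB co'[OF _ k]] by simp
  qed
  have "nabla E' (\<lambda>w. f w (s w)) z0 v = (\<Sum>k<r'. (\<Sum>j<r. F k j * frechet_derivative (\<lambda>z. co j z (s z)) (at z0) v) *\<^sub>R \<epsilon>' k z0)"
   unfolding a'(8)[OF oB(1,3) sm' zB] by (intro sum.cong) (use fd in auto)
  also have "\<dots> = f z0 (nabla E s z0 v)" unfolding a(8)[OF oB(1,2) sB zB] by (rule fco[OF zB, symmetric])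
  finally show ?thesis using sm' B by blast
 qed
 show "smooth_section E' U (\<lambda>z. f z (s z))" by (rule E'.smooth_section_local[OF U]) (use * in blast)
 show "z \<in> U ==> nabla E' (\<lambda>w. f w (s w)) z v = f z (nabla E s z v)" using * by blast
qed

text \<open>Two numbers with the same exponential differ by a multiple of the period.\<close>

lemma exp_period_induct:
 assumes step: "\<And>w. Q (w + 2 * pi * \<i>) \<longleftrightarrow> Q w" and Ln: "\<And>z. z \<noteq> 0 ==> Q (Ln z)"
 shows "Q w"
proof -
 have Qn: "Q (w + of_nat n * (2 * pi * \<i>)) \<longleftrightarrow> Q w" for w n
 proof (induction n)
  case (Suc n)
  have "w + of_nat (Suc n) * (2 * pi * \<i>) = (w + of_nat n * (2 * pi * \<i>)) + 2 * pi * \<i>" by (simp add: algebra_simps)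
  then show ?case by (simp only: step Suc)
 qed simp
 have Q0: "Q (Ln (exp w))" by (rule Ln) simp
 have "exp w = exp (Ln (exp w))" by simp
 then obtain n :: int where "w = Ln (exp w) + complex_of_real (of_int (2 * n) * pi) * \<i>" using exp_eq by blast
 then have n: "w = Ln (exp w) + of_int n * (2 * pi * \<i>)" by (simp add: mult_ac)
 show "Q w"
 proof (cases "n \<ge> 0")
  case True
  then have "of_int n = (of_nat (nat n) :: complex)" by simp
  with n have "w = Ln (exp w) + of_nat (nat n) * (2 * pi * \<i>)" by simp
  then show ?thesis using Qn[of "Ln (exp w)" "nat n"] Q0 by simp
 next
  case False
  then have "of_nat (nat (- n)) = (- of_int n :: complex)" by simp
  moreover have "Ln (exp w) = w - of_int n * (2 * pi * \<i>)" by (subst (2) n) simp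
  ultimately have "Ln (exp w) = w + of_nat (nat (- n)) * (2 * pi * \<i>)" by simp
  then show ?thesis using Qn[of w "nat (- n)"] Q0 by simp
 qed
qed

text \<open>
 An isomorphism of the fibres over \<open>1\<close> that intertwines the monodromies extends by parallel
 transport. The extension at \<open>exp w\<close> does not depend on the choice of \<open>w\<close>.
\<close>

locale transported_iso = A: fbun E + B: fbun E' for E E' :: "'v::real_vector vbundle" +
 fixes g :: "'v \<Rightarrow> 'v"
 assumes g: "linear_iso (fibre E 1) (fibre E' 1) g"
  and g_mon: "\<And>a. a \<in> fibre E 1 ==> g (A.T (2 * pi * \<i>) a) = B.T (2 * pi * \<i>) (g a)"
begin

definition ext :: "complex \<Rightarrow> 'v \<Rightarrow> 'v" where
 "ext z a = B.T (Ln z) (g (inv_into (fibre E 1) (A.T (Ln z)) a))"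

lemmas lin_g = linear_isoD[OF g]

lemma A_mon: "linear_iso (fibre E 1) (fibre E 1) (A.T (2 * pi * \<i>))"
 using A.T_iso[of "2 * pi * \<i>"] exp_two_pi_i by (simp add: mult.commute mult.left_commute)

lemma ext_T: assumes a: "a \<in> fibre E 1" shows "ext (exp w) (A.T w a) = B.T w (g a)"
proof -
 define Q where "Q w \<longleftrightarrow> (\<forall>a\<in>fibre E 1. ext (exp w) (A.T w a) = B.T w (g a))" for w
 have e: "exp (w + 2 * pi * \<i>) = exp w" for w :: complex
  using exp_plus_2pin[of w 1] by (simp add: mult_ac)
 note mon = linear_isoD[OF A_mon]
 have Qs: "Q (w + 2 * pi * \<i>) \<longleftrightarrow> Q w" for w
 proof
  assume Q: "Q w"
  show "Q (w + 2 * pi * \<i>)"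
   unfolding Q_def
  proof
   fix a assume a: "a \<in> fibre E 1"
   show "ext (exp (w + 2 * pi * \<i>)) (A.T (w + 2 * pi * \<i>) a) = B.T (w + 2 * pi * \<i>) (g a)"
    unfolding e A.T_shift_period[OF a] B.T_shift_period[OF lin_g(4)[OF a]] g_mon[OF a, symmetric]
    using Q mon(4)[OF a] unfolding Q_def by blast
  qed
 next
  assume Q: "Q (w + 2 * pi * \<i>)"
  show "Q w"
   unfolding Q_def
  proof
   fix a assume "a \<in> fibre E 1"
   then obtain b where b: "b \<in> fibre E 1" "a = A.T (2 * pi * \<i>) b" using mon(3) by blast
   have "ext (exp (w + 2 * pi * \<i>)) (A.T (w + 2 * pi * \<i>) b) = B.T (w + 2 * pi * \<i>) (g b)"
    using Q b(1) unfolding Q_def by blast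
   then show "ext (exp w) (A.T w a) = B.T w (g a)"
    unfolding e A.T_shift_period[OF b(1)] B.T_shift_period[OF lin_g(4)[OF b(1)]] g_mon[OF b(1), symmetric] b(2) .
  qed
 qed
 have Q0: "Q (Ln z)" if "z \<noteq> 0" for z
  unfolding Q_def ext_def using that inv_into_f_f[OF A.T_lin(2)] by simp
 have "Q w" by (rule exp_period_induct[of Q]) (fact Qs, fact Q0)
 then show ?thesis using a by (simp add: Q_def)
qed

lemma ext_iso: assumes "z \<noteq> 0" shows "linear_iso (fibre E z) (fibre E' z) (ext z)"
proof -
 have z: "exp (Ln z) = z" using assms by simp
 have 1: "linear_iso (fibre E z) (fibre E 1) (inv_into (fibre E 1) (A.T (Ln z)))"
  using linear_iso_inv[OF A.T_iso[of "Ln z"] A.subspace_fibre] z by simp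
 have 2: "linear_iso (fibre E' 1) (fibre E' z) (B.T (Ln z))" using B.T_iso[of "Ln z"] z by simp
 show ?thesis unfolding ext_def[abs_def] by (rule linear_iso_comp[OF linear_iso_comp[OF 1 g] 2])
qed

lemma ext_locally_constant: "locally_constant_map E E' ext"
 unfolding locally_constant_map_def
proof (intro conjI allI impI)
 fix z :: complex assume z: "z \<noteq> 0"
 show "linear_map_on (fibre E z) (ext z)" "ext z ` fibre E z \<subseteq> fibre E' z"
  using linear_isoD[OF ext_iso[OF z]] by auto
next
 fix z0 :: complex assume z0: "z0 \<noteq> 0"
 define w0 where "w0 = Ln z0"
 have e0: "exp w0 = z0" using z0 by (simp add: w0_def)
 obtain W r \<epsilon> co where ff: "flat_frame E W r \<epsilon> co" "z0 \<in> W" using A.flat_frame_exists[OF z0] .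
 obtain W' r' \<epsilon>' co' where ff': "flat_frame E' W' r' \<epsilon>' co'" "z0 \<in> W'" using B.flat_frame_exists[OF z0] .
 obtain \<rho> where r0: "\<rho> > 0" "\<forall>w. w \<in> ball w0 \<rho> --> exp w \<in> W"
  "\<forall>w a. w \<in> ball w0 \<rho> --> a \<in> fibre E 1 --> A.T w a = (\<Sum>j<r. co j (exp w0) (A.T w0 a) *\<^sub>R \<epsilon> j (exp w))"
  using A.T_local_ball[OF ff(1) ff(2)[folded e0]] by (elim exE conjE) (rule that)
 note \<rho> = r0[rule_format]
 obtain \<rho>' where r0p: "\<rho>' > 0" "\<forall>w. w \<in> ball w0 \<rho>' --> exp w \<in> W'"
  "\<forall>w a. w \<in> ball w0 \<rho>' --> a \<in> fibre E' 1 --> B.T w a = (\<Sum>j<r'. co' j (exp w0) (B.T w0 a) *\<^sub>R \<epsilon>' j (exp w))"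
  using B.T_local_ball[OF ff'(1) ff'(2)[folded e0]] by (elim exE conjE) (rule that)
 note \<rho>' = r0p[rule_format]
 have m0: "min \<rho> \<rho>' > 0" using \<rho>(1) \<rho>'(1) by simp
 obtain B where B0: "open B" "exp w0 \<in> B" "\<forall>z\<in>B. \<exists>w\<in>ball w0 (min \<rho> \<rho>'). exp w = z"
  using exp_local_inverse[OF m0, of w0] by (elim exE conjE) (rule that)
 note B = B0(1,2) B0(3)[rule_format]
 note a = flat_frameD[OF ff(1)]
 have "\<exists>b. b \<in> fibre E 1 \<and> A.T w0 b = \<epsilon> j z0" if "j < r" for j
  by (rule A.T_surj[of "\<epsilon> j z0" w0]) (use a(3)[OF ff(2) that] e0 in auto)
 then have "\<exists>b. \<forall>j. j < r --> b j \<in> fibre E 1 \<and> A.T w0 (b j) = \<epsilon> j z0" by (intro choice allI) blast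
 then obtain b where b: "\<And>j. j < r ==> b j \<in> fibre E 1" "\<And>j. j < r ==> A.T w0 (b j) = \<epsilon> j z0" by blast
 define F where "F k j = co' k (exp w0) (B.T w0 (g (b j)))" for k j
 have "ext z (\<epsilon> j z) = (\<Sum>k<r'. F k j *\<^sub>R \<epsilon>' k z) \<and> z \<in> W \<inter> W'" if z: "z \<in> B" and j: "j < r" for z j
 proof -
  obtain w where w: "w \<in> ball w0 \<rho>" "w \<in> ball w0 \<rho>'" "exp w = z" using B(3)[OF z] by auto
  have "A.T w (b j) = (\<Sum>i<r. (if i = j then 1 else 0) *\<^sub>R \<epsilon> i z)"
   unfolding \<rho>(3)[OF w(1) b(1)[OF j]] b(2)[OF j] w(3) e0 by (rule sum.cong) (use a(5)[OF ff(2) _ j] in auto)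
  also have "\<dots> = \<epsilon> j z" using j by (simp add: if_distrib[of "\<lambda>c. c *\<^sub>R _"] cong: if_cong)
  finally have "ext z (\<epsilon> j z) = B.T w (g (b j))" using ext_T[OF b(1)[OF j], of w] w(3) by simp
  then show ?thesis
   using \<rho>'(3)[OF w(2) lin_g(4)[OF b(1)[OF j]]] \<rho>(2)[OF w(1)] \<rho>'(2)[OF w(2)] w(3) by (simp add: F_def)
 qed
 moreover have "B \<subseteq> W \<inter> W'"
 proof
  fix z assume "z \<in> B"
  from B(3)[OF this] obtain w where w: "w \<in> ball w0 \<rho>" "w \<in> ball w0 \<rho>'" "exp w = z" by auto
  then show "z \<in> W \<inter> W'" using \<rho>(2)[OF w(1)] \<rho>'(2)[OF w(2)] by simp
 qed
 ultimately show "\<exists>W r \<epsilon> co W' r' \<epsilon>' co' B F. flat_frame E W r \<epsilon> co \<and> flat_frame E' W' r' \<epsilon>' co' \<and>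
    open B \<and> z0 \<in> B \<and> B \<subseteq> W \<inter> W' \<and> (\<forall>z\<in>B. \<forall>j<r. ext z (\<epsilon> j z) = (\<Sum>k<r'. F k j *\<^sub>R \<epsilon>' k z))"
  using ff(1) ff'(1) B(1,2) e0
  by (intro exI[of _ W] exI[of _ r] exI[of _ \<epsilon>] exI[of _ co] exI[of _ W'] exI[of _ r'] exI[of _ \<epsilon>'] exI[of _ co']
    exI[of _ B] exI[of _ F]) simp
qed

end

context fbun
begin

text \<open>A flat pairing of the fibres over \<open>z\<close> and \<open>c z\<close> is invariant under simultaneous parallel transport.\<close>

lemma flat_pairing_T:
 fixes P :: "complex \<Rightarrow> 'v \<Rightarrow> 'v \<Rightarrow> 'c::real_normed_vector"
 assumes P: "flat_pairing E c P" and c: "exp \<kappa> = c" and a: "a \<in> fibre E 1" and b: "b \<in> fibre E 1"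
 shows "P (exp w) (T w a) (T (w + \<kappa>) b) = P 1 a (T \<kappa> b)"
proof -
 define h where "h w = P (exp w) (T w a) (T (w + \<kappa>) b)" for w
 have ec: "exp (w + \<kappa>) = c * exp w" for w using c by (simp add: exp_add mult.commute)
 have bil: "bilinear_form_on (fibre E z) (fibre E (c * z)) (P z)" if "z \<noteq> 0" for z
  using P that by (auto simp: flat_pairing_def)
 have "\<forall>w0\<in>UNIV. eventually (\<lambda>w. h w0 = h w) (at w0 within UNIV)"
 proof
  fix w0 :: complex
  obtain W r \<epsilon> co where ff: "flat_frame E W r \<epsilon> co" "exp w0 \<in> W"
   by (rule flat_frame_exists[OF exp_not_eq_zero])
  obtain W' r' \<epsilon>' co' where ff': "flat_frame E W' r' \<epsilon>' co'" "exp (w0 + \<kappa>) \<in> W'"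
   by (rule flat_frame_exists[OF exp_not_eq_zero])
  obtain \<rho> where r0: "\<rho> > 0" "\<forall>w. w \<in> ball w0 \<rho> --> exp w \<in> W"
   "\<forall>w a. w \<in> ball w0 \<rho> --> a \<in> fibre E 1 --> T w a = (\<Sum>j<r. co j (exp w0) (T w0 a) *\<^sub>R \<epsilon> j (exp w))"
   using T_local_ball[OF ff(1) ff(2)] by (elim exE conjE) (rule that)
  note \<rho> = r0[rule_format]
  obtain \<rho>' where r0p: "\<rho>' > 0" "\<forall>w. w \<in> ball (w0 + \<kappa>) \<rho>' --> exp w \<in> W'"
   "\<forall>w a. w \<in> ball (w0 + \<kappa>) \<rho>' --> a \<in> fibre E 1 --> T w a = (\<Sum>j<r'. co' j (exp (w0 + \<kappa>)) (T (w0 + \<kappa>) a) *\<^sub>R \<epsilon>' j (exp w))"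
   using T_local_ball[OF ff'(1) ff'(2)] by (elim exE conjE) (rule that)
  note \<rho>' = r0p[rule_format]
  define s where "s z = (\<Sum>j<r. co j (exp w0) (T w0 a) *\<^sub>R \<epsilon> j z)" for z
  define t where "t z = (\<Sum>j<r'. co' j (exp (w0 + \<kappa>)) (T (w0 + \<kappa>) b) *\<^sub>R \<epsilon>' j z)" for z
  have fs: "flat_section E W s" and ft: "flat_section E W' t"
   unfolding s_def t_def by (rule flat_frame_const_section[OF ff(1)], rule flat_frame_const_section[OF ff'(1)])
  define U where "U = W \<inter> (\<lambda>z. c * z) -` W'"
  have oU: "open U" unfolding U_def
   by (intro open_Int open_vimage continuous_intros flat_frameD(1)[OF ff(1)] flat_frameD(1)[OF ff'(1)])
  have U: "open_punctured U" using oU flat_frameD(2)[OF ff(1)] by (auto simp: open_punctured_def U_def)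
  have n0: "z \<noteq> 0" "c * z \<noteq> 0" if "z \<in> U" for z using that U c by (auto simp: open_punctured_def)
  have ss: "smooth_section E U s" "smooth_section E ((\<lambda>z. c * z) ` U) t"
   by (rule smooth_section_subset[OF conjunct1[OF fs[unfolded flat_section_def]]], force simp: U_def,
     rule smooth_section_subset[OF conjunct1[OF ft[unfolded flat_section_def]]], force simp: U_def)
  have der: "((\<lambda>w. P w (s w) (t (c * w))) has_derivative (\<lambda>v. 0)) (at z)" if z: "z \<in> U" for z
  proof -
   have "((\<lambda>w. P w (s w) (t (c * w))) has_derivative
      (\<lambda>v. P z (nabla E s z v) (t (c * z)) + P z (s z) (nabla E t (c * z) (c * v)))) (at z)"
    by (rule P[unfolded flat_pairing_def, THEN conjunct2, rule_format, OF _ z]) (use U ss in simp)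
   moreover have "nabla E s z v = 0" "nabla E t (c * z) (c * v) = 0" for v
    using fs ft z by (auto simp: flat_section_def U_def)
   moreover have "t (c * z) \<in> fibre E (c * z)" "s z \<in> fibre E z"
    using smooth_section_fibre[OF ss(2), of "c * z"] smooth_section_fibre[OF ss(1) z] z n0[OF z] by auto
   then have "P z 0 (t (c * z)) = 0" "P z (s z) 0 = 0"
    using linear_map_on_zero[OF bilinear_form_onD(2)[OF bil] subspace_fibre] linear_map_on_zero[OF bilinear_form_onD(1)[OF bil] subspace_fibre]
     n0[OF z] by auto
   ultimately show ?thesis by simp
  qed
  have "exp w0 \<in> U" using ff(2) ff'(2) by (simp add: U_def ec)
  then obtain e where e: "e > 0" "ball (exp w0) e \<subseteq> U" using oU open_contains_ball by metis
  have const: "P z (s z) (t (c * z)) = P (exp w0) (s (exp w0)) (t (c * exp w0))" if "z \<in> ball (exp w0) e" for z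
  proof (rule has_derivative_zero_unique[OF convex_ball, of "exp w0" e "\<lambda>w. P w (s w) (t (c * w))" z "exp w0"])
   show "((\<lambda>w. P w (s w) (t (c * w))) has_derivative (\<lambda>h. 0)) (at x within ball (exp w0) e)"
    if "x \<in> ball (exp w0) e" for x
    by (rule has_derivative_at_withinI[OF der]) (rule subsetD[OF e(2) that])
  qed (use that e(1) in auto)
  have heq: "h w = P (exp w) (s (exp w)) (t (c * exp w))" if "w \<in> ball w0 (min \<rho> \<rho>')" for w
  proof -
   have w: "w \<in> ball w0 \<rho>" "w + \<kappa> \<in> ball (w0 + \<kappa>) \<rho>'" using that by (auto simp: dist_norm)
   show ?thesis unfolding h_def \<rho>(3)[OF w(1) a] \<rho>'(3)[OF w(2) b] s_def t_def ec ..
  qed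
  have "isCont exp w0" by (intro continuous_intros)
  then have "\<forall>\<^sub>F w in nhds w0. exp w \<in> ball (exp w0) e"
   using e(1) by (intro topological_tendstoD[OF _ open_ball]) (auto simp: isCont_def tendsto_at_iff_tendsto_nhds)
  moreover have "\<forall>\<^sub>F w in nhds w0. w \<in> ball w0 (min \<rho> \<rho>')"
   using \<rho>(1) \<rho>'(1) by (intro eventually_nhds_in_open) auto
  ultimately have "\<forall>\<^sub>F w in nhds w0. h w0 = h w"
  proof eventually_elim
   case (elim w)
   then show ?case using const[of "exp w"] heq[of w] heq[of w0] \<rho>(1) \<rho>'(1) by simp
  qed
  then show "eventually (\<lambda>w. h w0 = h w) (at w0 within UNIV)" unfolding eventually_at_filter by eventually_elim auto
 qed
 from connected_local_const[OF connected_UNIV UNIV_I UNIV_I this, of w 0]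
 show ?thesis using T_flat(2)[OF a] by (simp add: h_def)
qed

lemma T_frame_vectors:
 assumes ff: "flat_frame E W r \<epsilon> co" and w0: "exp w0 \<in> W"
 shows "\<exists>\<rho> b. \<rho> > 0 \<and> (\<forall>w. w \<in> ball w0 \<rho> --> exp w \<in> W) \<and> (\<forall>j. j < r --> b j \<in> fibre E 1) \<and>
  (\<forall>j w. j < r --> w \<in> ball w0 \<rho> --> T w (b j) = \<epsilon> j (exp w))"
proof -
 note a = flat_frameD[OF ff]
 obtain \<rho> where r0: "\<rho> > 0" "\<forall>w. w \<in> ball w0 \<rho> --> exp w \<in> W"
  "\<forall>w a. w \<in> ball w0 \<rho> --> a \<in> fibre E 1 --> T w a = (\<Sum>j<r. co j (exp w0) (T w0 a) *\<^sub>R \<epsilon> j (exp w))"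
  using T_local_ball[OF ff w0] by (elim exE conjE) (rule that)
 note \<rho> = r0[rule_format]
 have "\<exists>b. b \<in> fibre E 1 \<and> T w0 b = \<epsilon> j (exp w0)" if "j < r" for j
  by (rule T_surj[OF a(3)[OF w0 that]]) auto
 then have "\<exists>b. \<forall>j. j < r --> b j \<in> fibre E 1 \<and> T w0 (b j) = \<epsilon> j (exp w0)" by (intro choice allI) blast
 then obtain b where b: "\<And>j. j < r ==> b j \<in> fibre E 1" "\<And>j. j < r ==> T w0 (b j) = \<epsilon> j (exp w0)" by blast
 have "T w (b j) = \<epsilon> j (exp w)" if j: "j < r" and w: "w \<in> ball w0 \<rho>" for j w
 proof -
  have "T w (b j) = (\<Sum>i<r. (if i = j then 1 else 0) *\<^sub>R \<epsilon> i (exp w))"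
   unfolding \<rho>(3)[OF w b(1)[OF j]] b(2)[OF j] by (rule sum.cong) (use a(5)[OF w0 _ j] in auto)
  also have "\<dots> = \<epsilon> j (exp w)" using j by (simp add: if_distrib[of "\<lambda>c. c *\<^sub>R _"] cong: if_cong)
  finally show ?thesis .
 qed
 note bT = this
 show ?thesis
  by (intro exI[of _ \<rho>] exI[of _ b] conjI allI impI; (fact r0(1) | erule \<rho>(2) | erule b(1) | erule (1) bT))
qed

lemma flat_pairingI:
 fixes P :: "complex \<Rightarrow> 'v \<Rightarrow> 'v \<Rightarrow> 'c::real_normed_vector"
 assumes c: "exp \<kappa> = c" and bil: "\<And>z. z \<noteq> 0 ==> bilinear_form_on (fibre E z) (fibre E (c * z)) (P z)"
  and Q: "\<And>w a b. a \<in> fibre E 1 ==> b \<in> fibre E 1 ==> P (exp w) (T w a) (T (w + \<kappa>) b) = Q a b"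
 shows "flat_pairing E c P"
 unfolding flat_pairing_def
proof (intro conjI allI impI ballI)
 show "bilinear_form_on (fibre E z) (fibre E (c * z)) (P z)" if "z \<noteq> 0" for z by (rule bil[OF that])
 fix U s t z0 assume Ust: "open_punctured U \<and> smooth_section E U s \<and> smooth_section E ((\<lambda>z. c * z) ` U) t"
  and z0U: "z0 \<in> U"
 have c0: "c \<noteq> 0" using c by auto
 have U: "open U" "0 \<notin> U" and s: "smooth_section E U s" and t: "smooth_section E ((\<lambda>z. c * z) ` U) t"
  using Ust by (auto simp: open_punctured_def)
 have z0: "z0 \<noteq> 0" using U z0U by auto
 define w0 where "w0 = Ln z0"
 have e0: "exp w0 = z0" using z0 by (simp add: w0_def)
 have ec: "exp (w + \<kappa>) = c * exp w" for w using c by (simp add: exp_add mult.commute)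
 obtain W r \<epsilon> co where ff: "flat_frame E W r \<epsilon> co" "exp w0 \<in> W"
  by (rule flat_frame_exists[OF exp_not_eq_zero])
 obtain W' r' \<epsilon>' co' where ff': "flat_frame E W' r' \<epsilon>' co'" "exp (w0 + \<kappa>) \<in> W'"
  by (rule flat_frame_exists[OF exp_not_eq_zero])
 note f = flat_frameD[OF ff(1)] and f' = flat_frameD[OF ff'(1)]
 obtain \<rho> a where r0: "\<rho> > 0" "\<forall>w. w \<in> ball w0 \<rho> --> exp w \<in> W"
  "\<forall>j. j < r --> a j \<in> fibre E 1" "\<forall>j w. j < r --> w \<in> ball w0 \<rho> --> T w (a j) = \<epsilon> j (exp w)"
  using T_frame_vectors[OF ff(1) ff(2)] by (elim exE conjE) (rule that)
 note \<rho> = r0[rule_format]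
 obtain \<rho>' b where r0p: "\<rho>' > 0" "\<forall>w. w \<in> ball (w0 + \<kappa>) \<rho>' --> exp w \<in> W'"
  "\<forall>j. j < r' --> b j \<in> fibre E 1" "\<forall>j w. j < r' --> w \<in> ball (w0 + \<kappa>) \<rho>' --> T w (b j) = \<epsilon>' j (exp w)"
  using T_frame_vectors[OF ff'(1) ff'(2)] by (elim exE conjE) (rule that)
 note \<rho>' = r0p[rule_format]
 have m0: "min \<rho> \<rho>' > 0" using \<rho>(1) \<rho>'(1) by simp
 obtain B where B0: "open B" "exp w0 \<in> B" "\<forall>z\<in>B. \<exists>w\<in>ball w0 (min \<rho> \<rho>'). exp w = z"
  using exp_local_inverse[OF m0, of w0] by (elim exE conjE) (rule that)
 note B = B0(1,2) B0(3)[rule_format]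
 define q where "q j k = Q (a j) (b k)" for j k
 have BW: "z \<in> W \<and> c * z \<in> W'" and Pq: "\<And>j k. j < r ==> k < r' ==> P z (\<epsilon> j z) (\<epsilon>' k (c * z)) = q j k"
  if z: "z \<in> B" for z
 proof -
  obtain w where "w \<in> ball w0 (min \<rho> \<rho>')" and ez: "exp w = z" using B(3)[OF z] by blast
  then have w: "w \<in> ball w0 \<rho>" "w + \<kappa> \<in> ball (w0 + \<kappa>) \<rho>'" by (auto simp: dist_norm)
  show "z \<in> W \<and> c * z \<in> W'" using \<rho>(2)[OF w(1)] \<rho>'(2)[OF w(2)] ez ec by simp
  show "P z (\<epsilon> j z) (\<epsilon>' k (c * z)) = q j k" if "j < r" "k < r'" for j k
   using Q[OF \<rho>(3)[OF that(1)] \<rho>'(3)[OF that(2)], of w] \<rho>(4)[OF that(1) w(1)] \<rho>'(4)[OF that(2) w(2)] ez ec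
   by (simp add: q_def)
 qed
 define V where "V = U \<inter> B"
 have V: "open V" "V \<subseteq> W" "z0 \<in> V" "V \<subseteq> U" using U B BW z0U e0 by (auto simp: V_def)
 have nz: "z \<noteq> 0" "c * z \<noteq> 0" if "z \<in> V" for z using that U(2) V(4) c0 by auto
 have VW': "(\<lambda>z. c * z) ` V \<subseteq> W'" using BW by (auto simp: V_def)
 have oV': "open ((\<lambda>z. c * z) ` V)"
 proof -
  have "(\<lambda>z. c * z) ` V = (\<lambda>z. z / c) -` V" using c0 by (force simp: field_simps image_iff)
  then show ?thesis using V(1) c0 by (auto intro!: open_vimage continuous_intros)
 qed
 have sV: "smooth_section E V s" by (rule smooth_section_subset[OF s V(4)])
 have tV: "smooth_section E ((\<lambda>z. c * z) ` V) t" by (rule smooth_section_subset[OF t]) (use V(4) in auto)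
 have sf: "s z \<in> fibre E z" if "z \<in> V" for z by (rule smooth_section_fibre[OF sV that nz(1)[OF that]])
 have tf: "t z \<in> fibre E z" if "z \<in> (\<lambda>z. c * z) ` V" for z using smooth_section_fibre[OF tV that] nz(2) that by auto
 have smu: "smooth_on V (\<lambda>z. co j z (s z))" if "j < r" for j
  using iffD1[OF f(7)[OF V(1,2) sf] sV] that by blast
 have smv: "smooth_on ((\<lambda>z. c * z) ` V) (\<lambda>z. co' k z (t z))" if "k < r'" for k
  using iffD1[OF f'(7)[OF oV' VW' tf] tV] that by blast
 have expand: "P z x y = (\<Sum>j<r. \<Sum>k<r'. (co j z x * co' k (c * z) y) *\<^sub>R q j k)"
  if z: "z \<in> V" and x: "x \<in> fibre E z" and y: "y \<in> fibre E (c * z)" for z x y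
 proof -
  have zB: "z \<in> B" "z \<in> W" "c * z \<in> W'" using z BW by (auto simp: V_def)
  note b1 = bilinear_form_onD(1)[OF bil[OF nz(1)[OF z]]] and b2 = bilinear_form_onD(2)[OF bil[OF nz(1)[OF z]]]
  note s1 = subspace_fibre[OF nz(1)[OF z]] and s2 = subspace_fibre[OF nz(2)[OF z]]
  have e1: "\<epsilon> j z \<in> fibre E z" if "j < r" for j by (rule f(3)[OF zB(2) that])
  have e2: "\<epsilon>' k (c * z) \<in> fibre E (c * z)" if "k < r'" for k by (rule f'(3)[OF zB(3) that])
  have "P z x y = P z (\<Sum>j<r. co j z x *\<^sub>R \<epsilon> j z) y" using f(6)[OF zB(2) x] by simp
  also have "\<dots> = (\<Sum>j<r. P z (co j z x *\<^sub>R \<epsilon> j z) y)"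
   by (rule linear_map_on_sum[OF b2[OF y] s1]) (use e1 subspace_scale[OF s1] in auto)
  also have "\<dots> = (\<Sum>j<r. co j z x *\<^sub>R P z (\<epsilon> j z) y)"
   by (rule sum.cong) (use linear_map_on_scale[OF b2[OF y] e1] in auto)
  also have "\<dots> = (\<Sum>j<r. \<Sum>k<r'. (co j z x * co' k (c * z) y) *\<^sub>R q j k)"
  proof (rule sum.cong[OF refl])
   fix j assume "j \<in> {..<r}"
   then have j: "j < r" by simp
   have "P z (\<epsilon> j z) y = P z (\<epsilon> j z) (\<Sum>k<r'. co' k (c * z) y *\<^sub>R \<epsilon>' k (c * z))" using f'(6)[OF zB(3) y] by simp
   also have "\<dots> = (\<Sum>k<r'. P z (\<epsilon> j z) (co' k (c * z) y *\<^sub>R \<epsilon>' k (c * z)))"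
    by (rule linear_map_on_sum[OF b1[OF e1[OF j]] s2]) (use e2 subspace_scale[OF s2] in auto)
   also have "\<dots> = (\<Sum>k<r'. co' k (c * z) y *\<^sub>R q j k)"
    by (rule sum.cong) (use linear_map_on_scale[OF b1[OF e1[OF j]] e2] Pq[OF zB(1) j] in auto)
   finally show "co j z x *\<^sub>R P z (\<epsilon> j z) y = (\<Sum>k<r'. (co j z x * co' k (c * z) y) *\<^sub>R q j k)"
    by (simp add: scaleR_sum_right)
  qed
  finally show ?thesis .
 qed
 let ?Du = "\<lambda>j v. frechet_derivative (\<lambda>z. co j z (s z)) (at z0) v"
 let ?Dv = "\<lambda>k v. frechet_derivative (\<lambda>z. co' k z (t z)) (at (c * z0)) v"
 have cz0: "c * z0 \<in> (\<lambda>z. c * z) ` V" by (rule imageI[OF V(3)])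
 have dv: "((\<lambda>z. co' k (c * z) (t (c * z))) has_derivative (\<lambda>v. ?Dv k (c * v))) (at z0)" if "k < r'" for k
  by (rule has_derivative_compose[where f = "\<lambda>z. c * z" and g = "\<lambda>z. co' k z (t z)", OF _ smooth_on_has_derivative[OF smv[OF that] cz0]])
   (auto intro!: derivative_eq_intros)
 have "((\<lambda>z. \<Sum>j<r. \<Sum>k<r'. (co j z (s z) * co' k (c * z) (t (c * z))) *\<^sub>R q j k) has_derivative
   (\<lambda>v. \<Sum>j<r. \<Sum>k<r'. (co j z0 (s z0) * ?Dv k (c * v) + ?Du j v * co' k (c * z0) (t (c * z0))) *\<^sub>R q j k)) (at z0)"
  by (intro has_derivative_sum has_derivative_scaleR_left has_derivative_mult smooth_on_has_derivative[OF smu V(3)] dv) auto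
 moreover have "(\<Sum>j<r. \<Sum>k<r'. (co j z0 (s z0) * ?Dv k (c * v) + ?Du j v * co' k (c * z0) (t (c * z0))) *\<^sub>R q j k) =
   P z0 (nabla E s z0 v) (t (c * z0)) + P z0 (s z0) (nabla E t (c * z0) (c * v))" for v
 proof -
  have zW: "z0 \<in> W" "c * z0 \<in> W'" using V VW' by auto
  have nf: "nabla E s z0 v \<in> fibre E z0" unfolding f(8)[OF V(1,2) sV V(3)]
   by (intro subspace_sum subspace_scale subspace_fibre[OF nz(1)[OF V(3)]]) (use f(3)[OF zW(1)] in auto)
  have nf': "nabla E t (c * z0) (c * v) \<in> fibre E (c * z0)" unfolding f'(8)[OF oV' VW' tV cz0]
   by (intro subspace_sum subspace_scale subspace_fibre[OF nz(2)[OF V(3)]]) (use f'(3)[OF zW(2)] in auto)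
  have 1: "co j z0 (nabla E s z0 v) = ?Du j v" if "j < r" for j
   unfolding f(8)[OF V(1,2) sV V(3)] by (rule flat_frame_co_sum[OF ff(1) zW(1) subspace_fibre[OF nz(1)[OF V(3)]] that])
  have 2: "co' k (c * z0) (nabla E t (c * z0) (c * v)) = ?Dv k (c * v)" if "k < r'" for k
   unfolding f'(8)[OF oV' VW' tV cz0] by (rule flat_frame_co_sum[OF ff'(1) zW(2) subspace_fibre[OF nz(2)[OF V(3)]] that])
  show ?thesis
   unfolding expand[OF V(3) nf tf[OF cz0]] expand[OF V(3) sf[OF V(3)] nf'] sum.distrib[symmetric]
   by (intro sum.cong refl) (simp add: 1 2 scaleR_add_left add.commute)
 qed
 ultimately have "((\<lambda>z. \<Sum>j<r. \<Sum>k<r'. (co j z (s z) * co' k (c * z) (t (c * z))) *\<^sub>R q j k) has_derivative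
   (\<lambda>v. P z0 (nabla E s z0 v) (t (c * z0)) + P z0 (s z0) (nabla E t (c * z0) (c * v)))) (at z0)" by simp
 then show "((\<lambda>w. P w (s w) (t (c * w))) has_derivative
   (\<lambda>v. P z0 (nabla E s z0 v) (t (c * z0)) + P z0 (s z0) (nabla E t (c * z0) (c * v)))) (at z0)"
  by (rule has_derivative_transform_within_open[OF _ V(1,3)]) (rule expand[symmetric], assumption, erule sf, rule tf, erule imageI)
qed

end

section \<open>Isomorphism of flat bundles with pairing is an equivalence relation\<close>

text \<open>
 This isolates the bundle map of \<open>gamma_iso\<close>, so that inverses and composites can be given explicitly.
\<close>

definition gamma_iso_by :: "'v::real_vector gamma \<Rightarrow> 'v gamma \<Rightarrow> (complex \<Rightarrow> 'v \<Rightarrow> 'v) \<Rightarrow> bool" where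
 "gamma_iso_by = (\<lambda>(E, P) (E', P') f. (\<forall>z. z \<noteq> 0 --> linear_iso (fibre E z) (fibre E' z) (f z)) \<and>
     (\<forall>U s. open_punctured U \<and> (\<forall>z\<in>U. s z \<in> fibre E z) -->
       (smooth_section E U s \<longleftrightarrow> smooth_section E' U (\<lambda>z. f z (s z)))) \<and>
     (\<forall>U s. open_punctured U \<and> smooth_section E U s -->
       (\<forall>z\<in>U. \<forall>v. nabla E' (\<lambda>w. f w (s w)) z v = f z (nabla E s z v))) \<and>
     (\<forall>z. z \<noteq> 0 --> (\<forall>a \<in> fibre E z. \<forall>b \<in> fibre E (- z).
       P' z (f z a) (f (- z) b) = P z a b)))"

lemma gamma_iso_iff: "(x, y) \<in> gamma_iso m \<longleftrightarrow> x \<in> gamma_data m \<and> y \<in> gamma_data m \<and> (\<exists>f. gamma_iso_by x y f)"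
 unfolding gamma_iso_def gamma_iso_by_def by (cases x; cases y) simp

lemma gamma_iso_byD:
 assumes "gamma_iso_by (E, P) (E', P') f"
 shows "z \<noteq> 0 ==> linear_iso (fibre E z) (fibre E' z) (f z)"
  "open_punctured U ==> (\<And>z. z \<in> U ==> s z \<in> fibre E z) ==>
    (smooth_section E U s \<longleftrightarrow> smooth_section E' U (\<lambda>z. f z (s z)))"
  "open_punctured U ==> smooth_section E U s ==> z \<in> U ==>
    nabla E' (\<lambda>w. f w (s w)) z v = f z (nabla E s z v)"
  "z \<noteq> 0 ==> a \<in> fibre E z ==> b \<in> fibre E (- z) ==> P' z (f z a) (f (- z) b) = P z a b"
proof -
 note c = assms[unfolded gamma_iso_by_def prod.case]
 show "z \<noteq> 0 ==> linear_iso (fibre E z) (fibre E' z) (f z)" by (rule conjunct1[OF c, rule_format])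
 show "smooth_section E U s \<longleftrightarrow> smooth_section E' U (\<lambda>z. f z (s z))"
  if "open_punctured U" "\<And>z. z \<in> U ==> s z \<in> fibre E z"
  by (rule conjunct1[OF conjunct2[OF c], rule_format]) (use that in simp)
 show "nabla E' (\<lambda>w. f w (s w)) z v = f z (nabla E s z v)" if "open_punctured U" "smooth_section E U s" "z \<in> U"
  by (rule conjunct1[OF conjunct2[OF conjunct2[OF c]], rule_format, OF conjI[OF that(1,2)] that(3)])
 show "P' z (f z a) (f (- z) b) = P z a b" if "z \<noteq> 0" "a \<in> fibre E z" "b \<in> fibre E (- z)"
  by (rule conjunct2[OF conjunct2[OF conjunct2[OF c]], rule_format, OF that])
qed

lemma gamma_iso_byI:
 assumes "\<And>z. z \<noteq> 0 ==> linear_iso (fibre E z) (fibre E' z) (f z)"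
  "\<And>U s. open_punctured U ==> (\<And>z. z \<in> U ==> s z \<in> fibre E z) ==>
    (smooth_section E U s \<longleftrightarrow> smooth_section E' U (\<lambda>z. f z (s z)))"
  "\<And>U s z v. open_punctured U ==> smooth_section E U s ==> z \<in> U ==>
    nabla E' (\<lambda>w. f w (s w)) z v = f z (nabla E s z v)"
  "\<And>z a b. z \<noteq> 0 ==> a \<in> fibre E z ==> b \<in> fibre E (- z) ==> P' z (f z a) (f (- z) b) = P z a b"
 shows "gamma_iso_by (E, P) (E', P') f"
 unfolding gamma_iso_by_def prod.case
proof (intro conjI allI ballI impI)
 show "linear_iso (fibre E z) (fibre E' z) (f z)" if "z \<noteq> 0" for z by (rule assms(1)[OF that])
 show "smooth_section E U s \<longleftrightarrow> smooth_section E' U (\<lambda>z. f z (s z))"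
  if "open_punctured U \<and> (\<forall>z\<in>U. s z \<in> fibre E z)" for U s by (rule assms(2)) (use that in auto)
 show "nabla E' (\<lambda>w. f w (s w)) z v = f z (nabla E s z v)" if "open_punctured U \<and> smooth_section E U s" "z \<in> U" for U s z v
  by (rule assms(3)[OF conjunct1[OF that(1)] conjunct2[OF that(1)] that(2)])
 show "P' z (f z a) (f (- z) b) = P z a b" if "z \<noteq> 0" "a \<in> fibre E z" "b \<in> fibre E (- z)" for z a b
  by (rule assms(4)[OF that])
qed

lemma equiv_gamma_iso: "equiv (gamma_data m) (gamma_iso m)"
proof (rule equivI)
 show "gamma_iso m \<subseteq> gamma_data m \<times> gamma_data m" by (auto simp: gamma_iso_def)
 show "refl_on (gamma_data m) (gamma_iso m)"
  unfolding refl_on_def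
 proof
  fix x assume x: "x \<in> gamma_data m"
  obtain E P where xE: "x = (E, P)" by (cases x)
  have "gamma_iso_by x x (\<lambda>z a. a)" unfolding xE by (rule gamma_iso_byI) (simp_all add: linear_iso_id)
  then show "(x, x) \<in> gamma_iso m" using x unfolding gamma_iso_iff by blast
 qed
 show "sym (gamma_iso m)"
 proof (rule symI)
  fix x y assume "(x, y) \<in> gamma_iso m"
  then obtain f where gd: "x \<in> gamma_data m" "y \<in> gamma_data m" and fb: "gamma_iso_by x y f" unfolding gamma_iso_iff by blast
  obtain E P where x: "x = (E, P)" by (cases x)
  obtain E' P' where y: "y = (E', P')" by (cases y)
  have xy: "(E, P) \<in> gamma_data m" "(E', P') \<in> gamma_data m" using gd x y by simp_all
  note f = gamma_iso_byD(1)[OF fb[unfolded x y]] and fs = gamma_iso_byD(2)[OF fb[unfolded x y]]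
   and fn = gamma_iso_byD(3)[OF fb[unfolded x y]] and fP = gamma_iso_byD(4)[OF fb[unfolded x y]]
  interpret A: fbun E using xy by unfold_locales (auto simp: gamma_data_def)
  interpret B: fbun E' using xy by unfold_locales (auto simp: gamma_data_def)
  define h where "h z = inv_into (fibre E z) (f z)" for z
  have h: "linear_iso (fibre E' z) (fibre E z) (h z)" if "z \<noteq> 0" for z
   unfolding h_def by (rule linear_iso_inv[OF f[OF that] A.subspace_fibre[OF that]])
  have fh: "f z (h z b) = b" if "z \<noteq> 0" "b \<in> fibre E' z" for z b
   unfolding h_def using linear_isoD(3)[OF f[OF that(1)]] that(2) by (simp add: f_inv_into_f)
  have hf: "h z (f z a) = a" if "z \<noteq> 0" "a \<in> fibre E z" for z a
   unfolding h_def using linear_isoD(2)[OF f[OF that(1)]] that(2) by simp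
  have n0: "z \<noteq> 0" if "open_punctured U" "z \<in> U" for z U using that by (auto simp: open_punctured_def)
  have hsm: "smooth_section E' U s \<longleftrightarrow> smooth_section E U (\<lambda>z. h z (s z))"
   if U: "open_punctured U" and s: "\<And>z. z \<in> U ==> s z \<in> fibre E' z" for U s
  proof -
   have "h z (s z) \<in> fibre E z" if "z \<in> U" for z using linear_isoD(4)[OF h[OF n0[OF U that]] s[OF that]] .
   from fs[OF U this] have "smooth_section E U (\<lambda>z. h z (s z)) \<longleftrightarrow> smooth_section E' U (\<lambda>z. f z (h z (s z)))" .
   moreover have "smooth_section E' U (\<lambda>z. f z (h z (s z))) \<longleftrightarrow> smooth_section E' U s"
    using B.smooth_section_cong[of U "\<lambda>z. f z (h z (s z))" s] B.smooth_section_cong[of U s "\<lambda>z. f z (h z (s z))"]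
     fh n0[OF U] s by auto
   ultimately show ?thesis by simp
  qed
  have hn: "nabla E (\<lambda>w. h w (s w)) z v = h z (nabla E' s z v)"
   if U: "open_punctured U" and s: "smooth_section E' U s" and z: "z \<in> U" for U s z v
  proof -
   have sf: "s z \<in> fibre E' z" if "z \<in> U" for z by (rule B.smooth_section_fibre[OF s that n0[OF U that]])
   have hs: "smooth_section E U (\<lambda>w. h w (s w))" using hsm[OF U sf] s by blast
   have "nabla E' (\<lambda>w. f w (h w (s w))) z v = nabla E' s z v"
    by (rule B.nablaD(3)[OF U s _ z]) (use fh n0[OF U] sf in auto)
   then have "f z (nabla E (\<lambda>w. h w (s w)) z v) = nabla E' s z v" using fn[OF U hs z, of v] by simp
   moreover have "nabla E (\<lambda>w. h w (s w)) z v \<in> fibre E z"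
    by (rule A.smooth_section_fibre[OF A.nablaD(1)[OF U hs] z n0[OF U z]])
   ultimately show ?thesis using hf[OF n0[OF U z], of "nabla E (\<lambda>w. h w (s w)) z v"] by simp
  qed
  have hP: "P z (h z a) (h (- z) b) = P' z a b" if "z \<noteq> 0" "a \<in> fibre E' z" "b \<in> fibre E' (- z)" for z a b
  proof -
   have m: "- z \<noteq> 0" using that(1) by simp
   show ?thesis
    using fP[OF that(1) linear_isoD(4)[OF h[OF that(1)] that(2)] linear_isoD(4)[OF h[OF m] that(3)]]
     fh[OF that(1,2)] fh[OF m that(3)] by simp
  qed
  have "gamma_iso_by (E', P') (E, P) h" by (rule gamma_iso_byI; fact h hsm hn hP)
  then show "(y, x) \<in> gamma_iso m" using gd unfolding gamma_iso_iff x y by blast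
 qed
 show "trans (gamma_iso m)"
 proof (rule transI)
  fix x y z assume "(x, y) \<in> gamma_iso m" "(y, z) \<in> gamma_iso m"
  then obtain f g where gd: "x \<in> gamma_data m" "y \<in> gamma_data m" "z \<in> gamma_data m"
   and fb: "gamma_iso_by x y f" and gb: "gamma_iso_by y z g" unfolding gamma_iso_iff by blast
  obtain E P where x: "x = (E, P)" by (cases x)
  obtain E' P' where y: "y = (E', P')" by (cases y)
  obtain E'' P'' where z: "z = (E'', P'')" by (cases z)
  have xyz: "(E, P) \<in> gamma_data m" using gd x by simp_all
  note f = gamma_iso_byD(1)[OF fb[unfolded x y]] and fs = gamma_iso_byD(2)[OF fb[unfolded x y]]
   and fn = gamma_iso_byD(3)[OF fb[unfolded x y]] and fP = gamma_iso_byD(4)[OF fb[unfolded x y]]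
  note g = gamma_iso_byD(1)[OF gb[unfolded y z]] and gs = gamma_iso_byD(2)[OF gb[unfolded y z]]
   and gn = gamma_iso_byD(3)[OF gb[unfolded y z]] and gP = gamma_iso_byD(4)[OF gb[unfolded y z]]
  interpret A: fbun E using xyz by unfold_locales (auto simp: gamma_data_def)
  have n0: "z \<noteq> 0" if "open_punctured U" "z \<in> U" for z U using that by (auto simp: open_punctured_def)
  have fin: "f z a \<in> fibre E' z" if "z \<noteq> 0" "a \<in> fibre E z" for z a using linear_isoD(4)[OF f[OF that(1)] that(2)] .
  have 1: "linear_iso (fibre E z) (fibre E'' z) (\<lambda>a. g z (f z a))" if "z \<noteq> 0" for z
   by (rule linear_iso_comp[OF f[OF that] g[OF that]])
  have 2: "smooth_section E U s \<longleftrightarrow> smooth_section E'' U (\<lambda>z. g z (f z (s z)))"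
   if U: "open_punctured U" and s: "\<And>z. z \<in> U ==> s z \<in> fibre E z" for U s
   using fs[OF U s] gs[OF U, of "\<lambda>z. f z (s z)"] fin[OF n0[OF U] s] by blast
  have 3: "nabla E'' (\<lambda>w. g w (f w (s w))) z v = g z (f z (nabla E s z v))"
   if U: "open_punctured U" and s: "smooth_section E U s" and z: "z \<in> U" for U s z v
  proof -
   have sf: "s z \<in> fibre E z" if "z \<in> U" for z by (rule A.smooth_section_fibre[OF s that n0[OF U that]])
   have "smooth_section E' U (\<lambda>w. f w (s w))" using fs[OF U sf] s by blast
   from gn[OF U this z, of v] show ?thesis using fn[OF U s z, of v] by simp
  qed
  have 4: "P'' z (g z (f z a)) (g (- z) (f (- z) b)) = P z a b"
   if "z \<noteq> 0" "a \<in> fibre E z" "b \<in> fibre E (- z)" for z a b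
   using gP[OF that(1) fin[OF that(1,2)] fin[OF _ that(3)]] fP[OF that] that(1) by simp
  have "gamma_iso_by (E, P) (E'', P'') (\<lambda>z a. g z (f z a))"
   by (rule gamma_iso_byI; fact 1 2 3 4)
  then show "(x, z) \<in> gamma_iso m" using gd unfolding gamma_iso_iff x z by blast
 qed
qed

section \<open>The flat bundle with given monodromy\<close>

text \<open>
 In a flat frame the connection is the componentwise derivative. The rules for a connection become rules for
 derivatives, and the curvature vanishes because second derivatives commute.
\<close>

lemma flat_bundle_if_flat_frames:
 fixes E :: "'v::real_vector vbundle"
 assumes vb: "vector_bundle E" and ex: "\<And>z. z \<noteq> 0 ==> \<exists>W r \<epsilon> co. flat_frame E W r \<epsilon> co \<and> z \<in> W"
  and cong: "\<And>U s t z v. open U ==> z \<in> U ==> (\<And>w. w \<in> U ==> t w = s w) ==> nabla E t z v = nabla E s z v"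
 shows "flat_bundle E"
proof -
 interpret vbun E by unfold_locales (fact vb)
 have loc: "\<exists>B. open B \<and> z \<in> B \<and> smooth_section E (U \<inter> B) (\<lambda>z. nabla E s z v)"
  "linear (nabla E s z)"
  "smooth_section E U t ==> nabla E (\<lambda>w. s w + t w) z v = nabla E s z v + nabla E t z v"
  "smooth_on U f ==> nabla E (\<lambda>w. f w *\<^sub>R s w) z v = f z *\<^sub>R nabla E s z v + frechet_derivative f (at z) v *\<^sub>R s z"
  "nabla E (\<lambda>w. nabla E s w v) z u = nabla E (\<lambda>w. nabla E s w u) z v"
  if U: "open_punctured U" and s: "smooth_section E U s" and z: "z \<in> U" for U s t z u v f
 proof -
  have oU: "open U" "0 \<notin> U" using U by (auto simp: open_punctured_def)
  have z0: "z \<noteq> 0" using oU z by auto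
  obtain W r \<epsilon> co where ff: "flat_frame E W r \<epsilon> co" and zW: "z \<in> W" using ex[OF z0] by (elim exE conjE) (rule that)
  note a = flat_frameD[OF ff]
  define V where "V = U \<inter> W"
  have V: "open V" "V \<subseteq> W" "z \<in> V" "V \<subseteq> U" using oU a(1) z zW by (auto simp: V_def)
  have n0: "w \<noteq> 0" if "w \<in> V" for w using that oU V by auto
  have sub: "subspace (fibre E w)" if "w \<in> V" for w by (rule subspace_fibre[OF n0[OF that]])
  have fib: "x w \<in> fibre E w" if "smooth_section E V x" "w \<in> V" for x w
   by (rule smooth_section_fibre[OF that n0[OF that(2)]])
  have smc: "smooth_on V (\<lambda>w. co j w (x w))" if x: "smooth_section E V x" and j: "j < r" for x j
   using iffD1[OF a(7)[OF V(1,2) fib[OF x]] x] j by simp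
  note hd = smooth_on_has_derivative[OF smc]
  have sV: "smooth_section E V s" by (rule smooth_section_subset[OF s V(4)])
  have efib: "(\<Sum>j<r. c j *\<^sub>R \<epsilon> j w) \<in> fibre E w" if "w \<in> V" for c w
   by (intro subspace_sum subspace_scale sub[OF that]) (use a(3) V(2) that in auto)
  have cs: "co j w (\<Sum>k<r. c k *\<^sub>R \<epsilon> k w) = c j" if "w \<in> V" "j < r" for c w j
   by (rule flat_frame_co_sum[OF ff subsetD[OF V(2) that(1)] sub[OF that(1)] that(2)])
  have nab: "nabla E x w y = (\<Sum>j<r. frechet_derivative (\<lambda>z. co j z (x z)) (at w) y *\<^sub>R \<epsilon> j w)"
   if "smooth_section E V x" "w \<in> V" for x w y by (rule a(8)[OF V(1,2) that])
  have con: "co j w (nabla E x w y) = frechet_derivative (\<lambda>z. co j z (x z)) (at w) y"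
   if "smooth_section E V x" "w \<in> V" "j < r" for x w y j
   unfolding nab[OF that(1,2)] by (rule cs[OF that(2,3)])
  have sn: "smooth_section E V (\<lambda>w. nabla E s w y)" for y
  proof (rule iffD2[OF a(7)[OF V(1,2)]])
   show "nabla E s w y \<in> fibre E w" if "w \<in> V" for w unfolding nab[OF sV that] by (rule efib[OF that])
   show "\<forall>j<r. smooth_on V (\<lambda>z. co j z (nabla E s z y))"
    by (intro allI impI smooth_on_cong[OF V(1) con[OF sV, symmetric] smooth_on_frechet_derivative[OF smc[OF sV]]])
  qed
  then show "\<exists>B. open B \<and> z \<in> B \<and> smooth_section E (U \<inter> B) (\<lambda>z. nabla E s z v)"
   unfolding V_def using a(1) zW by (intro exI[of _ W] conjI)
  have fl: "linear (frechet_derivative (\<lambda>z. co j z (s z)) (at z))" if "j < r" for j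
   by (rule has_derivative_linear[OF hd[OF sV that V(3)]])
  show "linear (nabla E s z)"
   unfolding linear_iff
  proof (intro conjI allI)
   show "nabla E s z (x + y) = nabla E s z x + nabla E s z y" for x y
    unfolding nab[OF sV V(3)] sum.distrib[symmetric]
    by (rule sum.cong) (use linear_add[OF fl] in \<open>auto simp: scaleR_add_left\<close>)
   show "nabla E s z (c *\<^sub>R x) = c *\<^sub>R nabla E s z x" for c x
    unfolding nab[OF sV V(3)] scaleR_sum_right
    by (rule sum.cong) (use linear_scale[OF fl] in auto)
  qed
  show "nabla E (\<lambda>w. s w + t w) z v = nabla E s z v + nabla E t z v" if t: "smooth_section E U t"
  proof -
   have tV: "smooth_section E V t" by (rule smooth_section_subset[OF t V(4)])
   have cadd: "co j w (s w + t w) = co j w (s w) + co j w (t w)" if "w \<in> V" "j < r" for w j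
    by (rule linear_map_on_add[OF a(4)]) (use that V(2) fib[OF sV] fib[OF tV] in auto)
   have st: "smooth_section E V (\<lambda>w. s w + t w)"
   proof (rule iffD2[OF a(7)[OF V(1,2)]])
    show "s w + t w \<in> fibre E w" if "w \<in> V" for w
     by (rule subspace_add[OF sub[OF that] fib[OF sV that] fib[OF tV that]])
    show "\<forall>j<r. smooth_on V (\<lambda>w. co j w (s w + t w))"
     by (intro allI impI smooth_on_cong[OF V(1) cadd[symmetric] smooth_on_add[OF V(1) smc[OF sV] smc[OF tV]]])
   qed
   have "frechet_derivative (\<lambda>w. co j w (s w + t w)) (at z) v =
     frechet_derivative (\<lambda>w. co j w (s w)) (at z) v + frechet_derivative (\<lambda>w. co j w (t w)) (at z) v" if j: "j < r" for j
    using fun_cong[OF frechet_derivative_at[OF has_derivative_add[OF hd[OF sV j V(3)] hd[OF tV j V(3)]]], of v]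
     frechet_derivative_cong_open(1)[OF V(1,3) cadd[OF _ j]] by simp
   then show ?thesis
    unfolding nab[OF sV V(3)] nab[OF tV V(3)] nab[OF st V(3)] sum.distrib[symmetric]
    by (intro sum.cong refl) (simp add: scaleR_add_left)
  qed
  show "nabla E (\<lambda>w. f w *\<^sub>R s w) z v = f z *\<^sub>R nabla E s z v + frechet_derivative f (at z) v *\<^sub>R s z" if f: "smooth_on U f"
  proof -
   have fV: "smooth_on V f" by (rule smooth_on_subset[OF f V(4)])
   have cmul: "co j w (f w *\<^sub>R s w) = f w * co j w (s w)" if "w \<in> V" "j < r" for w j
    using linear_map_on_scale[OF a(4) fib[OF sV that(1)], of j "f w"] that V(2) by auto
   have st: "smooth_section E V (\<lambda>w. f w *\<^sub>R s w)"
   proof (rule iffD2[OF a(7)[OF V(1,2)]])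
    show "f w *\<^sub>R s w \<in> fibre E w" if "w \<in> V" for w
     by (rule subspace_scale[OF sub[OF that] fib[OF sV that]])
    show "\<forall>j<r. smooth_on V (\<lambda>w. co j w (f w *\<^sub>R s w))"
     by (intro allI impI smooth_on_cong[OF V(1) cmul[symmetric] smooth_on_mult[OF V(1) fV smc[OF sV]]])
   qed
   have d: "frechet_derivative (\<lambda>w. co j w (f w *\<^sub>R s w)) (at z) v =
     f z * frechet_derivative (\<lambda>w. co j w (s w)) (at z) v + frechet_derivative f (at z) v * co j z (s z)" if j: "j < r" for j
    using fun_cong[OF frechet_derivative_at[OF has_derivative_mult[OF smooth_on_has_derivative[OF fV V(3)] hd[OF sV j V(3)]]], of v]
     frechet_derivative_cong_open(1)[OF V(1,3) cmul[OF _ j]] by simp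
   have "nabla E (\<lambda>w. f w *\<^sub>R s w) z v = f z *\<^sub>R nabla E s z v + frechet_derivative f (at z) v *\<^sub>R (\<Sum>j<r. co j z (s z) *\<^sub>R \<epsilon> j z)"
    unfolding nab[OF sV V(3)] nab[OF st V(3)] scaleR_sum_right sum.distrib[symmetric]
    by (intro sum.cong refl) (simp add: scaleR_add_left d)
   then show ?thesis unfolding a(6)[OF zW fib[OF sV V(3)]] .
  qed
  have D2: "frechet_derivative (\<lambda>w. co j w (nabla E s w y)) (at z) x =
    frechet_derivative (\<lambda>w. frechet_derivative (\<lambda>z. co j z (s z)) (at w) y) (at z) x" if j: "j < r" for j x y
   using frechet_derivative_cong_open(1)[OF V(1,3) con[OF sV _ j, of _ y]] by simp
  show "nabla E (\<lambda>w. nabla E s w v) z u = nabla E (\<lambda>w. nabla E s w u) z v"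
   unfolding nab[OF sn V(3)]
   by (intro sum.cong refl) (use smooth_on_symmetric_second_derivative[OF V(1) smc[OF sV] V(3)] D2 in auto)
 qed
 have con: "connection E"
  unfolding connection_def
 proof (intro allI impI, elim conjE, intro conjI allI ballI impI)
  fix U s assume U: "open_punctured U" and s: "smooth_section E U s"
  show "smooth_section E U (\<lambda>z. nabla E s z v)" for v by (rule smooth_section_local[OF U loc(1)[OF U s]])
  show "linear (nabla E s z)" if "z \<in> U" for z by (rule loc(2)[OF U s that])
  show "nabla E t z v = nabla E s z v" if "\<forall>z\<in>U. t z = s z" "z \<in> U" for t z v
   by (rule cong[OF _ that(2)]) (use U that(1) in \<open>auto simp: open_punctured_def\<close>)
  show "nabla E (\<lambda>w. s w + t w) z v = nabla E s z v + nabla E t z v" if "smooth_section E U t" "z \<in> U" for t z v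
   by (rule loc(3)[OF U s that(2,1)])
  show "nabla E (\<lambda>w. f w *\<^sub>R s w) z v = f z *\<^sub>R nabla E s z v + frechet_derivative f (at z) v *\<^sub>R s z"
   if "smooth_on U f" "z \<in> U" for f z v by (rule loc(4)[OF U s that(2,1)])
 qed
 show ?thesis
  unfolding flat_bundle_def
 proof (intro conjI vb con allI impI ballI, elim conjE)
  fix U s z u v assume U: "open_punctured U" and s: "smooth_section E U s" and z: "z \<in> U"
  show "nabla E (\<lambda>w. nabla E s w v) z u = nabla E (\<lambda>w. nabla E s w u) z v" by (rule loc(5)[OF U s z])
 qed
qed

lemma fin_dim_coordinates:
 assumes "fin_dim_space H"
 shows "\<exists>n h co. inj_on h {..<n::nat} \<and> independent (h ` {..<n}) \<and> span (h ` {..<n}) = H \<and>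
  (\<forall>j. linear_map_on H (co j)) \<and> (\<forall>j<n. \<forall>k<n. co j (h k) = (if j = k then 1 else (0::real))) \<and>
  (\<forall>a\<in>H. (\<Sum>j<n. co j a *\<^sub>R h j) = a)"
proof -
 obtain B where B: "finite B" "independent B" "span B = H" using fin_dim_space_basis[OF assms] by blast
 obtain h where h: "bij_betw h {..<card B} B" using ex_bij_betw_nat_finite[OF B(1)] by (auto simp: atLeast0LessThan)
 have hi: "h ` {..<card B} = B" "inj_on h {..<card B}" using h by (auto simp: bij_betw_def)
 let ?co = "\<lambda>j a. representation B a (h j)"
 have 1: "linear_map_on H (?co j)" for j
  unfolding linear_map_on_def B(3)[symmetric]
  using representation_add[OF B(2)] representation_scale[OF B(2)] by simp
 have 2: "?co j (h k) = (if j = k then 1 else 0)" if "j < card B" "k < card B" for j k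
 proof -
  have "h k \<in> B" using hi that by blast
  moreover have "h j = h k \<longleftrightarrow> j = k" using inj_on_eq_iff[OF hi(2)] that by simp
  ultimately show ?thesis using representation_basis[OF B(2), of "h k"] by simp
 qed
 have 3: "(\<Sum>j<card B. ?co j a *\<^sub>R h j) = a" if "a \<in> H" for a
  using sum_representation_eq[OF B(2) _ B(1) order_refl, of a] that B(3)
   sum.reindex[OF hi(2), of "\<lambda>b. representation B a b *\<^sub>R b"] hi(1) by simp
 show ?thesis
  using hi B 1 2 3 by (intro exI[of _ "card B"] exI[of _ h] exI[of _ ?co]) auto
qed

text \<open>
 All fibres are \<open>H\<close>. There are two charts, the plane cut along the negative and along the positive real axis.
 The frame is \<open>h\<close> in the first chart; in the second chart it is \<open>M h\<close> on the lower half plane and \<open>h\<close>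
 elsewhere. So a flat section that crosses the negative real axis downwards changes from \<open>a\<close> to \<open>M a\<close>.
\<close>

locale model_bundle =
 fixes H :: "'v::real_vector set" and M :: "'v \<Rightarrow> 'v" and n :: nat and h :: "nat \<Rightarrow> 'v" and co :: "nat \<Rightarrow> 'v \<Rightarrow> real"
 assumes M: "linear_iso H H M" and inj_h: "inj_on h {..<n}" and ind_h: "independent (h ` {..<n})"
  and span_h: "span (h ` {..<n}) = H" and co_lin: "\<And>j. linear_map_on H (co j)"
  and co_h: "\<And>j k. j < n ==> k < n ==> co j (h k) = (if j = k then 1 else 0)"
  and co_sum: "\<And>a. a \<in> H ==> (\<Sum>j<n. co j a *\<^sub>R h j) = a"
begin

definition N :: "bool \<Rightarrow> complex \<Rightarrow> 'v \<Rightarrow> 'v" where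
 "N b z a = (if b \<and> Im z < 0 then M a else a)"

definition Ni :: "bool \<Rightarrow> complex \<Rightarrow> 'v \<Rightarrow> 'v" where
 "Ni b z a = (if b \<and> Im z < 0 then inv_into H M a else a)"

definition V :: "bool \<Rightarrow> complex set" where
 "V b = - (if b then nonneg_Reals else nonpos_Reals)"

definition bun :: "'v vbundle" where
 "bun = \<lparr>fibre = (\<lambda>z. H), frames = range (\<lambda>b. (V b, n, \<lambda>j z. N b z (h j))),
   nabla = (\<lambda>s z v. let b = (z \<notin> V False) in
    \<Sum>j<n. frechet_derivative (\<lambda>w. co j (Ni b w (s w))) (at z) v *\<^sub>R N b z (h j))\<rparr>"

lemma bun_simps: "fibre bun z = H" "frames bun = range (\<lambda>b. (V b, n, \<lambda>j z. N b z (h j)))"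
 by (simp_all add: bun_def)

lemmas M_lin = linear_isoD[OF M]

lemma subH: "subspace H" unfolding span_h[symmetric] by (rule subspace_span)

lemma h_H: "j < n ==> h j \<in> H" unfolding span_h[symmetric] by (rule span_base) simp

lemma sum_H: "(\<And>j. j < n ==> x j \<in> H) ==> (\<Sum>j<n. c j *\<^sub>R x j) \<in> H"
 by (intro subspace_sum subspace_scale subH) auto

lemma N_iso: "linear_iso H H (N b z)"
proof -
 have "N b z = (if b \<and> Im z < 0 then M else (\<lambda>a. a))" by (rule ext) (simp add: N_def)
 then show ?thesis using M linear_iso_id[of H] by metis
qed

lemmas N_lin = linear_isoD[OF N_iso]

lemma Ni_lin: "linear_map_on H (Ni b z)" "a \<in> H ==> Ni b z a \<in> H"
proof -
 have "Ni b z = (if b \<and> Im z < 0 then inv_into H M else (\<lambda>a. a))" by (rule ext) (simp add: Ni_def)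
 then have iso: "linear_iso H H (Ni b z)" using linear_iso_inv[OF M subH] linear_iso_id[of H] by metis
 show "linear_map_on H (Ni b z)" "a \<in> H ==> Ni b z a \<in> H" by (fact linear_isoD(1)[OF iso], fact linear_isoD(4)[OF iso])
qed

lemma N_Ni: "a \<in> H ==> N b z (Ni b z a) = a" "a \<in> H ==> Ni b z (N b z a) = a"
 unfolding N_def Ni_def using M_lin(2,3) by (simp_all add: f_inv_into_f)

lemma open_V: "open (V b)" "0 \<notin> V b"
 unfolding V_def by (auto simp: open_Compl closed_nonneg_Reals_complex closed_nonpos_Reals_complex)

lemma V_Im: assumes "z \<in> V b" "z \<in> V b'" "b \<noteq> b'" shows "Im z \<noteq> 0"
 using assms by (cases b; cases b') (auto simp: V_def complex_nonneg_Reals_iff complex_nonpos_Reals_iff)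

lemma V_cover: "z \<noteq> 0 ==> z \<in> V False \<or> z \<in> V True"
 by (auto simp: V_def complex_nonneg_Reals_iff complex_nonpos_Reals_iff complex_eq_iff)

lemma co_lincomb: assumes "\<And>i. i < n ==> x i \<in> H" shows "co j (\<Sum>i<n. c i *\<^sub>R x i) = (\<Sum>i<n. c i * co j (x i))"
proof -
 have "co j (\<Sum>i<n. c i *\<^sub>R x i) = (\<Sum>i<n. co j (c i *\<^sub>R x i))"
  by (rule linear_map_on_sum[OF co_lin subH]) (use assms subspace_scale[OF subH] in auto)
 also have "\<dots> = (\<Sum>i<n. c i * co j (x i))" by (rule sum.cong) (use linear_map_on_scale[OF co_lin assms] in auto)
 finally show ?thesis .
qed

lemma co_sum_h: "j < n ==> co j (\<Sum>i<n. c i *\<^sub>R h i) = c j"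
proof -
 assume j: "j < n"
 have "(\<Sum>i<n. c i * co j (h i)) = (\<Sum>i<n. if j = i then c i else 0)" by (rule sum.cong) (use co_h[OF j] in auto)
 then show ?thesis using co_lincomb[of h j c, OF h_H] j by simp
qed

lemma N_sum: "N b z (\<Sum>j<n. c j *\<^sub>R h j) = (\<Sum>j<n. c j *\<^sub>R N b z (h j))"
proof -
 have "N b z (\<Sum>j<n. c j *\<^sub>R h j) = (\<Sum>j<n. N b z (c j *\<^sub>R h j))"
  by (rule linear_map_on_sum[OF N_lin(1) subH]) (use h_H subspace_scale[OF subH] in auto)
 also have "\<dots> = (\<Sum>j<n. c j *\<^sub>R N b z (h j))" by (rule sum.cong) (use linear_map_on_scale[OF N_lin(1) h_H] in auto)
 finally show ?thesis .
qed

lemma N_co_sum: "a \<in> H ==> (\<Sum>j<n. co j (Ni b z a) *\<^sub>R N b z (h j)) = a"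
 using N_sum[of b z "\<lambda>j. co j (Ni b z a)", symmetric] co_sum[OF Ni_lin(2)] N_Ni(1) by simp

lemma co_N_sum: "j < n ==> co j (Ni b z (\<Sum>i<n. c i *\<^sub>R N b z (h i))) = c j"
 using N_Ni(2)[OF sum_H[of h c], OF h_H] co_sum_h by (simp add: N_sum[symmetric])

lemma co_transition:
 assumes a: "a \<in> H"
 shows "co j (Ni b' z a) = (\<Sum>i<n. co i (Ni b z a) * co j (Ni b' z (N b z (h i))))"
proof -
 have "co j (Ni b' z a) = co j (Ni b' z (\<Sum>i<n. co i (Ni b z a) *\<^sub>R N b z (h i)))" using N_co_sum[OF a, of b z] by simp
 also have "Ni b' z (\<Sum>i<n. co i (Ni b z a) *\<^sub>R N b z (h i)) = (\<Sum>i<n. Ni b' z (co i (Ni b z a) *\<^sub>R N b z (h i)))"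
  by (rule linear_map_on_sum[OF Ni_lin(1) subH], rule subspace_scale[OF subH N_lin(4)[OF h_H]]) simp
 also have "\<dots> = (\<Sum>i<n. co i (Ni b z a) *\<^sub>R Ni b' z (N b z (h i)))"
  by (rule sum.cong[OF refl], rule linear_map_on_scale[OF Ni_lin(1) N_lin(4)[OF h_H]]) simp
 finally show ?thesis using co_lincomb[of "\<lambda>i. Ni b' z (N b z (h i))"] Ni_lin(2) N_lin(4) h_H by simp
qed

lemma transition_locally_constant:
 assumes z: "z \<in> V b \<inter> V b'" and i: "i < n"
 shows "\<exists>B. open B \<and> z \<in> B \<and> (\<forall>w\<in>B. co j (Ni b' w (N b w (h i))) = co j (Ni b' z (N b z (h i))))"
proof (cases "b = b'")
 case True
 then show ?thesis using N_Ni(2)[OF h_H[OF i]] by (intro exI[of _ UNIV]) simp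
next
 case False
 then have nz: "Im z \<noteq> 0" using V_Im z by blast
 show ?thesis
 proof (cases "Im z < 0")
  case True
  then show ?thesis by (intro exI[of _ "{w. Im w < 0}"]) (simp add: N_def Ni_def open_halfspace_Im_lt)
 next
  case False
  then show ?thesis using nz by (intro exI[of _ "{w. Im w > 0}"]) (simp add: N_def Ni_def open_halfspace_Im_gt)
 qed
qed

lemma transition_smooth:
 assumes "open U" "U \<subseteq> V b \<inter> V b'" "i < n" shows "smooth_on U (\<lambda>w. co j (Ni b' w (N b w (h i))))"
proof (rule smooth_on_local[OF assms(1)])
 fix z assume zU: "z \<in> U"
 obtain B where B: "open B" "z \<in> B" "\<forall>w\<in>B. co j (Ni b' w (N b w (h i))) = co j (Ni b' z (N b z (h i)))"
  using transition_locally_constant[OF subsetD[OF assms(2) zU] assms(3), of j] by (elim exE conjE) (rule that)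
 have o: "open (U \<inter> B)" using assms(1) B(1) by blast
 have "smooth_on (U \<inter> B) (\<lambda>w. co j (Ni b' w (N b w (h i))))"
  by (rule smooth_on_cong[OF o _ smooth_on_const[OF o, of "co j (Ni b' z (N b z (h i)))"]]) (use B(3) in simp)
 then show "\<exists>B. open B \<and> z \<in> B \<and> smooth_on (U \<inter> B) (\<lambda>w. co j (Ni b' w (N b w (h i))))" using B(1,2) by blast
qed

lemma smooth_section_bun:
 assumes U: "open U" "U \<subseteq> V b" and s: "\<And>z. z \<in> U ==> s z \<in> H"
 shows "smooth_section bun U s \<longleftrightarrow> (\<forall>j<n. smooth_on U (\<lambda>z. co j (Ni b z (s z))))"
proof
 assume "smooth_section bun U s"
 then have "\<exists>f. (\<forall>i<n. smooth_on (U \<inter> V b) (f i)) \<and> (\<forall>z\<in>U \<inter> V b. s z = (\<Sum>i<n. f i z *\<^sub>R N b z (h i)))"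
  unfolding smooth_section_def bun_simps by simp
 then obtain f where f: "\<forall>i<n. smooth_on (U \<inter> V b) (f i)" "\<forall>z\<in>U \<inter> V b. s z = (\<Sum>i<n. f i z *\<^sub>R N b z (h i))" by blast
 have UV: "U \<inter> V b = U" using U by auto
 show "\<forall>j<n. smooth_on U (\<lambda>z. co j (Ni b z (s z)))"
 proof (intro allI impI)
  fix j assume j: "j < n"
  show "smooth_on U (\<lambda>z. co j (Ni b z (s z)))"
   by (rule smooth_on_cong[OF U(1), of "f j"]) (use f UV j co_N_sum[OF j] in auto)
 qed
next
 assume sm: "\<forall>j<n. smooth_on U (\<lambda>z. co j (Ni b z (s z)))"
 have "\<exists>f. (\<forall>i<n. smooth_on (U \<inter> V b') (f i)) \<and> (\<forall>z\<in>U \<inter> V b'. s z = (\<Sum>i<n. f i z *\<^sub>R N b' z (h i)))" for b'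
 proof (intro exI[of _ "\<lambda>j z. co j (Ni b' z (s z))"] conjI allI impI ballI)
  have o: "open (U \<inter> V b')" using U(1) open_V by blast
  show "s z = (\<Sum>i<n. co i (Ni b' z (s z)) *\<^sub>R N b' z (h i))" if "z \<in> U \<inter> V b'" for z
   using N_co_sum[OF s] that by simp
  fix j assume "j < n"
  have sub: "U \<inter> V b' \<subseteq> V b \<inter> V b'" using U(2) by blast
  have 1: "smooth_on (U \<inter> V b') (\<lambda>z. co i (Ni b z (s z)))" if "i < n" for i
   by (rule smooth_on_subset[of U]) (use sm that in auto)
  have "smooth_on (U \<inter> V b') (\<lambda>z. \<Sum>i<n. co i (Ni b z (s z)) * co j (Ni b' z (N b z (h i))))"
   by (rule smooth_on_sum[OF o], rule smooth_on_mult[OF o 1 transition_smooth[OF o sub]]) auto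
  then show "smooth_on (U \<inter> V b') (\<lambda>z. co j (Ni b' z (s z)))"
   by (rule smooth_on_cong[OF o, rotated]) (rule co_transition[OF s, symmetric], simp)
 qed
 then show "smooth_section bun U s" unfolding smooth_section_def bun_simps by auto
qed

lemma vector_bundle_bun: "vector_bundle bun"
 unfolding vector_bundle_def bun_simps
proof (intro conjI allI impI ballI)
 fix z :: complex assume "z \<noteq> 0"
 then show "\<exists>(W, r, e)\<in>range (\<lambda>b. (V b, n, \<lambda>j z. N b z (h j))). z \<in> W" using V_cover[of z] by auto
next
 fix x assume "x \<in> range (\<lambda>b. (V b, n, \<lambda>j z. N b z (h j)))"
 then obtain b where x: "x = (V b, n, \<lambda>j z. N b z (h j))" by blast
 have inj: "inj_on (\<lambda>i. N b z (h i)) {..<n}" for z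
  using comp_inj_on[OF inj_h inj_on_subset[OF N_lin(2)], of b z] h_H by (auto simp: o_def)
 have im: "(\<lambda>i. N b z (h i)) ` {..<n} = N b z ` h ` {..<n}" for z by auto
 have ind: "independent ((\<lambda>i. N b z (h i)) ` {..<n})" for z
 proof (rule independent_if_scalars_zero)
  fix f x assume sum0: "(\<Sum>x\<in>(\<lambda>i. N b z (h i)) ` {..<n}. f x *\<^sub>R x) = 0" and "x \<in> (\<lambda>i. N b z (h i)) ` {..<n}"
  then obtain j where j: "j < n" "x = N b z (h j)" by blast
  have "(\<Sum>i<n. f (N b z (h i)) *\<^sub>R N b z (h i)) = 0"
   using sum0 sum.reindex[OF inj, of "\<lambda>x. f x *\<^sub>R x"] by simp
  moreover have "co j (Ni b z 0) = 0"
   using linear_map_on_zero[OF co_lin subH] linear_map_on_zero[OF Ni_lin(1) subH] by simp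
  ultimately show "f x = 0" using co_N_sum[OF j(1), of b z "\<lambda>i. f (N b z (h i))"] j(2) by simp
 qed simp
 have sp: "span ((\<lambda>i. N b z (h i)) ` {..<n}) = H" for z
 proof
  show "span ((\<lambda>i. N b z (h i)) ` {..<n}) \<subseteq> H" using N_lin(4) h_H by (intro span_minimal subH) auto
  show "H \<subseteq> span ((\<lambda>i. N b z (h i)) ` {..<n})"
  proof
   fix a assume a: "a \<in> H"
   have "(\<Sum>j<n. co j (Ni b z a) *\<^sub>R N b z (h j)) \<in> span ((\<lambda>i. N b z (h i)) ` {..<n})"
    by (intro span_sum span_scale span_base) auto
   then show "a \<in> span ((\<lambda>i. N b z (h i)) ` {..<n})" unfolding N_co_sum[OF a] .
  qed
 qed
 have sm: "smooth_section bun (V b) (\<lambda>z. N b z (h j))" if j: "j < n" for j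
  by (rule iffD2[OF smooth_section_bun[OF open_V(1) order_refl]])
   (use N_lin(4)[OF h_H[OF j]] N_Ni(2)[OF h_H[OF j]] smooth_on_const[OF open_V(1)] in simp_all)
 show "case x of (W, r, e) \<Rightarrow> open_punctured W \<and>
    (\<forall>z\<in>W. inj_on (\<lambda>i. e i z) {..<r} \<and> independent ((\<lambda>i. e i z) ` {..<r}) \<and> span ((\<lambda>i. e i z) ` {..<r}) = H) \<and>
    (\<forall>j<r. smooth_section bun W (e j))"
  unfolding x prod.case open_punctured_def using open_V inj ind sp sm by (intro conjI ballI allI impI)
qed

lemma flat_frame_bun: "flat_frame bun (V b) n (\<lambda>j z. N b z (h j)) (\<lambda>j z a. co j (Ni b z a))"
 unfolding flat_frame_def bun_simps
proof (intro conjI allI ballI impI; (elim conjE)?)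
 interpret vbun bun by unfold_locales (rule vector_bundle_bun)
 show "open_punctured (V b)" using open_V by (simp add: open_punctured_def)
 show "N b z (h j) \<in> H" if "j < n" for z j by (rule N_lin(4)[OF h_H[OF that]])
 show "linear_map_on H (\<lambda>a. co j (Ni b z a))" for z j
  unfolding linear_map_on_def
 proof (intro conjI ballI allI)
  show "co j (Ni b z (x + y)) = co j (Ni b z x) + co j (Ni b z y)" if "x \<in> H" "y \<in> H" for x y
   unfolding linear_map_on_add[OF Ni_lin(1) that]
   by (rule linear_map_on_add[OF co_lin Ni_lin(2)[OF that(1)] Ni_lin(2)[OF that(2)]])
  show "co j (Ni b z (c *\<^sub>R x)) = c *\<^sub>R co j (Ni b z x)" if "x \<in> H" for c x
   unfolding linear_map_on_scale[OF Ni_lin(1) that] by (rule linear_map_on_scale[OF co_lin Ni_lin(2)[OF that]])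
 qed
 show "co j (Ni b z (N b z (h k))) = (if j = k then 1 else 0)" if "j < n" "k < n" for z j k
  using N_Ni(2)[OF h_H[OF that(2)]] co_h[OF that] by simp
 show "(\<Sum>j<n. co j (Ni b z a) *\<^sub>R N b z (h j)) = a" if "a \<in> H" for z a by (rule N_co_sum[OF that])
 show "smooth_section bun U s = (\<forall>j<n. smooth_on U (\<lambda>z. co j (Ni b z (s z))))"
  if "open U" "U \<subseteq> V b" "\<forall>z\<in>U. s z \<in> H" for U s by (rule smooth_section_bun) (use that in auto)
 fix U s z v assume U: "open U" "U \<subseteq> V b" and s: "smooth_section bun U s" and z: "z \<in> U"
 define c where "c = (z \<notin> V False)"
 have z0: "z \<noteq> 0" using U z open_V by auto
 have zc: "z \<in> V c" using V_cover[OF z0] by (cases "z \<in> V False") (simp_all add: c_def)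
 have nab: "nabla bun s z v = (\<Sum>j<n. frechet_derivative (\<lambda>w. co j (Ni c w (s w))) (at z) v *\<^sub>R N c z (h j))"
  by (simp add: bun_def c_def Let_def)
 have sH: "s w \<in> H" if w: "w \<in> U" for w
 proof -
  have "w \<noteq> 0" using U(2) w open_V(2)[of b] by auto
  from smooth_section_fibre[OF s w this] show ?thesis by (simp add: bun_simps)
 qed
 have smb: "smooth_on U (\<lambda>w. co j (Ni b w (s w)))" if "j < n" for j
  using iffD1[OF smooth_section_bun[OF U sH] s] that by simp
 let ?D = "\<lambda>i. frechet_derivative (\<lambda>w. co i (Ni b w (s w))) (at z) v"
 have D: "frechet_derivative (\<lambda>w. co j (Ni c w (s w))) (at z) v = (\<Sum>i<n. ?D i * co j (Ni c z (N b z (h i))))" for j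
 proof -
  have zz: "z \<in> V b \<inter> V c" using zc z U by auto
  have "\<exists>B. \<forall>i. i < n --> open (B i) \<and> z \<in> B i \<and> (\<forall>w\<in>B i. co j (Ni c w (N b w (h i))) = co j (Ni c z (N b z (h i))))"
  proof (intro choice allI)
   fix i show "\<exists>B. i < n --> open B \<and> z \<in> B \<and> (\<forall>w\<in>B. co j (Ni c w (N b w (h i))) = co j (Ni c z (N b z (h i))))"
   proof (cases "i < n")
    case True
    then show ?thesis using transition_locally_constant[OF zz True, of j] by simp
   qed simp
  qed
  then obtain B where B: "\<forall>i. i < n --> open (B i) \<and> z \<in> B i \<and> (\<forall>w\<in>B i. co j (Ni c w (N b w (h i))) = co j (Ni c z (N b z (h i))))" ..
  define W where "W = U \<inter> (\<Inter>i<n. B i)"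
  have W: "open W" "z \<in> W" "W \<subseteq> U" unfolding W_def using U(1) z B by (auto intro!: open_Int open_INT)
  have eq: "co j (Ni c w (s w)) = (\<Sum>i<n. co i (Ni b w (s w)) * co j (Ni c z (N b z (h i))))" if w: "w \<in> W" for w
   unfolding co_transition[OF sH[OF subsetD[OF W(3) w]], of j c w b]
  proof (rule sum.cong[OF refl])
   fix i assume "i \<in> {..<n}"
   then have i: "i < n" and wB: "w \<in> B i" using w by (auto simp: W_def)
   have "co j (Ni c w (N b w (h i))) = co j (Ni c z (N b z (h i)))"
    by (rule bspec[OF conjunct2[OF conjunct2[OF mp[OF spec[OF B] i]]] wB])
   then
   show "co i (Ni b w (s w)) * co j (Ni c w (N b w (h i))) = co i (Ni b w (s w)) * co j (Ni c z (N b z (h i)))"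
    by (rule arg_cong)
  qed
  have der: "((\<lambda>w. \<Sum>i<n. co i (Ni b w (s w)) * co j (Ni c z (N b z (h i)))) has_derivative
    (\<lambda>v. \<Sum>i<n. frechet_derivative (\<lambda>w. co i (Ni b w (s w))) (at z) v * co j (Ni c z (N b z (h i))))) (at z)"
   by (rule has_derivative_sum, rule has_derivative_mult_left, rule smooth_on_has_derivative[OF smb z]) simp
  have "frechet_derivative (\<lambda>w. co j (Ni c w (s w))) (at z) =
    frechet_derivative (\<lambda>w. \<Sum>i<n. co i (Ni b w (s w)) * co j (Ni c z (N b z (h i)))) (at z)"
   by (rule frechet_derivative_cong_open(1)[OF W(1,2)]) (rule eq)
  then show ?thesis using fun_cong[OF frechet_derivative_at[OF der], of v] by simp
 qed
 have "nabla bun s z v = (\<Sum>j<n. \<Sum>i<n. ?D i *\<^sub>R (co j (Ni c z (N b z (h i))) *\<^sub>R N c z (h j)))"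
  unfolding nab D scaleR_sum_left scaleR_scaleR ..
 also have "\<dots> = (\<Sum>i<n. ?D i *\<^sub>R (\<Sum>j<n. co j (Ni c z (N b z (h i))) *\<^sub>R N c z (h j)))"
  by (subst sum.swap) (simp only: scaleR_sum_right)
 also have "\<dots> = (\<Sum>i<n. ?D i *\<^sub>R N b z (h i))"
  by (rule sum.cong[OF refl], rule arg_cong[OF N_co_sum[OF N_lin(4)[OF h_H]]]) simp
 finally show "nabla bun s z v = (\<Sum>j<n. ?D j *\<^sub>R N b z (h j))" .
qed

lemma flat_bundle_bun: "flat_bundle bun"
proof (rule flat_bundle_if_flat_frames[OF vector_bundle_bun])
 show "\<exists>W r \<epsilon> co. flat_frame bun W r \<epsilon> co \<and> z \<in> W" if "z \<noteq> 0" for z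
  using flat_frame_bun V_cover[OF that] by blast
 fix U :: "complex set" and s t :: "complex \<Rightarrow> 'v" and z v
 assume U: "open U" "z \<in> U" and st: "\<And>w. w \<in> U ==> t w = s w"
 have "frechet_derivative (\<lambda>w. co j (Ni b w (t w))) (at z) = frechet_derivative (\<lambda>w. co j (Ni b w (s w))) (at z)" for j b
  by (rule frechet_derivative_cong_open(1)[OF U]) (simp add: st)
 then show "nabla bun t z v = nabla bun s z v" by (simp add: bun_def)
qed

sublocale B: fbun bun by unfold_locales (rule flat_bundle_bun)

text \<open>
 Along the unit circle, the section with the value \<open>a\<close> up to the angle \<open>\<pi>\<close> and \<open>M a\<close> afterwards is flat:
 its coordinates are constant in the second chart near the angle \<open>\<pi>\<close>, and in the first chart elsewhere.
\<close>

lemma monodromy_bun: assumes a: "a \<in> H" shows "bundle_monodromy bun 1 a = M a"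
proof -
 have a1: "a \<in> fibre bun 1" using a by (simp add: bun_simps)
 let ?X = "{- pi<..<3 * pi}"
 define \<sigma> where "\<sigma> t = (if t \<le> pi then a else M a)" for t :: real
 have cont: "continuous_on ?X cis" by (intro continuous_intros)
 have VF: "cis t \<in> V False" if "- pi < t" "t < pi" for t
 proof (rule ccontr)
  assume "cis t \<notin> V False"
  then have "sin t = 0" "cos t \<le> 0" by (simp_all add: V_def complex_nonpos_Reals_iff)
  with sin_eq_0_pi[OF that] show False by simp
 qed
 have VF': "cis t \<in> V False" if "pi < t" "t < 3 * pi" for t
  using VF[of "t - 2 * pi"] that by (simp add: cis_divide[symmetric])
 have fl2: "flat_along bun cis ?X \<sigma>"
  unfolding flat_along_def
 proof
  fix t assume t: "t \<in> ?X"
  consider "t < pi" | "t > pi" | "t = pi" by linarith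
  then show "lflat bun cis ?X \<sigma> t"
  proof cases
   case 1
   have "\<forall>\<^sub>F t' in nhds t. t' < pi" using 1 by (intro eventually_nhds_in_open[of "{..<pi}", simplified]) auto
   then have "\<forall>\<^sub>F t' in nhds t. t' \<in> ?X --> \<sigma> t' = (\<Sum>j<n. co j a *\<^sub>R N False (cis t') (h j))"
    by eventually_elim (simp add: \<sigma>_def N_def co_sum[OF a])
   moreover have "cis t \<in> V False" by (rule VF) (use 1 t in auto)
   ultimately show ?thesis by (intro B.lflatI[where c = cis and x = t, OF flat_frame_bun])
  next
   case 2
   have "\<forall>\<^sub>F t' in nhds t. t' > pi" using 2 by (intro eventually_nhds_in_open[of "{pi<..}", simplified]) auto
   then have "\<forall>\<^sub>F t' in nhds t. t' \<in> ?X --> \<sigma> t' = (\<Sum>j<n. co j (M a) *\<^sub>R N False (cis t') (h j))"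
    by eventually_elim (simp add: \<sigma>_def N_def co_sum[OF M_lin(4)[OF a]])
   moreover have "cis t \<in> V False" by (rule VF') (use 2 t in auto)
   ultimately show ?thesis by (intro B.lflatI[where c = cis and x = t, OF flat_frame_bun])
  next
   case 3
   have "\<forall>\<^sub>F t' in nhds t. t' \<in> {0<..<2 * pi}" using 3 by (intro eventually_nhds_in_open) auto
   then have "\<forall>\<^sub>F t' in nhds t. t' \<in> ?X --> \<sigma> t' = (\<Sum>j<n. co j a *\<^sub>R N True (cis t') (h j))"
   proof eventually_elim
    case (elim t')
    have "\<sigma> t' = N True (cis t') a"
    proof (cases "t' \<le> pi")
     case True
     then have "sin t' \<ge> 0" using elim by (intro sin_ge_zero) auto
     then show ?thesis using True by (simp add: \<sigma>_def N_def)
    next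
     case False
     then have "sin t' < 0" using elim by (intro sin_lt_zero) auto
     then show ?thesis using False by (simp add: \<sigma>_def N_def)
    qed
    then show ?case using N_sum[of True "cis t'" "\<lambda>j. co j a"] co_sum[OF a] by simp
   qed
   moreover have "cis t \<in> V True" using 3 by (simp add: V_def complex_nonneg_Reals_iff)
   ultimately show ?thesis by (intro B.lflatI[where c = cis and x = t, OF flat_frame_bun])
  qed
 qed
 have "lflat bun (\<lambda>t. exp (\<i> * complex_of_real t)) UNIV (\<lambda>t. B.T (\<i> * complex_of_real t) a) t" for t
  using B.T_flat(1)[OF a1]
  by (intro lflat_compose[where \<sigma> = "\<lambda>w. B.T w a" and g = "\<lambda>t. \<i> * complex_of_real t"])
   (auto simp: flat_along_def intro!: continuous_intros)
 then have "flat_along bun cis UNIV (\<lambda>t. B.T (\<i> * complex_of_real t) a)"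
  unfolding flat_along_def cis_conv_exp by blast
 then have fl1: "flat_along bun cis ?X (\<lambda>t. B.T (\<i> * complex_of_real t) a)" by (rule flat_along_subset) simp
 have "B.T (\<i> * complex_of_real (2 * pi)) a = \<sigma> (2 * pi)"
  by (rule B.flat_along_unique[OF _ cont fl1 fl2, of 0]) (use B.T_flat(2)[OF a1] in \<open>auto simp: \<sigma>_def\<close>)
 then show ?thesis
  using B.flat_shift_T[OF a1, of 0 "2 * pi"] B.T_flat(2)[OF a1] by (simp add: bundle_monodromy_def \<sigma>_def)
qed

end

lemma flat_bundle_with_monodromy:
 assumes H: "fin_dim_space H" and M: "linear_iso H H M"
 shows "\<exists>E. flat_bundle E \<and> fibre E 1 = H \<and> (\<forall>a\<in>H. bundle_monodromy E 1 a = M a)"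
proof -
 obtain n h co where b: "inj_on h {..<n::nat}" "independent (h ` {..<n})" "span (h ` {..<n}) = H"
  "\<forall>j. linear_map_on H (co j)" "\<forall>j<n. \<forall>k<n. co j (h k) = (if j = k then 1 else (0::real))"
  "\<forall>a\<in>H. (\<Sum>j<n. co j a *\<^sub>R h j) = a"
  using fin_dim_coordinates[OF H] by (elim exE conjE) (rule that)
 interpret model_bundle H M n h co by unfold_locales (use b M in auto)
 show ?thesis using flat_bundle_bun monodromy_bun by (intro exI[of _ bun]) (simp add: bun_simps)
qed

section \<open>Seifert form pairs and flat bundles with pairing\<close>

lemma linear_iso_preimage:
 assumes "linear_iso V W f" "y \<in> W" obtains x where "x \<in> V" "y = f x"
proof -
 have "y \<in> f ` V" using linear_isoD(3)[OF assms(1)] assms(2) by simp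
 then show thesis by (rule imageE) (rule that)
qed

lemma linear_map_on_transport:
 assumes f: "linear_iso V V' f" and V: "subspace V" and lin: "linear_map_on V F" and FF: "\<And>a. a \<in> V ==> F' (f a) = F a"
 shows "linear_map_on V' F'"
 unfolding linear_map_on_def
proof (intro conjI ballI allI)
 note fl = linear_isoD[OF f]
 fix x assume "x \<in> V'"
 then obtain a where a: "a \<in> V" "x = f a" using fl(3) by blast
 show "F' (c *\<^sub>R x) = c *\<^sub>R F' x" for c
  unfolding a(2) linear_map_on_scale[OF fl(1) a(1), symmetric] FF[OF a(1)] FF[OF subspace_scale[OF V a(1)]]
  by (rule linear_map_on_scale[OF lin a(1)])
 fix y assume "y \<in> V'"
 then obtain b where b: "b \<in> V" "y = f b" using fl(3) by blast
 show "F' (x + y) = F' x + F' y"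
  unfolding a(2) b(2) linear_map_on_add[OF fl(1) a(1) b(1), symmetric] FF[OF a(1)] FF[OF b(1)] FF[OF subspace_add[OF V a(1) b(1)]]
  by (rule linear_map_on_add[OF lin a(1) b(1)])
qed

lemma bilinear_form_transport:
 assumes f: "linear_iso V V' f" and g: "linear_iso W W' g" and V: "subspace V" and W: "subspace W"
  and B: "bilinear_form_on V W B" and BB: "\<And>a b. a \<in> V ==> b \<in> W ==> B' (f a) (g b) = B a b"
 shows "bilinear_form_on V' W' B'"
 unfolding bilinear_form_on_def
proof (intro conjI ballI)
 fix x assume "x \<in> V'"
 then obtain a where a: "a \<in> V" "x = f a" using linear_isoD(3)[OF f] by blast
 show "linear_map_on W' (B' x)"
  unfolding a(2) by (rule linear_map_on_transport[OF g W bilinear_form_onD(1)[OF B a(1)]]) (rule BB[OF a(1)])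
next
 fix y assume "y \<in> W'"
 then obtain b where b: "b \<in> W" "y = g b" using linear_isoD(3)[OF g] by blast
 show "linear_map_on V' (\<lambda>x. B' x y)"
  unfolding b(2) by (rule linear_map_on_transport[OF f V bilinear_form_onD(2)[OF B b(1)]]) (rule BB[OF _ b(1)])
qed

lemma nondegenerate_transport:
 assumes f: "linear_iso V V' f" and g: "linear_iso W W' g" and V: "subspace V" and W: "subspace W"
  and B: "nondegenerate_on V W B" and BB: "\<And>a b. a \<in> V ==> b \<in> W ==> B' (f a) (g b) = B a b"
 shows "nondegenerate_on V' W' B'"
 unfolding nondegenerate_on_def
proof (intro conjI ballI impI)
 note fl = linear_isoD[OF f] and gl = linear_isoD[OF g]
 fix x assume x: "x \<in> V'" and 0: "\<forall>y\<in>W'. B' x y = 0"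
 obtain a where a: "a \<in> V" "x = f a" using x fl(3) by blast
 have "B a b = 0" if "b \<in> W" for b using 0 BB[OF a(1) that] gl(4)[OF that] a(2) by simp
 then have "a = 0" using B a(1) unfolding nondegenerate_on_def by blast
 then show "x = 0" using a(2) linear_map_on_zero[OF fl(1) V] by simp
next
 note fl = linear_isoD[OF f] and gl = linear_isoD[OF g]
 fix y assume y: "y \<in> W'" and 0: "\<forall>x\<in>V'. B' x y = 0"
 obtain b where b: "b \<in> W" "y = g b" using y gl(3) by blast
 have "B a b = 0" if "a \<in> V" for a using 0 BB[OF that b(1)] fl(4)[OF that] b(2) by simp
 then have "b = 0" using B b(1) unfolding nondegenerate_on_def by blast
 then show "y = 0" using b(2) linear_map_on_zero[OF gl(1) W] by simp
qed

lemma eigenvalues_in_circle_transport: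
 assumes f: "linear_iso H H' f" and H: "subspace H" and gH: "\<And>a. a \<in> H ==> g a \<in> H"
  and fg: "\<And>a. a \<in> H ==> g' (f a) = f (g a)" and e: "eigenvalues_in_circle H g"
 shows "eigenvalues_in_circle H' g'"
 unfolding eigenvalues_in_circle_def eigenvalue_on_def
proof (intro allI impI, elim bexE conjE)
 note fl = linear_isoD[OF f]
 fix l x assume x: "x \<in> H' \<times> H'" "x \<noteq> 0" "map_prod g' g' x = cscale l x"
 obtain a b where ab: "a \<in> H" "b \<in> H" "fst x = f a" "snd x = f b"
  using x(1) fl(3) by (metis imageE mem_Times_iff)
 have sc: "\<And>c u. u \<in> H ==> c *\<^sub>R u \<in> H" by (rule subspace_scale[OF H])
 have 1: "g' (f a) = Re l *\<^sub>R f a - Im l *\<^sub>R f b" "g' (f b) = Re l *\<^sub>R f b + Im l *\<^sub>R f a"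
  using arg_cong[OF x(3), of fst] arg_cong[OF x(3), of snd] ab(3,4) by (simp_all add: cscale_def)
 have "f (g a) = f (Re l *\<^sub>R a - Im l *\<^sub>R b)"
  unfolding linear_map_on_diff[OF fl(1) H sc[OF ab(1)] sc[OF ab(2)]] linear_map_on_scale[OF fl(1) ab(1)]
   linear_map_on_scale[OF fl(1) ab(2)] fg[OF ab(1), symmetric] by (rule 1(1))
 then have ga: "g a = Re l *\<^sub>R a - Im l *\<^sub>R b"
  by (rule inj_onD[OF fl(2) _ gH[OF ab(1)] subspace_diff[OF H sc[OF ab(1)] sc[OF ab(2)]]])
 have "f (g b) = f (Re l *\<^sub>R b + Im l *\<^sub>R a)"
  unfolding linear_map_on_add[OF fl(1) sc[OF ab(2)] sc[OF ab(1)]] linear_map_on_scale[OF fl(1) ab(1)]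
   linear_map_on_scale[OF fl(1) ab(2)] fg[OF ab(2), symmetric] by (rule 1(2))
 then have gb: "g b = Re l *\<^sub>R b + Im l *\<^sub>R a"
  by (rule inj_onD[OF fl(2) _ gH[OF ab(2)] subspace_add[OF H sc[OF ab(2)] sc[OF ab(1)]]])
 have "(a, b) \<noteq> 0"
 proof
  assume "(a, b) = 0"
  then have "a = 0" "b = 0" by (simp_all add: zero_prod_def)
  then show False using x(2) ab(3,4) linear_map_on_zero[OF fl(1) H] by (simp add: prod_eq_iff)
 qed
 moreover have "map_prod g g (a, b) = cscale l (a, b)" using ga gb by (simp add: cscale_def)
 ultimately have "eigenvalue_on H g l" unfolding eigenvalue_on_def using ab(1,2) by (intro bexI[of _ "(a, b)"]) auto
 then show "cmod l = 1" using e unfolding eigenvalues_in_circle_def by blast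
qed

definition pfac :: "int \<Rightarrow> complex" where
 "pfac m = 1 / (2 * of_real pi * \<i>) powi (m + 1)"

text \<open>
 The line \<open>(2 \<pi> i)\<^sup>-\<^sup>m\<^sup>-\<^sup>1 \<real>\<close> is \<open>i\<^sup>m\<^sup>+\<^sup>1 \<real>\<close>.
\<close>

lemma pfac_eq: "pfac m = \<i> powi (m + 1) * of_real ((- 1) powi (m + 1) / (2 * pi) powi (m + 1))" "pfac m \<noteq> 0"
proof -
 have "\<i> powi k * (\<i> powi k * (- 1) powi k) = (1 :: complex)" for k
  by (simp flip: power_int_mult_distrib)
 then have "1 / \<i> powi (m + 1) = \<i> powi (m + 1) * (- 1) powi (m + 1)"
  by (simp add: divide_eq_eq mult.commute)
 moreover have "pfac m = 1 / \<i> powi (m + 1) / (2 * of_real pi) powi (m + 1)"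
  unfolding pfac_def power_int_mult_distrib by simp
 ultimately show "pfac m = \<i> powi (m + 1) * of_real ((- 1) powi (m + 1) / (2 * pi) powi (m + 1))"
  by (simp add: of_real_power_int)
 show "pfac m \<noteq> 0" by (simp add: pfac_def)
qed

lemma sign_square: "(- 1 :: real) powi k * (- 1) powi k = 1" "(- 1 :: real) powi k * ((- 1) powi k * x) = x"
 using minus_one_powi(2)[of k, where 'a = real] by (simp_all flip: mult.assoc)

text \<open>
 The construction in terms of parallel transport: the shift \<open>\<gamma>\<^sub>-\<^sub>\<pi>\<close> becomes a shift of the argument of
 \<open>T\<close> by \<open>i \<pi>\<close>, and the flatness of the pairings becomes their independence of \<open>w\<close>.
\<close>

definition realizes :: "int \<Rightarrow> 'v::real_vector set \<Rightarrow> ('v \<Rightarrow> 'v \<Rightarrow> real) \<Rightarrow> 'v vbundle \<Rightarrow>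
  (complex \<Rightarrow> 'v \<Rightarrow> 'v \<Rightarrow> complex) \<Rightarrow> ('v \<Rightarrow> 'v) \<Rightarrow> bool" where
 "realizes m H L E P \<iota> \<longleftrightarrow> linear_iso H (fibre E 1) \<iota> \<and>
   (\<forall>a\<in>H. bundle_monodromy E 1 (\<iota> a) = \<iota> ((- 1) powi (m + 1) *\<^sub>R Seifert_monodromy H L a)) \<and>
   (\<forall>w. \<forall>a\<in>H. \<forall>b\<in>H.
    P (exp w) (fbun.T E w (\<iota> a)) (fbun.T E (w + \<i> * of_real pi) (\<iota> b)) = pfac m * of_real (L a b))"

context fbun
begin

lemma exp_half_turn: "exp (w + \<i> * of_real pi) = - exp w" by (simp add: exp_add)

lemma monodromy_T: assumes a: "a \<in> fibre E 1" shows "bundle_monodromy E (exp w) (T w a) = T w (T (2 * pi * \<i>) a)"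
 using flat_shift_T[OF a, of w "2 * pi"] T_shift_period[OF a, of w] by (simp add: bundle_monodromy_def mult_ac)

lemma monodromy_one: assumes a: "a \<in> fibre E 1" shows "bundle_monodromy E 1 a = T (2 * pi * \<i>) a"
proof -
 have "T (2 * pi * \<i>) a \<in> fibre E 1"
  using T_lin(4)[OF a, of "2 * pi * \<i>"] exp_two_pi_i by (simp add: mult_ac)
 then show ?thesis using monodromy_T[OF a, of 0] T_flat(2)[OF a] T_flat(2) by simp
qed

lemma half_turn_back: assumes b: "b \<in> fibre E 1"
 shows "flat_shift E (- exp w) (- pi) (T (w + \<i> * of_real pi) b) = T w b"
 using flat_shift_T[OF b, of "w + \<i> * of_real pi" "- pi"] by (simp add: exp_half_turn)

lemma half_turn: assumes b: "b \<in> fibre E 1"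
 shows "flat_shift E (exp w) pi (T w b) = T (w + \<i> * of_real pi) b"
 by (rule flat_shift_T[OF b])

end

locale realization = fbun E + seifert_form H L for E :: "'v::real_vector vbundle" and H L +
 fixes m P \<iota>
 assumes real: "realizes m H L E P \<iota>" and evs: "eigenvalues_in_circle H (Seifert_monodromy H L)"
begin

abbreviation "\<epsilon> \<equiv> (- 1 :: real) powi (m + 1)"
abbreviation "M \<equiv> Seifert_monodromy H L"

lemma iso: "linear_iso H (fibre E 1) \<iota>" using real by (simp add: realizes_def)
lemmas lin = linear_isoD[OF iso]

lemma P_eq: "a \<in> H ==> b \<in> H ==> P (exp w) (T w (\<iota> a)) (T (w + \<i> * of_real pi) (\<iota> b)) = pfac m * of_real (L a b)"
 using real by (simp add: realizes_def)

lemma M_H: "a \<in> H ==> \<epsilon> *\<^sub>R M a \<in> H" by (rule subspace_scale[OF subH linear_isoD(4)[OF monodromy(1)]])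

lemma Mon: assumes "a \<in> H" shows "T (2 * pi * \<i>) (\<iota> a) = \<iota> (\<epsilon> *\<^sub>R M a)"
 using real assms unfolding monodromy_one[OF lin(4)[OF assms], symmetric] by (simp add: realizes_def)

lemma iso_T: "linear_iso H (fibre E (exp w)) (\<lambda>a. T w (\<iota> a))" by (rule linear_iso_comp[OF iso T_iso])

lemma at_exp: assumes "(z :: complex) \<noteq> 0" obtains w where "exp w = z" by (rule that[OF exp_Ln[OF assms]])

lemma surj_T: assumes "x \<in> fibre E (exp w)" obtains a where "a \<in> H" "x = T w (\<iota> a)"
 using assms unfolding linear_isoD(3)[OF iso_T, symmetric] by (rule imageE) (rule that)

lemma iso_T': "linear_iso H (fibre E (- exp w)) (\<lambda>a. T (w + \<i> * of_real pi) (\<iota> a))"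
 using iso_T[of "w + \<i> * of_real pi"] by (simp only: exp_half_turn)

lemma surj_T': assumes "x \<in> fibre E (- exp w)" obtains a where "a \<in> H" "x = T (w + \<i> * of_real pi) (\<iota> a)"
 using assms unfolding linear_isoD(3)[OF iso_T', symmetric] by (rule imageE) (rule that)

lemma iota_inv: "x \<in> fibre E 1 ==> \<iota> (inv_into H \<iota> x) = x" "x \<in> fibre E 1 ==> inv_into H \<iota> x \<in> H"
 using lin(3) by (auto simp: f_inv_into_f inv_into_into)

lemma scaled_L: "bilinear_form_on H H (\<lambda>a b. pfac m * of_real (L a b))" "nondegenerate_on H H (\<lambda>a b. pfac m * of_real (L a b))"
proof -
 show "bilinear_form_on H H (\<lambda>a b. pfac m * of_real (L a b))"
  unfolding bilinear_form_on_def linear_map_on_def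
 proof (intro conjI ballI allI)
  fix a b c assume ab: "a \<in> H" "b \<in> H"
  show "pfac m * of_real (L a (r *\<^sub>R b)) = r *\<^sub>R (pfac m * of_real (L a b))" for r
   unfolding L_scale(1)[OF ab] real_scaleR_def of_real_mult scaleR_conv_of_real by (rule mult.left_commute)
  show "pfac m * of_real (L (r *\<^sub>R a) b) = r *\<^sub>R (pfac m * of_real (L a b))" for r
   unfolding L_scale(2)[OF ab(2,1)] real_scaleR_def of_real_mult scaleR_conv_of_real by (rule mult.left_commute)
  assume c: "c \<in> H"
  show "pfac m * of_real (L a (b + c)) = pfac m * of_real (L a b) + pfac m * of_real (L a c)"
   unfolding L_add(1)[OF ab(1) ab(2) c] of_real_add by (rule distrib_left)
  show "pfac m * of_real (L (a + c) b) = pfac m * of_real (L a b) + pfac m * of_real (L c b)"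
   unfolding L_add(2)[OF ab(2) ab(1) c] of_real_add by (rule distrib_left)
 qed
 show "nondegenerate_on H H (\<lambda>a b. pfac m * of_real (L a b))"
  using nondeg pfac_eq(2) by (simp add: nondegenerate_on_def)
qed

text \<open>
 The symmetry of \<open>P\<close> is the equation \<open>L (M a) b = L b a\<close>, since two half turns make up the monodromy.
\<close>

lemma in_gamma_data: "(E, P) \<in> gamma_data m"
 unfolding gamma_data_def mem_Collect_eq prod.case
proof (intro conjI allI impI ballI)
 show "flat_bundle E" by (rule fb)
 have bil: "bilinear_form_on (fibre E z) (fibre E (- z)) (P z)" if z: "z \<noteq> 0" for z
 proof -
  obtain w where w: "exp w = z" using at_exp[OF z] .
  show ?thesis unfolding w[symmetric]
   by (rule bilinear_form_transport[OF iso_T iso_T' subH subH scaled_L(1)]) (rule P_eq)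
 qed
 show "flat_pairing E (- 1) P"
 proof (rule flat_pairingI[where \<kappa> = "\<i> * of_real pi" and Q = "\<lambda>a b. pfac m * of_real (L (inv_into H \<iota> a) (inv_into H \<iota> b))"])
  show "exp (\<i> * complex_of_real pi) = - 1" by simp
  show "bilinear_form_on (fibre E z) (fibre E (- 1 * z)) (P z)" if "z \<noteq> 0" for z using bil[OF that] by simp
  show "P (exp w) (T w a) (T (w + \<i> * of_real pi) b) = pfac m * of_real (L (inv_into H \<iota> a) (inv_into H \<iota> b))"
   if "a \<in> fibre E 1" "b \<in> fibre E 1" for w a b
   using P_eq[OF iota_inv(2)[OF that(1)] iota_inv(2)[OF that(2)], of w] iota_inv(1)[OF that(1)] iota_inv(1)[OF that(2)] by simp
 qed
 fix z :: complex assume "z \<noteq> 0"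
 then obtain w where w: "exp w = z" using at_exp by blast
 have evM: "eigenvalues_in_circle H (\<lambda>a. \<epsilon> *\<^sub>R M a)"
  by (rule eigenvalues_in_circle_scale[OF evs, where e = \<epsilon>]) (simp_all add: sign_square)
 show "eigenvalues_in_circle (fibre E z) (bundle_monodromy E z)"
  unfolding w[symmetric]
 proof (rule eigenvalues_in_circle_transport[OF iso_T subH _ _ evM])
  show "\<epsilon> *\<^sub>R M a \<in> H" if "a \<in> H" for a by (rule M_H[OF that])
  show "bundle_monodromy E (exp w) (T w (\<iota> a)) = T w (\<iota> (\<epsilon> *\<^sub>R M a))" if "a \<in> H" for a
   unfolding monodromy_T[OF lin(4)[OF that]] Mon[OF that] ..
 qed
 show "nondegenerate_on (fibre E z) (fibre E (- z)) (P z)"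
  unfolding w[symmetric] by (rule nondegenerate_transport[OF iso_T iso_T' subH subH scaled_L(2)]) (rule P_eq)
 fix x y assume "x \<in> fibre E z" "y \<in> fibre E (- z)"
 then obtain a b where a: "a \<in> H" "x = T w (\<iota> a)" and b: "b \<in> H" "y = T (w + \<i> * of_real pi) (\<iota> b)"
  unfolding w[symmetric] by (elim surj_T surj_T') blast
 have Pxy: "P z x y = pfac m * of_real (L a b)" unfolding a(2) b(2) w[symmetric] by (rule P_eq[OF a(1) b(1)])
 show "P z x y \<in> range (\<lambda>x::real. \<i> powi (m + 1) * of_real x)"
  unfolding Pxy pfac_eq(1) by (rule image_eqI[of _ _ "\<epsilon> / (2 * pi) powi (m + 1) * L a b"]) simp_all
 obtain a1 where a1: "a1 \<in> H" "a = M a1" by (rule linear_iso_preimage[OF monodromy(1) a(1)])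
 define a' where "a' = \<epsilon> *\<^sub>R a1"
 have a': "a' \<in> H" unfolding a'_def by (rule subspace_scale[OF subH a1(1)])
 have "M a' = \<epsilon> *\<^sub>R a" unfolding a'_def a1(2) by (rule linear_map_on_scale[OF linear_isoD(1)[OF monodromy(1)] a1(1)])
 then have Ma': "\<epsilon> *\<^sub>R M a' = a" by (simp add: sign_square)
 have w2: "w + \<i> * of_real pi + \<i> * of_real pi = w + 2 * pi * \<i>" by simp
 have Tx: "T (w + \<i> * of_real pi + \<i> * of_real pi) (\<iota> a') = x"
  unfolding w2 T_shift_period[OF lin(4)[OF a']] Mon[OF a'] Ma' a(2) ..
 have "P (- z) y x = pfac m * of_real (L b a')"
  using P_eq[OF b(1) a', of "w + \<i> * of_real pi"] unfolding Tx b(2)[symmetric] exp_half_turn w .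
 moreover have "L b a' = \<epsilon> * L a b"
 proof -
  have "L a b = \<epsilon> * L b a'"
   using L_scale(2)[OF b(1) linear_isoD(4)[OF monodromy(1) a'], of \<epsilon>] unfolding Ma' real_scaleR_def monodromy(2)[OF a' b(1)] .
  then show ?thesis by (simp only: sign_square(2))
 qed
 ultimately show "P (- z) y x = (- 1) powi (m + 1) * P z x y" unfolding Pxy by (simp add: of_real_power_int)
qed

text \<open>
 The flat pairing of each fibre with itself is recovered from \<open>P\<close> by a half turn in the positive direction.
\<close>

lemma beta_to_gammaI: "beta_to_gamma m (H, L) (E, P)"
 unfolding beta_to_gamma_def prod.case
proof (intro conjI exI[of _ \<iota>] exI[of _ "\<lambda>z x y. Re (P z x (flat_shift E z pi y) / pfac m)"] ballI allI impI)
 let ?\<Lambda> = "\<lambda>z x y. Re (P z x (flat_shift E z pi y) / pfac m)"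
 have \<Lambda>: "?\<Lambda> (exp w) (T w (\<iota> a)) (T w (\<iota> b)) = L a b" if "a \<in> H" "b \<in> H" for w a b
  unfolding half_turn[OF lin(4)[OF that(2)]] P_eq[OF that]
  by (simp only: nonzero_mult_div_cancel_left[OF pfac_eq(2)] Re_complex_of_real)
 show "flat_bundle E" by (rule fb)
 show "linear_iso H (fibre E 1) \<iota>" by (rule iso)
 show "bundle_monodromy E 1 (\<iota> a) = \<iota> (\<epsilon> *\<^sub>R M a)" if "a \<in> H" for a using real that by (simp add: realizes_def)
 show "?\<Lambda> 1 (\<iota> a) (\<iota> b) = L a b" if "a \<in> H" "b \<in> H" for a b
  using \<Lambda>[OF that, of 0] unfolding T_flat(2)[OF lin(4)[OF that(1)]] T_flat(2)[OF lin(4)[OF that(2)]] exp_zero .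
 show "flat_pairing E 1 ?\<Lambda>"
 proof (rule flat_pairingI[where \<kappa> = 0 and Q = "\<lambda>a b. L (inv_into H \<iota> a) (inv_into H \<iota> b)"])
  show "exp 0 = (1 :: complex)" by simp
  show "bilinear_form_on (fibre E z) (fibre E (1 * z)) (?\<Lambda> z)" if z: "z \<noteq> 0" for z
  proof -
   obtain w where w: "exp w = z" using at_exp[OF z] .
   show ?thesis unfolding w[symmetric] mult_1
    by (rule bilinear_form_transport[OF iso_T iso_T subH subH bil]) (rule \<Lambda>)
  qed
  show "?\<Lambda> (exp w) (T w a) (T (w + 0) b) = L (inv_into H \<iota> a) (inv_into H \<iota> b)"
   if "a \<in> fibre E 1" "b \<in> fibre E 1" for w a b
   using \<Lambda>[OF iota_inv(2)[OF that(1)] iota_inv(2)[OF that(2)], of w]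
   unfolding iota_inv(1)[OF that(1)] iota_inv(1)[OF that(2)] add_0_right .
 qed
 fix z :: complex and x y assume z: "z \<noteq> 0" and xy: "x \<in> fibre E z" "y \<in> fibre E (- z)"
 obtain w where w: "exp w = z" using at_exp[OF z] .
 obtain a b where a: "a \<in> H" "x = T w (\<iota> a)" and b: "b \<in> H" "y = T (w + \<i> * of_real pi) (\<iota> b)"
  using xy unfolding w[symmetric] by (elim surj_T surj_T') blast
 show "P z x y = 1 / (2 * of_real pi * \<i>) powi (m + 1) * of_real (?\<Lambda> z x (flat_shift E (- z) (- pi) y))"
  unfolding a(2) b(2) w[symmetric] half_turn_back[OF lin(4)[OF b(1)]] pfac_def[symmetric] \<Lambda>[OF a(1) b(1)]
  by (rule P_eq[OF a(1) b(1)])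
qed

end

lemma beta_to_gammaE:
 assumes x: "(H, L) \<in> beta_data" and K: "beta_to_gamma m (H, L) (E, P)"
 obtains \<iota> where "realization E H L m P \<iota>"
proof -
 interpret S: seifert_form H L by (rule beta_data_seifert_form[OF x])
 obtain \<iota> and \<Lambda> :: "complex \<Rightarrow> 'a \<Rightarrow> 'a \<Rightarrow> real" where fb: "flat_bundle E" and iso: "linear_iso H (fibre E 1) \<iota>"
  and mon: "\<forall>a\<in>H. bundle_monodromy E 1 (\<iota> a) = \<iota> ((- 1) powi (m + 1) *\<^sub>R Seifert_monodromy H L a)"
  and fp: "flat_pairing E 1 \<Lambda>" and \<Lambda>: "\<forall>a\<in>H. \<forall>b\<in>H. \<Lambda> 1 (\<iota> a) (\<iota> b) = L a b"
  and P: "\<forall>z. z \<noteq> 0 --> (\<forall>a \<in> fibre E z. \<forall>b \<in> fibre E (- z).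
      P z a b = 1 / (2 * of_real pi * \<i>) powi (m + 1) * of_real (\<Lambda> z a (flat_shift E (- z) (- pi) b)))"
  using K unfolding beta_to_gamma_def prod.case by (elim exE conjE) (rule that)
 interpret fbun E by unfold_locales (rule fb)
 note lin = linear_isoD[OF iso]
 have "P (exp w) (T w (\<iota> a)) (T (w + \<i> * of_real pi) (\<iota> b)) = pfac m * of_real (L a b)" if ab: "a \<in> H" "b \<in> H" for w a b
 proof -
  have f: "T w (\<iota> a) \<in> fibre E (exp w)" "T (w + \<i> * of_real pi) (\<iota> b) \<in> fibre E (- exp w)"
   using T_lin(4)[OF lin(4)[OF ab(1)]] T_lin(4)[OF lin(4)[OF ab(2)], of "w + \<i> * of_real pi"] by (simp_all add: exp_half_turn)
  have "\<Lambda> (exp w) (T w (\<iota> a)) (T w (\<iota> b)) = L a b"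
   using flat_pairing_T[OF fp exp_zero lin(4)[OF ab(1)] lin(4)[OF ab(2)], of w] T_flat(2)[OF lin(4)[OF ab(2)]] \<Lambda> ab by simp
  then show ?thesis
   using P[rule_format, OF exp_not_eq_zero f] half_turn_back[OF lin(4)[OF ab(2)], of w] by (simp add: pfac_def)
 qed
 then have "realizes m H L E P \<iota>" unfolding realizes_def using iso mon by blast
 moreover have "eigenvalues_in_circle H (Seifert_monodromy H L)" using x by (simp add: beta_data_def)
 ultimately show thesis by (intro that[of \<iota>]) unfold_locales
qed

text \<open>
 As the monodromy is determined by \<open>L\<close>, an isomorphism of Seifert form pairs intertwines the bundle
 monodromies, and so extends by parallel transport.
\<close>

lemma realizations_isomorphic:
 assumes r: "realization E H L m P \<iota>" and r': "realization E' H' L' m P' \<iota>'"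
  and f: "linear_iso H H' f" and fL: "\<And>a b. a \<in> H ==> b \<in> H ==> L' (f a) (f b) = L a b"
 shows "\<exists>F. gamma_iso_by (E, P) (E', P') F"
proof -
 interpret A: realization E H L m P \<iota> by (rule r)
 interpret B: realization E' H' L' m P' \<iota>' by (rule r')
 note fl = linear_isoD[OF f]
 define g where "g a = \<iota>' (f (inv_into H \<iota> a))" for a
 have g: "linear_iso (fibre E 1) (fibre E' 1) g"
  unfolding g_def by (rule linear_iso_comp[OF linear_iso_comp[OF linear_iso_inv[OF A.iso A.subH] f] B.iso])
 have gi: "g (\<iota> a) = \<iota>' (f a)" if "a \<in> H" for a using that A.lin(2) by (simp add: g_def)
 have fM: "f (A.M a) = B.M (f a)" if a: "a \<in> H" for a
 proof (rule B.monodromy_unique[symmetric])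
  note Ma = linear_isoD(4)[OF A.monodromy(1) a]
  show "f a \<in> H'" "f (A.M a) \<in> H'" using fl(4) a Ma by auto
  fix b' assume "b' \<in> H'"
  then obtain b where b: "b \<in> H" "b' = f b" using fl(3) by blast
  show "L' (f (A.M a)) b' = L' b' (f a)"
   unfolding b(2) fL[OF Ma b(1)] fL[OF b(1) a] by (rule A.monodromy(2)[OF a b(1)])
 qed
 have g_mon: "g (A.T (2 * pi * \<i>) x) = B.T (2 * pi * \<i>) (g x)" if x: "x \<in> fibre E 1" for x
 proof -
  obtain a where a: "a \<in> H" "x = \<iota> a" by (rule that[OF A.iota_inv(2)[OF x] A.iota_inv(1)[OF x, symmetric]])
  have "f (A.\<epsilon> *\<^sub>R A.M a) = A.\<epsilon> *\<^sub>R B.M (f a)"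
   unfolding linear_map_on_scale[OF fl(1) linear_isoD(4)[OF A.monodromy(1) a(1)]] fM[OF a(1)] ..
  then show ?thesis
   unfolding a(2) A.Mon[OF a(1)] gi[OF a(1)] gi[OF A.M_H[OF a(1)]] B.Mon[OF fl(4)[OF a(1)]] by (rule arg_cong)
 qed
 define g' where "g' = inv_into (fibre E 1) g"
 have g'g: "g' (g x) = x" if "x \<in> fibre E 1" for x using linear_isoD(2)[OF g] that by (simp add: g'_def)
 have g': "linear_iso (fibre E' 1) (fibre E 1) g'" unfolding g'_def by (rule linear_iso_inv[OF g A.subspace_fibre]) simp
 have g'_mon: "g' (B.T (2 * pi * \<i>) y) = A.T (2 * pi * \<i>) (g' y)" if y: "y \<in> fibre E' 1" for y
 proof -
  obtain x where x: "x \<in> fibre E 1" "y = g x" by (rule linear_iso_preimage[OF g y])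
  have "A.T (2 * pi * \<i>) x \<in> fibre E 1"
   using A.T_lin(4)[OF x(1), of "2 * pi * \<i>"] exp_two_pi_i by (simp add: mult_ac)
  then show ?thesis unfolding x(2) g_mon[OF x(1), symmetric] g'g[OF x(1)] by (rule g'g)
 qed
 interpret X: transported_iso E E' g by unfold_locales (fact g, fact g_mon)
 interpret Y: transported_iso E' E g' by unfold_locales (fact g', fact g'_mon)
 have YX: "Y.ext z (X.ext z x) = x" if z: "z \<noteq> 0" and x: "x \<in> fibre E z" for z x
 proof -
  obtain w where w: "exp w = z" using A.at_exp[OF z] .
  obtain a where a: "a \<in> fibre E 1" "x = A.T w a" by (rule A.T_surj[OF x[folded w]])
  show ?thesis unfolding a(2) w[symmetric] X.ext_T[OF a(1)] Y.ext_T[OF X.lin_g(4)[OF a(1)]] g'g[OF a(1)] ..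
 qed
 have "gamma_iso_by (E, P) (E', P') X.ext"
 proof (rule gamma_iso_byI)
  show "linear_iso (fibre E z) (fibre E' z) (X.ext z)" if "z \<noteq> 0" for z by (rule X.ext_iso[OF that])
  show "smooth_section E U s \<longleftrightarrow> smooth_section E' U (\<lambda>z. X.ext z (s z))"
   if U: "open_punctured U" and s: "\<And>z. z \<in> U ==> s z \<in> fibre E z" for U s
  proof
   show "smooth_section E U s ==> smooth_section E' U (\<lambda>z. X.ext z (s z))"
    by (rule locally_constant_map_connection(1)[OF A.fbun_axioms B.fbun_axioms X.ext_locally_constant U])
   assume "smooth_section E' U (\<lambda>z. X.ext z (s z))"
   then have "smooth_section E U (\<lambda>z. Y.ext z (X.ext z (s z)))"
    by (rule locally_constant_map_connection(1)[OF B.fbun_axioms A.fbun_axioms Y.ext_locally_constant U])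
   then show "smooth_section E U s"
    by (rule A.smooth_section_cong) (rule YX, use U in \<open>auto simp: open_punctured_def\<close>, erule s)
  qed
  show "nabla E' (\<lambda>w. X.ext w (s w)) z v = X.ext z (nabla E s z v)"
   if "open_punctured U" "smooth_section E U s" "z \<in> U" for U s z v
   by (rule locally_constant_map_connection(2)[OF A.fbun_axioms B.fbun_axioms X.ext_locally_constant that])
  fix z :: complex and x y assume z: "z \<noteq> 0" and xy: "x \<in> fibre E z" "y \<in> fibre E (- z)"
  obtain w where w: "exp w = z" using A.at_exp[OF z] .
  obtain a b where a: "a \<in> H" "x = A.T w (\<iota> a)" and b: "b \<in> H" "y = A.T (w + \<i> * of_real pi) (\<iota> b)"
   using xy unfolding w[symmetric] by (elim A.surj_T A.surj_T') blast
  have ex: "X.ext (exp w) x = B.T w (\<iota>' (f a))" unfolding a(2) X.ext_T[OF A.lin(4)[OF a(1)]] gi[OF a(1)] ..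
  have ey: "X.ext (- exp w) y = B.T (w + \<i> * of_real pi) (\<iota>' (f b))"
   unfolding b(2) A.exp_half_turn[symmetric] X.ext_T[OF A.lin(4)[OF b(1)]] gi[OF b(1)] ..
  show "P' z (X.ext z x) (X.ext (- z) y) = P z x y"
   unfolding w[symmetric] ex ey B.P_eq[OF fl(4)[OF a(1)] fl(4)[OF b(1)]] fL[OF a(1) b(1)]
   unfolding a(2) b(2) A.P_eq[OF a(1) b(1)] ..
 qed
 then show ?thesis by blast
qed

text \<open>
 A bundle isomorphism maps flat sections to flat sections.
\<close>

lemma gamma_iso_by_T:
 assumes E: "fbun E" and E': "fbun E'" and F: "gamma_iso_by (E, P) (E', P') F" and a: "a \<in> fibre E 1"
 shows "F (exp w) (fbun.T E w a) = fbun.T E' w (F 1 a)"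
proof -
 interpret A: fbun E by (rule E)
 interpret B: fbun E' by (rule E')
 note FD = gamma_iso_byD[OF F]
 have "flat_along E' exp UNIV (\<lambda>w. F (exp w) (A.T w a))"
  unfolding flat_along_def
 proof
  fix w :: complex
  have "lflat E exp UNIV (\<lambda>w. A.T w a) w" using A.T_flat(1)[OF a] by (auto simp: flat_along_def)
  then obtain U s where U: "open_punctured U" "exp w \<in> U" and s: "flat_section E U s"
   and ev: "\<forall>\<^sub>F w' in nhds w. w' \<in> UNIV --> A.T w' a = s (exp w')" unfolding lflat_def by (elim exE conjE) (rule that)
  have n0: "z \<noteq> 0" if "z \<in> U" for z using U(1) that by (auto simp: open_punctured_def)
  have sm: "smooth_section E U s" and s0: "nabla E s z v = 0" if "z \<in> U" for z v
   using s that unfolding flat_section_def by simp_all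
  have sm: "smooth_section E U s" using s unfolding flat_section_def by simp
  have sf: "s z \<in> fibre E z" if "z \<in> U" for z by (rule A.smooth_section_fibre[OF sm that n0[OF that]])
  have F0: "F z 0 = 0" if "z \<in> U" for z
   by (rule linear_map_on_zero[OF linear_isoD(1)[OF FD(1)] A.subspace_fibre]) (rule n0[OF that])+
  have "smooth_section E' U (\<lambda>z. F z (s z))" using FD(2)[OF U(1) sf] sm by blast
  moreover have "nabla E' (\<lambda>z. F z (s z)) z v = 0" if "z \<in> U" for z v
   using FD(3)[OF U(1) sm that, of v] s0[OF that] F0[OF that] by simp
  ultimately have "flat_section E' U (\<lambda>z. F z (s z))" unfolding flat_section_def by blast
  moreover have "\<forall>\<^sub>F w' in nhds w. w' \<in> UNIV --> F (exp w') (A.T w' a) = F (exp w') (s (exp w'))"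
   using ev by eventually_elim simp
  ultimately show "lflat E' exp UNIV (\<lambda>w. F (exp w) (A.T w a)) w"
   unfolding lflat_def using U by (intro exI[of _ U] exI[of _ "\<lambda>z. F z (s z)"] conjI)
 qed
 from B.T_unique[OF this, of w] show ?thesis using A.T_flat(2)[OF a] by simp
qed

lemma isomorphic_realizations:
 assumes r: "realization E H L m P \<iota>" and r': "realization E' H' L' m P' \<iota>'"
  and F: "gamma_iso_by (E, P) (E', P') F"
 shows "\<exists>f. linear_iso H H' f \<and> (\<forall>a\<in>H. \<forall>b\<in>H. L' (f a) (f b) = L a b)"
proof -
 interpret A: realization E H L m P \<iota> by (rule r)
 interpret B: realization E' H' L' m P' \<iota>' by (rule r')
 note FD = gamma_iso_byD[OF F]
 define f where "f a = inv_into H' \<iota>' (F 1 (\<iota> a))" for a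
 have F1: "linear_iso (fibre E 1) (fibre E' 1) (F 1)" by (rule FD(1)) simp
 have f: "linear_iso H H' f"
  unfolding f_def by (rule linear_iso_comp[OF linear_iso_comp[OF A.iso F1] linear_iso_inv[OF B.iso B.subH]])
 have fi: "F 1 (\<iota> a) = \<iota>' (f a)" if "a \<in> H" for a
  unfolding f_def by (rule B.iota_inv(1)[OF linear_isoD(4)[OF F1 A.lin(4)[OF that]], symmetric])
 have "L' (f a) (f b) = L a b" if ab: "a \<in> H" "b \<in> H" for a b
 proof -
  note fab = linear_isoD(4)[OF f ab(1)] linear_isoD(4)[OF f ab(2)]
  have h: "exp (0 + \<i> * of_real pi) = - exp (0 :: complex)" by simp
  have T1: "A.T 0 (\<iota> a) \<in> fibre E (exp 0)" by (rule A.T_lin(4)[OF A.lin(4)[OF ab(1)]])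
  have T2: "A.T (0 + \<i> * of_real pi) (\<iota> b) \<in> fibre E (- exp 0)"
   using A.T_lin(4)[OF A.lin(4)[OF ab(2)], of "0 + \<i> * of_real pi"] unfolding h .
  have "pfac m * of_real (L' (f a) (f b)) = P' (exp 0) (B.T 0 (\<iota>' (f a))) (B.T (0 + \<i> * of_real pi) (\<iota>' (f b)))"
   by (rule B.P_eq[OF fab, symmetric])
  also have "\<dots> = P' (exp 0) (F (exp 0) (A.T 0 (\<iota> a))) (F (exp (0 + \<i> * of_real pi)) (A.T (0 + \<i> * of_real pi) (\<iota> b)))"
   unfolding gamma_iso_by_T[OF A.fbun_axioms B.fbun_axioms F A.lin(4)[OF ab(1)]]
    gamma_iso_by_T[OF A.fbun_axioms B.fbun_axioms F A.lin(4)[OF ab(2)]] fi[OF ab(1)] fi[OF ab(2)] ..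
  also have "\<dots> = P (exp 0) (A.T 0 (\<iota> a)) (A.T (0 + \<i> * of_real pi) (\<iota> b))"
   unfolding h by (rule FD(4)[OF exp_not_eq_zero T1 T2])
  also have "\<dots> = pfac m * of_real (L a b)" by (rule A.P_eq[OF ab])
  finally show ?thesis using pfac_eq(2)[of m] by simp
 qed
 then show ?thesis using f by blast
qed

text \<open>
 On the model bundle, \<open>P\<close> is defined by transport to the fibre over \<open>1\<close> along the principal branch of the
 logarithm. Other branches give the same value because the monodromy preserves \<open>L\<close>.
\<close>

lemma beta_to_gamma_total:
 assumes x: "(H, L) \<in> beta_data" shows "\<exists>y. beta_to_gamma m (H, L) y"
proof -
 interpret S: seifert_form H L by (rule beta_data_seifert_form[OF x])
 let ?\<epsilon> = "(- 1 :: real) powi (m + 1)"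
 define M where "M a = ?\<epsilon> *\<^sub>R Seifert_monodromy H L a" for a
 note monl = linear_isoD[OF S.monodromy(1)]
 have sc: "linear_iso H H (\<lambda>a. ?\<epsilon> *\<^sub>R a)"
  unfolding linear_iso_def linear_map_on_def
 proof (intro conjI ballI allI)
  show "bij_betw (\<lambda>a. ?\<epsilon> *\<^sub>R a) H H"
   by (rule bij_betw_byWitness[where f' = "\<lambda>a. ?\<epsilon> *\<^sub>R a"]) (use subspace_scale[OF S.subH] in \<open>auto simp: sign_square\<close>)
 qed (simp_all add: scaleR_add_right mult.commute)
 have M: "linear_iso H H M" unfolding M_def by (rule linear_iso_comp[OF S.monodromy(1) sc])
 note Ml = linear_isoD[OF M]
 have LM: "L (M a) (M b) = L a b" if ab: "a \<in> H" "b \<in> H" for a b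
  unfolding M_def S.L_scale(1)[OF subspace_scale[OF S.subH monl(4)[OF ab(1)]] monl(4)[OF ab(2)]] S.L_scale(2)[OF monl(4)[OF ab(2)] monl(4)[OF ab(1)]]
  using S.monodromy_invariant[OF ab] by (simp add: sign_square)
 obtain E where fb: "flat_bundle E" and E1: "fibre E 1 = H" and mon: "\<forall>a\<in>H. bundle_monodromy E 1 a = M a"
  using flat_bundle_with_monodromy[OF S.H M] by (elim exE conjE) (rule that)
 interpret fbun E by unfold_locales (rule fb)
 have Mon: "T (2 * pi * \<i>) a = M a" if "a \<in> H" for a using mon monodromy_one[of a] that E1 by simp
 let ?J = "\<lambda>z. inv_into H (T (Ln z))"
 define P where "P z x y = pfac m * of_real (L (?J z x) (?J z (flat_shift E (- z) (- pi) y)))" for z x y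
 have e: "exp (w + 2 * pi * \<i>) = exp w" for w :: complex
  using exp_plus_2pin[of w 1] by (simp add: mult_ac)
 have Q: "\<forall>a\<in>H. \<forall>b\<in>H. L (?J (exp w) (T w a)) (?J (exp w) (T w b)) = L a b" for w
 proof (rule exp_period_induct[where Q = "\<lambda>w. \<forall>a\<in>H. \<forall>b\<in>H. L (?J (exp w) (T w a)) (?J (exp w) (T w b)) = L a b"])
  fix w
  have s: "T (w + 2 * pi * \<i>) a = T w (M a)" if "a \<in> H" for a
   using T_shift_period[of a w] Mon[OF that] that E1 by simp
  show "(\<forall>a\<in>H. \<forall>b\<in>H. L (?J (exp (w + 2 * pi * \<i>)) (T (w + 2 * pi * \<i>) a)) (?J (exp (w + 2 * pi * \<i>)) (T (w + 2 * pi * \<i>) b)) = L a b)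
    \<longleftrightarrow> (\<forall>a\<in>H. \<forall>b\<in>H. L (?J (exp w) (T w a)) (?J (exp w) (T w b)) = L a b)" (is "?A \<longleftrightarrow> ?B")
  proof
   assume A: ?A
   show ?B
   proof (intro ballI)
    fix a b assume a: "a \<in> H" and b: "b \<in> H"
    obtain a0 where a0: "a0 \<in> H" "a = M a0" by (rule linear_iso_preimage[OF M a])
    obtain b0 where b0: "b0 \<in> H" "b = M b0" by (rule linear_iso_preimage[OF M b])
    note ab = a0(1) b0(1) a0(2) b0(2)
    show "L (?J (exp w) (T w a)) (?J (exp w) (T w b)) = L a b"
     using bspec[OF bspec[OF A ab(1)] ab(2)] unfolding s[OF ab(1)] s[OF ab(2)] e ab(3,4) LM[OF ab(1,2)] .
   qed
  next
   assume B: ?B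
   show ?A
   proof (intro ballI)
    fix a b assume ab: "a \<in> H" "b \<in> H"
    show "L (?J (exp (w + 2 * pi * \<i>)) (T (w + 2 * pi * \<i>) a)) (?J (exp (w + 2 * pi * \<i>)) (T (w + 2 * pi * \<i>) b)) = L a b"
     unfolding s[OF ab(1)] s[OF ab(2)] e bspec[OF bspec[OF B Ml(4)[OF ab(1)]] Ml(4)[OF ab(2)]] by (rule LM[OF ab])
   qed
  qed
 next
  fix z :: complex assume "z \<noteq> 0"
  then have "?J (exp (Ln z)) (T (Ln z) a) = a" if "a \<in> H" for a
   using inv_into_f_f[OF T_lin(2)[of "Ln z", unfolded E1] that] by simp
  note J = this
  show "\<forall>a\<in>H. \<forall>b\<in>H. L (?J (exp (Ln z)) (T (Ln z) a)) (?J (exp (Ln z)) (T (Ln z) b)) = L a b"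
   by (intro ballI) (simp only: J)
 qed
 have Pw: "P (exp w) (T w a) (T (w + \<i> * of_real pi) b) = pfac m * of_real (L a b)" if ab: "a \<in> H" "b \<in> H" for w a b
  unfolding P_def half_turn_back[of b w, unfolded E1, OF ab(2)] bspec[OF bspec[OF Q ab(1)] ab(2)] ..
 have "realizes m H L E P (\<lambda>a. a)"
  unfolding realizes_def E1
 proof (intro conjI ballI allI)
  show "bundle_monodromy E 1 a = ?\<epsilon> *\<^sub>R Seifert_monodromy H L a" if "a \<in> H" for a using mon that by (simp add: M_def)
 qed (rule linear_iso_id, erule (1) Pw)
 moreover have "eigenvalues_in_circle H (Seifert_monodromy H L)" using x by (simp add: beta_data_def)
 ultimately interpret realization E H L m P "\<lambda>a. a" by unfold_locales
 show ?thesis using beta_to_gammaI by blast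
qed

text \<open>
 The Seifert form is read off at the base point. The symmetry of \<open>P\<close> shows that its monodromy is, up to sign,
 that of the bundle.
\<close>

lemma beta_to_gamma_surjective:
 assumes y: "(E, P) \<in> gamma_data m"
 shows "\<exists>x\<in>beta_data. beta_to_gamma m x (E, P)"
proof -
 have fb: "flat_bundle E" and fp: "flat_pairing E (- 1) P" using y by (simp_all add: gamma_data_def)
 have ev: "eigenvalues_in_circle (fibre E 1) (bundle_monodromy E 1)" using y by (simp add: gamma_data_def)
 have P: "nondegenerate_on (fibre E z) (fibre E (- z)) (P z)"
  "a \<in> fibre E z ==> b \<in> fibre E (- z) ==> P z a b \<in> range (\<lambda>x::real. \<i> powi (m + 1) * of_real x)"
  "a \<in> fibre E z ==> b \<in> fibre E (- z) ==> P (- z) b a = (- 1) powi (m + 1) * P z a b" if "z \<noteq> 0" for z a b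
  using y that by (simp_all add: gamma_data_def)
 interpret fbun E by unfold_locales (rule fb)
 let ?h = "\<i> * complex_of_real pi"
 let ?\<epsilon> = "(- 1 :: real) powi (m + 1)"
 define H where "H = fibre E 1"
 have subH: "subspace H" unfolding H_def by (rule subspace_fibre) simp
 have bP: "bilinear_form_on H (fibre E (- 1)) (P 1)" using fp by (simp add: flat_pairing_def H_def)
 have nP: "nondegenerate_on H (fibre E (- 1)) (P 1)" using P(1)[of 1] by (simp add: H_def)
 have iT: "linear_iso H (fibre E (- 1)) (T ?h)" using T_iso[of ?h] by (simp add: H_def)
 have sub1: "subspace (fibre E (- 1))" by (rule subspace_fibre) simp
 have iTi: "linear_iso (fibre E (- 1)) H (inv_into H (T ?h))" by (rule linear_iso_inv[OF iT subH])
 define L where "L a b = Re (P 1 a (T ?h b) / pfac m)" for a b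
 have PL: "P 1 a (T ?h b) = pfac m * of_real (L a b)" if ab: "a \<in> H" "b \<in> H" for a b
 proof -
  obtain r :: real where r: "P 1 a (T ?h b) = \<i> powi (m + 1) * of_real r"
   using P(2)[of 1 a "T ?h b"] ab linear_isoD(4)[OF iT] by (auto simp: H_def)
  obtain c :: real where c: "pfac m = \<i> powi (m + 1) * of_real c" by (rule that[OF pfac_eq(1)])
  have "c \<noteq> 0" using pfac_eq(2)[of m] unfolding c by auto
  then have "P 1 a (T ?h b) = pfac m * of_real (r / c)" unfolding r c by simp
  then show ?thesis unfolding L_def by (simp only: nonzero_mult_div_cancel_left[OF pfac_eq(2)] Re_complex_of_real)
 qed
 have PT: "P 1 a (T ?h (inv_into H (T ?h) b)) = P 1 a b" if "b \<in> fibre E (- 1)" for a b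
  using linear_isoD(3)[OF iT] that by (simp add: f_inv_into_f)
 have B: "bilinear_form_on H H (\<lambda>a b. P 1 a (T ?h b))"
  by (rule bilinear_form_transport[OF linear_iso_id iTi subH sub1 bP]) (rule PT)
 have Nd: "nondegenerate_on H H (\<lambda>a b. P 1 a (T ?h b))"
  by (rule nondegenerate_transport[OF linear_iso_id iTi subH sub1 nP]) (rule PT)
 have bL: "bilinear_form_on H H L"
  unfolding bilinear_form_on_def linear_map_on_def L_def
 proof (intro conjI ballI allI)
  have Ra: "Re ((x + y) / pfac m) = Re (x / pfac m) + Re (y / pfac m)" for x y by (simp add: add_divide_distrib)
  have Rs: "Re ((r *\<^sub>R x) / pfac m) = r *\<^sub>R Re (x / pfac m)" for r x
  proof -
   have "(r *\<^sub>R x) / pfac m = r *\<^sub>R (x / pfac m)" by (simp add: scaleR_conv_of_real)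
   then show ?thesis by (simp only: scaleR_complex.sel real_scaleR_def)
  qed
  note B1 = bilinear_form_onD(1)[OF B] and B2 = bilinear_form_onD(2)[OF B]
  fix a b assume ab: "a \<in> H" "b \<in> H"
  show "Re (P 1 a (T ?h (r *\<^sub>R b)) / pfac m) = r *\<^sub>R Re (P 1 a (T ?h b) / pfac m)" for r
   unfolding linear_map_on_scale[OF B1[OF ab(1)] ab(2)] by (rule Rs)
  show "Re (P 1 (r *\<^sub>R a) (T ?h b) / pfac m) = r *\<^sub>R Re (P 1 a (T ?h b) / pfac m)" for r
   unfolding linear_map_on_scale[OF B2[OF ab(2)] ab(1)] by (rule Rs)
  fix c assume c: "c \<in> H"
  show "Re (P 1 a (T ?h (b + c)) / pfac m) = Re (P 1 a (T ?h b) / pfac m) + Re (P 1 a (T ?h c) / pfac m)"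
   unfolding linear_map_on_add[OF B1[OF ab(1)] ab(2) c] by (rule Ra)
  show "Re (P 1 (a + c) (T ?h b) / pfac m) = Re (P 1 a (T ?h b) / pfac m) + Re (P 1 c (T ?h b) / pfac m)"
   unfolding linear_map_on_add[OF B2[OF ab(2)] ab(1) c] by (rule Ra)
 qed
 have nL: "nondegenerate_on H H L"
  unfolding nondegenerate_on_def
 proof (intro conjI ballI impI)
  show "a = 0" if a: "a \<in> H" and 0: "\<forall>b\<in>H. L a b = 0" for a
   by (rule Nd[unfolded nondegenerate_on_def, THEN conjunct1, THEN bspec[OF _ a], THEN mp]) (simp add: PL[OF a] 0)
  show "b = 0" if b: "b \<in> H" and 0: "\<forall>a\<in>H. L a b = 0" for b
   by (rule Nd[unfolded nondegenerate_on_def, THEN conjunct2, THEN bspec[OF _ b], THEN mp]) (simp add: PL[OF _ b] 0)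
 qed
 have H: "fin_dim_space H" unfolding H_def by (rule fin_dim_fibre) simp
 interpret S: seifert_form H L by unfold_locales (fact H, fact bL, fact nL)
 have e1: "exp ?h = - 1" by simp
 have e2: "?h + ?h = 2 * pi * \<i>" by simp
 have inv: "P (exp w) (T w a) (T (w + ?h) b) = pfac m * of_real (L a b)" if ab: "a \<in> H" "b \<in> H" for w a b
  unfolding flat_pairing_T[OF fp e1 ab[unfolded H_def]] by (rule PL[OF ab])
 have MonH: "T (2 * pi * \<i>) a \<in> H" if "a \<in> H" for a
  using T_lin(4)[of a "2 * pi * \<i>"] that exp_two_pi_i by (simp add: mult_ac H_def)
 have M: "Seifert_monodromy H L a = ?\<epsilon> *\<^sub>R T (2 * pi * \<i>) a" if a: "a \<in> H" for a
 proof (rule S.monodromy_unique[OF a subspace_scale[OF subH MonH[OF a]]])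
  fix b assume b: "b \<in> H"
  have A: "P (- 1) (T ?h b) (T (2 * pi * \<i>) a) = pfac m * of_real (L b a)"
   using inv[OF b a, of ?h] unfolding e1 e2 .
  have Tb: "T ?h b \<in> fibre E (- 1)" by (rule linear_isoD(4)[OF iT b])
  have "pfac m * of_real (L (T (2 * pi * \<i>) a) b) = P (- (- 1)) (T (2 * pi * \<i>) a) (T ?h b)"
   unfolding minus_minus by (rule PL[OF MonH[OF a] b, symmetric])
  also have "\<dots> = (- 1) powi (m + 1) * P (- 1) (T ?h b) (T (2 * pi * \<i>) a)"
   by (rule P(3)) (use Tb MonH[OF a] in \<open>simp_all add: H_def\<close>)
  also have "\<dots> = pfac m * of_real (?\<epsilon> * L b a)"
   unfolding A unfolding of_real_mult of_real_power_int of_real_minus of_real_1 by (rule mult.left_commute)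
  finally have "of_real (L (T (2 * pi * \<i>) a) b) = (of_real (?\<epsilon> * L b a) :: complex)"
   by (simp only: mult_left_cancel[OF pfac_eq(2)])
  then have "L (T (2 * pi * \<i>) a) b = ?\<epsilon> * L b a" by (rule of_real_eq_iff[THEN iffD1])
  then show "L (?\<epsilon> *\<^sub>R T (2 * pi * \<i>) a) b = L b a"
   using S.L_scale(2)[OF b MonH[OF a], of ?\<epsilon>] by (simp add: sign_square)
 qed
 have mon: "bundle_monodromy E 1 a = ?\<epsilon> *\<^sub>R Seifert_monodromy H L a" if a: "a \<in> H" for a
  unfolding M[OF a] monodromy_one[OF a[unfolded H_def]] by (simp add: sign_square)
 have evs: "eigenvalues_in_circle H (Seifert_monodromy H L)"
 proof (rule eigenvalues_in_circle_scale[OF ev[folded H_def], where e = ?\<epsilon>])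
  show "Seifert_monodromy H L a = ?\<epsilon> *\<^sub>R bundle_monodromy E 1 a" if "a \<in> H" for a using mon[OF that] by (simp add: sign_square)
  show "?\<epsilon> * ?\<epsilon> = 1" by (rule sign_square)
 qed
 have "realizes m H L E P (\<lambda>a. a)"
  unfolding realizes_def H_def[symmetric]
  by (intro conjI ballI allI) (rule linear_iso_id, erule mon, erule (1) inv)
 then interpret realization E H L m P "\<lambda>a. a" using evs by unfold_locales
 have "(H, L) \<in> beta_data" using H bL nL evs by (simp add: beta_data_def)
 then show ?thesis using beta_to_gammaI by blast
qed

theorem beta_gamma_correspondence:
 "class_correspondence (beta_data :: 'v::real_vector beta set) beta_iso (gamma_data m :: 'v gamma set) (gamma_iso m) (beta_to_gamma m)"
proof (rule class_correspondenceI[OF equiv_beta_iso equiv_gamma_iso])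
 fix x :: "'v beta" assume x: "x \<in> beta_data"
 obtain H L where xe: "x = (H, L)" by (cases x)
 show "\<exists>y. beta_to_gamma m x y" using beta_to_gamma_total[of H L m] x xe by simp
 fix y assume K: "beta_to_gamma m x y"
 obtain E P where ye: "y = (E, P)" by (cases y)
 obtain \<iota> where r: "realization E H L m P \<iota>" using beta_to_gammaE[OF x[unfolded xe] K[unfolded xe ye]] .
 show "y \<in> gamma_data m" unfolding ye by (rule realization.in_gamma_data[OF r])
next
 fix x x' :: "'v beta" and y y'
 assume xx: "(x, x') \<in> beta_iso" and K: "beta_to_gamma m x y" and K': "beta_to_gamma m x' y'"
 obtain H L where xe: "x = (H, L)" by (cases x)
 obtain H' L' where xe': "x' = (H', L')" by (cases x')
 obtain E P where ye: "y = (E, P)" by (cases y)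
 obtain E' P' where ye': "y' = (E', P')" by (cases y')
 obtain f where x: "(H, L) \<in> beta_data" "(H', L') \<in> beta_data" and f: "linear_iso H H' f"
  and fL: "\<forall>a\<in>H. \<forall>b\<in>H. L' (f a) (f b) = L a b" using xx unfolding xe xe' beta_iso_def by auto
 obtain \<iota> where r: "realization E H L m P \<iota>" using beta_to_gammaE[OF x(1) K[unfolded xe ye]] .
 obtain \<iota>' where r': "realization E' H' L' m P' \<iota>'" using beta_to_gammaE[OF x(2) K'[unfolded xe' ye']] .
 have "\<exists>F. gamma_iso_by (E, P) (E', P') F" by (rule realizations_isomorphic[OF r r' f]) (use fL in simp)
 then show "(y, y') \<in> gamma_iso m"
  unfolding gamma_iso_iff ye ye' using realization.in_gamma_data[OF r] realization.in_gamma_data[OF r'] by blast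
next
 fix x x' :: "'v beta" and y y'
 assume x: "x \<in> beta_data" "x' \<in> beta_data" and K: "beta_to_gamma m x y" and K': "beta_to_gamma m x' y'"
  and yy: "(y, y') \<in> gamma_iso m"
 obtain H L where xe: "x = (H, L)" by (cases x)
 obtain H' L' where xe': "x' = (H', L')" by (cases x')
 obtain E P where ye: "y = (E, P)" by (cases y)
 obtain E' P' where ye': "y' = (E', P')" by (cases y')
 obtain F where F: "gamma_iso_by (E, P) (E', P') F" using yy unfolding gamma_iso_iff ye ye' by blast
 obtain \<iota> where r: "realization E H L m P \<iota>" using beta_to_gammaE[OF x(1)[unfolded xe] K[unfolded xe ye]] .
 obtain \<iota>' where r': "realization E' H' L' m P' \<iota>'" using beta_to_gammaE[OF x(2)[unfolded xe'] K'[unfolded xe' ye']] .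
 show "(x, x') \<in> beta_iso"
  using isomorphic_realizations[OF r r' F] x unfolding beta_iso_def xe xe' by simp
next
 fix y :: "'v gamma" assume y: "y \<in> gamma_data m"
 obtain E P where ye: "y = (E, P)" by (cases y)
 have "(y, y) \<in> gamma_iso m" using equiv_gamma_iso[of m] y unfolding equiv_def refl_on_def by blast
 then show "\<exists>x\<in>beta_data. \<exists>y'. beta_to_gamma m x y' \<and> (y', y) \<in> gamma_iso m"
  using beta_to_gamma_surjective[OF y[unfolded ye]] ye by blast
qed

section \<open>Equivalence of the three kinds of data\<close>

theorem lemma5p1:
  fixes m :: int
  shows "class_correspondence (alpha_data m :: 'v::real_vector alpha set) (alpha_iso m)
           (beta_data :: 'v beta set) beta_iso alpha_to_beta \<and>
         class_correspondence (beta_data :: 'v beta set) beta_iso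
           (gamma_data m :: 'v gamma set) (gamma_iso m) (beta_to_gamma m)"
  by (rule conjI[OF alpha_beta_correspondence beta_gamma_correspondence])

end
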